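(* Let $\varphi$ be a probability density on $\mathbb{R}^d$ with values in $[0,1]$, let $K:=\widehat\varphi:\mathbb{R}^d\to\mathbb{C}$, and let $\omega$ be the determinantal point process on $\mathbb{R}^d$ with translation-invariant kernel $K(x,y):=K(x-y)$. Then both the diffraction spectrum of $\omega$ and the dynamical spectrum of $\omega$ are equivalent to $\delta_0+\lambda^d$. In particular, the diffraction spectrum and the dynamical spectrum of $\omega$ are equivalent.
   Context: A point process on $\mathbb{R}^d$ is a random variable $\omega$ with values in the space $\mathcal{N}(\mathbb{R}^d)$ of locally finite $\mathbb{N}_0\cup\{\infty\}$-valued Borel measures on $\mathbb{R}^d$, equipped with the $\sigma$-field $\mathscr{N}(\mathbb{R}^d)$ generated by the maps $\omega\mapsto\omega(A)$, $A$ Borel; $\mathbb{P}_\omega$ denotes its distribution. Writing $\omega=\sum_{i\in I}\delta_{x_i}$, put $\omega^{\bullet k}:=\sum_{i_1,\dots,i_k\in I\ \text{distinct}}\delta_{(x_{i_1},\dots,x_{i_k})}$. If $\mathbb{E}(\omega(A)^k)<\infty$ for all bounded Borel $A$, the $k$th factorial moment measure is the expectation measure $\mathbb{E}(\omega^{\bullet k}(\cdot))$; if it is absolutely continuous, its density $\varrho_k$ is the $k$-point correlation function. $\omega$ is determinantal with kernel $K(x,y)$ if, for every $k\in\mathbb{N}$, $\varrho_k$ exists and $\varrho_k(x_1,\dots,x_k)=\det\bigl(K(x_i,x_j)\bigr)_{1\le i,j\le k}$. For kernels of the form considered here, such a process exists, is unique in distribution, stationary and ergodic. $\lambda^d$ is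 Lebesgue measure on $\mathbb{R}^d$; $\widehat f(y)=\int_{\mathbb{R}^d}f(x)e^{-2\pi i xy}\,dx$. Two measures are equivalent if they have the same null sets. Diffraction spectrum: for a locally finite measure $\omega$, with $\widetilde\omega(A):=\omega(-A)$ and $B_n$ the open ball of radius $n$ around $0$, the autocorrelation measure is the vague limit $\gamma:=\lim_{n\to\infty}\frac{\omega|_{B_n}\ast\widetilde{\omega|_{B_n}}}{\lambda^d(B_n)}$; the diffraction measure is its Fourier transform $\widehat\gamma$, i.e. the unique translation-bounded measure with $\int f\,d\widehat\gamma=\int\widehat f\,d\gamma$ for all Schwartz functions $f$ (translation-bounded: $\sup_x\mu(x+B)<\infty$ for every bounded Borel $B$). For a stationary and ergodic point process with existing first and second moment measures, $\widehat\gamma$ exists almost surely and is almost surely independent of the realisation; the diffraction spectrum is the equivalence class of this measure. Dynamical spectrum: for $x\in\mathbb{R}^d$ let $T_x$ act on measures by $(T_x\omega)(A)=\omega(-x+A)$. The dynamical spectrum of a stationary point process is the maximal spectral type (an equivalence class of measures on $\mathbb{R}^d$) of the group of unitary operators $F\mapsto F\circ T_x$, $x\in\mathbb{R}^d$, on $L^2(\mathcal{N}(\mathbb{R}^d),\mathscr{N}(\mathbb{R}^d),\mathbb{P}_\omega)$, where the spectral measure $\sigma_F$ of $F$ is determined by $\langle F\circ T_x,F\rangle=\int_{\mathbb{R}^d}e^{2\pi i xt}\,d\sigma_F(t)$. *)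

theory Defs
  imports "HOL-Probability.Probability" "Jordan_Normal_Form.Determinant"
begin

section \<open>Measures on Euclidean space\<close>

definition equivalent_measures :: "'a measure \<Rightarrow> 'a measure \<Rightarrow> bool" where
  "equivalent_measures \<mu> \<nu> \<longleftrightarrow> sets \<mu> = sets \<nu> \<and> null_sets \<mu> = null_sets \<nu>"

definition measure_class :: "'a measure \<Rightarrow> 'a measure set" where
  "measure_class \<mu> = {\<nu>. equivalent_measures \<nu> \<mu>}"

definition add_measure :: "'a measure \<Rightarrow> 'a measure \<Rightarrow> 'a measure" where
  "add_measure \<mu> \<nu> = measure_of (space \<mu>) (sets \<mu>) (\<lambda>A. emeasure \<mu> A + emeasure \<nu> A)"

lemma sets_add_measure [simp, measurable_cong]: "sets (add_measure \<mu> \<nu>) = sets \<mu>"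
  by (simp add: add_measure_def)

lemma emeasure_add_measure:
  assumes "sets \<nu> = sets \<mu>" "A \<in> sets \<mu>"
  shows "emeasure (add_measure \<mu> \<nu>) A = emeasure \<mu> A + emeasure \<nu> A"
  unfolding add_measure_def
proof (rule emeasure_measure_of_sigma)
  show "sigma_algebra (space \<mu>) (sets \<mu>)" ..
  show "positive (sets \<mu>) (\<lambda>A. emeasure \<mu> A + emeasure \<nu> A)"
    by (simp add: positive_def)
  show "countably_additive (sets \<mu>) (\<lambda>A. emeasure \<mu> A + emeasure \<nu> A)"
    using assms(1)
    by (auto simp: countably_additive_def suminf_add[symmetric] suminf_emeasure)
  show "A \<in> sets \<mu>" by fact
qed

definition locally_finite_borel :: "'a::euclidean_space measure \<Rightarrow> bool" where
  "locally_finite_borel \<mu> \<longleftrightarrow>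
     sets \<mu> = sets borel \<and> (\<forall>A\<in>sets borel. bounded A \<longrightarrow> emeasure \<mu> A < \<infinity>)"

definition translation_bounded :: "'a::euclidean_space measure \<Rightarrow> bool" where
  "translation_bounded \<mu> \<longleftrightarrow>
     sets \<mu> = sets borel \<and>
     (\<forall>A\<in>sets borel. bounded A \<longrightarrow> (SUP x. emeasure \<mu> ((+) x ` A)) < \<infinity>)"

definition vague_limit :: "(nat \<Rightarrow> 'a::euclidean_space measure) \<Rightarrow> 'a measure \<Rightarrow> bool" where
  "vague_limit \<mu> \<gamma> \<longleftrightarrow>
     locally_finite_borel \<gamma> \<and>
     (\<forall>f :: 'a \<Rightarrow> real. continuous_on UNIV f \<and> compact (closure {x. f x \<noteq> 0}) \<longrightarrow>
        (\<lambda>n. \<integral>x. f x \<partial>\<mu> n) \<longlonglongrightarrow> (\<integral>x. f x \<partial>\<gamma>))"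

section \<open>Fourier transforms\<close>

definition fourier :: "('a::euclidean_space \<Rightarrow> complex) \<Rightarrow> 'a \<Rightarrow> complex" where
  "fourier f y = (\<integral>x. f x * exp (- 2 * of_real pi * \<i> * of_real (inner x y)) \<partial>lborel)"

primrec iterated_partial ::
  "'a::euclidean_space list \<Rightarrow> ('a \<Rightarrow> complex) \<Rightarrow> 'a \<Rightarrow> complex" where
  "iterated_partial [] f = f"
| "iterated_partial (b # bs) f = (\<lambda>x. frechet_derivative (iterated_partial bs f) (at x) b)"

text \<open>Since every iterated partial derivative is required to be totally differentiable
  everywhere, the following predicate includes smoothness.\<close>

definition schwartz :: "('a::euclidean_space \<Rightarrow> complex) \<Rightarrow> bool" where
  "schwartz f \<longleftrightarrow> (\<forall>bs. set bs \<subseteq> Basis \<longrightarrow>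
     (\<forall>x. iterated_partial bs f differentiable (at x)) \<and>
     (\<forall>N::nat. bounded (range (\<lambda>x. (1 + norm x) ^ N *\<^sub>R iterated_partial bs f x))))"

text \<open>A Schwartz function is integrable with respect to every translation-bounded \<open>\<mu>\<close>;
  for \<open>\<gamma>\<close> integrability has to be demanded because the Bochner integral is total.\<close>

definition measure_fourier_transform ::
  "'a::euclidean_space measure \<Rightarrow> 'a measure \<Rightarrow> bool" where
  "measure_fourier_transform \<gamma> \<mu> \<longleftrightarrow>
     translation_bounded \<mu> \<and>
     (\<forall>f. schwartz f \<longrightarrow> integrable \<gamma> (fourier f) \<and>
        (\<integral>t. f t \<partial>\<mu>) = (\<integral>x. fourier f x \<partial>\<gamma>))"

section \<open>Point processes\<close>

definition point_measures :: "'a::euclidean_space measure measure" where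
  "point_measures =
     (SUP A \<in> sets borel. vimage_algebra
        {\<omega>. locally_finite_borel \<omega> \<and> (\<forall>B\<in>sets borel. emeasure \<omega> B \<in> \<nat> \<union> {\<infinity>})}
        (\<lambda>\<omega>. emeasure \<omega> A) borel)"

lemma space_point_measures:
  "space point_measures =
     {\<omega>. locally_finite_borel \<omega> \<and> (\<forall>B\<in>sets borel. emeasure \<omega> B \<in> \<nat> \<union> {\<infinity>})}"
  by (auto simp: point_measures_def space_Sup_eq_UN)

definition point_process ::
  "'b measure \<Rightarrow> ('b \<Rightarrow> 'a::euclidean_space measure) \<Rightarrow> bool" where
  "point_process M X \<longleftrightarrow> prob_space M \<and> X \<in> M \<rightarrow>\<^sub>M point_measures"

text \<open>Every element of \<open>point_measures\<close> is the image of the counting measure on a set \<open>I\<close> of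
  naturals under some \<open>x\<close>, i.e. the sum of the Dirac measures at \<open>x i\<close> for \<open>i\<close> in \<open>I\<close>. The
  measure below, which lives on the extensional functions from \<open>{..<k}\<close>, does not depend on
  the chosen representation.\<close>

definition enumeration :: "'a::euclidean_space measure \<Rightarrow> nat set \<times> (nat \<Rightarrow> 'a)" where
  "enumeration \<omega> = (SOME (I, x). \<omega> = distr (count_space I) borel x)"

definition factorial_power ::
  "nat \<Rightarrow> 'a::euclidean_space measure \<Rightarrow> (nat \<Rightarrow> 'a) measure" where
  "factorial_power k \<omega> =
     (case enumeration \<omega> of (I, x) \<Rightarrow>
        distr (count_space {i \<in> {..<k} \<rightarrow>\<^sub>E I. inj_on i {..<k}})
          (\<Pi>\<^sub>M j\<in>{..<k}. borel) (\<lambda>i. \<lambda>j\<in>{..<k}. x (i j)))"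

definition factorial_moment ::
  "'b measure \<Rightarrow> ('b \<Rightarrow> 'a::euclidean_space measure) \<Rightarrow> nat \<Rightarrow> (nat \<Rightarrow> 'a) set \<Rightarrow> ennreal" where
  "factorial_moment M X k B = (\<integral>\<^sup>+ w. emeasure (factorial_power k (X w)) B \<partial>M)"

definition correlation_function ::
  "'b measure \<Rightarrow> ('b \<Rightarrow> 'a::euclidean_space measure) \<Rightarrow> nat \<Rightarrow> ((nat \<Rightarrow> 'a) \<Rightarrow> real) \<Rightarrow> bool" where
  "correlation_function M X k \<rho> \<longleftrightarrow>
     (\<forall>A\<in>sets borel. bounded A \<longrightarrow> (\<integral>\<^sup>+ w. emeasure (X w) A ^ k \<partial>M) < \<infinity>) \<and>
     \<rho> \<in> borel_measurable (\<Pi>\<^sub>M j\<in>{..<k}. lborel) \<and> (\<forall>x. 0 \<le> \<rho> x) \<and>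
     (\<forall>B\<in>sets (\<Pi>\<^sub>M j\<in>{..<k}. borel).
        factorial_moment M X k B = (\<integral>\<^sup>+ x\<in>B. ennreal (\<rho> x) \<partial>(\<Pi>\<^sub>M j\<in>{..<k}. lborel)))"

text \<open>Densities are determined only up to null sets, hence the identity with the determinant
  is required almost everywhere.\<close>

definition determinantal_process ::
  "'b measure \<Rightarrow> ('b \<Rightarrow> 'a::euclidean_space measure) \<Rightarrow> ('a \<Rightarrow> 'a \<Rightarrow> complex) \<Rightarrow> bool" where
  "determinantal_process M X K \<longleftrightarrow>
     point_process M X \<and>
     (\<forall>k\<ge>1. \<exists>\<rho>. correlation_function M X k \<rho> \<and>
        (AE x in (\<Pi>\<^sub>M j\<in>{..<k}. lborel).
           complex_of_real (\<rho> x) =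
           Determinant.det (Matrix.mat k k (\<lambda>(i, j). K (x i) (x j)))))"

section \<open>Diffraction spectrum\<close>

definition reflected :: "'a::euclidean_space measure \<Rightarrow> 'a measure" where
  "reflected \<mu> = distr \<mu> borel uminus"

definition finite_patch :: "'a::euclidean_space measure \<Rightarrow> nat \<Rightarrow> 'a measure" where
  "finite_patch \<omega> n = density \<omega> (indicator (ball 0 (real n)))"

definition autocorrelation ::
  "'a::ordered_euclidean_space measure \<Rightarrow> 'a measure \<Rightarrow> bool" where
  "autocorrelation \<omega> \<gamma> \<longleftrightarrow>
     vague_limit
       (\<lambda>n. scale_measure (1 / emeasure lborel (ball (0::'a) (real n)))
              (finite_patch \<omega> n \<star> reflected (finite_patch \<omega> n))) \<gamma>"

definition diffraction_measure ::
  "'a::ordered_euclidean_space measure \<Rightarrow> 'a measure \<Rightarrow> bool" where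
  "diffraction_measure \<omega> \<mu> \<longleftrightarrow> (\<exists>\<gamma>. autocorrelation \<omega> \<gamma> \<and> measure_fourier_transform \<gamma> \<mu>)"

text \<open>The almost sure diffraction measure is unique, so this is a single equivalence class,
  or empty if there is no such measure.\<close>

definition diffraction_spectrum ::
  "'b measure \<Rightarrow> ('b \<Rightarrow> 'a::ordered_euclidean_space measure) \<Rightarrow> 'a measure set" where
  "diffraction_spectrum M X =
     (\<Union>\<mu> \<in> {\<mu>. AE w in M. diffraction_measure (X w) \<mu>}. measure_class \<mu>)"

section \<open>Dynamical spectrum\<close>

definition translate :: "'a::euclidean_space \<Rightarrow> 'a measure \<Rightarrow> 'a measure" where
  "translate x \<omega> = distr \<omega> borel ((+) x)"

definition stationary :: "'a::euclidean_space measure measure \<Rightarrow> bool" where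
  "stationary P \<longleftrightarrow> (\<forall>x. distr P point_measures (translate x) = P)"

definition square_integrable :: "'c measure \<Rightarrow> ('c \<Rightarrow> complex) \<Rightarrow> bool" where
  "square_integrable P F \<longleftrightarrow>
     F \<in> borel_measurable P \<and> integrable P (\<lambda>\<omega>. (cmod (F \<omega>))\<^sup>2)"

definition L2_inner :: "'c measure \<Rightarrow> ('c \<Rightarrow> complex) \<Rightarrow> ('c \<Rightarrow> complex) \<Rightarrow> complex" where
  "L2_inner P F G = (\<integral>\<omega>. F \<omega> * cnj (G \<omega>) \<partial>P)"

definition spectral_measure ::
  "'a::euclidean_space measure measure \<Rightarrow> ('a measure \<Rightarrow> complex) \<Rightarrow> 'a measure \<Rightarrow> bool" where
  "spectral_measure P F \<sigma> \<longleftrightarrow>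
     sets \<sigma> = sets borel \<and> finite_measure \<sigma> \<and>
     (\<forall>x. L2_inner P (F \<circ> translate x) F =
        (\<integral>t. exp (2 * of_real pi * \<i> * of_real (inner x t)) \<partial>\<sigma>))"

text \<open>\<open>P\<close> is the distribution of the point process. Elements of the Hilbert space are
  represented by functions; stationarity makes composition with translations well defined on
  classes modulo \<open>P\<close>. By Bochner's theorem every square integrable \<open>F\<close> then has a unique
  spectral measure. The maximal spectral type is the class of a spectral measure dominating
  all others; the spectrum of a non-stationary law is left empty.\<close>

definition dynamical_spectrum ::
  "'a::euclidean_space measure measure \<Rightarrow> 'a measure set" where
  "dynamical_spectrum P =
     (\<Union>\<sigma> \<in> {\<sigma>. stationary P \<and>
               (\<exists>F. square_integrable P F \<and> spectral_measure P F \<sigma>) \<and>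
               (\<forall>G \<tau>. square_integrable P G \<and> spectral_measure P G \<tau> \<longrightarrow>
                  absolutely_continuous \<sigma> \<tau>)}. measure_class \<sigma>)"

end

(* By the Leibniz formula the correlation functions are at most k!, which gives exponential moments of the
counts, so that polynomials in the counts are dense in L^2; hence omega is stationary. Permutations mixing two
blocks of points contribute two factors of K, so covariances of such polynomials decay like k2 = |K|^2, which is
integrable since phi is bounded. Their spectral measures therefore have a density away from the atom at 0, and
delta_0 + Lebesgue measure dominates every spectral measure. The count of the unit cube has an a.e. positive
spectral density, a multiple of 1 - ps where ps < 1 is the Fourier transform of k2; this gives the converse.
The covariance decay also yields a law of large numbers for pairs of lattice cells; refining the lattice gives
almost surely the autocorrelation delta_0 + (1 - k2) lambda, with Fourier transform delta_0 + (1 - ps) lambda. *)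

theory Submission
  imports Defs "HOL-Library.Discrete_Functions"
begin

text \<open>No rate of decay of \<open>k2\<close> is available beyond integrability, so covariances
  are bounded by integrals of \<open>k2\<close> over balls of fixed radius, never pointwise; these
  are again integrable functions of the centre. Counts are taken on bounded convex sets: their
  frontiers are Lebesgue null, which makes correlations continuous in the translation, and the class
  is closed under intersection and translation. Stationarity is a uniqueness statement: the
  translated law has the same factorial moments, and polynomials are dense in L^2 of the sum of both
  laws. The factor 1 - \<open>ps\<close> is positive off the origin because \<open>k2\<close> is
  continuous with value 1 at 0 and mass at most 1; the mass bound is a Plancherel estimate using phi
  <= 1. The exceptional null set for the autocorrelation must not depend on the test function: it is
  collected from the countably many pairs of a mesh 1/N and a lattice vector, and test functions are
  enclosed between step functions on pairs of cells. As the diffraction spectrum collects every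
  almost sure diffraction measure, the transform of the autocorrelation must be shown
  unique.\<close>

hide_fact (open) Henstock_Kurzweil_Integration.integral_cong Henstock_Kurzweil_Integration.integral_diff
  Henstock_Kurzweil_Integration.integral_add Henstock_Kurzweil_Integration.integral_nonneg Henstock_Kurzweil_Integration.integral_cnj
  Henstock_Kurzweil_Integration.integrable_diff Henstock_Kurzweil_Integration.integrable_add Henstock_Kurzweil_Integration.integrable_cong
  Henstock_Kurzweil_Integration.integrable_bound Henstock_Kurzweil_Integration.integral_sum Henstock_Kurzweil_Integration.integrable_sum

abbreviation NNI :: "'a measure \<Rightarrow> ('a \<Rightarrow> ennreal) \<Rightarrow> ennreal" where "NNI \<equiv> nn_integral"
abbreviation nn_lborel :: "('a::euclidean_space \<Rightarrow> ennreal) \<Rightarrow> ennreal" (binder "NN " 60) where "nn_lborel \<equiv> nn_integral lborel"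
abbreviation BM where "BM \<equiv> borel_measurable"
abbreviation bl :: "nat \<Rightarrow> 'a::euclidean_space set" where "bl n \<equiv> ball 0 (real n)"
abbreviation cr where "cr \<equiv> complex_of_real"
abbreviation ind :: "'a set \<Rightarrow> 'a \<Rightarrow> 'b::zero_neq_one" where "ind \<equiv> indicator"
abbreviation vol :: "'a::euclidean_space set \<Rightarrow> real" where "vol \<equiv> measure lborel"
abbreviation ph :: "'a::real_inner \<Rightarrow> 'a \<Rightarrow> real" where "ph x y \<equiv> 2 * pi * inner x y"
abbreviation PM :: "'a::euclidean_space measure set" where "PM \<equiv> space point_measures"
abbreviation LL :: "nat \<Rightarrow> (nat \<Rightarrow> 'a::euclidean_space) measure" where "LL k \<equiv> (\<Pi>\<^sub>M j\<in>{..<k}. lborel)"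
abbreviation seq_tendsto :: "(nat \<Rightarrow> 'a::topological_space) \<Rightarrow> 'a \<Rightarrow> bool" ("(_/ ~~> _)" [60, 60] 60)
  where "f ~~> l \<equiv> f \<longlonglongrightarrow> l"

section \<open>Integrals of products over coordinates and the one-dimensional Gaussian\<close>

lemma
 fixes g :: "'a::euclidean_space => real => complex"
 assumes "!!b. b : Basis ==> integrable lborel (g b)"
 shows integrable_prod_Basis: "integrable lborel (%x::'a. PROD b:Basis. g b (inner x b))"
  and integral_prod_Basis:
   "(LINT x|(lborel::'a measure). (PROD b:Basis. g b (inner x b))) = (PROD b:Basis. (LBINT x. g b x))"
proof -
 interpret product_sigma_finite "%_::'a. lborel :: real measure" ..
 \<comment> \<open>\<open>?T\<close> assembles a point from its coordinates. By
   \<open>lborel_eq\<close> it carries the product of one-dimensional Lebesgue measures over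
   \<open>Basis\<close> to \<open>lborel\<close>, so Fubini for finite products yields both
   claims.\<close>
 let ?T = "%f::'a => real. SUM b:Basis. f b *\<^sub>R b"
 have m: "g b : BM borel" if "b : Basis" for b using borel_measurable_integrable[OF assms[OF that]] by simp
 have T [measurable]: "?T : (\<Pi>\<^sub>M b\<in>Basis. lborel) \<rightarrow>\<^sub>M borel" by measurable
 have inn: "inner (?T f) b = f b" if "b : Basis" for f b using that by (rule inner_sum_left_Basis)
 have *: "(%f. PROD b:Basis. g b (inner (?T f) b)) = (%f. PROD b:Basis. g b (f b))" by (intro ext prod.cong refl) (simp only: inn)
 have m2: "(%x::'a. PROD b:Basis. g b (inner x b)) : BM borel" by (intro borel_measurable_prod measurable_compose[OF _ m]) measurable
 have "integrable (distr (\<Pi>\<^sub>M b\<in>Basis. lborel) borel ?T) (%x::'a. PROD b:Basis. g b (inner x b))" using product_integrable_prod[OF finite_Basis assms]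
  by (subst integrable_distr_eq) (simp_all only: * T m2)
 then show "integrable lborel (%x::'a. PROD b:Basis. g b (inner x b))" by (simp only: lborel_eq[symmetric])
 have "(LINT x|(distr (\<Pi>\<^sub>M b\<in>Basis. lborel) borel ?T). (PROD b:Basis. g b (inner x b))) = (PROD b:Basis. (LBINT x. g b x))"
  using product_integral_prod[OF finite_Basis assms] by (subst integral_distr) (simp_all only: * T m2)
 then show "(LINT x|(lborel::'a measure). (PROD b:Basis. g b (inner x b))) = (PROD b:Basis. (LBINT x. g b x))" by (simp only: lborel_eq[symmetric])
qed

lemma borel_measurable_cis [measurable]: "(cis :: real => complex) : BM borel" unfolding cis_conv_exp by measurable

lemma fourier_cis:
 "fourier f y = (LBINT x. f x*cis (- (ph x y)))" unfolding fourier_def by (intro integral_cong) (auto simp: cis_conv_exp algebra_simps)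

lemma integrable_scaleR_cancel:
 fixes f :: "'a => 'b::{banach,second_countable_topology}"
 assumes "integrable M (%x. c *\<^sub>R f x)" "c ~= 0"
 shows "integrable M f" using integrable_scaleR_right[OF assms(1), of "inverse c"] assms(2) by simp

text \<open>An affine substitution turns the integral into the characteristic function of the
  standard normal distribution, whose value is known.\<close>

lemma
 fixes e t :: real assumes "e > 0"
 shows integrable_gauss1: "integrable lborel (%x. cr (exp (- (pi*e*x^2)))*cis (- (2*pi*(x*t))))"
  and integral_gauss1: "(LBINT x. cr (exp (- (pi*e*x^2)))*cis (- (2*pi*(x*t))))
   = cr (1 / sqrt e*exp (- (pi*t^2/e)))"
proof -
 \<comment> \<open>With this scale \<open>std_normal_density (c*x)\<close> is exp(-pi e x^2) up to
   the factor 1/sqrt(2 pi); the frequency \<open>s\<close> below is then dictated by s c = -2 pi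
   t.\<close>
 define c where "c = sqrt (2*pi*e)"
 have c: "c > 0" "c^2 = 2*pi*e" using assms by (auto simp: c_def)
 have dens: "std_normal_density (0 + c*x) = exp (- (pi*e*x^2)) / sqrt (2*pi)" for x by (simp add: std_normal_density_def power_mult_distrib c)
 define s where "s = - (2*pi*t/c)"
 have "char std_normal_distribution s = exp (- (s^2)/2)" by (simp add: char_std_normal_distribution)
 moreover have "char std_normal_distribution s = (LBINT x. std_normal_density x *\<^sub>R cis (s*x))"
  unfolding char_def by (subst integral_density) (auto simp: cis_conv_exp)
 ultimately have 1: "(LBINT x. std_normal_density x *\<^sub>R cis (s*x)) = exp (- (s^2)/2)" by simp
 have I: "integrable lborel (%x. std_normal_density x *\<^sub>R cis (s*x))" by (rule integrable_bound[of _ std_normal_density]) (auto simp: integrable_normal_density)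
 have eq: "std_normal_density (0 + c*x) *\<^sub>R cis (s*(0 + c*x))
   = (1 / sqrt (2*pi)) *\<^sub>R (cr (exp (- (pi*e*x^2)))*cis (- (2*pi*(x*t))))" for x
 proof -
  have "s*(0 + c*x) = - (2*pi*(x*t))" using c by (simp add: s_def)
  then show ?thesis unfolding dens by (simp add: scaleR_conv_of_real)
 qed
 have "integrable lborel (%x. std_normal_density (0 + c*x) *\<^sub>R cis (s*(0 + c*x)))" using lborel_integrable_real_affine[OF I, of c 0] c by simp
 then show "integrable lborel (%x. cr (exp (- (pi*e*x^2)))*cis (- (2*pi*(x*t))))" unfolding eq by (rule integrable_scaleR_cancel) simp
 have "exp (- (s^2)/2) = (LBINT x. std_normal_density x *\<^sub>R cis (s*x))" using 1 by simp
 also have "... = \<bar>c\<bar> *\<^sub>R (LBINT x. std_normal_density (0 + c*x) *\<^sub>R cis (s*(0 + c*x)))"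
  by (rule lborel_integral_real_affine) (use c in auto)
 also have "... = (c / sqrt (2*pi)) *\<^sub>R (LBINT x. cr (exp (- (pi*e*x^2)))*cis (- (2*pi*(x*t))))" unfolding eq using c by simp
 also have "c / sqrt (2*pi) = sqrt e" by (simp add: c_def real_sqrt_mult)
 finally have "cr (exp (- (s^2)/2)) = sqrt e *\<^sub>R (LBINT x. cr (exp (- (pi*e*x^2)))*cis (- (2*pi*(x*t))))" .
 moreover have "- (s^2)/2 = - (pi*t^2/e)"
 proof -
  have "s^2 = 4*pi^2*t^2/(2*pi*e)" unfolding s_def c(2)[symmetric] by (simp add: power_divide power_mult_distrib)
  then show ?thesis using assms by (simp add: field_simps power2_eq_square)
 qed
 ultimately have "cr (exp (- (pi*t^2/e))) = cr (sqrt e)*(LBINT x. cr (exp (- (pi*e*x^2)))*cis (- (2*pi*(x*t))))"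
  by (simp add: scaleR_conv_of_real)
 then show "(LBINT x. cr (exp (- (pi*e*x^2)))*cis (- (2*pi*(x*t))))
   = cr (1 / sqrt e*exp (- (pi*t^2/e)))" using assms by (simp add: )
qed

section \<open>Fourier inversion\<close>

definition gauss :: "real => 'a::euclidean_space => real" where
 "gauss e x = exp (- (pi*e*(norm x)^2))"

text \<open>The Fourier transform of \<open>gauss e\<close>. It is the density of a centred normal
  law with covariance e/(2 pi) times the identity, hence an approximate identity as \<open>e\<close>
  tends to 0.\<close>

definition hk :: "real => 'a::euclidean_space => real" where
 "hk e x = (1 / sqrt e)^DIM('a)*exp (- (pi*(norm x)^2/e))"

lemma gauss_measurable [measurable]: "gauss e : BM borel" unfolding gauss_def by measurable

lemma hk_measurable [measurable]: "hk e : BM borel" unfolding hk_def by measurable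

lemma gauss_pos [simp]: "gauss e x > 0" by (simp add: gauss_def)
lemma gauss_nonneg [simp]: "gauss e x >= 0" by (simp add: gauss_def)
lemma gauss_le_1: "e >= 0 ==> gauss e x <= 1" by (simp add: gauss_def)
lemma hk_nonneg [simp]: "e >= 0 ==> hk e x >= 0" by (simp add: hk_def)

lemma norm_power2_Basis: "(norm (x::'a::euclidean_space))^2 = (SUM b:Basis. (inner x b)^2)"
 unfolding power2_norm_eq_inner by (subst euclidean_inner) (simp add: power2_eq_square)

lemma
 fixes y :: "'a::euclidean_space" assumes e: "e > 0"
 shows integrable_gauss_cis: "integrable lborel (%x::'a. cr (gauss e x)*cis (- (ph x y)))"
  and fourier_gauss: "fourier (%x::'a. cr (gauss e x)) y = cr (hk e y)"
proof -
 let ?g = "%b x. cr (exp (- (pi*e*x^2)))*cis (- (2*pi*(x*inner y b)))"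
 have cs: "cis (SUM i:A. f i) = (PROD i:A. cis (f i))" if "finite A" for A :: "'a set" and f using that by (induction A) (auto simp: cis_mult[symmetric])
 have eq: "(PROD b:Basis. ?g b (inner x b)) = cr (gauss e x)*cis (- (ph x y))" for x :: 'a
 proof -
  have "(PROD b:Basis. ?g b (inner x b)) = cr (PROD b:Basis. exp (- (pi*e*(inner x b)^2)))
   * (PROD b:Basis. cis (- (2*pi*(inner x b*inner y b))))" by (simp add: prod.distrib)
  also have "(PROD b:Basis. exp (- (pi*e*(inner x b)^2))) = exp (- (pi*e*(norm x)^2))"
   unfolding norm_power2_Basis by (simp add: exp_sum[symmetric] sum_distrib_left sum_negf)
  also have "(PROD b:Basis. cis (- (2*pi*(inner x b*inner y b)))) = cis (- (ph x y))"
   by (subst euclidean_inner) (simp add: cs[symmetric] sum_distrib_left sum_negf)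
  finally show ?thesis by (simp add: gauss_def)
 qed
 show "integrable lborel (%x::'a. cr (gauss e x)*cis (- (ph x y)))"
  using integrable_prod_Basis[of ?g] integrable_gauss1[OF e] by (simp add: eq)
 have "fourier (%x::'a. cr (gauss e x)) y = (LINT x|(lborel::'a measure). (PROD b:Basis. ?g b (inner x b)))" unfolding fourier_cis eq ..
 also have "... = (PROD b:Basis. cr (1 / sqrt e*exp (- (pi*(inner y b)^2/e))))"
  using e by (subst integral_prod_Basis) (simp_all add: integrable_gauss1 integral_gauss1)
 also have "... = cr (hk e y)" unfolding of_real_prod[symmetric] hk_def norm_power2_Basis
  by (simp add: prod_dividef exp_sum[symmetric] sum_distrib_left sum_negf sum_divide_distrib power_divide del: of_real_prod)
 finally show "fourier (%x::'a. cr (gauss e x)) y = cr (hk e y)" .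
qed

lemma integrable_gauss: "e > 0 ==> integrable lborel (gauss e :: 'a::euclidean_space => real)"
 using integrable_gauss_cis[of e "0::'a"] by (simp add: complex_of_real_integrable_eq)

lemma integral_gauss: "e > 0 ==> (LBINT x. gauss e (x::'a::euclidean_space)) = (1 / sqrt e)^DIM('a)" using fourier_gauss[of e "0::'a"]
 by (simp add: fourier_cis hk_def of_real_power[symmetric] of_real_divide[symmetric] del: of_real_power of_real_divide)

lemma hk_eq: "e > 0 ==> hk e (x::'a::euclidean_space) = (1 / sqrt e)^DIM('a)*gauss (1/e) x" by (simp add: hk_def gauss_def)

lemma
 assumes "e > 0"
 shows integrable_hk: "integrable lborel (hk e :: 'a::euclidean_space => real)"
  and integral_hk: "(LBINT x. hk e (x::'a)) = 1"
proof -
 have *: "hk e = (%x::'a. (1 / sqrt e)^DIM('a)*gauss (1/e) x)" using assms by (intro ext hk_eq)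
 show "integrable lborel (hk e :: 'a => real)" unfolding * using assms by (simp add: integrable_gauss)
 show "(LBINT x. hk e (x::'a)) = 1" unfolding * using assms by (simp add: integral_gauss power_divide real_sqrt_divide)
qed

lemma hk_minus_commute: "hk e (x - y) = hk e (y - x)" by (simp add: hk_def norm_minus_commute)

lemma integrable_lborel_translate:
 fixes f :: "'a::euclidean_space => 'b::{banach,second_countable_topology}"
 shows "integrable lborel (%x. f (c + x)) \<longleftrightarrow> integrable lborel f"
proof -
 have "integrable lborel f ==> integrable lborel (%x. f (c + x))" for c and f :: "'a => 'b"
  using integrable_distr[of "(+) c" lborel borel f] by (simp add: lborel_distr_plus)
 from this[of f c] this[of "%x. f (c + x)" "- c"] show ?thesis by auto
qed

lemma integral_lborel_translate:
 fixes f :: "'a::euclidean_space => 'b::{banach,second_countable_topology}"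
 assumes [measurable]: "f : BM borel"
 shows "(LBINT x. f (c + x)) = (LBINT x. f x)" by (subst (2) lborel_distr_plus[of c, symmetric]) (simp add: integral_distr)

lemma lborel_distr_uminus': "distr lborel borel uminus = (lborel :: 'a::euclidean_space measure)"
 by (subst (2) lborel_affine[of "-1" 0]) (auto simp: density_1 one_ennreal_def[symmetric])

lemma integral_lborel_uminus:
 fixes f :: "'a::euclidean_space => 'b::{banach,second_countable_topology}"
 assumes [measurable]: "f : BM borel"
 shows "(LBINT x. f (- x)) = (LBINT x. f x)" by (subst (2) lborel_distr_uminus'[symmetric]) (simp add: integral_distr)

text \<open>The substitution s = y + sqrt(e) z moves the parameter from the kernel into the argument
  of \<open>f\<close>; the fixed weight \<open>hk 1\<close> then serves as majorant in
  \<open>hk_approximate_identity\<close>.\<close>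

lemma hk_rescale:
 fixes y :: "'a::euclidean_space" and f :: "'a => complex"
 assumes "e > 0" and [measurable]: "f : BM borel"
 shows "(LBINT s. f s*hk e (s - y)) = (LBINT z. f (y + sqrt e *\<^sub>R z)*hk 1 z)"
proof -
 have "(LBINT s. f s*hk e (s - y)) =
  (\<integral>s. f s*hk e (s - y) \<partial>density (distr lborel borel (%x. y + sqrt e *\<^sub>R x)) (%x. ennreal (\<bar>sqrt e\<bar>^DIM('a))))"
  using assms(1) by (subst lborel_affine[of "sqrt e" y]) simp_all
 also have "... = (LBINT z. (sqrt e^DIM('a)) *\<^sub>R (f (y + sqrt e *\<^sub>R z)*hk e (sqrt e *\<^sub>R z)))"
  using assms(1) by (subst integral_density) (simp_all add: integral_distr)
 also have "... = (LBINT z. f (y + sqrt e *\<^sub>R z)*hk 1 z)"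
 proof (intro integral_cong refl)
  fix z :: 'a
  have "hk e (sqrt e *\<^sub>R z) * sqrt e^DIM('a) = hk 1 z" using assms(1) by (simp add: hk_def power_mult_distrib power_divide)
  then have "cr (sqrt e^DIM('a))*cr (hk e (sqrt e *\<^sub>R z)) = cr (hk 1 z)"
   unfolding of_real_mult[symmetric] by (simp add: mult.commute)
  then show "(sqrt e^DIM('a)) *\<^sub>R (f (y + sqrt e *\<^sub>R z)*cr (hk e (sqrt e *\<^sub>R z))) = f (y + sqrt e *\<^sub>R z)*cr (hk 1 z)"
   by (simp add: scaleR_conv_of_real)
 qed
 finally show ?thesis .
qed

lemma hk_approximate_identity:
 fixes y :: "'a::euclidean_space" and f :: "'a => complex"
 assumes [measurable]: "f : BM borel" and bd: "!!x. norm (f x) <= B" and cont: "isCont f y"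
  and e: "!!n. e n > 0" "e ~~> 0"
 shows "(%n. (LBINT s. f s*hk (e n) (s - y))) ~~> f y"
proof -
 have "(%n. (LBINT z. f (y + sqrt (e n) *\<^sub>R z)*hk 1 z)) ~~> (LINT z|(lborel::'a measure). f y*hk 1 z)"
 proof (rule integral_dominated_convergence[where w="%z. B*hk 1 z"])
  show "AE z in lborel. (%n. f (y + sqrt (e n) *\<^sub>R z)*cr (hk 1 z)) ~~> f y*cr (hk 1 z)"
  proof (intro always_eventually allI tendsto_mult tendsto_const)
   fix z :: 'a
   have "(%n. y + sqrt (e n) *\<^sub>R z) ~~> y + sqrt 0 *\<^sub>R z" by (intro tendsto_intros e)
   then show "(%n. f (y + sqrt (e n) *\<^sub>R z)) ~~> f y" using isCont_tendsto_compose[OF cont] by simp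
  qed
  show "!!n. AE z in lborel. norm (f (y + sqrt (e n) *\<^sub>R z)*cr (hk 1 z)) <= B*hk 1 z" by (auto simp: norm_mult intro!: mult_right_mono bd)
 qed (auto intro: integrable_hk)
 also have "(LINT z|(lborel::'a measure). f y*hk 1 z) = f y" by (simp add: integral_hk)
 finally show ?thesis by (simp add: hk_rescale e)
qed

lemma integrable_pair_mult:
 fixes f :: "'a => complex" and g :: "'b => complex"
 assumes "sigma_finite_measure M" "sigma_finite_measure N" and f: "integrable M f" and g: "integrable N g"
 shows "integrable (M \<Otimes>\<^sub>M N) (%(x, y). f x*g y)"
proof -
 interpret pair_sigma_finite M N using assms by (simp add: pair_sigma_finite_def)
 note [measurable] = borel_measurable_integrable[OF f] borel_measurable_integrable[OF g]
 show ?thesis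
 proof (rule Fubini_integrable)
  show "(%(x, y). f x*g y) : BM (M \<Otimes>\<^sub>M N)" by measurable
  show "integrable M (%x. (LINT y|N. norm (case (x, y) of (x, y) => f x*g y)))" using f by (simp add: norm_mult)
  show "AE x in M. integrable N (%y. case (x, y) of (x, y) => f x*g y)" using g by simp
 qed
qed

lemma norm_fourier_le: "norm (fourier f y) <= (LBINT x. norm (f x))"
proof -
 have "norm (fourier f y) <= (LBINT x. norm (f x*cis (- (ph x y))))" unfolding fourier_cis by (rule integral_norm_bound)
 then show ?thesis by (simp add: norm_mult)
qed

lemma isCont_fourier:
 fixes f :: "'a::euclidean_space => complex"
 assumes f: "integrable lborel f"
 shows "isCont (fourier f) y" unfolding continuous_at_sequentially
proof (intro allI impI)
 fix X :: "nat => 'a" assume X: "X ~~> y"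
 note [measurable] = borel_measurable_integrable[OF f]
 have "(%n. (LBINT x. f x*cis (- (ph x (X n))))) ~~> (LBINT x. f x*cis (- (ph x y)))"
  by (rule integral_dominated_convergence[where w="%x. norm (f x)"]) (auto simp: norm_mult f cis_conv_exp intro!: tendsto_intros X)
 then show "(fourier f \<circ> X) ~~> fourier f y" by (simp add: fourier_cis comp_def)
qed

lemma fourier_measurable [measurable]:
 fixes f :: "'a::euclidean_space => complex"
 assumes f: "integrable lborel f"
 shows "fourier f : BM borel" by (intro borel_measurable_continuous_onI continuous_at_imp_continuous_on) (simp add: isCont_fourier f)

text \<open>The Gaussian weight makes the double integral absolutely convergent even if
  \<open>fourier f\<close> is not integrable; exchanging the integrals then moves the transform onto
  the Gaussian, where it is explicit.\<close>

lemma fourier_smoothing: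
 fixes f :: "'a::euclidean_space => complex"
 assumes f: "integrable lborel f" and e: "e > 0"
 shows "(LBINT x. fourier f x*cis (ph x y)*gauss e x) = (LBINT s. f s*hk e (s - y))"
  (is "?L = ?R")
proof -
 note [measurable] = borel_measurable_integrable[OF f]
 let ?h = "%s x. f s*cis (- (ph s x))*cis (ph x y)*cr (gauss e x)"
 have g: "integrable lborel (%x::'a. cr (gauss e x))" using integrable_gauss[OF e] by (simp add: complex_of_real_integrable_eq)
 have I: "integrable (lborel \<Otimes>\<^sub>M lborel) (%(s, x). ?h s x)"
 proof (rule integrable_bound[OF integrable_pair_mult[OF _ _ f g]])
  show "AE x in lborel \<Otimes>\<^sub>M lborel. cmod (case x of (s, x) => ?h s x) <= cmod (case x of (x, y) => f x*cr (gauss e y))"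
   by (auto simp: norm_mult)
 qed (auto intro: lborel.sigma_finite_measure_axioms)
 have "?L = (LBINT x. (LBINT s. ?h s x))" unfolding fourier_cis by simp
 also have "... = (LBINT s. (LBINT x. ?h s x))" by (rule lborel_pair.Fubini_integral[OF I])
 also have "... = ?R"
 proof (intro integral_cong refl)
  fix s :: 'a
  have "(LBINT x. ?h s x) = (LBINT x. f s*(cr (gauss e x)*cis (- (ph x (s - y)))))" by (intro integral_cong refl)
    (simp add: cis_mult inner_diff_right inner_commute[of s] algebra_simps)
  also have "... = f s*fourier (%x. cr (gauss e x)) (s - y)" unfolding fourier_cis by simp
  finally show "(LBINT x. ?h s x) = f s*hk e (s - y)" by (simp add: fourier_gauss[OF e])
 qed
 finally show ?thesis .
qed

lemma gauss_tendsto_1: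
 assumes "e ~~> 0" shows "(%n. gauss (e n) x) ~~> 1"
proof -
 have "(%n. exp (- (pi*e n*(norm x)^2))) ~~> exp (- (pi*0*(norm x)^2))" by (intro tendsto_intros assms)
 then show ?thesis by (simp add: gauss_def)
qed

lemma inverse_Suc_tendsto: "(%n. inverse (real (Suc n))) ~~> 0" by (rule LIMSEQ_inverse_real_of_nat)

text \<open>Both sides are limits of the smoothing identity at \<open>y\<close> as the damping
  vanishes: one by dominated convergence with majorant |\<open>fourier f\<close>|, the other because
  \<open>hk\<close> is an approximate identity at a continuity point.\<close>

theorem fourier_inversion:
 fixes f :: "'a::euclidean_space => complex"
 assumes f: "integrable lborel f" and bd: "!!x. norm (f x) <= B" and cont: "isCont f y"
  and ff: "integrable lborel (fourier f)"
 shows "(LBINT x. fourier f x*cis (ph x y)) = f y"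
proof (rule LIMSEQ_unique)
 note [measurable] = borel_measurable_integrable[OF f] borel_measurable_integrable[OF ff]
 let ?e = "%n. inverse (real (Suc n))"
 show "(%n. (LBINT x. fourier f x*cis (ph x y)*gauss (?e n) x)) ~~> (LBINT x. fourier f x*cis (ph x y))"
 proof (rule integral_dominated_convergence[where w="%x. norm (fourier f x)"])
  show "AE x in lborel. (%n. fourier f x*cis (ph x y)*cr (gauss (?e n) x)) ~~> fourier f x*cis (ph x y)"
   using tendsto_mult[OF tendsto_const tendsto_of_real[OF gauss_tendsto_1[OF inverse_Suc_tendsto]]] by fastforce
  show "!!n. AE x in lborel. norm (fourier f x*cis (ph x y)*cr (gauss (?e n) x)) <= norm (fourier f x)"
   by (intro AE_I2) (simp add: norm_mult mult_left_le[OF gauss_le_1])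
 qed (use ff in auto)
 show "(%n. (LBINT x. fourier f x*cis (ph x y)*gauss (?e n) x)) ~~> f y"
  unfolding fourier_smoothing[OF f, of "?e _", OF positive_imp_inverse_positive[OF of_nat_0_less_iff[THEN iffD2, OF zero_less_Suc]]]
  by (rule hk_approximate_identity[OF _ bd cont _ inverse_Suc_tendsto]) auto
qed

text \<open>For a nonnegative transform the damped integrals increase as the damping is removed, and
  by smoothing at 0 they converge to \<open>f 0\<close>. Monotone convergence therefore gives
  integrability, the hypothesis that inversion requires.\<close>

lemma integrable_nonneg_fourier:
 fixes f :: "'a::euclidean_space => complex"
 assumes f: "integrable lborel f" and bd: "!!x. norm (f x) <= B" and cont: "isCont f 0"
  and D: "!!x. fourier f x = cr (D x)" "!!x. D x >= 0"
 shows "integrable lborel (fourier f)"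
proof -
 let ?e = "%n. inverse (real (Suc n))"
 have [measurable]: "D : BM borel" using measurable_compose[OF fourier_measurable[OF f] borel_measurable_Re] by (simp add: D)
 have fb: "norm (fourier f x) <= (LBINT x. norm (f x))" for x by (rule norm_fourier_le)
 have I: "integrable lborel (%x. D x*gauss (?e n) x)" for n
 proof (rule integrable_bound[of _ "%x. (LBINT x. norm (f x))*gauss (?e n) x"])
  show "AE x in lborel. norm (D x*gauss (?e n) x) <= norm ((LBINT x. norm (f x))*gauss (?e n) x)" using fb by (auto simp: D abs_mult intro!: mult_right_mono)
 qed (auto intro!: integrable_gauss)
 have lim: "(%n. (LBINT s. f s*hk (?e n) (s - 0))) ~~> f 0" using borel_measurable_integrable[OF f]
  by (intro hk_approximate_identity[OF _ bd cont _ inverse_Suc_tendsto]) auto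
 have eq: "(LBINT s. f s*hk (?e n) (s - 0)) = cr (LBINT x. D x*gauss (?e n) x)" for n
  using fourier_smoothing[OF f, of "?e n" 0] unfolding D by (simp flip: of_real_mult)
 have "(%n. (LBINT x. D x*gauss (?e n) x)) ~~> Re (f 0)" using tendsto_Re[OF lim[unfolded eq]] by simp
 then have "integrable lborel D"
 proof (rule integrable_monotone_convergence[rotated 3])
  show "AE x in lborel. mono (%n. D x*gauss (?e n) x)" by (auto simp: mono_def gauss_def D field_simps intro!: AE_I2 mult_left_mono mult_right_mono)
  show "AE x in lborel. (%n. D x*gauss (?e n) x) ~~> D x"
   using tendsto_mult[OF tendsto_const gauss_tendsto_1[OF inverse_Suc_tendsto]] by fastforce
 qed (use I in auto)
 then show ?thesis unfolding D(1)[abs_def] by (simp add: complex_of_real_integrable_eq)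
qed

text \<open>A Plancherel estimate: with Gaussian damping, the integral of |K|^2 equals the integral
  of \<open>f\<close> times its smoothing \<open>R\<close>. The bound \<open>f x <= 1\<close> gives
  \<open>R t <= 1\<close>, so what remains is at most the mass of \<open>f\<close>.\<close>

lemma fourier_L2_le_1:
 fixes f :: "'a::euclidean_space => real"
 assumes f: "integrable lborel f" and f01: "!!x. 0 <= f x" "!!x. f x <= 1" and "(LBINT x. f x) = 1"
 defines "K \<equiv> fourier (%x. cr (f x))"
 shows "integrable lborel (%x. (cmod (K x))^2)" "(LBINT x. (cmod (K x))^2) <= 1"
proof -
 let ?f = "%x. cr (f x)"
 let ?e = "%n. inverse (real (Suc n))"
 have cf: "integrable lborel ?f" using f by (simp add: complex_of_real_integrable_eq)
 note [measurable] = borel_measurable_integrable[OF f]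
 have [measurable]: "K : BM borel" unfolding K_def by (rule fourier_measurable[OF cf])
 have K1: "cmod (K x) <= 1" for x using norm_fourier_le[of ?f x] assms by (simp add: K_def)
 have I: "integrable lborel (%x. (cmod (K x))^2*gauss (?e n) x)" for n
 proof (rule integrable_bound[of _ "%x. gauss (?e n) x"])
  show "AE x in lborel. norm ((cmod (K x))^2*gauss (?e n) x) <= norm (gauss (?e n) x)"
   using K1 by (auto simp: abs_mult intro!: mult_left_le_one_le power_le_one)
 qed (auto intro!: integrable_gauss)
 have le: "(LBINT x. (cmod (K x))^2*gauss e x) <= 1" if e: "e > 0" for e
 proof -
  define R where "R t = (LBINT s. f s*hk e (s - t))" for t
  have hki: "integrable lborel (%s. hk e (s - t))" for t :: 'a using integrable_lborel_translate[of "hk e" "-t"] integrable_hk[OF e] by (simp add: add.commute)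
  have hk1: "(LBINT s. hk e (s - t)) = 1" for t :: 'a using integral_lborel_translate[of "hk e" "-t"] integral_hk[OF e] by (simp add: add.commute)
  have Ri: "integrable lborel (%s. f s*hk e (s - t))" for t by (rule integrable_bound[OF hki[of t]])
    (use f01 e in \<open>auto simp: abs_mult intro!: mult_left_le_one_le\<close>)
  have R: "0 <= R t" "R t <= 1" for t
  proof -
   show "0 <= R t" unfolding R_def using f01 e by (intro integral_nonneg_AE) auto
   have "R t <= (LBINT s. hk e (s - t))" unfolding R_def using f01 e by (intro integral_mono Ri hki) (auto intro!: mult_left_le_one_le)
   then show "R t <= 1" by (simp add: hk1)
  qed
  have [measurable]: "R : BM borel" unfolding R_def by measurable
  have sm: "(LBINT x. K x*cis (ph x t)*gauss e x) = cr (R t)" for t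
   unfolding K_def fourier_smoothing[OF cf e] R_def by (simp flip: of_real_mult)
  let ?h = "%t x. ?f t*(K x*cis (ph x t)*cr (gauss e x))"
  have g: "integrable lborel (%x::'a. cr (gauss e x))" using integrable_gauss[OF e] by (simp add: complex_of_real_integrable_eq)
  have J: "integrable (lborel \<Otimes>\<^sub>M lborel) (%(t, x). ?h t x)"
  proof (rule integrable_bound[OF integrable_pair_mult[OF _ _ cf g]])
   show "AE x in lborel \<Otimes>\<^sub>M lborel. cmod (case x of (s, x) => ?h s x) <= cmod (case x of (x, y) => ?f x*cr (gauss e y))"
    using K1 by (auto simp: norm_mult intro!: AE_I2 mult_left_mono mult_left_le_one_le)
  qed (auto intro: lborel.sigma_finite_measure_axioms)
  have "cr (LBINT x. (cmod (K x))^2*gauss e x)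
    = (LBINT x. K x*cnj (K x)*gauss e x)"
   by (simp flip: integral_complex_of_real add: complex_norm_square[symmetric] of_real_mult[symmetric] del: of_real_mult of_real_power)
  also have "... = (LBINT x. (LBINT t. ?h t x))"
  proof (intro integral_cong refl)
   fix x
   have "cnj (K x) = (LBINT t. ?f t*cis (ph x t))" unfolding K_def fourier_cis integral_cnj[symmetric] by (simp add: cis_cnj inner_commute)
   then have "K x*cnj (K x)*gauss e x = (LBINT t. (K x*gauss e x)*(?f t*cis (ph x t)))" by simp
   then show "K x*cnj (K x)*gauss e x = (LBINT t. ?h t x)" by (simp add: mult_ac)
  qed
  also have "... = (LBINT t. (LBINT x. ?h t x))" by (rule lborel_pair.Fubini_integral[OF J])
  also have "... = (LBINT t. cr (f t*R t))" by (simp add: sm)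
  finally have "(LBINT x. (cmod (K x))^2*gauss e x) = (LBINT t. f t*R t)" unfolding integral_complex_of_real by (simp only: of_real_eq_iff)
  also have "... <= (LBINT t. f t)"
  proof (rule integral_mono[OF _ f])
   show "integrable lborel (%t. f t*R t)" by (rule integrable_bound[OF f]) (use f01 R in \<open>auto simp: abs_mult intro!: mult_left_le\<close>)
   show "!!x. f x*R x <= f x" using f01 R by (simp add: mult_left_le)
  qed
  finally show ?thesis using assms by simp
 qed
 \<comment> \<open>Fatou's lemma removes the damping without presupposing integrability of
   |K|^2.\<close>
 have 1: "(NN x. ennreal ((cmod (K x))^2)) <= 1"
 proof -
  have "(NN x. ennreal ((cmod (K x))^2)) = (NN x. liminf (%n. ennreal ((cmod (K x))^2*gauss (?e n) x)))"
  proof (intro nn_integral_cong)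
   fix x
   have "(%n. ennreal ((cmod (K x))^2*gauss (?e n) x)) ~~> ennreal ((cmod (K x))^2*1)"
    by (intro tendsto_ennrealI tendsto_mult tendsto_const gauss_tendsto_1 inverse_Suc_tendsto)
   from lim_imp_Liminf[OF sequentially_bot this]
   show "ennreal ((cmod (K x))^2) = liminf (%n. ennreal ((cmod (K x))^2*gauss (?e n) x))" by (simp only: mult_1_right)
  qed
  also have "... <= liminf (%n. (NN x. ennreal ((cmod (K x))^2*gauss (?e n) x)))" by (rule nn_integral_liminf) measurable
  also have "... <= 1"
  proof -
   have "(NN x. ennreal ((cmod (K x))^2*gauss (?e n) x)) <= 1" for n using le[of "?e n"] by (subst nn_integral_eq_integral[OF I]) auto
   then show ?thesis by (intro Liminf_le) (auto intro!: always_eventually)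
  qed
  finally show ?thesis .
 qed
 then show *: "integrable lborel (%x. (cmod (K x))^2)" by (intro integrableI_nonneg) (auto simp: less_top[symmetric] top_unique)
 show "(LBINT x. (cmod (K x))^2) <= 1" using 1 by (subst (asm) nn_integral_eq_integral[OF *]) auto
qed

section \<open>Decay of Fourier transforms of Schwartz functions\<close>

lemma integrable_prod_inverse:
 "integrable lborel (%x::'a::euclidean_space. PROD b:Basis. inverse (1 + (inner x b)^2))"
proof -
 have "integrable lborel (%x. inverse (1 + x^2 :: real))" using integrable_inverse_1_plus_square by (simp add: set_integrable_def einterval_def)
 then have "integrable lborel (%x. cr (inverse (1 + x^2)))" by (simp only: complex_of_real_integrable_eq)
 then have "integrable lborel (%x::'a. PROD b:Basis. cr (inverse (1 + (inner x b)^2)))" by (rule integrable_prod_Basis)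
 then show ?thesis unfolding of_real_prod[symmetric] by (simp only: complex_of_real_integrable_eq)
qed

text \<open>Each coordinate satisfies 1 + x_b^2 <= (1 + |x|)^2, so decay of order twice the
  dimension in the norm is dominated by the integrable product of one-dimensional factors. This is
  the origin of the exponent \<open>2*DIM('a)\<close> below.\<close>

lemma inverse_power_le_prod:
 "inverse ((1 + norm (x::'a::euclidean_space))^(2*DIM('a))) <= (PROD b:Basis. inverse (1 + (inner x b)^2))"
proof -
 have "(1 + (inner x b)^2) <= (1 + norm x)^2" if "b : Basis" for b
 proof -
  have "(inner x b)^2 <= (norm x)^2" using Basis_le_norm[OF that, of x] by (metis abs_ge_zero power2_abs power_mono)
  moreover have "1 + u <= (1 + r)^2" if "u <= r^2" "0 <= r" for u r :: real using that by (simp add: power2_sum)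
  ultimately show ?thesis by simp
 qed
 then have "(PROD b:Basis. (1 + (inner x b)^2)) <= (PROD b:(Basis::'a set). (1 + norm x)^2)" by (intro prod_mono) auto
 also have "... = (1 + norm x)^(2*DIM('a))" by (simp add: power_mult)
 finally have "inverse ((1 + norm x)^(2*DIM('a))) <= inverse (PROD b:Basis. (1 + (inner x b)^2))"
  by (intro le_imp_inverse_le prod_pos) (auto simp: add_pos_nonneg)
 then show ?thesis by (simp add: prod_inversef[symmetric])
qed

lemma integrable_poly_decay:
 fixes f :: "'a::euclidean_space => complex"
 assumes [measurable]: "f : BM borel"
  and le: "!!x. (1 + norm x)^(2*DIM('a))*norm (f x) <= C"
 shows "integrable lborel f"
proof (rule integrable_bound[of _ "%x. C*(PROD b:Basis. inverse (1 + (inner x b)^2))"])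
 have C: "C >= 0" using le[of 0] by (simp add: order_trans[OF norm_ge_zero])
 show "AE x in lborel. norm (f x) <= norm (C*(PROD b:Basis. inverse (1 + (inner x b)^2)))"
 proof (intro AE_I2)
  fix x :: 'a
  have "norm (f x) <= C*inverse ((1 + norm x)^(2*DIM('a)))" using le[of x] by (simp add: field_simps add_pos_nonneg)
  also have "... <= C*(PROD b:Basis. inverse (1 + (inner x b)^2))" by (intro mult_left_mono inverse_power_le_prod C)
  finally show "norm (f x) <= norm (C*(PROD b:Basis. inverse (1 + (inner x b)^2)))" by (simp only: real_norm_def abs_ge_self order_trans)
 qed
qed (auto intro: integrable_prod_inverse)

text \<open>Difference quotients of an integrable function integrate to 0 by translation invariance,
  and the decay of \<open>h'\<close> supplies a majorant for them. This plays the part of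
  integration by parts along a coordinate.\<close>

lemma integral_partial_derivative_eq_0:
 fixes h h' :: "'a::euclidean_space => complex"
 assumes b: "b : Basis" and der: "!!x. (h has_derivative D x) (at x)" "!!x. D x b = h' x"
  and h'm [measurable]: "h' : BM borel"
  and h: "!!x. (1 + norm x)^(2*DIM('a))*norm (h x) <= C"
  and h': "!!x. (1 + norm x)^(2*DIM('a))*norm (h' x) <= C"
 shows "(LBINT x. h' x) = 0"
proof -
 define N where "N = 2*DIM('a)"
 have C: "C >= 0" using h[of 0] by (simp add: order_trans[OF norm_ge_zero])
 have nb: "norm b = 1" using b by simp
 have hc: "continuous_on UNIV h" by (intro continuous_at_imp_continuous_on ballI has_derivative_continuous[OF der(1)])
 then have [measurable]: "h : BM borel" by (rule borel_measurable_continuous_onI)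
 have hi: "integrable lborel h" by (rule integrable_poly_decay[OF _ h]) simp
 define s where "s n = inverse (real (Suc n))" for n
 have s: "0 < s n" "s n <= 1" for n by (auto simp: s_def field_simps)
 have vd: "((%u. h (x + u *\<^sub>R b)) has_vector_derivative h' (x + u *\<^sub>R b)) (at u within S)" for x u S
 proof -
  have "((%u. h (x + u *\<^sub>R b)) has_derivative (%t. D (x + u *\<^sub>R b) (t *\<^sub>R b))) (at u within S)"
   by (rule has_derivative_compose[OF _ der(1)]) (auto intro!: derivative_eq_intros)
  then show ?thesis unfolding has_vector_derivative_def using linear_scale[OF has_derivative_linear[OF der(1)]] by (simp add: der(2))
 qed
 let ?q = "%n x. (1 / s n) *\<^sub>R (h (s n *\<^sub>R b + x) - h x)"
 have 0: "(LBINT x. ?q n x) = 0" for n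
 proof -
  have "integrable lborel (%x. h (s n *\<^sub>R b + x))" using hi by (simp add: integrable_lborel_translate)
  then show ?thesis using hi by (simp add: integral_lborel_translate)
 qed
 have "(%n. (LBINT x. ?q n x)) ~~> (LBINT x. h' x)"
 proof (rule integral_dominated_convergence[where w="%x. C*2^N*(PROD b:Basis. inverse (1 + (inner x b)^2))"])
  show "AE x in lborel. (%n. ?q n x) ~~> h' x"
  proof (intro AE_I2)
   fix x :: 'a
   have "((%u. h (x + u *\<^sub>R b)) has_vector_derivative h' x) (at 0)" using vd[of x 0] by simp
   then have "((%u. norm (h (x + u *\<^sub>R b) - h x - u *\<^sub>R h' x)/norm u) \<longlongrightarrow> 0) (at 0)"
    unfolding has_vector_derivative_def has_derivative_at by simp
   then have "((%u. norm ((h (x + u *\<^sub>R b) - h x) /\<^sub>R u - h' x)) \<longlongrightarrow> 0) (at 0)"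
   proof (rule Lim_transform_eventually)
    show "\<forall>\<^sub>F u in at 0. norm (h (x + u *\<^sub>R b) - h x - u *\<^sub>R h' x)/norm u = norm ((h (x + u *\<^sub>R b) - h x) /\<^sub>R u - h' x)"
    proof (rule eventually_at_filter[THEN iffD2, OF always_eventually], intro allI impI)
     fix u :: real assume "u ~= 0"
     then have "(h (x + u *\<^sub>R b) - h x) /\<^sub>R u - h' x = (h (x + u *\<^sub>R b) - h x - u *\<^sub>R h' x) /\<^sub>R u" by (simp add: scaleR_diff_right)
     then show "norm (h (x + u *\<^sub>R b) - h x - u *\<^sub>R h' x)/norm u = norm ((h (x + u *\<^sub>R b) - h x) /\<^sub>R u - h' x)"
      by (simp add: divide_inverse mult.commute)
    qed
   qed
   then have "((%u. (h (x + u *\<^sub>R b) - h x) /\<^sub>R u) \<longlongrightarrow> h' x) (at 0)" unfolding tendsto_norm_zero_iff LIM_zero_iff .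
   moreover have "filterlim s (at 0) sequentially" unfolding s_def filterlim_at using inverse_Suc_tendsto by auto
   ultimately have "(%n. (h (x + s n *\<^sub>R b) - h x) /\<^sub>R s n) ~~> h' x" by (rule filterlim_compose)
   then show "(%n. ?q n x) ~~> h' x" by (simp add: inverse_eq_divide add.commute)
  qed
  show "AE x in lborel. norm (?q n x) <= C*2^N*(PROD b:Basis. inverse (1 + (inner x b)^2))" for n
  proof (intro AE_I2)
   fix x :: 'a
   \<comment> \<open>Moving \<open>x\<close> by a vector of length at most 1 changes 1 + |x| by a
     factor of at most 2, hence the loss \<open>2^N\<close>; the mean value theorem then bounds the
     difference quotient by \<open>B\<close>.\<close>
   define B where "B = C*2^N*inverse ((1 + norm x)^N)"
   have B: "norm (h' (x + u *\<^sub>R b)) <= B" if "u : {0..s n}" for u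
   proof -
    have "norm x <= norm (x + u *\<^sub>R b) + norm (u *\<^sub>R b)" using norm_triangle_ineq4[of "x + u *\<^sub>R b" "u *\<^sub>R b"] by simp
    moreover have ub: "norm (u *\<^sub>R b) <= 1" using that s[of n] nb by simp
    moreover have *: "1 + p <= 2*(1 + q)" if "p <= q + r" "r <= 1" "0 <= q" for p q r :: real using that by simp
    ultimately have "1 + norm x <= 2*(1 + norm (x + u *\<^sub>R b))" by (intro *[OF _ ub norm_ge_zero])
    then have "(1 + norm x)^N <= (2*(1 + norm (x + u *\<^sub>R b)))^N" by (intro power_mono) auto
    then have "(1 + norm x)^N*norm (h' (x + u *\<^sub>R b)) <= 2^N*((1 + norm (x + u *\<^sub>R b))^N*norm (h' (x + u *\<^sub>R b)))"
     unfolding power_mult_distrib mult.assoc[symmetric] by (intro mult_right_mono) auto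
    also have "... <= 2^N*C" using h' by (intro mult_left_mono) (auto simp: N_def)
    finally show ?thesis unfolding B_def by (simp add: field_simps add_pos_nonneg)
   qed
   have "norm (h (x + s n *\<^sub>R b) - h (x + 0 *\<^sub>R b)) <= B*norm (s n - 0)"
   proof (rule differentiable_bound[of "{0..s n}" "%u. h (x + u *\<^sub>R b)" "%u t. t *\<^sub>R h' (x + u *\<^sub>R b)"])
    show "!!u. u : {0..s n} ==> onorm (%t. t *\<^sub>R h' (x + u *\<^sub>R b)) <= B"
     by (rule onorm_le) (simp add: mult.commute[of B] mult_left_mono B)
   qed (use vd s[of n] in \<open>auto simp: has_vector_derivative_def\<close>)
   then have "norm (?q n x) <= B" using s[of n] by (simp add: divide_simps add.commute)
   also have "... <= C*2^N*(PROD b:Basis. inverse (1 + (inner x b)^2))"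
    unfolding B_def N_def using C by (intro mult_left_mono inverse_power_le_prod) auto
   finally show "norm (?q n x) <= C*2^N*(PROD b:Basis. inverse (1 + (inner x b)^2))" .
  qed
 qed (auto intro: integrable_prod_inverse)
 then show ?thesis unfolding 0 using LIMSEQ_unique[OF tendsto_const] by metis
qed

lemma schwartz_iterated:
 assumes "schwartz f" "set bs <= Basis"
 shows "!!x. (iterated_partial bs f has_derivative frechet_derivative (iterated_partial bs f) (at x)) (at x)"
  and "EX C. ALL x. (1 + norm x)^N*norm (iterated_partial bs f x) <= C"
  and "iterated_partial bs f : BM borel"
proof -
 show d: "!!x. (iterated_partial bs f has_derivative frechet_derivative (iterated_partial bs f) (at x)) (at x)"
  using assms by (auto simp: schwartz_def frechet_derivative_works[symmetric])
 have "bounded (range (%x. (1 + norm x)^N *\<^sub>R iterated_partial bs f x))" using assms by (auto simp: schwartz_def)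
 then show "EX C. ALL x. (1 + norm x)^N*norm (iterated_partial bs f x) <= C" by (auto simp: bounded_iff)
 have "continuous_on UNIV (iterated_partial bs f)" by (intro continuous_at_imp_continuous_on ballI has_derivative_continuous[OF d])
 then show "iterated_partial bs f : BM borel" by (rule borel_measurable_continuous_onI)
qed

lemma integrable_iterated_partial:
 assumes "schwartz f" "set bs <= Basis"
 shows "integrable lborel (iterated_partial bs f)" using integrable_poly_decay[OF schwartz_iterated(3)[OF assms]] schwartz_iterated(2)[OF assms] by metis

lemma fourier_partial:
 fixes f :: "'a::euclidean_space => complex"
 assumes f: "schwartz f" and bs: "set bs <= Basis" and b: "b : Basis"
 shows "fourier (iterated_partial (b # bs) f) y = 2*pi*\<i>*inner y b*fourier (iterated_partial bs f) y"
proof -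
 note iterated_partial.simps [simp del]
 let ?g = "iterated_partial bs f" and ?g' = "iterated_partial (b # bs) f"
 have bs': "set (b # bs) <= Basis" using bs b by auto
 note [measurable] = schwartz_iterated(3)[OF f bs] schwartz_iterated(3)[OF f bs']
 obtain C where C: "(1 + norm x)^(2*DIM('a))*norm (?g x) <= C" for x using schwartz_iterated(2)[OF f bs] by metis
 obtain C' where C': "(1 + norm x)^(2*DIM('a))*norm (?g' x) <= C'" for x using schwartz_iterated(2)[OF f bs'] by metis
 have C0: "C >= 0" using C[of 0] by (simp add: order_trans[OF norm_ge_zero])
 have C0': "C' >= 0" using order_trans[OF _ C'[of 0]] by simp
 let ?c = "%x. cis (- (ph x y))"
 let ?k = "2*pi*\<i>*inner y b"
 have "(LBINT x. (?g' x*?c x - ?k*(?g x*?c x))) = 0"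
 proof (rule integral_partial_derivative_eq_0[OF b, of "%x. ?g x*?c x"])
  fix x
  have dc: "(?c has_derivative (%v. (- (ph v y)) *\<^sub>R (\<i>*?c x))) (at x)" by (auto intro!: derivative_eq_intros)
  show "((%x. ?g x*?c x) has_derivative
   (%v. ?g x*((- (ph v y)) *\<^sub>R (\<i>*?c x)) + frechet_derivative ?g (at x) v * ?c x)) (at x)"
   by (rule has_derivative_mult[OF schwartz_iterated(1)[OF f bs] dc])
  show "?g x*((- (ph b y)) *\<^sub>R (\<i>*?c x)) + frechet_derivative ?g (at x) b*?c x
   = ?g' x*?c x - ?k*(?g x*?c x)" by (simp add: iterated_partial.simps scaleR_conv_of_real inner_commute algebra_simps)
  let ?C = "C + C' + 2*pi*\<bar>inner y b\<bar>*C"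
  show "(1 + norm x)^(2*DIM('a))*norm (?g x*?c x) <= ?C" using C[of x] C0 C0' by (simp add: norm_mult add_increasing2)
  have "(1 + norm x)^(2*DIM('a))*norm (?g' x*?c x - ?k*(?g x*?c x))
   <= (1 + norm x)^(2*DIM('a))*(norm (?g' x) + 2*pi*\<bar>inner y b\<bar>*norm (?g x))"
   by (intro mult_left_mono order_trans[OF norm_triangle_ineq4]) (auto simp: norm_mult)
  also have "... = (1 + norm x)^(2*DIM('a))*norm (?g' x) + 2*pi*\<bar>inner y b\<bar>*((1 + norm x)^(2*DIM('a))*norm (?g x))"
   by (simp only: ring_distribs mult_ac)
  also have "... <= C' + 2*pi*\<bar>inner y b\<bar>*C" by (intro add_mono C' mult_left_mono C) auto
  finally show "(1 + norm x)^(2*DIM('a))*norm (?g' x*?c x - ?k*(?g x*?c x)) <= ?C" using C0 by linarith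
  show "(%x. ?g' x*?c x - ?k*(?g x*?c x)) : BM borel" by measurable
 qed
 moreover have I: "integrable lborel (%x. ?g x*?c x)" by (rule integrable_bound[OF integrable_iterated_partial[OF f bs]]) (auto simp: norm_mult)
 moreover have "integrable lborel (%x. ?g' x*?c x)" by (rule integrable_bound[OF integrable_iterated_partial[OF f bs']]) (auto simp: norm_mult)
 ultimately show ?thesis unfolding fourier_cis by (subst (asm) integral_diff) simp_all
qed

text \<open>The left side is the reciprocal of the integrable majorant; the right side involves only
  pure powers of single coordinates, which correspond to repeated derivatives in one direction. The
  largest coordinate in absolute value, \<open>m\<close>, carries the estimate.\<close>

lemma prod_le_max_power:
 fixes y :: "'a::euclidean_space"
 shows "(PROD b:Basis. 1 + (inner y b)^2) <= 2^DIM('a)*(1 + (SUM b:Basis. (inner y b)^(2*DIM('a))))"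
proof -
 define m where "m = Max ((%b. \<bar>inner y b\<bar>) ` Basis)"
 have "m : (%b. \<bar>inner y b\<bar>) ` Basis" unfolding m_def by (rule Max_in) auto
 then obtain b0 where b0: "b0 : Basis" "m = \<bar>inner y b0\<bar>" by auto
 have le: "\<bar>inner y b\<bar> <= m" if "b : Basis" for b using that by (simp add: m_def)
 have m0: "m >= 0" using b0 by simp
 have "(PROD b:Basis. 1 + (inner y b)^2) <= (PROD b:(Basis::'a set). 1 + m^2)"
  using le by (intro prod_mono) (auto simp: abs_le_square_iff[symmetric] m0)
 also have "... = (1 + m^2)^DIM('a)" by simp
 also have "... <= 2^DIM('a)*(1 + m^(2*DIM('a)))"
 proof (cases "m <= 1")
  case True
  then have "(1 + m^2)^DIM('a) <= 2^DIM('a)" using m0 by (intro power_mono) (auto simp: power_le_one)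
  then show ?thesis using m0 by (simp add: algebra_simps add_increasing2)
 next
  case False
  then have "(1 + m^2)^DIM('a) <= (2*m^2)^DIM('a)" by (intro power_mono) (auto simp: one_le_power)
  also have "... = 2^DIM('a)*m^(2*DIM('a))" by (simp add: power_mult_distrib power_mult)
  also have "... <= 2^DIM('a)*(1 + m^(2*DIM('a)))" by simp
  finally show ?thesis .
 qed
 also have "m^(2*DIM('a)) = (inner y b0)^(2*DIM('a))" unfolding b0 by (simp add: power_even_abs)
 also have "... <= (SUM b:Basis. (inner y b)^(2*DIM('a)))" by (rule member_le_sum) (use b0 in \<open>auto simp: zero_le_even_power\<close>)
 finally show ?thesis by simp
qed

text \<open>The \<open>2*DIM('a)\<close>-fold derivative in each basis direction bounds the
  corresponding power of the coordinate times \<open>fourier f\<close>; the sum of these bounds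
  gives decay like the integrable product.\<close>

theorem integrable_fourier_schwartz:
 fixes f :: "'a::euclidean_space => complex"
 assumes f: "schwartz f"
 shows "integrable lborel (fourier f)"
proof -
 have fi: "integrable lborel f" using integrable_iterated_partial[OF f, of "[]"] by simp
 note [measurable] = fourier_measurable[OF fi]
 let ?N = "2*DIM('a)"
 define g where "g b = iterated_partial (replicate ?N b) f" for b
 define A where "A b = (LBINT x. norm (g b x))" for b
 define A0 where "A0 = (LBINT x. norm (f x))"
 have rep: "fourier (iterated_partial (replicate n b) f) y = (2*pi*\<i>*inner y b)^n*fourier f y"
  if "b : Basis" for n b y
 proof (induction n)
  case (Suc n)
  have "set (replicate n b) <= Basis" using that by auto
  from fourier_partial[OF f this that, of y] Suc show ?case by simp
 qed simp
 have bnd: "\<bar>inner y b\<bar>^?N*norm (fourier f y) <= A b" if b: "b : Basis" for b y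
 proof -
  have "1*\<bar>inner y b\<bar>^?N <= (2*pi)^?N*\<bar>inner y b\<bar>^?N" using pi_ge_two by (intro mult_right_mono one_le_power) auto
  also have "... = norm ((2*pi*\<i>*inner y b)^?N)" by (simp add: norm_mult norm_power power_mult_distrib)
  finally have "\<bar>inner y b\<bar>^?N*norm (fourier f y) <= norm ((2*pi*\<i>*inner y b)^?N*fourier f y)" by (simp add: norm_mult mult_right_mono)
  also have "... <= A b" unfolding rep[OF b, symmetric] A_def g_def by (rule norm_fourier_le)
  finally show ?thesis .
 qed
 let ?p = "%y. PROD b:Basis. inverse (1 + (inner y b)^2)"
 show ?thesis
 proof (rule integrable_bound[of _ "%y. 2^DIM('a)*(A0 + (SUM b:Basis. A b))*?p y"])
  show "AE y in lborel. norm (fourier f y) <= norm (2^DIM('a)*(A0 + (SUM b:Basis. A b))*?p y)"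
  proof (intro AE_I2)
   fix y :: 'a
   have pp: "(PROD b:Basis. 1 + (inner y b)^2) > 0" by (intro prod_pos) (auto simp: add_pos_nonneg)
   have "(PROD b:Basis. 1 + (inner y b)^2)*norm (fourier f y) <= 2^DIM('a)*(1 + (SUM b:Basis. (inner y b)^?N))*norm (fourier f y)"
    by (intro mult_right_mono prod_le_max_power) auto
   also have "... = 2^DIM('a)*(norm (fourier f y) + (SUM b:Basis. \<bar>inner y b\<bar>^?N*norm (fourier f y)))"
    by (simp add: sum_distrib_right power_even_abs distrib_left distrib_right)
   also have "... <= 2^DIM('a)*(A0 + (SUM b:Basis. A b))" by (intro mult_left_mono add_mono sum_mono bnd) (auto simp: A0_def norm_fourier_le)
   finally have "norm (fourier f y) <= 2^DIM('a)*(A0 + (SUM b:Basis. A b))*inverse (PROD b:Basis. 1 + (inner y b)^2)"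
    using pp by (simp add: field_simps)
   then show "norm (fourier f y) <= norm (2^DIM('a)*(A0 + (SUM b:Basis. A b))*?p y)" by (simp add: prod_inversef[symmetric] del: norm_mult norm_power)
  qed
 qed (auto intro: integrable_prod_inverse)
qed

section \<open>Schwartz functions of Gaussian type\<close>

inductive epoly :: "('a::euclidean_space => real) => bool" where
 epoly_const: "epoly (%_. c)"
| epoly_inner: "epoly (%x. inner x v)"
| epoly_add: "epoly p ==> epoly q ==> epoly (%x. p x + q x)"
| epoly_mult: "epoly p ==> epoly q ==> epoly (%x. p x*q x)"

lemma epoly_diff: "epoly p ==> epoly q ==> epoly (%x. p x - q x)" using epoly_add[OF _ epoly_mult[OF epoly_const[of "-1"]]] by simp

lemma epoly_sum: "finite A ==> (!!i. i : A ==> epoly (p i)) ==> epoly (%x. SUM i:A. p i x)"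
 by (induction A rule: finite_induct) (auto intro: epoly_const epoly_add)

lemma epoly_norm_power2: "epoly (%x. (norm (x - y))^2)"
proof -
 have "epoly (%x. (inner x b - inner y b)*(inner x b - inner y b))" for b by (intro epoly_mult epoly_diff epoly_inner epoly_const)
 then show ?thesis unfolding norm_power2_Basis inner_diff_left by (intro epoly_sum) (simp_all add: power2_eq_square)
qed

text \<open>Closure under partial derivatives is what the class \<open>epoly\<close> is made for:
  every iterated partial derivative of p exp(q) is again of the form p' exp(q) with the same
  exponent.\<close>

lemma epoly_derivative:
 assumes "epoly p"
 shows "EX D. (ALL x. (p has_derivative D x) (at x)) & epoly (%x. D x b)" using assms
proof induction
 case (epoly_const c)
 show ?case by (rule exI[of _ "%_ _. 0"]) (auto intro: epoly.epoly_const)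
next
 case (epoly_inner v)
 show ?case by (rule exI[of _ "%_ x. inner x v"]) (auto intro!: epoly.epoly_const derivative_eq_intros)
next
 case (epoly_add p q)
 then obtain D E where "!!x. (p has_derivative D x) (at x)" "epoly (%x. D x b)"
  "!!x. (q has_derivative E x) (at x)" "epoly (%x. E x b)" by metis
 then show ?case by (intro exI[of _ "%x v. D x v + E x v"]) (auto intro: epoly.epoly_add derivative_intros)
next
 case (epoly_mult p q)
 then obtain D E where "!!x. (p has_derivative D x) (at x)" "epoly (%x. D x b)"
  "!!x. (q has_derivative E x) (at x)" "epoly (%x. E x b)" by metis
 then show ?case using epoly_mult(1,2) by (intro exI[of _ "%x v. p x*E x v + D x v * q x"]) (auto intro!: epoly.epoly_add epoly.epoly_mult derivative_intros)
qed

lemma epoly_bound: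
 assumes "epoly p"
 shows "EX C k. ALL x. \<bar>p x\<bar> <= C*(1 + norm x)^k" using assms
proof induction
 case (epoly_const c)
 show ?case by (rule exI[of _ "\<bar>c\<bar>"], rule exI[of _ 0]) auto
next
 case (epoly_inner v)
 have "\<bar>inner x v\<bar> <= norm v * (1 + norm x)^1" for x using Cauchy_Schwarz_ineq2[of x v] by (simp add: algebra_simps add_increasing)
 then show ?case by metis
next
 case (epoly_add p q)
 then obtain C k D l where C: "!!x. \<bar>p x\<bar> <= C*(1 + norm x)^k" "!!x. \<bar>q x\<bar> <= D*(1 + norm x)^l" by metis
 have C0: "C >= 0" "D >= 0" using C[of 0] by (auto intro: order_trans[OF abs_ge_zero])
 have "\<bar>p x + q x\<bar> <= (C + D)*(1 + norm x)^(k + l)" for x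
 proof -
  have "\<bar>p x + q x\<bar> <= C*(1 + norm x)^k + D*(1 + norm x)^l" using C[of x] by linarith
  also have "... <= C*(1 + norm x)^(k + l) + D*(1 + norm x)^(k + l)" using C0 by (intro add_mono mult_left_mono power_increasing) auto
  finally show ?thesis by (simp add: algebra_simps)
 qed
 then show ?case by metis
next
 case (epoly_mult p q)
 then obtain C k D l where C: "!!x. \<bar>p x\<bar> <= C*(1 + norm x)^k" "!!x. \<bar>q x\<bar> <= D*(1 + norm x)^l" by metis
 have "\<bar>p x*q x\<bar> <= (C*D)*(1 + norm x)^(k + l)" for x
 proof -
  have "\<bar>p x*q x\<bar> <= (C*(1 + norm x)^k)*(D*(1 + norm x)^l)"
   unfolding abs_mult using C by (intro mult_mono) (auto intro: order_trans[OF abs_ge_zero])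
  then show ?thesis by (simp add: power_add mult_ac)
 qed
 then show ?case by metis
qed

lemma power_le_exp_square:
 assumes "c > (0::real)"
 shows "EX C. ALL r>=0. (1 + r)^m*exp (- c*r^2) <= C"
proof (intro exI allI impI)
 fix r :: real assume r: "r >= 0"
 have "(1 + r)^m /\<^sub>R fact m <= exp (1 + r)" using sum_le_suminf[OF summable_exp_generic[of "1 + r"], of "{m}"] r by (simp add: exp_def)
 then have 1: "(1 + r)^m <= fact m*exp (1 + r)" by (simp add: field_simps)
 \<comment> \<open>Completing the square absorbs the linear exponent of exp(1 + r) into the
   Gaussian.\<close>
 have "r - c*r^2 = 1/(4*c) - c*(r - 1/(2*c))^2" using assms by (simp add: power2_eq_square field_simps)
 also have "... <= 1/(4*c)" using assms by simp
 finally have 2: "r - c*r^2 <= 1/(4*c)" .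
 have "(1 + r)^m*exp (- c*r^2) <= fact m*exp (1 + r)*exp (- c*r^2)" using 1 by (intro mult_right_mono) auto
 also have "... = fact m*exp (1 + (r - c*r^2))" by (simp add: exp_add[symmetric])
 also have "... <= fact m*exp (1 + 1/(4*c))" using 2 by (intro mult_left_mono) auto
 finally show "(1 + r)^m*exp (- c*r^2) <= fact m*exp (1 + 1/(4*c))" .
qed

lemma schwartz_epoly_exp:
 fixes p q :: "'a::euclidean_space => real"
 assumes p: "epoly p" and q: "epoly q" and c: "c > 0" "!!x. q x <= - c*(norm x)^2"
 shows "schwartz (%x. cr (p x*exp (q x)))"
proof -
 have it: "EX p'. epoly p' & iterated_partial bs (%x. cr (p x*exp (q x))) = (%x. cr (p' x*exp (q x)))"
  for bs
 proof (induction bs)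
  case Nil
  then show ?case using p by auto
 next
  case (Cons b bs)
  then obtain p' where p': "epoly p'" "iterated_partial bs (%x. cr (p x*exp (q x))) = (%x. cr (p' x*exp (q x)))" by auto
  obtain D where D: "!!x. (p' has_derivative D x) (at x)" "epoly (%x. D x b)" using epoly_derivative[OF p'(1)] by metis
  obtain E where E: "!!x. (q has_derivative E x) (at x)" "epoly (%x. E x b)" using epoly_derivative[OF q] by metis
  have "((%x. cr (p' x*exp (q x))) has_derivative (%v. cr (p' x*(exp (q x)*E x v) + D x v * exp (q x)))) (at x)" for x
   by (intro has_derivative_of_real has_derivative_mult D) (auto intro!: derivative_eq_intros E simp: mult.commute)
  from frechet_derivative_at[OF this]
  have "iterated_partial (b # bs) (%x. cr (p x*exp (q x))) = (%x. cr ((p' x*E x b + D x b)*exp (q x)))"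
   unfolding iterated_partial.simps p'(2) by (simp add: fun_eq_iff algebra_simps)
  then show ?case using epoly_add[OF epoly_mult[OF p'(1) E(2)] D(2)] by blast
 qed
 show ?thesis unfolding schwartz_def
 proof (intro allI impI conjI)
  fix bs :: "'a list" and x and N :: nat
  obtain p' where p': "epoly p'" and eq: "iterated_partial bs (%x. cr (p x*exp (q x))) = (%x. cr (p' x*exp (q x)))" using it by blast
  obtain D where D: "!!x. (p' has_derivative D x) (at x)" using epoly_derivative[OF p'] by metis
  obtain E where E: "!!x. (q has_derivative E x) (at x)" using epoly_derivative[OF q] by metis
  have "((%x. cr (p' x*exp (q x))) has_derivative (%v. cr (p' x*(exp (q x)*E x v) + D x v * exp (q x)))) (at x)" for x
   by (intro has_derivative_of_real has_derivative_mult D) (auto intro!: derivative_eq_intros E simp: mult.commute)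
  then show "iterated_partial bs (%x. cr (p x*exp (q x))) differentiable at x" unfolding eq differentiable_def by blast
  obtain C k where C: "!!x. \<bar>p' x\<bar> <= C*(1 + norm x)^k" using epoly_bound[OF p'] by metis
  have C0: "C >= 0" using C[of 0] by (auto intro: order_trans[OF abs_ge_zero])
  obtain B where B: "!!r. r >= 0 ==> (1 + r)^(N + k)*exp (- c*r^2) <= B" using power_le_exp_square[OF c(1)] by metis
  have "norm ((1 + norm x)^N *\<^sub>R cr (p' x*exp (q x))) <= C*B" for x
  proof -
   have "norm ((1 + norm x)^N *\<^sub>R cr (p' x*exp (q x))) = (1 + norm x)^N*(\<bar>p' x\<bar>*exp (q x))" by (simp add: norm_mult abs_mult)
   also have "... <= (1 + norm x)^N*((C*(1 + norm x)^k)*exp (- c*(norm x)^2))" using C c(2) C0 by (intro mult_left_mono mult_mono) auto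
   also have "... = C*((1 + norm x)^(N + k)*exp (- c*(norm x)^2))" by (simp add: power_add mult_ac)
   also have "... <= C*B" using B C0 by (intro mult_left_mono) auto
   finally show ?thesis .
  qed
  then show "bounded (range (%x. (1 + norm x)^N *\<^sub>R iterated_partial bs (%x. cr (p x*exp (q x))) x))" unfolding eq by (auto simp: bounded_iff)
 qed
qed

lemma schwartz_gauss: "e > 0 ==> schwartz (%x::'a::euclidean_space. cr (gauss e x))"
 using schwartz_epoly_exp[OF epoly_const[of 1] epoly_mult[OF epoly_const[of "- (pi*e)"] epoly_norm_power2[of 0]], of "pi*e"] by (simp add: gauss_def)

text \<open>The fixed factor \<open>gauss 1\<close> is the weight that turns the measures compared
  in \<open>measure_fourier_transform_unique\<close> into finite ones, while the shifted Gaussian is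
  the separating test function.\<close>

lemma schwartz_gauss_mult:
 assumes "e > 0"
 shows "schwartz (%x::'a::euclidean_space. cr (gauss e (x - y)*gauss 1 x))"
proof -
 have "schwartz (%x::'a. cr (1*exp (- (pi*e)*(norm (x - y))^2 + (- pi)*(norm (x - 0))^2)))"
  by (intro schwartz_epoly_exp[where c=pi] epoly_add epoly_mult epoly_const epoly_norm_power2) (use assms in auto)
 then show ?thesis by (simp add: gauss_def exp_add[symmetric])
qed

section \<open>Measures determined by their integrals of test functions\<close>

lemma borel_measure_eqI_continuous:
 fixes mm nu :: "'a::euclidean_space measure"
 assumes mm: "locally_finite_borel mm" and nu: "locally_finite_borel nu"
  and eq: "!!f :: 'a => real. continuous_on UNIV f ==> compact (closure {x. f x ~= 0}) ==> (LINT x|mm. f x) = (LINT x|nu. f x)"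
 shows "mm = nu"
proof -
 have fin: "emeasure M (box a b) < \<infinity>" if "locally_finite_borel M" for M :: "'a measure" and a b
  using that bounded_box[of a b] by (auto simp: locally_finite_borel_def)
 have box: "emeasure mm (box a b) = emeasure nu (box a b)" for a b
 proof (cases "box a b = {}")
  case False
  define f where "f n x = min 1 (real n*infdist x (- box a b))" for n x
  \<comment> \<open>\<open>infdist\<close> to the empty set is 0 by convention, so positivity of the
    distance inside the box requires a nonempty complement.\<close>
  have ne: "- box a b ~= {}" using bounded_box[of a b] not_bounded_UNIV by (metis Compl_empty_eq double_complement)
  have cl: "closed (- box a b)" by (rule closed_Compl[OF open_box])
  have f0: "f n x = 0" if "x ~: box a b" for n x using that by (simp add: f_def)
  have pos: "infdist x (- box a b) > 0" if "x : box a b" for x using that in_closed_iff_infdist_zero[OF cl ne, of x] infdist_nonneg[of x "- box a b"] by fastforce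
  have fc: "continuous_on UNIV (f n)" for n unfolding f_def by (intro continuous_intros)
  have fb: "0 <= f n x" "f n x <= 1" for n x by (auto simp: f_def infdist_nonneg)
  have fcp: "compact (closure {x. f n x ~= 0})" for n using f0 by (intro compact_closure[THEN iffD2] bounded_subset[OF bounded_box[of a b]]) auto
  have lim: "(%n. (LINT x|M. f n x)) ~~> measure M (box a b)" if M: "locally_finite_borel M" for M :: "'a measure"
  proof -
   have sM [measurable_cong, simp]: "sets M = sets borel" using M by (simp add: locally_finite_borel_def)
   have "(%n. (LINT x|M. f n x)) ~~> (LINT x|M. ind (box a b) x)"
   proof (rule integral_dominated_convergence[where w="ind (box a b)"])
    show "AE x in M. (%n. f n x) ~~> ind (box a b) x"
    proof (intro AE_I2)
     fix x
     show "(%n. f n x) ~~> ind (box a b) x"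
     proof (cases "x : box a b")
      case True
      obtain N where N: "real N*infdist x (- box a b) > 1" using reals_Archimedean3[OF pos[OF True]] by blast
      have "f n x = 1" if "n >= N" for n
      proof -
       have "real N*infdist x (- box a b) <= real n*infdist x (- box a b)" using that by (intro mult_right_mono) (auto simp: infdist_nonneg)
       then show ?thesis using N by (simp add: f_def)
      qed
      then have "eventually (%n. f n x = 1) sequentially" by (auto simp: eventually_sequentially)
      then show ?thesis using True by (simp add: tendsto_eventually)
     qed (simp add: f0)
    qed
    show "AE x in M. norm (f n x) <= ind (box a b) x" for n using fb f0 by (intro AE_I2) (auto simp: indicator_def)
    show "!!n. f n : BM M" using borel_measurable_continuous_onI[OF fc] by (simp cong: measurable_cong_sets)
   qed (use fin[OF M] in auto)
   then show ?thesis by simp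
  qed
  have "measure mm (box a b) = measure nu (box a b)" using LIMSEQ_unique[OF lim[OF mm]] lim[OF nu] by (simp add: eq[OF fc fcp])
  moreover have "emeasure mm (box a b) ~= \<infinity>" "emeasure nu (box a b) ~= \<infinity>" using fin[OF mm, of a b] fin[OF nu, of a b] by auto
  ultimately show ?thesis by (simp add: emeasure_eq_ennreal_measure)
 qed simp
 show ?thesis
 proof (rule measure_eqI_generator_eq[where E="range (%(a, b). box a b)" and \<Omega>=UNIV and A="%n::nat. box (- (real n *\<^sub>R One)) (real n *\<^sub>R One)"])
  show "Int_stable (range (%(a, b). box a b :: 'a set))" by (auto simp: Int_stable_def box_Int_box)
  show "sets mm = sigma_sets UNIV (range (%(a, b). box a b))" "sets nu = sigma_sets UNIV (range (%(a, b). box a b))"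
   using mm nu by (auto simp: locally_finite_borel_def borel_eq_box)
  show "!!n. emeasure mm (box (- (real n *\<^sub>R One)) (real n *\<^sub>R One)) ~= \<infinity>" using fin[OF mm] by (simp add: less_top)
  show "(UN i. box (- (real i *\<^sub>R One)) (real i *\<^sub>R One)) = (UNIV :: 'a set)" by (rule UN_box_eq_UNIV)
  show "emeasure mm Z = emeasure nu Z" if "Z : range (%(a, b). box a b)" for Z using that box by (elim rangeE) (simp split: prod.splits)
  show "range (%n::nat. box (- (real n *\<^sub>R One)) (real n *\<^sub>R One)) <= range (%(a, b). box a b :: 'a set)"
   by (intro image_subsetI rev_image_eqI[of "(_, _)"]) (rule UNIV_I, simp)
  show "range (%(a, b). box a b :: 'a set) <= Pow UNIV" by simp
 qed
qed

text \<open>Integrating the Gaussian integrals against a test function \<open>f\<close> and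
  exchanging the order gives the integral of the smoothed \<open>f\<close>, which tends to that of
  \<open>f\<close> as the width tends to 0.\<close>

lemma finite_measure_eqI_gauss:
 fixes mm nu :: "'a::euclidean_space measure"
 assumes "finite_measure mm" "finite_measure nu" and s: "sets mm = sets borel" "sets nu = sets borel"
  and eq: "!!e y. e > 0 ==> (LINT x|mm. gauss e (x - y)) = (LINT x|nu. gauss e (x - y))"
 shows "mm = nu"
proof (rule borel_measure_eqI_continuous)
 interpret mm: finite_measure mm by fact
 interpret nu: finite_measure nu by fact
 show "locally_finite_borel mm" "locally_finite_borel nu" using s by (auto simp: locally_finite_borel_def less_top[symmetric])
 fix f :: "'a => real" assume fc: "continuous_on UNIV f" and supp: "compact (closure {x. f x ~= 0})"
 have [measurable]: "f : BM borel" by (rule borel_measurable_continuous_onI[OF fc])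
 have "compact (f ` closure {x. f x ~= 0})" by (rule compact_continuous_image[OF continuous_on_subset[OF fc] supp]) auto
 then have "bounded (f ` closure {x. f x ~= 0})" by (rule compact_imp_bounded)
 then obtain B where B: "!!x. x : closure {x. f x ~= 0} ==> \<bar>f x\<bar> <= B" unfolding bounded_iff by (metis imageI real_norm_def)
 have B0: "\<bar>f x\<bar> <= \<bar>B\<bar>" for x
 proof (cases "f x = 0")
  case False
  then have "x : closure {x. f x ~= 0}" by (intro subsetD[OF closure_subset]) simp
  from B[OF this] show ?thesis by simp
 qed simp
 have fi: "integrable lborel (%x. cr (f x))"
 proof -
  have "integrable lborel (%x. ind (closure {x. f x ~= 0}) x *\<^sub>R f x)" using borel_integrable_compact[OF supp continuous_on_subset[OF fc]] by simp
  moreover have "(%x. ind (closure {x. f x ~= 0}) x *\<^sub>R f x) = f"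
   using closure_subset[of "{x. f x ~= 0}"] by (auto simp: fun_eq_iff indicator_def)
  ultimately show ?thesis by (simp only: complex_of_real_integrable_eq)
 qed
 define e where "e n = inverse (real (Suc n))" for n
 have e: "e n > 0" for n by (simp add: e_def)
 have elim: "e ~~> 0" unfolding e_def by (rule inverse_Suc_tendsto)
 have main: "(%n. (LBINT s. f s*(LINT x|M. hk (e n) (x - s)))) ~~> (LINT x|M. f x)"
  if "finite_measure M" and sM: "sets M = sets borel" for M :: "'a measure"
 proof -
  interpret finite_measure M by fact
  note [measurable_cong] = sM
  have hki: "integrable lborel (%s. hk e' (s - x))" if "e' > 0" for e' and x :: 'a
   using integrable_lborel_translate[of "hk e'" "-x"] integrable_hk[OF that] by (simp add: add.commute)
  have hk1: "(LBINT s. hk e' (s - x)) = 1" if "e' > 0" for e' and x :: 'a using integral_lborel_translate[of "hk e'" "-x"] integral_hk[OF that] by (simp add: add.commute)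
  have "(%n. (LINT x|M. (LBINT s. cr (f s)*hk (e n) (s - x)))) ~~> (LINT x|M. cr (f x))"
  proof (rule integral_dominated_convergence[where w="%_. \<bar>B\<bar>"])
   show "AE x in M. (%n. (LBINT s. cr (f s)*hk (e n) (s - x))) ~~> cr (f x)" using fc B0
    by (intro AE_I2 hk_approximate_identity[where B="\<bar>B\<bar>"] e elim) (auto simp: continuous_on_eq_continuous_at intro: continuous_of_real)
   show "AE x in M. norm (LBINT s. cr (f s)*hk (e n) (s - x)) <= \<bar>B\<bar>" for n
   proof (intro AE_I2)
    fix x
    have "norm (LBINT s. cr (f s)*hk (e n) (s - x)) <= (LBINT s. \<bar>B\<bar>*hk (e n) (s - x))"
    proof (rule order_trans[OF integral_norm_bound integral_mono])
     show "integrable lborel (%s. norm (cr (f s)*hk (e n) (s - x)))" by (rule integrable_bound[of _ "%s. \<bar>B\<bar>*hk (e n) (s - x)"])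
       (use hki[OF e] B0 e[of n] in \<open>auto simp: norm_mult abs_mult intro!: mult_right_mono\<close>)
    qed (use hki[OF e] B0 e[of n] in \<open>auto simp: norm_mult intro!: mult_mono\<close>)
    also have "... = \<bar>B\<bar>" using hk1[OF e] by simp
    finally show "norm (LBINT s. cr (f s)*hk (e n) (s - x)) <= \<bar>B\<bar>" .
   qed
  qed auto
  moreover have "(LINT x|M. (LBINT s. cr (f s)*hk (e n) (s - x))) = cr (LBINT s. f s*(LINT x|M. hk (e n) (x - s)))" for n
  proof -
   interpret P: pair_sigma_finite M lborel by (simp add: pair_sigma_finite_def sigma_finite_measure_axioms lborel.sigma_finite_measure_axioms)
   have "integrable (M \<Otimes>\<^sub>M lborel) (%(x, s). cr (f s)*hk (e n) (s - x))"
   proof (rule integrable_bound[OF integrable_pair_mult[OF sigma_finite_measure_axioms lborel.sigma_finite_measure_axioms _ fi, of "%_. (1 / sqrt (e n))^DIM('a)"]])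
    show "AE x in M \<Otimes>\<^sub>M lborel. cmod (case x of (x, s) => cr (f s)*hk (e n) (s - x))
     <= cmod (case x of (x, y) => cr ((1 / sqrt (e n))^DIM('a))*cr (f y))"
     using e[of n] by (auto simp: norm_mult hk_def abs_mult norm_power norm_divide mult.commute[of "\<bar>f _\<bar>"] mult.assoc
       intro!: AE_I2 mult_left_mono mult_left_le_one_le)
   qed auto
   from P.Fubini_integral[OF this, symmetric]
   have "(LINT x|M. (LBINT s. cr (f s)*hk (e n) (s - x))) = (LBINT s. (LINT x|M. cr (f s)*hk (e n) (s - x)))" by simp
   also have "... = (LBINT s. cr (f s*(LINT x|M. hk (e n) (x - s))))"
   proof (intro integral_cong refl)
    fix s
    have "(LINT x|M. hk (e n) (s - x)) = (LINT x|M. hk (e n) (x - s))" by (subst hk_minus_commute) (rule refl)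
    then show "(LINT x|M. cr (f s)*hk (e n) (s - x)) = cr (f s*(LINT x|M. hk (e n) (x - s)))" by simp
   qed
   finally show ?thesis by (simp only: integral_complex_of_real)
  qed
  ultimately show ?thesis by (simp only: integral_complex_of_real tendsto_of_real_iff)
 qed
 have "(LINT x|mm. hk (e n) (x - s)) = (LINT x|nu. hk (e n) (x - s))" for n s using eq[of "1/e n" s] e[of n] by (simp add: hk_eq)
 then show "(LINT x|mm. f x) = (LINT x|nu. f x)"
  using LIMSEQ_unique[OF main[OF \<open>finite_measure mm\<close> s(1)]] main[OF \<open>finite_measure nu\<close> s(2)] by simp
qed

section \<open>Sums of measures; measures with an atom at the origin and a density\<close>

lemma nn_integral_add_measure:
 assumes s: "sets N = sets M" and f: "f : BM M"
 shows "(\<integral>\<^sup>+x. f x \<partial>add_measure M N) = (NNI M (%x. f x)) + (NNI N (%x. f x))"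
proof -
 have sp: "space N = space M" using s by (rule sets_eq_imp_space_eq)
 have sp': "space (add_measure M N) = space M" by (rule sets_eq_imp_space_eq) simp
 show ?thesis using f
 proof (induction f rule: borel_measurable_induct)
  case (cong f g)
  have "(NNI K (%x. f x)) = (NNI K (%x. g x))" if "space K = space M" for K using cong(3) that by (intro nn_integral_cong) simp
  from this[OF refl] this[OF sp] this[OF sp'] cong show ?case by simp
 next
  case (set A)
  then show ?case using s by (simp add: emeasure_add_measure)
 next
  case (mult u c)
  moreover from mult have "u : BM N" using s by (simp cong: measurable_cong_sets)
  ultimately show ?case using s by (simp add: nn_integral_cmult distrib_left cong: measurable_cong_sets)
 next
  case (add u v)
  moreover from add have "u : BM N" "v : BM N" using s by (simp_all cong: measurable_cong_sets)
  ultimately show ?case using s by (simp add: nn_integral_add add_ac cong: measurable_cong_sets)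
 next
  case (seq U)
  have m: "U i : BM N" "U i : BM (add_measure M N)" for i using seq(1) s by (simp_all cong: measurable_cong_sets)
  have "(\<integral>\<^sup>+x. (SUP i. U i) x \<partial>add_measure M N) = (SUP i. (NNI M (%x. U i x)) + (NNI N (%x. U i x)))"
   using seq m by (simp add: nn_integral_monotone_convergence_SUP SUP_apply[abs_def])
  also have "... = (SUP i. (NNI M (%x. U i x))) + (SUP i. (NNI N (%x. U i x)))"
   using \<open>incseq U\<close> by (intro ennreal_SUP_add) (auto intro!: nn_integral_mono simp: incseq_def le_fun_def)
  finally show ?case using seq m by (simp add: nn_integral_monotone_convergence_SUP SUP_apply[abs_def])
 qed
qed

lemma space_add_measure [simp]: "space (add_measure M N) = space M" by (rule sets_eq_imp_space_eq) simp

lemma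
 fixes f :: "'a => 'b::{banach,second_countable_topology}"
 assumes s: "sets N = sets M"
 shows integrable_add_measure: "integrable (add_measure M N) f \<longleftrightarrow> integrable M f & integrable N f"
  and integral_add_measure: "integrable M f ==> integrable N f ==> (\<integral>x. f x \<partial>add_measure M N) = (LINT x|M. f x) + (LINT x|N. f x)"
proof -
 have mN: "f : BM N \<longleftrightarrow> f : BM M" for f :: "'a => 'b" using s by (simp cong: measurable_cong_sets)
 have mA: "f : BM (add_measure M N) \<longleftrightarrow> f : BM M" for f :: "'a => 'b"
  by (simp cong: measurable_cong_sets)
 have iff: "integrable (add_measure M N) f \<longleftrightarrow> integrable M f & integrable N f" for f :: "'a => 'b"
  unfolding integrable_iff_bounded mN mA by (auto simp: nn_integral_add_measure[OF s])
 then show "integrable (add_measure M N) f \<longleftrightarrow> integrable M f & integrable N f" .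
 assume "integrable M f" "integrable N f"
 with iff have "integrable (add_measure M N) f" by simp
 then show "(\<integral>x. f x \<partial>add_measure M N) = (LINT x|M. f x) + (LINT x|N. f x)"
 proof (induction rule: integrable_induct)
  case (base A c)
  then have A: "A : sets M" and fin: "emeasure M A < \<infinity>" "emeasure N A < \<infinity>" by (auto simp: emeasure_add_measure[OF s])
  then have "measure (add_measure M N) A = measure M A + measure N A" using emeasure_add_measure[OF s A] by (simp add: measure_def enn2real_plus)
  then show ?case using A s fin base(2) by (simp add: scaleR_add_left)
 next
  case (add f g)
  then show ?case by (simp add: iff)
 next
  case (lim f u)
  have "integrable M f" "integrable N f" using lim.hyps(4) iff by auto
  have uM: "integrable M (u i)" "integrable N (u i)" for i using lim.hyps(1) iff by auto
  have spN: "space N = space M" using s by (rule sets_eq_imp_space_eq)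
  have c: "(%i. (LINT x|K. u i x)) ~~> (LINT x|K. f x)" if "integrable K f" "!!i. integrable K (u i)" "space K = space M" for K
  proof (rule integral_dominated_convergence[where w="%x. 2*norm (f x)"])
   show "AE x in K. (%i. u i x) ~~> f x" using lim.hyps(2) that(3) by (intro AE_I2) simp
   show "AE x in K. norm (u i x) <= 2*norm (f x)" for i using lim.hyps(3) that(3) by (intro AE_I2) simp
  qed (use that in auto)
  have "(%i. (LINT x|M. u i x) + (LINT x|N. u i x)) ~~> (LINT x|M. f x) + (LINT x|N. f x)"
   by (intro tendsto_add c \<open>integrable M f\<close> \<open>integrable N f\<close> uM refl spN)
  moreover have "(%i. (LINT x|M. u i x) + (LINT x|N. u i x)) ~~> (\<integral>x. f x \<partial>add_measure M N)"
   using c[OF lim.hyps(4) lim.hyps(1)] lim.IH by simp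
  ultimately show ?case by (rule LIMSEQ_unique[rotated])
 qed
qed

text \<open>The common shape of the measures in the final argument: autocorrelation, diffraction
  measure, spectral measures of polynomials in counts and, with both parameters equal to 1, the
  reference measure. \<open>ennreal\<close> truncates negative values, hence the sign conditions in
  the integral formulas.\<close>

definition atom_density :: "real => ('a::euclidean_space => real) => 'a measure" where
 "atom_density c D = add_measure (scale_measure (ennreal c) (return borel 0)) (density lborel (%x. ennreal (D x)))"

lemma sets_atom_density [simp, measurable_cong]: "sets (atom_density c D) = sets borel" by (simp add: atom_density_def)

lemma space_atom_density [simp]: "space (atom_density c D) = UNIV" using sets_eq_imp_space_eq[OF sets_atom_density] by simp

lemma emeasure_atom_density:
 assumes "A : sets borel" "D : BM borel"
 shows "emeasure (atom_density c D) A = ennreal c*ind A 0 + (NN x. ennreal (D x)*ind A x)"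
 using assms unfolding atom_density_def by (subst emeasure_add_measure) (auto simp: emeasure_density)

lemma
 fixes f :: "'a::euclidean_space => 'b::{banach,second_countable_topology}"
 assumes c: "c >= 0" and D: "!!x. D x >= 0" and [measurable]: "D : BM borel" "f : BM borel"
  and fD: "integrable lborel (%x. D x *\<^sub>R f x)"
 shows integrable_atom_density: "integrable (atom_density c D) f"
  and integral_atom_density: "(\<integral>x. f x \<partial>atom_density c D) = c *\<^sub>R f 0 + (LBINT x. D x *\<^sub>R f x)"
proof -
 have 1: "scale_measure (ennreal c) (return borel (0::'a)) = density (return borel 0) (%_. ennreal c)"
  by (rule measure_eqI) (auto simp: emeasure_density nn_integral_return)
 have 2: "integrable (return borel (0::'a)) (%x. c *\<^sub>R f x)" by (subst integrable_iff_bounded) (simp add: nn_integral_return)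
 have i1: "integrable (scale_measure (ennreal c) (return borel 0)) f" unfolding 1 using c 2 by (subst integrable_density) auto
 have i2: "integrable (density lborel (%x. ennreal (D x))) f" using D fD by (subst integrable_density) auto
 show "integrable (atom_density c D) f" unfolding atom_density_def using i1 i2 by (subst integrable_add_measure) auto
 have "(\<integral>x. f x \<partial>scale_measure (ennreal c) (return borel 0)) = c *\<^sub>R f 0"
  unfolding 1 using c by (subst integral_density) (auto simp: integral_return)
 moreover have "(\<integral>x. f x \<partial>density lborel (%x. ennreal (D x))) = (LBINT x. D x *\<^sub>R f x)" using D by (subst integral_density) auto
 ultimately show "(\<integral>x. f x \<partial>atom_density c D) = c *\<^sub>R f 0 + (LBINT x. D x *\<^sub>R f x)"
  unfolding atom_density_def using i1 i2 by (subst integral_add_measure) auto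
qed

lemma add_measure_return_lborel: "add_measure (return borel 0) lborel = atom_density 1 (%_. 1)" by (simp add: atom_density_def density_1 scale_measure_1)

lemma null_sets_atom_density_mono:
 assumes [measurable]: "D : BM borel" and "c > 0" "A : null_sets (atom_density c (%_. 1))"
 shows "A : null_sets (atom_density c' D)"
proof -
 have A [measurable]: "A : sets borel" using assms by auto
 have "emeasure (atom_density c (%_. 1)) A = 0" using assms by auto
 then have "ind A 0 = (0::ennreal)" "emeasure lborel A = 0" using \<open>c > 0\<close> by (auto simp: emeasure_atom_density ennreal_eq_0_iff)
 then have "AE x in lborel. x ~: A" by (intro AE_not_in) (auto simp: null_sets_def)
 then have "(NN x. ennreal (D x)*ind A x) = (NNI (lborel::'a measure) (%x. 0))" by (intro nn_integral_cong_AE) (auto elim!: eventually_mono)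
 then show ?thesis using \<open>ind A 0 = 0\<close> by (auto simp: null_sets_def emeasure_atom_density)
qed

lemma null_sets_atom_density:
 assumes [measurable]: "D : BM borel" and c: "c > 0" and D: "AE x in lborel. D x > 0"
 shows "null_sets (atom_density c D) = null_sets (atom_density 1 (%_. 1))"
proof (intro equalityI subsetI)
 fix A assume A': "A : null_sets (atom_density c D)"
 then have [measurable]: "A : sets borel" by auto
 from A' have "ind A 0 = (0::ennreal)" "(NN x. ennreal (D x)*ind A x) = 0" using c by (auto simp: emeasure_atom_density null_sets_def ennreal_eq_0_iff)
 then have "AE x in lborel. ennreal (D x)*ind A x = 0" by (subst (asm) nn_integral_0_iff_AE) auto
 with D have "AE x in lborel. x ~: A" by eventually_elim (auto simp: indicator_def ennreal_eq_0_iff)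
 then have "emeasure lborel A = 0" by (subst (asm) AE_iff_measurable[OF _ refl]) auto
 then show "A : null_sets (atom_density 1 (%_. 1))" using \<open>ind A 0 = 0\<close> by (auto simp: emeasure_atom_density null_sets_def)
qed (rule null_sets_atom_density_mono[of _ 1], simp_all)

text \<open>Testing with \<open>gauss e (x - y)*gauss 1 x\<close> shows that the two measures,
  weighted by \<open>gauss 1\<close>, have equal Gaussian integrals. The weighted measures are
  finite, hence equal, and dividing by the strictly positive weight recovers the originals.\<close>

theorem measure_fourier_transform_unique:
 fixes ga mm nu :: "'a::euclidean_space measure"
 assumes mm: "measure_fourier_transform ga mm" and nu: "measure_fourier_transform ga nu"
  and ga: "sets ga = sets borel" "emeasure ga UNIV ~= 0"
 shows "mm = nu"
proof -
 have spga: "space ga = UNIV" using sets_eq_imp_space_eq[OF ga(1)] by simp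
 have gs: "schwartz (%x::'a. cr (gauss 1 x))" by (rule schwartz_gauss) simp
 have fg: "fourier (%x::'a. cr (gauss 1 x)) = (%x. cr (hk 1 x))" by (rule ext) (simp add: fourier_gauss)
 have hk: "integrable ga (%x. cr (hk 1 x))" using mm gs by (auto simp: measure_fourier_transform_def fg)
 have hkpos: "hk 1 x > 0" for x :: 'a by (simp add: hk_def)
 \<comment> \<open>The Bochner integral of a non-integrable function is 0. The integral of
   \<open>gauss 1\<close> must equal that of the positive function \<open>hk 1\<close> under the
   nonzero measure \<open>ga\<close>; as this value is not 0, \<open>gauss 1\<close> is forced to be
   integrable.\<close>
 have ne: "(LINT x|ga. cr (hk 1 x)) ~= 0"
 proof
  assume "(LINT x|ga. cr (hk 1 x)) = 0"
  then have "(LINT x|ga. hk 1 x) = 0" by simp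
  then have "AE x in ga. hk 1 x = 0" using hk by (subst (asm) integral_nonneg_eq_0_iff_AE) (auto simp: complex_of_real_integrable_eq less_imp_le hkpos)
  then have "AE x in ga. False" using hkpos by (auto simp: less_le)
  from AE_E[OF this] obtain N where "N : sets ga" "space ga <= N" "emeasure ga N = 0" by auto
  then have "N = UNIV" using spga by auto
  then show False using ga(2) \<open>emeasure ga N = 0\<close> by simp
 qed
 have main: "integrable M (gauss 1)" "sets M = sets borel"
  "!!e y. e > 0 ==> cr (LINT x|M. gauss e (x - y)*gauss 1 x) = (LINT x|ga. fourier (%x. cr (gauss e (x - y)*gauss 1 x)) x)"
  if M: "measure_fourier_transform ga M" for M
 proof -
  have "(LINT x|M. cr (gauss 1 x)) = (LINT x|ga. cr (hk 1 x))" using M gs unfolding measure_fourier_transform_def fg[symmetric] by blast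
  with ne have "(LINT x|M. cr (gauss 1 x)) ~= 0" by simp
  then have "integrable M (%x. cr (gauss 1 x))" using not_integrable_integral_eq by blast
  then show "integrable M (gauss 1)" by (simp add: complex_of_real_integrable_eq)
  show "sets M = sets borel" using M by (simp add: measure_fourier_transform_def translation_bounded_def)
  fix e :: real and y assume "e > 0"
  then show "cr (LINT x|M. gauss e (x - y)*gauss 1 x) = (LINT x|ga. fourier (%x. cr (gauss e (x - y)*gauss 1 x)) x)"
   using M schwartz_gauss_mult[of e y] by (simp only: measure_fourier_transform_def integral_complex_of_real[symmetric])
 qed
 define w where "w M = density M (%x::'a. ennreal (gauss 1 x))" for M
 have w: "finite_measure (w M)" "sets (w M) = sets borel"
  "!!e y. (\<integral>x. gauss e (x - y) \<partial>w M) = (LINT x|M. gauss e (x - y)*gauss 1 x)"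
  "M = density (w M) (%x. ennreal (1/gauss 1 x))"
  if "measure_fourier_transform ga M" for M
 proof -
  note m = main(1,2)[OF that]
  note [measurable_cong] = m(2)
  show "sets (w M) = sets borel" using m by (simp add: w_def)
  have "emeasure (w M) (space (w M)) = (NNI M (%x. ennreal (gauss 1 x)))" by (simp add: w_def emeasure_density)
  also have "... = ennreal (LINT x|M. gauss 1 x)" by (rule nn_integral_eq_integral[OF m(1)]) simp
  finally show "finite_measure (w M)" by (intro finite_measureI) simp
  show "(\<integral>x. gauss e (x - y) \<partial>w M) = (LINT x|M. gauss e (x - y)*gauss 1 x)" for e y
   unfolding w_def by (subst integral_density) (auto simp: mult.commute)
  have g1: "gauss 1 x ~= 0" for x :: 'a using gauss_pos[of 1 x] by (metis less_irrefl)
  have "ennreal (gauss 1 x)*ennreal (1/gauss 1 x) = 1" for x :: 'a using g1 by (simp add: ennreal_mult[symmetric])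
  then show "M = density (w M) (%x. ennreal (1/gauss 1 x))" unfolding w_def by (subst density_density_eq) (auto simp: density_1)
 qed
 have "w mm = w nu"
 proof (rule finite_measure_eqI_gauss)
  fix e :: real and y :: 'a assume "e > 0"
  from trans[OF main(3)[OF mm this, of y] main(3)[OF nu this, of y, symmetric]]
  have "(LINT x|mm. gauss e (x - y)*gauss 1 x) = (LINT x|nu. gauss e (x - y)*gauss 1 x)" by (simp only: of_real_eq_iff)
  then show "(\<integral>x. gauss e (x - y) \<partial>w mm) = (\<integral>x. gauss e (x - y) \<partial>w nu)" by (simp add: w mm nu)
 qed (intro w mm nu)+
 then show ?thesis using w(4)[OF mm] w(4)[OF nu] by simp
qed

section \<open>The Fourier pair formed by autocorrelation and diffraction measure\<close>

lemma cnj_fourier_even: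
 fixes k :: "'a::euclidean_space => real"
 assumes k: "integrable lborel k" and even: "!!x. k (- x) = k x"
 shows "fourier (%x. cr (k x)) t = cr (Re (fourier (%x. cr (k x)) t))"
proof -
 note [measurable] = borel_measurable_integrable[OF k]
 have "cnj (fourier (%x. cr (k x)) t) = (LBINT x. cr (k x)*cis (ph x t))"
  unfolding fourier_cis integral_cnj[symmetric] by (simp add: cis_cnj)
 also have "... = (LBINT x. cr (k (- x))*cis (ph (- x) t))" by (rule integral_lborel_uminus[symmetric]) measurable
 also have "... = fourier (%x. cr (k x)) t" unfolding fourier_cis by (simp add: even)
 finally have "fourier (%x. cr (k x)) t : \<real>" by (simp add: Reals_cnj_iff)
 then show ?thesis by (simp add: of_real_Re)
qed

lemma continuous_AE_eq_0:
 fixes g :: "'a::euclidean_space => real"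
 assumes c: "continuous_on UNIV g" and ae: "AE x in lborel. g x = 0"
 shows "g x = 0"
proof (rule ccontr)
 assume ne: "g x ~= 0"
 have o: "open {x. g x ~= 0}" using open_Collect_neq[OF c continuous_on_const[of UNIV 0]] by simp
 then have "{x. g x ~= 0} : sets lborel" by auto
 then have "{x. g x ~= 0} : null_sets lborel" using ae by (subst (asm) AE_iff_null) auto
 then have "negligible {x. g x ~= 0}" by (simp add: negligible_iff_null_sets null_sets_completionI)
 with open_not_negligible[OF o] ne show False by auto
qed

text \<open>Applied to \<open>k = |K|^2\<close>.\<close>

locale pair_kernel =
 fixes k :: "'a::euclidean_space => real"
 assumes k_integrable: "integrable lborel k" and k_cont: "continuous_on UNIV k"
  and k_nonneg: "!!x. 0 <= k x" and k_le_1: "!!x. k x <= 1" and k_even: "!!x. k (- x) = k x"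
  and k_0: "k 0 = 1" and k_mass: "(LBINT x. k x) <= 1"
begin

text \<open>Taking the real part loses nothing: \<open>k\<close> is even, so its transform is real
  (\<open>fourier_k\<close>).\<close>

definition ps :: "'a => real" where "ps t = Re (fourier (%x. cr (k x)) t)"

lemma k_measurable [measurable]: "k : BM borel" using borel_measurable_integrable[OF k_integrable] by simp

lemma ck_integrable: "integrable lborel (%x. cr (k x))" using k_integrable by (simp add: complex_of_real_integrable_eq)

lemma fourier_k: "fourier (%x. cr (k x)) t = cr (ps t)" unfolding ps_def by (rule cnj_fourier_even[OF k_integrable k_even])

lemma ps_measurable [measurable]: "ps : BM borel" unfolding ps_def using fourier_measurable[OF ck_integrable] by measurable

lemma ps_cos: "ps t = (LBINT x. k x*cos (ph x t))"
proof -
 have "integrable lborel (%x. cr (k x)*cis (- (ph x t)))" by (rule integrable_bound[OF ck_integrable]) (auto simp: norm_mult)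
 then show ?thesis unfolding ps_def fourier_cis by (subst integral_Re[symmetric]) auto
qed

lemma ps_abs_le_1: "\<bar>ps t\<bar> <= 1"
proof -
 have "\<bar>ps t\<bar> = norm (fourier (%x. cr (k x)) t)" by (simp add: fourier_k)
 also have "... <= (LBINT x. norm (cr (k x)))" by (rule norm_fourier_le)
 also have "... = (LBINT x. k x)" using k_nonneg by simp
 finally show ?thesis using k_mass by simp
qed

text \<open>If \<open>ps t\<close> were at least 1, the mass bound would force the continuous
  nonnegative function k(x) (1 - cos(2 pi x t)) to vanish identically. Since \<open>k\<close> is
  positive near 0, the cosine would equal 1 at all small multiples of \<open>t\<close>.\<close>

lemma ps_less_1:
 assumes "t ~= 0" shows "ps t < 1"
proof (rule ccontr)
 assume "~ ps t < 1"
 define g where "g x = k x*(1 - cos (ph x t))" for x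
 have gc: "continuous_on UNIV g" unfolding g_def by (intro continuous_intros k_cont)
 have i: "integrable lborel (%x. k x*cos (ph x t))" by (rule integrable_bound[OF k_integrable]) (auto simp: abs_mult k_nonneg intro!: mult_left_le)
 have g_eq: "g = (%x. k x - k x*cos (ph x t))" by (auto simp: g_def algebra_simps)
 have gi: "integrable lborel g" unfolding g_eq using i k_integrable by simp
 have "(LBINT x. g x) = (LBINT x. k x) - ps t" unfolding g_eq ps_cos using i k_integrable by simp
 then have "(LBINT x. g x) <= 0" using k_mass \<open>\<not> ps t < 1\<close> by simp
 moreover have g0: "g x >= 0" for x using k_nonneg by (simp add: g_def)
 moreover have "0 <= (LBINT x. g x)" by (rule integral_nonneg) (rule g0)
 ultimately have "(LBINT x. g x) = 0" by (intro antisym)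
 then have "AE x in lborel. g x = 0" using gi g0 by (subst (asm) integral_nonneg_eq_0_iff_AE) auto
 from continuous_AE_eq_0[OF gc this] have gz: "g x = 0" for x .
 have "((%s. k (s *\<^sub>R t)) \<longlongrightarrow> k (0 *\<^sub>R t)) (at 0)"
  using k_cont by (intro isCont_tendsto_compose[of _ k] tendsto_intros) (auto simp: continuous_on_eq_continuous_at)
 then have "eventually (%s. k (s *\<^sub>R t) > 0) (at 0)" using k_0 by (intro order_tendstoD(1)) auto
 then have "eventually (%s. k (s *\<^sub>R t) > 0) (at_right 0)" unfolding eventually_at_filter by eventually_elim auto
 \<comment> \<open>For positive \<open>s\<close> below this bound the phase at
   \<open>s *\<^sub>R t\<close> lies strictly between 0 and one full turn, so its cosine is not
   1.\<close>
 moreover have "eventually (%s. s < 1/(norm t)^2) (at_right (0::real))" using assms by (intro order_tendstoD(2)[OF tendsto_ident_at]) simp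
 moreover have "eventually (%s. s > (0::real)) (at_right 0)" by (simp add: eventually_at_filter)
 ultimately have "eventually (%s. False) (at_right (0::real))"
 proof eventually_elim
  case (elim s)
  let ?u = "s*(norm t)^2"
  have u: "0 < ?u" "?u < 1" using elim assms by (auto simp: field_simps)
  have "cos (ph (s *\<^sub>R t) t) = 1" using gz[of "s *\<^sub>R t"] elim by (simp add: g_def)
  then have "cos (2*pi*?u) = 1" by (simp add: power2_norm_eq_inner)
  then obtain n :: int where "2*pi*?u = n*2*pi" unfolding cos_one_2pi_int by auto
  then have "?u = n" by simp
  then show False using u by auto
 qed
 then show False by simp
qed

lemma ps_less_1_AE: "AE t in lborel. 0 < 1 - ps t"
proof -
 have "AE t in lborel. t ~= (0::'a)" by (rule AE_lborel_singleton)
 then show ?thesis by eventually_elim (simp add: ps_less_1)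
qed

lemma translation_bounded_diffraction: "translation_bounded (atom_density 1 (%t. 1 - ps t))" unfolding translation_bounded_def
proof (intro conjI ballI impI)
 fix A :: "'a set" assume [measurable]: "A : sets borel" and "bounded A"
 have fin: "emeasure lborel A < \<infinity>" using emeasure_bounded_finite[OF \<open>bounded A\<close>] by simp
 have "emeasure (atom_density 1 (%t. 1 - ps t)) ((+) x ` A) <= 1 + 2*emeasure lborel A" for x
 proof -
  have im: "(+) x ` A = (%y. - x + y) -` A" by (auto simp: image_iff intro!: bexI[of _ "- x + _"])
  have [measurable]: "(+) x ` A : sets borel"
   unfolding im using measurable_sets[of "%y. - x + y" borel borel A] by (simp del: add_uminus_conv_diff uminus_add_conv_diff)
  have eq: "emeasure lborel ((+) x ` A) = emeasure lborel A"
   by (subst (2) lborel_distr_plus[of "- x", symmetric]) (simp add: emeasure_distr im del: add_uminus_conv_diff uminus_add_conv_diff)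
  have "(NN t. ennreal (1 - ps t)*ind ((+) x ` A) t) <= (NN t. 2*ind ((+) x ` A) t)"
  proof (intro nn_integral_mono mult_right_mono)
   fix t show "ennreal (1 - ps t) <= 2" using ps_abs_le_1[of t] by (subst ennreal_numeral[symmetric]) (intro ennreal_leI, linarith)
  qed simp
  also have "... = 2*emeasure lborel A" by (simp add: nn_integral_cmult_indicator eq)
  finally have "(NN t. ennreal (1 - ps t)*ind ((+) x ` A) t) <= 2*emeasure lborel A" .
  then show ?thesis by (simp add: emeasure_atom_density) (intro add_mono, auto simp: indicator_def)
 qed
 then have "(SUP x. emeasure (atom_density 1 (%t. 1 - ps t)) ((+) x ` A)) <= 1 + 2*emeasure lborel A" by (intro SUP_least)
 also have "... < \<infinity>" using fin by (auto simp: ennreal_mult_less_top ennreal_add_eq_top less_top)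
 finally show "(SUP x. emeasure (atom_density 1 (%t. 1 - ps t)) ((+) x ` A)) < \<infinity>" .
qed simp

text \<open>\<open>fourier f 0\<close> is the integral of \<open>f\<close>, and by inversion the
  integral of \<open>fourier f\<close> is \<open>f 0\<close>, so the atom and the Lebesgue part
  exchange roles; Fubini passes the transform from \<open>f\<close> to \<open>k\<close>, producing
  \<open>ps\<close>.\<close>

lemma fourier_diffraction: "measure_fourier_transform (atom_density 1 (%x. 1 - k x)) (atom_density 1 (%t. 1 - ps t))" unfolding measure_fourier_transform_def
proof (intro conjI allI impI translation_bounded_diffraction)
 fix f :: "'a => complex" assume f: "schwartz f"
 have fi: "integrable lborel f" using integrable_iterated_partial[OF f, of "[]"] by simp
 have ffi: "integrable lborel (fourier f)" by (rule integrable_fourier_schwartz[OF f])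
 note [measurable] = borel_measurable_integrable[OF fi] borel_measurable_integrable[OF ffi]
 obtain B where B: "!!x. norm (f x) <= B" using schwartz_iterated(2)[OF f, of "[]" 0] by auto
 have fc: "isCont f 0" using has_derivative_continuous[OF schwartz_iterated(1)[OF f, of "[]"]] by simp
 have ki: "integrable lborel (%x. cr (k x)*fourier f x)" by (rule integrable_bound[OF ffi])
   (auto simp: norm_mult k_nonneg k_le_1 intro!: mult_left_le_one_le)
 have psi: "integrable lborel (%x. cr (ps x)*f x)" by (rule integrable_bound[OF fi])
   (auto simp: norm_mult ps_abs_le_1 intro!: mult_left_le_one_le)
 have 1: "(%x. (1 - k x) *\<^sub>R fourier f x) = (%x. fourier f x - cr (k x)*fourier f x)" by (simp add: scaleR_conv_of_real algebra_simps)
 have 2: "(%x. (1 - ps x) *\<^sub>R f x) = (%x. f x - cr (ps x)*f x)" by (simp add: scaleR_conv_of_real algebra_simps)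
 show "integrable (atom_density 1 (%x. 1 - k x)) (fourier f)" by (rule integrable_atom_density) (use ki ffi k_le_1 1 in auto)
 have "(\<integral>x. fourier f x \<partial>atom_density 1 (%x. 1 - k x)) = fourier f 0 + (LBINT x. fourier f x) - (LBINT x. cr (k x)*fourier f x)"
  by (subst integral_atom_density) (use ki ffi k_le_1 1 in auto)
 also have "fourier f 0 = (LBINT x. f x)" by (simp add: fourier_cis)
 also have "(LBINT x. fourier f x) = f 0" using fourier_inversion[OF fi B fc ffi] by simp
 also have "(LBINT x. cr (k x)*fourier f x) = (LBINT t. cr (ps t)*f t)"
 proof -
  let ?h = "%x t. cr (k x)*(f t*cis (- (ph t x)))"
  have J: "integrable (lborel \<Otimes>\<^sub>M lborel) (%(x, t). ?h x t)" by (rule integrable_bound[OF integrable_pair_mult[OF _ _ ck_integrable fi]])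
    (auto simp: norm_mult intro: lborel.sigma_finite_measure_axioms)
  have "(LBINT x. cr (k x)*fourier f x) = (LBINT x. (LBINT t. ?h x t))" unfolding fourier_cis by simp
  also have "... = (LBINT t. (LBINT x. ?h x t))" by (rule lborel_pair.Fubini_integral[OF J, symmetric])
  also have "... = (LBINT t. cr (ps t)*f t)"
  proof (intro integral_cong refl)
   fix t
   have "(LBINT x. ?h x t) = (LBINT x. f t*(cr (k x)*cis (- (ph x t))))" by (simp add: mult_ac inner_commute)
   also have "... = f t*fourier (%x. cr (k x)) t" unfolding fourier_cis by simp
   finally show "(LBINT x. ?h x t) = cr (ps t)*f t" by (simp add: fourier_k)
  qed
  finally show ?thesis .
 qed
 finally have R: "(\<integral>x. fourier f x \<partial>atom_density 1 (%x. 1 - k x)) = (LBINT x. f x) + f 0 - (LBINT t. cr (ps t)*f t)" .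
 have "1 - ps t >= 0" for t using ps_abs_le_1[of t] by linarith
 then have "(\<integral>t. f t \<partial>atom_density 1 (%t. 1 - ps t)) = f 0 + ((LBINT x. f x) - (LBINT t. cr (ps t)*f t))"
  by (subst integral_atom_density) (use psi fi 2 in auto)
 then show "(\<integral>t. f t \<partial>atom_density 1 (%t. 1 - ps t)) = (\<integral>x. fourier f x \<partial>atom_density 1 (%x. 1 - k x))" unfolding R by simp
qed

end

section \<open>Dense subspaces of the square-integrable functions\<close>

text \<open>The distance is a nonnegative integral in \<open>ennreal\<close>, so functions can be
  compared before their square integrability is established. \<open>V\<close> is an arbitrary set;
  linear structure is passed on by separate lemmas.\<close>

definition L2_closure :: "'c measure => ('c => real) set => ('c => real) set" where
 "L2_closure P V = {f : BM P. ALL ep>0. EX g:V. g : BM P & (NNI P (%x. ennreal ((f x - g x)^2))) <= ennreal ep}"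

lemma L2_closureI:
 "f : BM P ==> (!!ep. ep > 0 ==> EX g:V. g : BM P & (NNI P (%x. ennreal ((f x - g x)^2))) <= ennreal ep) ==> f : L2_closure P V"
 by (simp add: L2_closure_def)

lemma L2_closureE:
 assumes "f : L2_closure P V" "ep > 0"
 obtains g where "g : V" "g : BM P" "(NNI P (%x. ennreal ((f x - g x)^2))) <= ennreal ep"
 using assms by (auto simp: L2_closure_def)

lemma L2_closure_measurable: "f : L2_closure P V ==> f : BM P" by (simp add: L2_closure_def)

lemma L2_closure_base: "f : V ==> f : BM P ==> f : L2_closure P V"
 by (auto simp: L2_closure_def intro!: bexI[of _ f])

lemma power2_add_le: "(a + b)^2 <= 2*a^2 + 2*(b::real)^2" using zero_le_power2[of "a - b"] by (simp add: power2_eq_square algebra_simps)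

lemma nn_integral_power2_add_le:
 fixes a b :: "'c => real"
 assumes [measurable]: "a : BM P" "b : BM P"
 shows "(NNI P (%x. ennreal ((a x + b x)^2))) <= 2*(NNI P (%x. ennreal ((a x)^2))) + 2*(NNI P (%x. ennreal ((b x)^2)))"
proof -
 have "(NNI P (%x. ennreal ((a x + b x)^2))) <= (NNI P (%x. 2*ennreal ((a x)^2) + 2*ennreal ((b x)^2)))"
 proof (intro nn_integral_mono)
  fix x
  have "ennreal ((a x + b x)^2) <= ennreal (2*(a x)^2 + 2*(b x)^2)" by (intro ennreal_leI power2_add_le)
  then show "ennreal ((a x + b x)^2) <= 2*ennreal ((a x)^2) + 2*ennreal ((b x)^2)" by (simp add: ennreal_mult)
 qed
 then show ?thesis by (simp add: nn_integral_add nn_integral_cmult)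
qed

lemma ennreal_quarters:
 assumes "ep > 0" shows "2*ennreal (ep/4) + 2*ennreal (ep/4) = ennreal ep"
proof -
 have "2*ennreal (ep/4) = ennreal (2*(ep/4))" using assms by (subst ennreal_mult) auto
 then show ?thesis using assms by (simp flip: ennreal_plus)
qed

lemma L2_closure_idem:
 assumes f [measurable]: "f : BM P"
  and h: "!!ep. ep > 0 ==> EX h:L2_closure P V. (NNI P (%x. ennreal ((f x - h x)^2))) <= ennreal ep"
 shows "f : L2_closure P V"
proof (rule L2_closureI[OF f])
 fix ep :: real assume "ep > 0"
 then have e: "ep/4 > 0" by simp
 from h[OF e] obtain h where h: "h : L2_closure P V" "(NNI P (%x. ennreal ((f x - h x)^2))) <= ennreal (ep/4)" by blast
 from L2_closureE[OF h(1) e] obtain g where g: "g : V" "g : BM P" "(NNI P (%x. ennreal ((h x - g x)^2))) <= ennreal (ep/4)" .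
 note [measurable] = L2_closure_measurable[OF h(1)] g(2)
 have "(NNI P (%x. ennreal ((f x - g x)^2))) = (NNI P (%x. ennreal (((f x - h x) + (h x - g x))^2)))" by simp
 also have "... <= 2*(NNI P (%x. ennreal ((f x - h x)^2))) + 2*(NNI P (%x. ennreal ((h x - g x)^2)))"
  by (rule nn_integral_power2_add_le) measurable
 also have "... <= 2*ennreal (ep/4) + 2*ennreal (ep/4)" using h g by (intro add_mono mult_left_mono) auto
 also have "... = ennreal ep" using \<open>ep > 0\<close> by (rule ennreal_quarters)
 finally show "EX g:V. g : BM P & (NNI P (%x. ennreal ((f x - g x)^2))) <= ennreal ep"
  using g(1,3) by (intro bexI[of _ g]) auto
qed

lemma L2_closure_add:
 assumes V: "!!u v. u : V ==> v : V ==> (%x. u x + v x) : V"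
  and f: "f : L2_closure P V" and g: "g : L2_closure P V"
 shows "(%x. f x + g x) : L2_closure P V"
proof (rule L2_closureI)
 note [measurable] = L2_closure_measurable[OF f] L2_closure_measurable[OF g]
 show "(%x. f x + g x) : BM P" by measurable
 fix ep :: real assume "ep > 0"
 then have e: "ep/4 > 0" by simp
 from L2_closureE[OF f e] obtain u where u: "u : V" "u : BM P" "(NNI P (%x. ennreal ((f x - u x)^2))) <= ennreal (ep/4)" .
 from L2_closureE[OF g e] obtain v where v: "v : V" "v : BM P" "(NNI P (%x. ennreal ((g x - v x)^2))) <= ennreal (ep/4)" .
 note [measurable] = u(2) v(2)
 have "(NNI P (%x. ennreal ((f x + g x - (u x + v x))^2))) = (NNI P (%x. ennreal (((f x - u x) + (g x - v x))^2)))" by (simp add: algebra_simps)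
 also have "... <= 2*(NNI P (%x. ennreal ((f x - u x)^2))) + 2*(NNI P (%x. ennreal ((g x - v x)^2)))"
  by (rule nn_integral_power2_add_le) measurable
 also have "... <= 2*ennreal (ep/4) + 2*ennreal (ep/4)" using u v by (intro add_mono mult_left_mono) auto
 also have "... = ennreal ep" using \<open>ep > 0\<close> by (rule ennreal_quarters)
 finally show "EX h:V. h : BM P & (NNI P (%x. ennreal ((f x + g x - h x)^2))) <= ennreal ep"
  using V[OF u(1) v(1)] by (intro bexI[of _ "%x. u x + v x"]) auto
qed

lemma L2_closure_cmult:
 assumes V: "!!u. u : V ==> (%x. c*u x) : V" and f: "f : L2_closure P V"
 shows "(%x. c*f x) : L2_closure P V"
proof (rule L2_closureI)
 note [measurable] = L2_closure_measurable[OF f]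
 show "(%x. c*f x) : BM P" by measurable
 fix ep :: real assume "ep > 0"
 then have e: "ep/(c^2 + 1) > 0" by (simp add: add_nonneg_pos)
 from L2_closureE[OF f e] obtain u where u: "u : V" "u : BM P" "(NNI P (%x. ennreal ((f x - u x)^2))) <= ennreal (ep/(c^2 + 1))" .
 note [measurable] = u(2)
 have "(NNI P (%x. ennreal ((c*f x - c*u x)^2))) = (NNI P (%x. ennreal (c^2)*ennreal ((f x - u x)^2)))"
  by (simp add: ennreal_mult[symmetric] power_mult_distrib[symmetric] algebra_simps)
 also have "... = ennreal (c^2)*(NNI P (%x. ennreal ((f x - u x)^2)))" by (rule nn_integral_cmult) measurable
 also have "... <= ennreal (c^2)*ennreal (ep/(c^2 + 1))" using u by (intro mult_left_mono) auto
 also have "... = ennreal (c^2*(ep/(c^2 + 1)))" using e by (simp add: ennreal_mult[symmetric])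
 also have "... <= ennreal ep"
 proof (intro ennreal_leI)
  have "c^2/(c^2 + 1)*ep <= 1*ep"
   using \<open>ep > 0\<close> by (intro mult_right_mono) (auto simp: add_nonneg_pos divide_le_eq_1)
  then show "c^2*(ep/(c^2 + 1)) <= ep" by simp
 qed
 finally show "EX h:V. h : BM P & (NNI P (%x. ennreal ((c*f x - h x)^2))) <= ennreal ep"
  using V[OF u(1)] by (intro bexI[of _ "%x. c*u x"]) auto
qed

lemma L2_closure_limit:
 assumes u: "!!n. u n : L2_closure P V" and f [measurable]: "f : BM P"
  and lim: "AE x in P. (%n. u n x) ~~> f x"
  and w [measurable]: "w : BM P" and dom: "!!n. AE x in P. \<bar>u n x - f x\<bar> <= w x"
  and fin: "(NNI P (%x. ennreal ((w x)^2))) < \<infinity>"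
 shows "f : L2_closure P V"
proof (rule L2_closure_idem[OF f])
 fix ep :: real assume "ep > 0"
 note [measurable] = L2_closure_measurable[OF u]
 have "(%n. (NNI P (%x. ennreal ((f x - u n x)^2)))) ~~> (NNI P (%x. 0))"
 proof (rule nn_integral_dominated_convergence[where w="%x. ennreal ((w x)^2)"])
  show "AE x in P. ennreal ((f x - u n x)^2) <= ennreal ((w x)^2)" for n using dom[of n]
  proof eventually_elim
   case (elim x)
   then have "\<bar>f x - u n x\<bar> <= \<bar>w x\<bar>" by (simp add: abs_minus_commute)
   then show ?case by (intro ennreal_leI) (simp add: abs_le_square_iff)
  qed
  show "AE x in P. (%n. ennreal ((f x - u n x)^2)) ~~> 0" using lim
  proof eventually_elim
   case (elim x)
   have "(%n. ennreal ((f x - u n x)^2)) ~~> ennreal ((f x - f x)^2)" by (intro tendsto_ennrealI tendsto_intros elim)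
   then show ?case by simp
  qed
 qed (use fin in auto)
 then have "eventually (%n. (NNI P (%x. ennreal ((f x - u n x)^2))) < ennreal ep) sequentially"
  using \<open>ep > 0\<close> by (intro order_tendstoD(2)) auto
 then obtain n where "(NNI P (%x. ennreal ((f x - u n x)^2))) < ennreal ep" by (auto simp: eventually_sequentially)
 then show "EX h:L2_closure P V. (NNI P (%x. ennreal ((f x - h x)^2))) <= ennreal ep" using u by (intro bexI[of _ "u n"]) auto
qed

text \<open>The two substantial instances are exponentials of counts, as a step towards polynomials
  in counts, and real trigonometric polynomials, which approximate indicators in L^2 of spectral
  measures.\<close>

locale bounded_algebra = finite_measure P for P :: "'c measure" +
 fixes \<A> :: "('c => real) set"
 assumes meas: "g : \<A> ==> g : BM P"
  and bounded: "g : \<A> ==> EX B. ALL x:space P. \<bar>g x\<bar> <= B"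
  and const: "(%_. c) : \<A>"
  and add: "g : \<A> ==> h : \<A> ==> (%x. g x + h x) : \<A>"
  and mult: "g : \<A> ==> h : \<A> ==> (%x. g x*h x) : \<A>"
begin

text \<open>The uniform closure of the algebra. The algebra itself need not be closed under absolute
  values; \<open>U\<close> is, and hence also under positive parts and truncation at 1, from which
  indicators are built.\<close>

definition U where "U = {f : BM P. ALL ep>0. EX g:\<A>. ALL x:space P. \<bar>f x - g x\<bar> <= ep}"

lemma U_E:
 assumes "f : U" "ep > 0" obtains g where "g : \<A>" "!!x. x : space P ==> \<bar>f x - g x\<bar> <= ep"
 using assms by (auto simp: U_def)

lemma U_meas: "f : U ==> f : BM P" by (simp add: U_def)

lemma \<A>_U: "f : \<A> ==> f : U" using meas by (auto simp: U_def intro!: bexI[of _ f])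

lemma U_const: "(%_. c) : U" by (intro \<A>_U const)

lemma U_bounded: assumes "f : U" shows "EX B>0. ALL x:space P. \<bar>f x\<bar> <= B"
proof -
 obtain g where g: "g : \<A>" "!!x. x : space P ==> \<bar>f x - g x\<bar> <= 1" using U_E[OF assms, of 1] by auto
 obtain B where B: "!!x. x : space P ==> \<bar>g x\<bar> <= B" using bounded[OF g(1)] by auto
 have "\<bar>f x\<bar> <= \<bar>B\<bar> + 1" if "x : space P" for x using g(2)[OF that] B[OF that] by linarith
 then show ?thesis by (intro exI[of _ "\<bar>B\<bar> + 1"]) auto
qed

lemma U_closed:
 assumes "f : BM P" "!!ep. ep > 0 ==> EX g:U. ALL x:space P. \<bar>f x - g x\<bar> <= ep"
 shows "f : U" unfolding U_def
proof (intro CollectI conjI allI impI)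
 fix ep :: real assume "ep > 0"
 then have e: "ep/2 > 0" by simp
 obtain g where g: "g : U" "ALL x:space P. \<bar>f x - g x\<bar> <= ep/2" using assms(2)[OF e] by auto
 obtain h where h: "h : \<A>" "!!x. x : space P ==> \<bar>g x - h x\<bar> <= ep/2" using U_E[OF g(1) e] by auto
 have "\<bar>f x - h x\<bar> <= ep" if "x : space P" for x using g(2)[rule_format, OF that] h(2)[OF that] by linarith
 then show "EX g:\<A>. ALL x:space P. \<bar>f x - g x\<bar> <= ep" using h by auto
qed fact

lemma U_add: assumes f: "f : U" and g: "g : U" shows "(%x. f x + g x) : U" unfolding U_def
proof (intro CollectI conjI allI impI)
 show "(%x. f x + g x) : BM P" using U_meas[OF f] U_meas[OF g] by measurable
 fix ep :: real assume "ep > 0"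
 then have e: "ep/2 > 0" by simp
 obtain u where u: "u : \<A>" "!!x. x : space P ==> \<bar>f x - u x\<bar> <= ep/2" using U_E[OF f e] by auto
 obtain v where v: "v : \<A>" "!!x. x : space P ==> \<bar>g x - v x\<bar> <= ep/2" using U_E[OF g e] by auto
 have "\<bar>f x + g x - (u x + v x)\<bar> <= ep" if "x : space P" for x using u(2)[OF that] v(2)[OF that] by linarith
 then show "EX g':\<A>. ALL x:space P. \<bar>f x + g x - g' x\<bar> <= ep" using add[OF u(1) v(1)] by (intro bexI[of _ "%x. u x + v x"]) auto
qed

lemma U_mult: assumes f: "f : U" and g: "g : U" shows "(%x. f x*g x) : U" unfolding U_def
proof (intro CollectI conjI allI impI)
 show "(%x. f x*g x) : BM P" using U_meas[OF f] U_meas[OF g] by measurable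
 fix ep :: real assume "ep > 0"
 obtain B where B: "B > 0" "!!x. x : space P ==> \<bar>f x\<bar> <= B" using U_bounded[OF f] by auto
 obtain C where C: "C > 0" "!!x. x : space P ==> \<bar>g x\<bar> <= C" using U_bounded[OF g] by auto
 \<comment> \<open>The product of the two errors is bounded by means of \<open>de <= 1\<close>, the
   mixed terms by \<open>B\<close> and \<open>C\<close>; together they cost
   \<open>de*(B + C + 1)\<close>, which this choice keeps below \<open>ep\<close>.\<close>
 define de where "de = ep/(ep + (B + C + 1))"
 have d: "de > 0" "de <= 1" "de*(B + C + 1) <= ep" using B(1) C(1) \<open>ep > 0\<close>
  by (simp_all add: de_def pos_divide_le_eq)
 obtain u where u: "u : \<A>" "!!x. x : space P ==> \<bar>f x - u x\<bar> <= de" using U_E[OF f d(1)] by auto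
 obtain v where v: "v : \<A>" "!!x. x : space P ==> \<bar>g x - v x\<bar> <= de" using U_E[OF g d(1)] by auto
 have "\<bar>f x*g x - u x * v x\<bar> <= ep" if x: "x : space P" for x
 proof -
  have "f x*g x - u x * v x = f x*(g x - v x) + (f x - u x)*(v x - g x) + (f x - u x)*g x" by (simp add: algebra_simps)
  also have "\<bar>...\<bar> <= \<bar>f x*(g x - v x)\<bar> + \<bar>(f x - u x)*(v x - g x)\<bar> + \<bar>(f x - u x)*g x\<bar>" by linarith
  also have "... <= B*de + de*1 + de*C" unfolding abs_mult abs_minus_commute[of "v x"] using B(1) C(1) d(1)
   by (intro add_mono mult_mono B(2)[OF x] C(2)[OF x] u(2)[OF x] v(2)[OF x] order_trans[OF v(2)[OF x] d(2)]) simp_all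
  finally show ?thesis using d by (simp add: algebra_simps)
 qed
 then show "EX g':\<A>. ALL x:space P. \<bar>f x*g x - g' x\<bar> <= ep" using mult[OF u(1) v(1)] by (intro bexI[of _ "%x. u x * v x"]) auto
qed

lemma U_poly:
 assumes "real_polynomial_function (p :: real => real)" and f: "f : U"
 shows "(%x. p (f x)) : U" using assms(1)
proof induction
 case (linear p)
 then interpret bounded_linear p .
 have "(%x. p (f x)) = (%x. p 1*f x)"
 proof
  fix x
  have "p (f x *\<^sub>R 1) = f x *\<^sub>R p 1" by (rule scaleR)
  then show "p (f x) = p 1*f x" by (simp only: real_scaleR_def mult_1_right mult.commute[of _ "p 1"])
 qed
 then show ?case using U_mult[OF U_const[of "p 1"] f] by simp
next
 case (const c)
 show ?case by (rule U_const)
next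
 case (add p q)
 show ?case by (rule U_add[OF add.IH])
next
 case (mult p q)
 show ?case by (rule U_mult[OF mult.IH])
qed

text \<open>By Weierstrass the absolute value is a uniform limit of polynomials on the bounded range
  of \<open>f\<close>, and \<open>U\<close> is closed under polynomials and uniform limits.\<close>

lemma U_abs: assumes f: "f : U" shows "(%x. \<bar>f x\<bar>) : U"
proof (rule U_closed)
 show "(%x. \<bar>f x\<bar>) : BM P" using U_meas[OF f] by measurable
 fix ep :: real assume "ep > 0"
 obtain B where B: "B > 0" "!!x. x : space P ==> \<bar>f x\<bar> <= B" using U_bounded[OF f] by auto
 have c: "continuous_on {-B..B} (%x::real. \<bar>x\<bar>)" by (intro continuous_intros)
 obtain p where p: "real_polynomial_function p" "!!x. x : {-B..B} ==> \<bar>\<bar>x\<bar> - p x\<bar> < ep"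
  by (rule Stone_Weierstrass_real_polynomial_function[OF compact_Icc c \<open>ep > 0\<close>]) (rule that)
 have "\<bar>\<bar>f x\<bar> - p (f x)\<bar> <= ep" if "x : space P" for x
 proof -
  have "- B <= f x" "f x <= B" using B(2)[OF that] by linarith+
  then have "f x : {-B..B}" by simp
  from p(2)[OF this] show ?thesis by (rule less_imp_le)
 qed
 then show "EX g:U. ALL x:space P. \<bar>\<bar>f x\<bar> - g x\<bar> <= ep" by (intro bexI[OF _ U_poly[OF p(1) f]]) simp
qed

lemma U_pos: assumes f: "f : U" shows "(%x. max 0 (f x)) : U"
proof -
 have "(%x. (1/2)*(f x + \<bar>f x\<bar>)) : U" by (intro U_mult U_const U_add U_abs f)
 moreover have "(%x. (1/2)*(f x + \<bar>f x\<bar>)) = (%x. max 0 (f x))" by (auto simp: max_def)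
 ultimately show ?thesis by simp
qed

lemma U_min_1: assumes f: "f : U" shows "(%x. min 1 (f x)) : U"
proof -
 have "(%x. 1 + (-1)*max 0 (1 + (-1)*f x)) : U" by (intro U_mult U_const U_add U_pos f)
 moreover have "(%x. 1 + (-1)*max 0 (1 + (-1)*f x)) = (%x. min 1 (f x))" by (auto simp: max_def min_def)
 ultimately show ?thesis by simp
qed

abbreviation "cl \<equiv> L2_closure P \<A>"

lemma U_cl: assumes f: "f : U" shows "f : cl"
proof (rule L2_closureI)
 show [measurable]: "f : BM P" by (rule U_meas[OF f])
 fix ep :: real assume "ep > 0"
 define m where "m = measure P (space P)"
 have m: "m >= 0" "emeasure P (space P) = ennreal m" by (auto simp: m_def emeasure_eq_measure)
 define de where "de = sqrt (ep/(m + 1))"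
 have d: "de > 0" "de^2*m <= ep" using \<open>ep > 0\<close> m by (auto simp: de_def field_simps)
 obtain g where g: "g : \<A>" "!!x. x : space P ==> \<bar>f x - g x\<bar> <= de" using U_E[OF f d(1)] by auto
 have "(NNI P (%x. ennreal ((f x - g x)^2))) <= (NNI P (%x. ennreal (de^2)))"
  using g d by (intro nn_integral_mono ennreal_leI) (simp add: abs_le_square_iff[symmetric])
 also have "... = ennreal (de^2*m)" using m by (simp add: ennreal_mult)
 also have "... <= ennreal ep" using d by (intro ennreal_leI)
 finally show "EX g:\<A>. g : BM P & (NNI P (%x. ennreal ((f x - g x)^2))) <= ennreal ep" using g meas by auto
qed

lemma cl_limit_bounded:
 assumes "!!n. u n : cl" "f : BM P" "AE x in P. (%n. u n x) ~~> f x" "!!n. AE x in P. \<bar>u n x - f x\<bar> <= B"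
 shows "f : cl"
proof (rule L2_closure_limit[OF assms(1-3) _ assms(4)])
 have "emeasure P (space P) < \<infinity>" by (simp add: less_top[symmetric])
 then show "(NNI P (%x. ennreal (B^2))) < \<infinity>" by (simp add: ennreal_mult_less_top)
qed simp

lemma indicator_pos_cl: assumes f: "f : U" shows "ind {x : space P. f x > 0} : cl"
proof (rule cl_limit_bounded)
 note [measurable] = U_meas[OF f]
 show "(%x. min 1 (real n*max 0 (f x))) : cl" for n by (intro U_cl U_min_1 U_mult U_const U_pos f)
 show "ind {x : space P. f x > 0} : BM P" by measurable
 show "AE x in P. (%n. min 1 (real n*max 0 (f x))) ~~> ind {x : space P. f x > 0} x"
 proof (intro AE_I2)
  fix x assume x: "x : space P"
  show "(%n. min 1 (real n*max 0 (f x))) ~~> ind {x : space P. f x > 0} x"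
  proof (cases "f x > 0")
   case True
   obtain N where N: "real N*f x > 1" using reals_Archimedean3[OF True] by blast
   have "min 1 (real n*max 0 (f x)) = 1" if "n >= N" for n
   proof -
    have "real N*f x <= real n*f x" using that True by (intro mult_right_mono) auto
    then have "1 < real n*f x" using N by linarith
    then show ?thesis using True by (simp add: min_def max_def)
   qed
   then have "eventually (%n. min 1 (real n*max 0 (f x)) = 1) sequentially" by (auto simp: eventually_sequentially)
   then show ?thesis using True x by (simp add: tendsto_eventually)
  qed simp
 qed
 show "AE x in P. \<bar>min 1 (real n*max 0 (f x)) - ind {x : space P. f x > 0} x\<bar> <= 1" for n
 proof (intro AE_I2)
  fix x
  have "0 <= min 1 (real n*max 0 (f x))" "min 1 (real n*max 0 (f x)) <= 1" by auto
  moreover have "0 <= (ind {x : space P. f x > 0} x :: real)" "(ind {x : space P. f x > 0} x :: real) <= 1" by (auto simp: indicator_def)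
  ultimately show "\<bar>min 1 (real n*max 0 (f x)) - ind {x : space P. f x > 0} x\<bar> <= 1" by linarith
 qed
qed

lemma cl_add: "f : cl ==> g : cl ==> (%x. f x + g x) : cl" by (rule L2_closure_add[OF add])
lemma cl_cmult: "f : cl ==> (%x. c*f x) : cl" by (rule L2_closure_cmult[OF mult[OF const]])
lemma cl_sum: "finite I ==> (!!i. i : I ==> f i : cl) ==> (%x. SUM i:I. f i x) : cl"
 by (induction I rule: finite_induct) (auto intro: cl_add U_cl U_const)

lemma cl_cong: assumes f: "f : cl" and eq: "!!x. x : space P ==> f x = g x" shows "g : cl"
proof (rule cl_limit_bounded[of "%_. f"])
 show "g : BM P" using L2_closure_measurable[OF f] eq by (simp cong: measurable_cong)
qed (use f eq in auto)

text \<open>A Dynkin argument. The sets {f > 0} with f in \<open>U\<close> are stable under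
  intersection, because the product of two positive parts is positive exactly on the intersection;
  complements and disjoint unions pass to the closure.\<close>

theorem indicator_cl:
 assumes E: "E : sigma_sets (space P) {{x : space P. g x > 0} | g. g : \<A>}"
 shows "ind E : cl"
proof -
 let ?G = "{{x : space P. g x > 0} | g. g : U}"
 have GP: "?G <= sets P"
 proof clarify
  fix f assume "f : U"
  note [measurable] = U_meas[OF this]
  show "{x : space P. 0 < f x} : sets P" by measurable
 qed
 then have sub: "sigma_sets (space P) ?G <= sets P" by (rule sets.sigma_sets_subset)
 have E': "E : sigma_sets (space P) ?G" by (rule subsetD[OF sigma_sets_mono' E]) (blast intro: \<A>_U)
 have "Int_stable ?G"
 proof (rule Int_stableI)
  fix a b assume "a : ?G" "b : ?G"
  then obtain f g where fg: "f : U" "g : U" "a = {x : space P. f x > 0}" "b = {x : space P. g x > 0}" by auto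
  have "0 < u & 0 < v \<longleftrightarrow> max 0 u*max 0 v > 0" for u v :: real by (simp add: max_def zero_less_mult_iff)
  then have "a Int b = {x : space P. max 0 (f x)*max 0 (g x) > 0}" unfolding fg by blast
  then show "a Int b : ?G" by (intro CollectI exI[of _ "%x. max 0 (f x)*max 0 (g x)"] conjI U_mult U_pos fg)
 qed
 moreover have "?G <= Pow (space P)" by auto
 ultimately show ?thesis using E'
 proof (induction rule: sigma_sets_induct_disjoint)
  case (basic A)
  then obtain g where "g : U" "A = {x : space P. 0 < g x}" by blast
  then show ?case by (simp only: indicator_pos_cl)
 next
  case empty
  show ?case by (rule cl_cong[OF U_cl[OF U_const[of 0]]]) simp
 next
  case (compl A)
  have "(%x. 1 + (-1)*ind A x) : cl" by (rule cl_add[OF U_cl[OF U_const] cl_cmult[OF compl.IH]])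
  then show ?case by (rule cl_cong) (auto simp: indicator_def)
 next
  case (union A)
  have [measurable]: "A i : sets P" for i using union(2) sub by auto
  have eq: "(SUM i<n. ind (A i) x) = (ind (UN i<n. A i) x :: real)" for n x
   using union(1) by (intro indicator_UN_disjoint[symmetric]) (auto intro: disjoint_family_on_mono)
  show ?case
  proof (rule cl_limit_bounded[of "%n x. SUM i<n. ind (A i) x"])
   show "(%x. SUM i<n. ind (A i) x) : cl" for n by (intro cl_sum union.IH) auto
   show "AE x in P. (%n. SUM i<n. ind (A i) x) ~~> (ind (\<Union> (range A)) x :: real)"
    unfolding eq by (intro AE_I2 LIMSEQ_indicator_UN)
   show "AE x in P. \<bar>(SUM i<n. ind (A i) x) - (ind (\<Union> (range A)) x :: real)\<bar> <= 1" for n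
    unfolding eq by (intro AE_I2) (auto simp: indicator_def)
   show "ind (\<Union> (range A)) : BM P" using sets.countable_UN[of A UNIV P] by (intro borel_measurable_indicator) auto
  qed
 qed
qed

theorem L2_dense:
 assumes gen: "sets P <= sigma_sets (space P) {{x : space P. g x > 0} | g. g : \<A>}"
  and f [measurable]: "f : BM P" and fin: "(NNI P (%x. ennreal ((f x)^2))) < \<infinity>"
 shows "f : cl"
proof -
 have simple: "s : cl" if s: "simple_function P s" for s :: "'c => real"
 proof (rule cl_cong)
  show "(%x. SUM y:s ` space P. y*ind (s -` {y} Int space P) x) : cl"
   by (intro cl_sum cl_cmult indicator_cl subsetD[OF gen] simple_functionD[OF s])
  fix x assume "x : space P"
  then show "(SUM y:s ` space P. y*ind (s -` {y} Int space P) x) = s x"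
   using simple_function_indicator_representation_banach[OF s] by (simp add: indicator_def mult.commute)
 qed
 obtain F where F: "!!i. simple_function P (F i)" "!!x. x : space P ==> (%i. F i x) ~~> f x"
  "!!i x. x : space P ==> dist (F i x) 0 <= 2*dist (f x) 0" using borel_measurable_implies_sequence_metric[OF f, of 0] by blast
 show ?thesis
 proof (rule L2_closure_limit[of F])
  show "AE x in P. \<bar>F n x - f x\<bar> <= 3*\<bar>f x\<bar>" for n
  proof (intro AE_I2)
   fix x assume "x : space P"
   from F(3)[OF this, of n] show "\<bar>F n x - f x\<bar> <= 3*\<bar>f x\<bar>" by simp
  qed
  have "(NNI P (%x. ennreal ((3*\<bar>f x\<bar>)^2))) = 9*(NNI P (%x. ennreal ((f x)^2)))"
   by (simp add: power_mult_distrib ennreal_mult nn_integral_cmult)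
  then show "(NNI P (%x. ennreal ((3*\<bar>f x\<bar>)^2))) < \<infinity>" using fin by (simp add: ennreal_mult_less_top)
 qed (use simple F in auto)
qed

end

section \<open>Factorial powers of counting measures\<close>

abbreviation "lfb \<equiv> locally_finite_borel"

lemma point_measuresD:
 assumes "W : PM"
 shows "sets W = sets borel" "space W = UNIV"
  "!!A. A : sets borel ==> bounded A ==> emeasure W A < \<infinity>"
  "!!A. A : sets borel ==> emeasure W A : \<nat> Un {\<infinity>}"
  "!!A. A : sets borel ==> bounded A ==> emeasure W A = ennreal (measure W A)"
  "!!A. A : sets borel ==> bounded A ==> EX n::nat. measure W A = real n"
  "!!A. A : sets borel ==> emeasure W A ~= 0 ==> emeasure W A >= 1"
proof -
 show s: "sets W = sets borel" and fin: "!!A. A : sets borel ==> bounded A ==> emeasure W A < \<infinity>"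
  and N: "!!A. A : sets borel ==> emeasure W A : \<nat> Un {\<infinity>}"
  using assms by (auto simp: space_point_measures locally_finite_borel_def)
 show "space W = UNIV" using sets_eq_imp_space_eq[OF s] by simp
 show e: "emeasure W A = ennreal (measure W A)" if "A : sets borel" "bounded A" for A using fin[OF that] by (intro emeasure_eq_ennreal_measure) auto
 show "EX n::nat. measure W A = real n" if "A : sets borel" "bounded A" for A
 proof -
  have "emeasure W A : \<nat>" using N[OF that(1)] fin[OF that] by auto
  then obtain n :: nat where "emeasure W A = of_nat n" by (auto simp: Nats_def)
  then show ?thesis by (auto simp: measure_def)
 qed
 show "emeasure W A >= 1" if A: "A : sets borel" "emeasure W A ~= 0" for A
 proof (cases "emeasure W A = \<infinity>")
  case False
  then have "emeasure W A : \<nat>" using N[OF A(1)] by auto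
  then obtain n :: nat where n: "emeasure W A = of_nat n" by (auto simp: Nats_def)
  with A have "n >= 1" by (cases n) auto
  then have "(of_nat 1 :: ennreal) <= of_nat n" by (intro of_nat_mono)
  with n show ?thesis by simp
 qed simp
qed

text \<open>A set of nonzero mass meets some small ball in nonzero mass; iteration with shrinking
  radii gives a decreasing sequence whose intersection is at most one point. Integrality keeps all
  masses at least 1, so the mass survives in the limit.\<close>

lemma point_measure_atom:
 fixes W :: "'a::euclidean_space measure"
 assumes w: "W : PM" and A: "A : sets borel" "bounded A" "emeasure W A ~= 0"
 shows "EX x:A. emeasure W {x} ~= 0"
proof -
 note p = point_measuresD[OF w]
 obtain D :: "'a set" where D: "countable D" "!!X. open X ==> X ~= {} ==> EX d:D. d : X"
  using countable_dense_setE by blast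
 let ?P = "%n B. B : sets borel & B <= A & emeasure W B ~= 0"
 let ?Q = "%n B C. C <= B & (EX d. C <= ball d (inverse (real (Suc n))))"
 have "EX f. ALL n. ?P n (f n) & ?Q n (f n) (f (Suc n))"
 proof (rule dependent_nat_choice)
  show "EX B. ?P 0 B" using A by blast
  fix B n assume B: "?P n B"
  let ?r = "inverse (real (Suc n))"
  have "EX d:D. emeasure W (B Int ball d ?r) ~= 0"
  proof (rule ccontr)
   assume "~ ?thesis"
   then have "B Int ball d ?r : null_sets W" if "d : D" for d using that B by (auto simp: null_sets_def p(1))
   then have U: "(UN d:D. B Int ball d ?r) : null_sets W" by (intro null_sets_UN' D(1))
   have "B <= (UN d:D. B Int ball d ?r)"
   proof
    fix x assume "x : B"
    moreover obtain d where "d : D" "d : ball x ?r" using D(2)[of "ball x ?r"] by auto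
    ultimately show "x : (UN d:D. B Int ball d ?r)" by (auto simp: dist_commute)
   qed
   from null_sets_subset[OF U _ this] B p(1) have "B : null_sets W" by simp
   then show False using B by (auto dest: null_setsD1)
  qed
  then obtain d where "emeasure W (B Int ball d ?r) ~= 0" by blast
  then have "?P (Suc n) (B Int ball d ?r) & ?Q n B (B Int ball d ?r)" using B by auto
  then show "EX C. ?P (Suc n) C & ?Q n B C" by blast
 qed
 then obtain f where f: "!!n. ?P n (f n)" "!!n. ?Q n (f n) (f (Suc n))" by blast
 have dec: "decseq f" using f(2) by (intro decseq_SucI) auto
 have fin: "emeasure W (f n) ~= \<infinity>" for n using p(3)[of "f n"] f(1)[of n] bounded_subset[OF A(2)] by (auto simp: less_top)
 have "(%n. emeasure W (f n)) ~~> emeasure W (INT n. f n)" using f(1) p(1) by (intro Lim_emeasure_decseq dec fin) auto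
 moreover have "emeasure W (f n) >= 1" for n using p(7) f(1) by blast
 ultimately have ge: "emeasure W (INT n. f n) >= 1" by (intro tendsto_lowerbound[of _ _ sequentially]) auto
 then have "(INT n. f n) ~= {}" by auto
 then obtain x where x: "x : (INT n. f n)" by blast
 have "(INT n. f n) <= {x}"
 proof
  fix y assume y: "y : (INT n. f n)"
  have "dist x y < 2*inverse (real (Suc n))" for n
  proof -
   obtain d where "f (Suc n) <= ball d (inverse (real (Suc n)))" using f(2) by blast
   then have "dist d x < inverse (real (Suc n))" "dist d y < inverse (real (Suc n))" using x y by auto
   then show ?thesis using dist_triangle3[of x y d] by linarith
  qed
  moreover have "(%n. 2*inverse (real (Suc n))) ~~> 2*0" by (intro tendsto_intros inverse_Suc_tendsto)
  ultimately have "dist x y <= 2*0" by (intro LIMSEQ_le_const[of "%n. 2*inverse (real (Suc n))"]) (blast intro: less_imp_le)+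
  then show "y : {x}" by simp
 qed
 then have "(INT n. f n) = {x}" using x by blast
 then have "emeasure W {x} ~= 0" using ge by auto
 moreover have "x : A" using x f(1)[of 0] by auto
 ultimately show ?thesis by blast
qed

lemma ball_UN_UNIV: "(UN n::nat. bl n) = (UNIV :: 'a::euclidean_space set)" using reals_Archimedean2 by (auto simp: dist_norm)

text \<open>Guarantees that the choice in \<open>enumeration\<close> is a genuine representation.
  There are finitely many atoms in every ball, each of integer mass, and off the atoms the measure
  vanishes by \<open>point_measure_atom\<close>.\<close>

theorem enumeration_exists:
 fixes W :: "'a::euclidean_space measure"
 assumes w: "W : PM"
 shows "EX I x. W = distr (count_space (I :: nat set)) borel x"
proof -
 note p = point_measuresD[OF w]
 define Z where "Z = {x. emeasure W {x} ~= 0}"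
 have Zfin: "finite (Z Int bl n)" for n
 proof (rule ccontr)
  assume inf: "~ ?thesis"
  obtain N :: nat where N: "measure W (bl n) = real N" using p(6)[of "bl n"] by auto
  obtain T where T: "T <= Z Int bl n" "finite T" "card T = Suc N" using infinite_arbitrarily_large[OF inf] by blast
  have "of_nat (Suc N) = (SUM x:T. (1::ennreal))" using T by simp
  also have "... <= (SUM x:T. emeasure W {x})" using T p(7) by (intro sum_mono) (auto simp: Z_def)
  also have "... = emeasure W T" using T p(1) by (intro emeasure_eq_sum_singleton[symmetric]) auto
  also have "... <= emeasure W (bl n)" using T p(1) by (intro emeasure_mono) auto
  also have "... = of_nat N" using N p(5)[of "bl n"] by (simp add: ennreal_of_nat_eq_real_of_nat)
  finally show False unfolding of_nat_le_iff by simp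
 qed
 have Zc: "countable Z"
 proof -
  have "Z = (UN n::nat. Z Int bl n)" by (simp only: Int_UN_distrib[symmetric] ball_UN_UNIV Int_UNIV_right)
  moreover have "countable (UN n::nat. Z Int bl n)" by (intro countable_UN[OF countableI_type] countable_finite Zfin)
  ultimately show ?thesis by (rule ssubst)
 qed
 have Zb: "C : sets borel" if "C <= Z" for C using countable_subset[OF that Zc] by (rule sets.countable[rotated]) auto
 have Z0: "emeasure W (- Z) = 0"
 proof -
  have "- Z Int bl n : null_sets W" for n
  proof (rule ccontr)
   assume a: "~ ?thesis"
   have b: "- Z Int bl n : sets borel" using Zb[of Z] by auto
   with a have "emeasure W (- Z Int bl n) ~= 0" by (auto simp: null_sets_def p(1))
   from point_measure_atom[OF w b _ this] obtain x where "x : - Z" "emeasure W {x} ~= 0" by auto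
   then show False by (simp add: Z_def)
  qed
  then have "(UN n::nat. - Z Int bl n) : null_sets W" by (rule null_sets_UN)
  moreover have "(UN n::nat. - Z Int bl n) = - Z" using ball_UN_UNIV by blast
  ultimately show ?thesis by auto
 qed
 have "EX n::nat. emeasure W {x} = of_nat n" for x using p(5)[of "{x}"] p(6)[of "{x}"] by (auto simp: ennreal_of_nat_eq_real_of_nat)
 then obtain m :: "'a => nat" where m: "!!x. emeasure W {x} = of_nat (m x)" by metis
 \<comment> \<open>Each atom \<open>x\<close> occurs \<open>m x\<close> times; the second component
   only separates the copies and is forgotten by \<open>fst\<close>.\<close>
 define S where "S = (SIGMA x:Z. {..<m x})"
 have Sc: "countable S" unfolding S_def by (intro countable_SIGMA Zc) auto
 define I where "I = to_nat_on S ` S"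
 have bij: "bij_betw (to_nat_on S) S I" unfolding I_def using inj_on_to_nat_on[OF Sc] by (rule inj_on_imp_bij_betw)
 define x where "x i = fst (inv_into S (to_nat_on S) i)" for i
 have "distr (count_space I) borel x = distr (distr (count_space S) (count_space I) (to_nat_on S)) borel x" by (simp only: distr_bij_count_space[OF bij])
 also have "... = distr (count_space S) borel (x \<circ> to_nat_on S)" by (rule distr_distr) (auto simp: I_def)
 also have "... = distr (count_space S) borel fst" using inj_on_to_nat_on[OF Sc] by (intro distr_cong) (auto simp: x_def)
 also have "... = W"
 proof (rule measure_eqI)
  show "sets (distr (count_space S) borel fst) = sets W" using p(1) by simp
  fix A assume "A : sets (distr (count_space S) borel fst)"
  then have A: "A : sets borel" by simp
  have "emeasure (distr (count_space S) borel fst) A = emeasure (count_space S) (fst -` A Int S)" using A by (subst emeasure_distr) auto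
  also have "fst -` A Int S = (UN x:Z Int A. {x} \<times> {..<m x})" by (auto simp: S_def)
  also have "emeasure (count_space S) ... = (\<integral>\<^sup>+x. emeasure (count_space S) ({x} \<times> {..<m x}) \<partial>count_space (Z Int A))"
   by (rule emeasure_UN_countable) (auto simp: S_def disjoint_family_on_def intro: countable_subset[OF _ Zc])
  also have "... = (\<integral>\<^sup>+x. emeasure W {x} \<partial>count_space (Z Int A))"
  proof (rule nn_integral_cong)
   fix y assume "y : space (count_space (Z Int A))"
   then have "{y} \<times> {..<m y} <= S" by (auto simp: S_def)
   then show "emeasure (count_space S) ({y} \<times> {..<m y}) = emeasure W {y}" by (subst emeasure_count_space_finite) (auto simp: m card_cartesian_product)
  qed
  also have "... = emeasure W (Z Int A)" using p(1) by (intro emeasure_countable_singleton[symmetric] countable_subset[OF _ Zc]) auto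
  also have "... = emeasure W A"
  proof (rule emeasure_eq_AE)
   have "- Z : null_sets W" using Z0 Zb[of Z] p(1) by (auto simp: null_sets_def)
   from AE_not_in[OF this] show "AE x in W. x : Z Int A \<longleftrightarrow> x : A" by eventually_elim auto
  qed (use A Zb[of "Z Int A"] p(1) in auto)
  finally show "emeasure (distr (count_space S) borel fst) A = emeasure W A" .
 qed
 finally show ?thesis by metis
qed

text \<open>\<open>ffact_count n k A\<close> is the value of the \<open>k\<close>th factorial power at \<open>A 0 \<times> ... \<times> A (k-1)\<close> of a
 counting measure \<open>n\<close>: a new point in \<open>A k\<close> must avoid the \<open>k\<close> points chosen before.\<close>

fun ffact_count :: "('a set => real) => nat => (nat => 'a set) => real" where
 "ffact_count n 0 A = 1"
| "ffact_count n (Suc k) A = ffact_count n k A*n (A k) - (SUM j<k. ffact_count n k (A(j := A j Int A k)))"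

lemma ffact_count_cong:
 assumes "!!B. B : F ==> n B = n' B" "!!B C. B : F ==> C : F ==> B Int C : F"
  and "!!j. j < k ==> A j : F" "!!j. j < k ==> A j = A' j"
 shows "ffact_count n k A = ffact_count n' k A'" using assms(3,4)
proof (induction k arbitrary: A A')
 case (Suc k)
 have "ffact_count n k A = ffact_count n' k A'" using Suc by (intro Suc.IH) auto
 moreover have "n (A k) = n' (A' k)" using Suc assms(1) by auto
 moreover have "ffact_count n k (A(j := A j Int A k)) = ffact_count n' k (A'(j := A' j Int A' k))" if "j < k" for j
  using that Suc.prems by (intro Suc.IH) (auto intro: assms(2))
 ultimately show ?case by simp
qed simp

lemma ffact_count_cong_sets:
 "(!!j. j < k ==> A j = A' j) ==> ffact_count n k A = ffact_count n k A'" by (rule ffact_count_cong[of UNIV]) auto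

lemma ffact_count_empty:
 assumes "n {} = 0" "j < k" "A j = {}"
 shows "ffact_count n k A = 0" using assms(2,3)
proof (induction k arbitrary: A j)
 case (Suc k)
 have 1: "ffact_count n k (A(i := A i Int A k)) = 0" if "i < k" for i
 proof (cases "j = k")
  case True
  then show ?thesis using that Suc.prems by (intro Suc.IH[of i]) auto
 next
  case False
  then show ?thesis using that Suc.prems by (intro Suc.IH[of j]) auto
 qed
 have "ffact_count n k A*n (A k) = 0"
 proof (cases "j = k")
  case True
  then show ?thesis using Suc.prems assms(1) by simp
 next
  case False
  then have "ffact_count n k A = 0" using Suc.prems by (intro Suc.IH[of j]) auto
  then show ?thesis by simp
 qed
 with 1 show ?case by simp
qed simp

lemma sum_add_lessThan:
 fixes f :: "nat => 'b::comm_monoid_add"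
 shows "(SUM j<k + l. f j) = (SUM j<k. f j) + (SUM j<l. f (k + j))" by (induction l) (simp_all add: add.assoc)

text \<open>A correction term that intersects a set of the first block with one of the second
  contains an empty set and vanishes, so the recursion for the second block runs independently of
  the first.\<close>

lemma ffact_count_append:
 assumes "n {} = 0" "!!i j. i < k ==> j < l ==> A i Int A (k + j) = {}"
 shows "ffact_count n (k + l) A = ffact_count n k A*ffact_count n l (%j. A (k + j))" using assms(2)
proof (induction l arbitrary: A)
 case (Suc l)
 let ?u = "%j. A(j := A j Int A (k + l))"
 have low: "ffact_count n (k + l) (?u j) = 0" if "j < k" for j using that Suc.prems[of j l] by (intro ffact_count_empty[where j=j] assms(1)) auto
 have high: "ffact_count n (k + l) (?u (k + j)) = ffact_count n k A*ffact_count n l ((%j. A (k + j))(j := A (k + j) Int A (k + l)))"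
  if "j < l" for j
 proof -
  have "ffact_count n (k + l) (?u (k + j)) = ffact_count n k (?u (k + j))*ffact_count n l (%i. ?u (k + j) (k + i))"
  proof (rule Suc.IH)
   fix i i' assume "i < k" "i' < l"
   then show "?u (k + j) i Int ?u (k + j) (k + i') = {}" using Suc.prems[of i i'] by auto
  qed
  also have "ffact_count n k (?u (k + j)) = ffact_count n k A" by (rule ffact_count_cong_sets) auto
  also have "(%i. ?u (k + j) (k + i)) = (%j. A (k + j))(j := A (k + j) Int A (k + l))" by auto
  finally show ?thesis .
 qed
 have "(SUM j<k + l. ffact_count n (k + l) (?u j)) = (SUM j<k. ffact_count n (k + l) (?u j)) + (SUM j<l. ffact_count n (k + l) (?u (k + j)))"
  by (rule sum_add_lessThan)
 also have "... = ffact_count n k A*(SUM j<l. ffact_count n l ((%j. A (k + j))(j := A (k + j) Int A (k + l))))" by (simp add: low high sum_distrib_left)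
 finally have s: "(SUM j<k + l. ffact_count n (k + l) (?u j)) = ffact_count n k A*(SUM j<l. ffact_count n l ((%j. A (k + j))(j := A (k + j) Int A (k + l))))" .
 have "ffact_count n (k + l) A = ffact_count n k A*ffact_count n l (%j. A (k + j))" using Suc.prems by (intro Suc.IH) auto
 then show ?case using s by (simp add: algebra_simps)
qed simp

lemma card_inj_tuples:
 fixes x :: "'i => 'a"
 assumes J: "finite J"
 defines "T k A \<equiv> {i : {..<k} \<rightarrow>\<^sub>E J. inj_on i {..<k} & (ALL j<k. x (i j) : A j)}"
 defines "n B \<equiv> real (card {i : J. x i : B})"
 shows "real (card (T k A)) = ffact_count n k A"
proof (induction k arbitrary: A)
 case 0
 have "T 0 A = {%_. undefined}" by (auto simp: T_def)
 then show ?case by simp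
next
 case (Suc k)
 have fin: "finite (T k A)" for k A unfolding T_def by (rule finite_subset[OF _ finite_PiE[of "{..<k}" "%_. J"]]) (use J in auto)
 define N where "N = {v : J. x v : A k}"
 have finN: "finite N" using J by (simp add: N_def)
 let ?S = "SIGMA i:T k A. N - i ` {..<k}"
 let ?f = "%(i, v). i(k := v)"
 have "bij_betw ?f ?S (T (Suc k) A)"
 proof (rule bij_betwI[where g="%i. (restrict i {..<k}, i k)"])
  show "?f : ?S \<rightarrow> T (Suc k) A"
  proof (rule Pi_I, clarify)
   fix i v assume i: "i : T k A" and v: "v : N" "v ~: i ` {..<k}"
   have "i(k := v) : {..<Suc k} \<rightarrow>\<^sub>E J" using i v by (auto simp: T_def N_def PiE_iff extensional_def less_Suc_eq)
   moreover have "inj_on (i(k := v)) {..<Suc k}" using i v by (auto simp: T_def lessThan_Suc inj_on_fun_updI)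
   ultimately show "i(k := v) : T (Suc k) A" using i v by (auto simp: T_def N_def less_Suc_eq)
  qed
  show "(%i. (restrict i {..<k}, i k)) : T (Suc k) A \<rightarrow> ?S"
  proof (rule Pi_I)
   fix i assume i: "i : T (Suc k) A"
   then have "restrict i {..<k} : T k A" by (auto simp: T_def PiE_iff inj_on_def)
   moreover have "i k : N" using i by (auto simp: T_def N_def PiE_iff)
   moreover have "i k ~= i j" if "j < k" for j
   proof
    assume "i k = i j"
    moreover have "inj_on i {..<Suc k}" using i by (simp add: T_def)
    ultimately have "k = j" using that by (intro inj_onD[of i "{..<Suc k}" k j]) auto
    then show False using that by simp
   qed
   then have "i k ~: restrict i {..<k} ` {..<k}" by auto
   ultimately show "(restrict i {..<k}, i k) : ?S" by simp
  qed
  show "(restrict (?f p) {..<k}, ?f p k) = p" if "p : ?S" for p using that by (auto simp: T_def PiE_iff extensional_def restrict_def)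
  show "?f (restrict i {..<k}, i k) = i" if "i : T (Suc k) A" for i using that by (auto simp: T_def PiE_iff extensional_def restrict_def less_Suc_eq fun_eq_iff)
 qed
 then have "card (T (Suc k) A) = card ?S" by (simp add: bij_betw_same_card)
 also have "... = (SUM i:T k A. card (N - i ` {..<k}))" using fin finN by (intro card_SigmaI) auto
 finally have "real (card (T (Suc k) A)) = (SUM i:T k A. real (card (N - i ` {..<k})))" by simp
 also have "... = (SUM i:T k A. n (A k) - (SUM j<k. ind (A k) (x (i j))))"
 proof (rule sum.cong[OF refl])
  fix i assume i: "i : T k A"
  have "N Int i ` {..<k} = i ` {j:{..<k}. x (i j) : A k}" using i by (auto simp: N_def T_def PiE_iff)
  moreover have "card (i ` {j:{..<k}. x (i j) : A k}) = card {j:{..<k}. x (i j) : A k}" using i by (intro card_image) (auto simp: T_def inj_on_def)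
  ultimately have c: "card (N Int i ` {..<k}) = card {j:{..<k}. x (i j) : A k}" by simp
  have "card (N - i ` {..<k}) + card (N Int i ` {..<k}) = card N"
   using card_Diff_subset_Int[of N "i ` {..<k}"] card_mono[OF finN, of "N Int i ` {..<k}"] by auto
  then have "real (card (N - i ` {..<k})) = real (card N) - real (card {j:{..<k}. x (i j) : A k})" unfolding c by linarith
  also have "real (card {j:{..<k}. x (i j) : A k}) = (SUM j<k. ind (A k) (x (i j)))" by (simp add: indicator_def sum.If_cases Int_def)
  finally show "real (card (N - i ` {..<k})) = n (A k) - (SUM j<k. ind (A k) (x (i j)))" by (simp add: n_def N_def)
 qed
 also have "... = real (card (T k A))*n (A k) - (SUM i:T k A. SUM j<k. ind (A k) (x (i j)))" by (simp add: sum_subtractf)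
 also have "(SUM i:T k A. SUM j<k. ind (A k) (x (i j)) :: real) = (SUM j<k. SUM i:T k A. ind (A k) (x (i j)))" by (rule sum.swap)
 also have "... = (SUM j<k. real (card (T k (A(j := A j Int A k)))))"
 proof (rule sum.cong[OF refl])
  fix j assume "j : {..<k}"
  then have "T k (A(j := A j Int A k)) = {i : T k A. x (i j) : A k}" by (auto simp: T_def)
  then show "(SUM i:T k A. ind (A k) (x (i j))) = real (card (T k (A(j := A j Int A k))))" using fin by (simp add: indicator_def sum.If_cases Int_def)
 qed
 finally show ?case by (simp add: Suc.IH del: fun_upd_apply)
qed

text \<open>Links the abstract \<open>factorial_power\<close> to the recursion. Only the finitely
  many indices \<open>J\<close> of points in the union of the sets \<open>A j\<close> matter, so the
  counting reduces to \<open>card_inj_tuples\<close>.\<close>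

lemma
 fixes W :: "'a::euclidean_space measure"
 assumes w: "W : PM" and A: "!!j. j < k ==> A j : sets borel" "!!j. j < k ==> bounded (A j)"
 shows emeasure_factorial_power: "emeasure (factorial_power k W) (PiE {..<k} A) = ennreal (ffact_count (measure W) k A)"
  and ffact_count_nonneg: "0 <= ffact_count (measure W) k A"
proof -
 note p = point_measuresD[OF w]
 obtain I x where e: "enumeration W = (I, x)" by force
 have "EX Ix. case Ix of (I, x) => W = distr (count_space (I :: nat set)) borel x" using enumeration_exists[OF w] by auto
 then have "case enumeration W of (I, x) => W = distr (count_space I) borel x" unfolding enumeration_def by (rule someI_ex)
 then have eq: "W = distr (count_space I) borel x" by (simp add: e)
 define B where "B = (UN j<k. A j)"
 have B: "B : sets borel" "bounded B" using A by (auto simp: B_def)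
 define J where "J = {i : I. x i : B}"
 have em: "emeasure W C = emeasure (count_space I) {i : I. x i : C}" if "C : sets borel" for C
  by (subst eq, subst emeasure_distr) (use that in \<open>auto intro!: arg_cong[of _ _ "emeasure _"]\<close>)
 have J: "finite J"
 proof (rule ccontr)
  assume "~ finite J"
  then have "emeasure W B = \<infinity>" using em[OF B(1)] by (simp add: J_def)
  then show False using p(3)[OF B] by simp
 qed
 have cnt: "measure W C = real (card {i : J. x i : C})" if C: "C : sets borel" "C <= B" for C
 proof -
  have fC: "emeasure (count_space I) {i : J. x i : C} = of_nat (card {i : J. x i : C})"
  proof (rule emeasure_count_space_finite)
   show "{i : J. x i : C} <= I" by (auto simp: J_def)
   show "finite {i : J. x i : C}" using J by simp
  qed
  have "{i : I. x i : C} = {i : J. x i : C}" using C by (auto simp: J_def)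
  then have "emeasure W C = ennreal (real (card {i : J. x i : C}))" using em[OF C(1)] fC by (simp add: ennreal_of_nat_eq_real_of_nat)
  then show ?thesis by (simp add: measure_def)
 qed
 let ?T = "{i : {..<k} \<rightarrow>\<^sub>E I. inj_on i {..<k}}"
 let ?S = "{i : {..<k} \<rightarrow>\<^sub>E J. inj_on i {..<k} & (ALL j<k. x (i j) : A j)}"
 have finS: "finite ?S" by (rule finite_subset[OF _ finite_PiE[of "{..<k}" "%_. J"]]) (use J in auto)
 have card: "real (card ?S) = ffact_count (measure W) k A"
 proof -
  have "real (card ?S) = ffact_count (%B. real (card {i : J. x i : B})) k A" by (rule card_inj_tuples[OF J])
  also have "... = ffact_count (measure W) k A"
   by (rule ffact_count_cong[of "{C. C : sets borel & C <= B}"]) (use A in \<open>auto simp: cnt B_def\<close>)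
  finally show ?thesis .
 qed
 then show "0 <= ffact_count (measure W) k A" by linarith
 have "emeasure (factorial_power k W) (PiE {..<k} A)
  = emeasure (count_space ?T) ((%i. \<lambda>j\<in>{..<k}. x (i j)) -` (PiE {..<k} A) Int space (count_space ?T))" unfolding factorial_power_def e prod.case
  by (rule emeasure_distr) (use A in \<open>auto intro!: sets_PiM_I_finite simp: space_PiM\<close>)
 also have "(%i. \<lambda>j\<in>{..<k}. x (i j)) -` (PiE {..<k} A) Int space (count_space ?T) = ?S" by (auto simp: PiE_iff J_def B_def; blast)
 also have "emeasure (count_space ?T) ?S = of_nat (card ?S)" by (rule emeasure_count_space_finite) (use finS in \<open>auto simp: J_def PiE_iff\<close>)
 also have "... = ennreal (real (card ?S))" by (simp add: ennreal_of_nat_eq_real_of_nat)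
 finally show "emeasure (factorial_power k W) (PiE {..<k} A) = ennreal (ffact_count (measure W) k A)" unfolding card .
qed

lemma lborel_product_sigma_finite: "product_sigma_finite (%_::nat. lborel :: 'a::euclidean_space measure)" by standard

lemma PiM_lborel_reindex:
 "distr (\<Pi>\<^sub>M j\<in>{k..<k + l::nat}. lborel) (\<Pi>\<^sub>M j\<in>{..<l}. lborel) (%x. \<lambda>j\<in>{..<l}. x (k + j))
  = (\<Pi>\<^sub>M j\<in>{..<l}. lborel :: 'a::euclidean_space measure)"
proof -
 interpret product_sigma_finite "%_::nat. lborel :: 'a measure" by (rule lborel_product_sigma_finite)
 let ?f = "%x::nat => 'a. \<lambda>j\<in>{..<l}. x (k + j)"
 show ?thesis
 proof (rule PiM_eqI)
  fix A :: "nat => 'a set" assume A: "!!j. j : {..<l} ==> A j : sets lborel"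
  have m: "?f : (\<Pi>\<^sub>M j\<in>{k..<k + l}. lborel) \<rightarrow>\<^sub>M (\<Pi>\<^sub>M j\<in>{..<l}. lborel)"
   by (rule measurable_restrict) (auto intro!: measurable_component_singleton)
  have "emeasure (distr (\<Pi>\<^sub>M j\<in>{k..<k + l}. lborel) (\<Pi>\<^sub>M j\<in>{..<l}. lborel) ?f) (PiE {..<l} A)
   = emeasure (\<Pi>\<^sub>M j\<in>{k..<k + l}. lborel) (?f -` PiE {..<l} A Int space (\<Pi>\<^sub>M j\<in>{k..<k + l}. lborel))"
   using A by (intro emeasure_distr m sets_PiM_I_finite) auto
  also have "?f -` PiE {..<l} A Int space (\<Pi>\<^sub>M j\<in>{k..<k + l}. lborel) = PiE {k..<k + l} (%j. A (j - k))"
  proof (rule Set.set_eqI, rule iffI)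
   fix x assume "x : ?f -` PiE {..<l} A Int space (\<Pi>\<^sub>M j\<in>{k..<k + l}. lborel)"
   then have x: "!!j. j < l ==> x (k + j) : A j" "x : extensional {k..<k + l}" by (auto simp: space_PiM PiE_iff)
   have "x i : A (i - k)" if "i : {k..<k + l}" for i using x(1)[of "i - k"] that by auto
   with x(2) show "x : PiE {k..<k + l} (%j. A (j - k))" by (auto simp: PiE_iff)
  next
   fix x assume x: "x : PiE {k..<k + l} (%j. A (j - k))"
   have "x (k + i) : A i" if "i < l" for i using PiE_mem[OF x, of "k + i"] that by auto
   with x show "x : ?f -` PiE {..<l} A Int space (\<Pi>\<^sub>M j\<in>{k..<k + l}. lborel)" by (auto simp: space_PiM PiE_iff)
  qed
  also have "emeasure (\<Pi>\<^sub>M j\<in>{k..<k + l}. lborel) ... = (PROD j:{k..<k + l}. emeasure lborel (A (j - k)))" using A by (intro emeasure_PiM) auto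
  also have "... = (PROD j:{..<l}. emeasure lborel (A j))" by (rule prod.reindex_bij_witness[of _ "%j. j + k" "%j. j - k"]) auto
  finally show "emeasure (distr (\<Pi>\<^sub>M j\<in>{k..<k + l}. lborel) (\<Pi>\<^sub>M j\<in>{..<l}. lborel) ?f) (PiE {..<l} A) = (PROD j:{..<l}. emeasure lborel (A j))" .
 qed auto
qed

lemma emeasure_lborel_vimage_plus:
 "A : sets borel ==> emeasure lborel ((+) (v::'a::euclidean_space) -` A) = emeasure lborel A"
 by (subst (2) lborel_distr_plus[of v, symmetric]) (simp add: emeasure_distr)

lemma PiM_lborel_translate:
 "distr (LL k) (LL k) (%x. \<lambda>j\<in>{..<k}. v + x j)
  = (\<Pi>\<^sub>M j\<in>{..<k::nat}. lborel :: 'a::euclidean_space measure)"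
proof -
 interpret product_sigma_finite "%_::nat. lborel :: 'a measure" by (rule lborel_product_sigma_finite)
 let ?f = "%x::nat => 'a. \<lambda>j\<in>{..<k}. v + x j"
 show ?thesis
 proof (rule PiM_eqI)
  fix A :: "nat => 'a set" assume A: "!!j. j : {..<k} ==> A j : sets lborel"
  have m: "?f : (LL k) \<rightarrow>\<^sub>M (LL k)" by measurable
  have "emeasure (distr (LL k) (LL k) ?f) (PiE {..<k} A)
   = emeasure (LL k) (?f -` PiE {..<k} A Int space (LL k))"
   using A by (intro emeasure_distr m sets_PiM_I_finite) auto
  also have "?f -` PiE {..<k} A Int space (LL k) = PiE {..<k} (%j. (+) v -` A j)" by (auto simp: space_PiM PiE_iff)
  also have "emeasure (LL k) ... = (PROD j:{..<k}. emeasure lborel ((+) v -` A j))"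
  proof (intro emeasure_PiM)
   fix i assume "i : {..<k}"
   then show "(+) v -` A i : sets lborel" using A measurable_sets[of "(+) v" borel borel "A i"] by auto
  qed simp
  also have "... = (PROD j:{..<k}. emeasure lborel (A j))" using A by (intro prod.cong emeasure_lborel_vimage_plus) auto
  finally show "emeasure (distr (LL k) (LL k) ?f) (PiE {..<k} A) = (PROD j:{..<k}. emeasure lborel (A j))" .
 qed auto
qed

section \<open>Determinantal moments\<close>

text \<open>The properties of K, the Fourier transform of phi, on which the rest of the argument
  rests; \<open>det_kernel_fourier\<close> verifies them. The mass bound \<open>K_L2_le\<close> is
  the place where phi <= 1 enters.\<close>

locale det_kernel =
 fixes K :: "'a::euclidean_space => complex"
 assumes K_cont: "continuous_on UNIV K" and K_0: "K 0 = 1" and K_le_1: "!!x. cmod (K x) <= 1"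
  and K_cnj: "!!x. K (- x) = cnj (K x)"
  and K_L2: "integrable lborel (%x. (cmod (K x))^2)" and K_L2_le: "(LBINT x. (cmod (K x))^2) <= 1"
begin

abbreviation "k2 x \<equiv> (cmod (K x))^2"

sublocale pair_kernel k2
proof
 show "continuous_on UNIV k2" by (intro continuous_intros K_cont)
qed (use K_0 K_le_1 K_cnj K_L2 K_L2_le in \<open>auto simp: power_le_one\<close>)

lemma K_measurable [measurable]: "K : BM borel" by (rule borel_measurable_continuous_onI[OF K_cont])

definition kmat where "kmat n x = Matrix.mat n n (%(i, j). K (x i - x j))"
definition dt where "dt n x = Determinant.det (kmat n x)"
definition R where "R n x = Re (dt n x)"

lemma dt_leibniz: "dt n x = (SUM p | p permutes {0..<n}. of_int (sign p)*(PROD i=0..<n. K (x i - x (p i))))"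
proof -
 have "dt n x = (SUM p | p permutes {0..<n}. of_int (sign p)*(PROD i=0..<n. kmat n x $$ (i, p i)))"
  unfolding dt_def by (rule Determinant.det_def') (simp add: kmat_def)
 also have "... = (SUM p | p permutes {0..<n}. of_int (sign p)*(PROD i=0..<n. K (x i - x (p i))))"
 proof (intro sum.cong refl arg_cong2[of _ _ _ _ "(*)"] prod.cong)
  fix p i assume "p : {p. p permutes {0..<n}}" "i : {0..<n}"
  then show "kmat n x $$ (i, p i) = K (x i - x (p i))" using permutes_in_image[of p "{0..<n}" i] by (auto simp: kmat_def)
 qed
 finally show ?thesis .
qed

lemma dt_cong: assumes "!!i. i < n ==> x i = y i" shows "dt n x = dt n y"
proof -
 have "kmat n x = kmat n y" unfolding kmat_def by (rule cong_mat) (use assms in auto)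
 then show ?thesis by (simp add: dt_def)
qed

lemma R_cong: "(!!i. i < n ==> x i = y i) ==> R n x = R n y" unfolding R_def using dt_cong[of n x y] by simp

lemma dt_cnj: "cnj (dt n x) = dt n x"
proof -
 let ?T = "Matrix.mat n n (%(i, j). K (x j - x i))"
 have "cnj (dt n x) = (SUM p | p permutes {0..<n}. of_int (sign p)*(PROD i=0..<n. K (x (p i) - x i)))" unfolding dt_leibniz by (simp add: K_cnj[symmetric])
 also have "... = (SUM p | p permutes {0..<n}. of_int (sign p)*(PROD i=0..<n. ?T $$ (i, p i)))"
 proof (intro sum.cong refl arg_cong2[of _ _ _ _ "(*)"] prod.cong)
  fix p i assume "p : {p. p permutes {0..<n}}" "i : {0..<n}"
  then show "K (x (p i) - x i) = ?T $$ (i, p i)" using permutes_in_image[of p "{0..<n}" i] by auto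
 qed
 also have "... = Determinant.det ?T" by (rule Determinant.det_def'[symmetric]) simp
 also have "?T = (kmat n x)\<^sup>T" by (rule eq_matI) (auto simp: kmat_def)
 also have "Determinant.det ... = dt n x" unfolding dt_def by (rule det_transpose[of _ n]) (simp add: kmat_def)
 finally show ?thesis .
qed

lemma dt_R: "dt n x = cr (R n x)" using dt_cnj[of n x] by (simp add: R_def complex_eq_iff)

lemma perm_count: "card {p. p permutes {0..<n}} = fact n" by (subst card_permutations[of "{0..<n}" n]) auto

lemma prod_K_le_1: "cmod (PROD i:I. K (f i)) <= 1" unfolding prod_norm[symmetric] by (intro prod_le_1) (auto simp: K_le_1)

lemma cmod_sign: "cmod (of_int (sign p)) = 1" by (cases "evenperm p") (auto simp: sign_def)

lemma abs_sign: "\<bar>real_of_int (sign p)\<bar> = 1" by (cases "evenperm p") (auto simp: sign_def)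

lemma dt_bound: "cmod (dt n x) <= fact n"
proof -
 have "cmod (dt n x) <= (SUM p | p permutes {0..<n}. 1)" unfolding dt_leibniz by (rule sum_norm_le) (simp add: norm_mult cmod_sign abs_sign prod_K_le_1)
 then show ?thesis by (simp add: perm_count)
qed

lemma R_bound: "\<bar>R n x\<bar> <= fact n" using dt_bound[of n x] by (simp add: dt_R)

lemma dt_measurable: "dt n : BM (\<Pi>\<^sub>M j\<in>{..<n}. lborel)"
proof -
 have m: "(%x. K (x i - x (p i))) : BM (\<Pi>\<^sub>M j\<in>{..<n}. lborel)"
  if "p permutes {0..<n}" "i : {0..<n}" for p i
 proof -
  have "p i : {..<n}" "i : {..<n}" using that permutes_in_image[of p "{0..<n}" i] by auto
  then have "(%x. x i) : (\<Pi>\<^sub>M j\<in>{..<n}. lborel) \<rightarrow>\<^sub>M borel" "(%x. x (p i)) : (\<Pi>\<^sub>M j\<in>{..<n}. lborel) \<rightarrow>\<^sub>M (borel :: 'a measure)"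
   using measurable_component_singleton[of _ "{..<n}" "%_. lborel :: 'a measure"] by auto
  then show ?thesis by measurable
 qed
 show ?thesis unfolding dt_leibniz[abs_def] by (intro borel_measurable_sum borel_measurable_times borel_measurable_prod borel_measurable_const m) auto
qed

lemma R_measurable [measurable]: "R n : BM (\<Pi>\<^sub>M j\<in>{..<n}. lborel)" unfolding R_def[abs_def] using dt_measurable by measurable

text \<open>Permutations that do not preserve the two blocks contribute at least two factors
 \<open>K (a - b)\<close> with \<open>a\<close> and \<open>b\<close> in different blocks.\<close>

lemma dt_block:
 "cmod (dt (k + l) x - dt k x*dt l (%j. x (k + j))) <= fact (k + l)*(SUM i<k. SUM j<l. k2 (x i - x (k + j)))"
proof -
 let ?n = "k + l"
 define S where "S = (SUM i<k. SUM j<l. k2 (x i - x (k + j)))"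
 \<comment> \<open>The block-diagonal truncation of the matrix. Its determinant is the product of
   the two smaller ones, and in its Leibniz expansion the terms of permutations mixing the blocks
   are 0 while all others are unchanged.\<close>
 define B where "B = (%i j. if (i < k) = (j < k) then K (x i - x j) else 0)"
 let ?B = "Matrix.mat ?n ?n (%(i, j). B i j)"
 have "?B = four_block_mat (kmat k x) (0\<^sub>m k l) (0\<^sub>m l k) (kmat l (%j. x (k + j)))" by (rule eq_matI) (auto simp: B_def kmat_def)
 then have "Determinant.det ?B = dt k x*dt l (%j. x (k + j))" unfolding dt_def by (simp, subst det_four_block_mat_lower_left_zero) (auto simp: kmat_def)
 moreover have "Determinant.det ?B = (SUM p | p permutes {0..<?n}. of_int (sign p)*(PROD i=0..<?n. ?B $$ (i, p i)))" by (rule Determinant.det_def') simp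
 moreover have "... = (SUM p | p permutes {0..<?n}. of_int (sign p)*(PROD i=0..<?n. B i (p i)))"
 proof (intro sum.cong refl arg_cong2[of _ _ _ _ "(*)"] prod.cong)
  fix p i assume "p : {p. p permutes {0..<?n}}" "i : {0..<?n}"
  then show "?B $$ (i, p i) = B i (p i)" using permutes_in_image[of p "{0..<?n}" i] by auto
 qed
 ultimately have eq: "dt ?n x - dt k x*dt l (%j. x (k + j)) =
  (SUM p | p permutes {0..<?n}. of_int (sign p)*((PROD i=0..<?n. K (x i - x (p i))) - (PROD i=0..<?n. B i (p i))))"
  unfolding dt_leibniz[of ?n] by (simp add: sum_subtractf right_diff_distrib)
 have "cmod (dt ?n x - dt k x*dt l (%j. x (k + j))) <= (SUM p | p permutes {0..<?n}. S)" unfolding eq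
 proof (rule sum_norm_le)
  fix p assume "p : {p. p permutes {0..<?n}}"
  then have p: "p permutes {0..<?n}" by simp
  have S_ge: "k2 (x i - x j) <= S" if "i < k" "k <= j" "j < ?n" for i j
  proof -
   have "k2 (x i - x (k + (j - k))) <= (SUM j<l. k2 (x i - x (k + j)))" by (rule member_le_sum[of "j - k" "{..<l}" "%j. k2 (x i - x (k + j))"]) (use that in auto)
   also have "... <= S" unfolding S_def
    by (rule member_le_sum[of i "{..<k}" "%i. SUM j<l. k2 (x i - x (k + j))"]) (use that in \<open>auto intro: sum_nonneg\<close>)
   finally show ?thesis using that by simp
  qed
  have S0: "S >= 0" unfolding S_def by (intro sum_nonneg) auto
  have "cmod ((PROD i=0..<?n. K (x i - x (p i))) - (PROD i=0..<?n. B i (p i))) <= S"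
  proof (cases "ALL i<?n. (i < k) = (p i < k)")
   case True
   then have "(PROD i=0..<?n. B i (p i)) = (PROD i=0..<?n. K (x i - x (p i)))" by (intro prod.cong) (auto simp: B_def)
   then show ?thesis using S0 by simp
  next
   case False
   then obtain i0 where i0: "i0 < ?n" "(i0 < k) ~= (p i0 < k)" by blast
   have pn: "p i < ?n \<longleftrightarrow> i < ?n" for i using permutes_in_image[OF p, of i] by simp
   have B0: "(PROD i=0..<?n. B i (p i)) = 0" using i0 by (intro prod_zero) (auto simp: B_def intro!: bexI[of _ i0])
   \<comment> \<open>If no index left the first block, \<open>p\<close> would permute it and hence
     also the second, contradicting \<open>i0\<close>. By counting, some index also crosses in the
     opposite direction (\<open>ex2\<close>), which yields the second factor.\<close>
   have ex1: "EX i<k. k <= p i"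
   proof (rule ccontr)
    assume "~ ?thesis"
    then have a: "p ` {..<k} <= {..<k}" by auto
    have inj: "inj p" using permutes_inj[OF p] .
    have "p ` {..<k} = {..<k}" by (rule card_subset_eq[OF _ a]) (auto simp: card_image inj_on_subset[OF inj])
    have "i < k" if "p i < k" for i
    proof -
     have "p i : p ` {..<k}" using that by (simp add: \<open>p ` {..<k} = {..<k}\<close>)
     then show ?thesis using inj by (simp add: inj_image_mem_iff)
    qed
    then show False using i0 a by auto
   qed
   then obtain i where i: "i < k" "k <= p i" by blast
   have ex2: "EX j. k <= j & j < ?n & p j < k"
   proof (rule ccontr)
    assume "~ ?thesis"
    then have a: "p ` {k..<?n} <= {k..<?n}" using pn by force
    have inj: "inj p" using permutes_inj[OF p] .
    have "p ` {k..<?n} = {k..<?n}" by (rule card_subset_eq[OF _ a]) (auto simp: card_image inj_on_subset[OF inj])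
    moreover have "p i : {k..<?n}" using i pn[of i] by auto
    ultimately have "i : {k..<?n}" using inj by (metis inj_image_mem_iff)
    then show False using i by simp
   qed
   then obtain j where j: "k <= j" "j < ?n" "p j < k" by blast
   have ij: "i ~= j" using i j by auto
   have "(PROD i=0..<?n. K (x i - x (p i))) = K (x i - x (p i))*(PROD i:{0..<?n} - {i}. K (x i - x (p i)))" by (rule prod.remove) (use i in auto)
   also have "(PROD i:{0..<?n} - {i}. K (x i - x (p i))) = K (x j - x (p j))*(PROD i:{0..<?n} - {i} - {j}. K (x i - x (p i)))"
    by (rule prod.remove) (use j ij in auto)
   finally have "cmod (PROD i=0..<?n. K (x i - x (p i))) = cmod (K (x i - x (p i)))*cmod (K (x j - x (p j)))*cmod (PROD i:{0..<?n} - {i} - {j}. K (x i - x (p i)))"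
    by (simp add: norm_mult mult.assoc)
   also have "... <= cmod (K (x i - x (p i)))*cmod (K (x j - x (p j)))" by (rule mult_left_le[OF prod_K_le_1]) simp
   \<comment> \<open>The inequality ab <= (a^2 + b^2)/2 turns the product of the two crossing
     factors into single values of \<open>k2\<close>, each depending on one pair of points.\<close>
   also have "... <= (k2 (x i - x (p i)) + k2 (x j - x (p j)))/2" using zero_le_power2[of "cmod (K (x i - x (p i))) - cmod (K (x j - x (p j)))"]
    by (simp add: power2_eq_square algebra_simps)
   also have "k2 (x j - x (p j)) = k2 (x (p j) - x j)" using K_cnj[of "x j - x (p j)"] by simp
   also have "(k2 (x i - x (p i)) + k2 (x (p j) - x j))/2 <= S" using S_ge[of i "p i"] S_ge[of "p j" j] i j pn[of i] by auto
   finally show ?thesis by (simp add: B0)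
  qed
  then show "cmod (of_int (sign p)*((PROD i=0..<?n. K (x i - x (p i))) - (PROD i=0..<?n. B i (p i)))) <= S" by (simp add: norm_mult cmod_sign abs_sign)
 qed
 also have "... = fact ?n*S" by (simp add: perm_count)
 finally show ?thesis unfolding S_def .
qed

lemma R_block: "\<bar>R (k + l) x - R k x*R l (%j. x (k + j))\<bar> <= fact (k + l)*(SUM i<k. SUM j<l. k2 (x i - x (k + j)))"
proof -
 have eq: "cr (R (k + l) x - R k x*R l (%j. x (k + j))) = dt (k + l) x - dt k x*dt l (%j. x (k + j))" by (simp add: dt_R)
 show ?thesis using dt_block[of k l x] unfolding eq[symmetric] norm_of_real .
qed

end

section \<open>Moments on products of bounded Borel sets\<close>

definition bbs :: "'a::euclidean_space set set" where "bbs = {A : sets borel. bounded A}"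

lemma bbs_borel: "A : bbs ==> A : sets borel" by (simp add: bbs_def)
lemma bbs_Int: "A : bbs ==> B : bbs ==> A Int B : bbs" by (auto simp: bbs_def bounded_Int)
lemma bbs_ball [simp]: "ball x r : bbs" by (simp add: bbs_def)

lemma bbs_vimage_plus: assumes "A : bbs" shows "(+) v -` A : bbs"
proof -
 have "(+) v -` A : sets borel" using assms measurable_sets[of "(+) v" borel borel A] by (auto simp: bbs_def)
 moreover have "(+) v -` A = (%y. - v + y) ` A" by (auto simp: image_iff intro!: bexI[of _ "v + _"])
 moreover have "bounded ((%y. - v + y) ` A)" using assms by (intro bounded_translation) (auto simp: bbs_def)
 ultimately show ?thesis by (simp add: bbs_def)
qed

lemma bbs_emeasure_lborel: "A : bbs ==> emeasure lborel A = ennreal (vol A)"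
 using emeasure_bounded_finite[of A] by (intro emeasure_eq_ennreal_measure) (auto simp: bbs_def)

lemma measure_lborel_vimage_plus: "A : bbs ==> vol ((+) v -` A) = vol (A :: 'a::euclidean_space set)"
 by (simp add: measure_def emeasure_lborel_vimage_plus bbs_borel)

lemma nn_integral_lborel_translate:
 fixes f :: "'a::euclidean_space => ennreal"
 assumes [measurable]: "f : BM borel"
 shows "(NN x. f (c + x)) = (NN x. f x)" by (subst (2) lborel_distr_plus[of c, symmetric]) (simp add: nn_integral_distr)

lemma nn_integral_lborel_uminus:
 fixes f :: "'a::euclidean_space => ennreal"
 assumes [measurable]: "f : BM borel"
 shows "(NN x. f (- x)) = (NN x. f x)" by (subst (2) lborel_distr_uminus'[symmetric]) (simp add: nn_integral_distr)

context det_kernel begin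

text \<open>The value that determinantal correlation functions prescribe for the k-th factorial
  moment of the product of the sets \<open>A j\<close>; no process is involved yet.\<close>

definition m :: "nat => (nat => 'a set) => real" where
 "m k A = (LINT x|(LL k). R k x*ind (PiE {..<k} A) x)"

lemma PiE_sets: "finite I ==> (!!j. j : I ==> A j : bbs) ==> PiE I A : sets (\<Pi>\<^sub>M j\<in>I. lborel)"
 for I :: "nat set" and A :: "nat => 'a set" by (intro sets_PiM_I_finite) (auto simp: bbs_borel)

lemma PiE_emeasure:
 fixes I :: "nat set" and A :: "nat => 'a set"
 assumes "finite I" "!!j. j : I ==> A j : bbs"
 shows "emeasure (\<Pi>\<^sub>M j\<in>I. lborel) (PiE I A) = ennreal (PROD j:I. vol (A j))"
proof -
 interpret product_sigma_finite "%_::nat. lborel :: 'a measure" by (rule lborel_product_sigma_finite)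
 have "emeasure (\<Pi>\<^sub>M j\<in>I. lborel) (PiE I A) = (PROD j:I. emeasure lborel (A j))" using assms by (intro emeasure_PiM) (auto simp: bbs_borel)
 also have "... = (PROD j:I. ennreal (vol (A j)))" using assms by (intro prod.cong refl bbs_emeasure_lborel) auto
 finally show ?thesis by (simp add: prod_ennreal)
qed

lemma
 assumes A: "!!j. j < k ==> A j : bbs"
 shows m_integrable: "integrable (LL k) (%x. R k x*ind (PiE {..<k} A) x)"
  and m_abs: "\<bar>m k A\<bar> <= fact k*(PROD j<k. vol (A j))"
proof -
 let ?M = "\<Pi>\<^sub>M j\<in>{..<k}. lborel :: 'a measure"
 have S: "PiE {..<k} A : sets ?M" using A by (intro PiE_sets) auto
 have E: "emeasure ?M (PiE {..<k} A) = ennreal (PROD j<k. vol (A j))" using A by (intro PiE_emeasure) auto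
 have I: "integrable ?M (%x. fact k*ind (PiE {..<k} A) x :: real)" using S E by (intro integrable_mult_right integrable_real_indicator) auto
 have b: "norm (R k x*ind (PiE {..<k} A) x) <= fact k*ind (PiE {..<k} A) x" for x using R_bound[of k x] by (auto simp: indicator_def)
 show I2: "integrable ?M (%x. R k x*ind (PiE {..<k} A) x)"
 proof (rule integrable_bound[OF I])
  show "(%x. R k x*ind (PiE {..<k} A) x) : BM ?M" using S by (intro borel_measurable_times borel_measurable_indicator R_measurable)
  show "AE x in ?M. norm (R k x*ind (PiE {..<k} A) x) <= norm (fact k*ind (PiE {..<k} A) x :: real)"
   using b by (intro AE_I2) (simp add: indicator_def)
 qed
 have "norm (m k A) <= (LINT x|?M. norm (R k x*ind (PiE {..<k} A) x))" unfolding m_def by (rule integral_norm_bound)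
 also have "... <= (LINT x|?M. fact k*ind (PiE {..<k} A) x)" by (rule integral_mono[OF integrable_norm[OF I2] I b])
 also have "... = fact k*(PROD j<k. vol (A j))" using S E by (simp add: measure_def prod_nonneg)
 finally show "\<bar>m k A\<bar> <= fact k*(PROD j<k. vol (A j))" by simp
qed

lemma m_translate: assumes A: "!!j. j < k ==> A j : bbs" shows "m k (%j. (+) v -` A j) = m k A"
proof -
 let ?M = "\<Pi>\<^sub>M j\<in>{..<k}. lborel :: 'a measure"
 let ?f = "%x. \<lambda>j\<in>{..<k}. v + x j"
 have S: "PiE {..<k} A : sets ?M" using A by (intro PiE_sets) auto
 have f: "?f : ?M \<rightarrow>\<^sub>M ?M" by measurable
 have "m k A = (\<integral>x. R k x*ind (PiE {..<k} A) x \<partial>distr ?M ?M ?f)" unfolding m_def PiM_lborel_translate ..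
 also have "... = (LINT x|?M. R k (?f x)*ind (PiE {..<k} A) (?f x))"
  using S by (intro integral_distr f borel_measurable_times borel_measurable_indicator R_measurable)
 also have "... = m k (%j. (+) v -` A j)" unfolding m_def
 proof (intro integral_cong refl arg_cong2[of _ _ _ _ "(*)"])
  fix x assume x: "x : space ?M"
  have "kmat k (?f x) = kmat k x" unfolding kmat_def by (rule cong_mat) auto
  then show "R k (?f x) = R k x" by (simp add: R_def dt_def)
  show "ind (PiE {..<k} A) (?f x) = (ind (\<Pi>\<^sub>E j\<in>{..<k}. (+) v -` A j) x :: real)" using x by (auto simp: indicator_def space_PiM PiE_iff)
 qed
 finally show ?thesis by simp
qed

lemma m_prod:
 assumes A: "!!j. j < k + l ==> A j : bbs"
 shows "integrable (LL (k + l)) (%x. R k x*R l (%j. x (k + j))*ind (PiE {..<k + l} A) x)"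
  and "(LINT x|(LL (k + l)). R k x*R l (%j. x (k + j))*ind (PiE {..<k + l} A) x) = m k A*m l (%j. A (k + j))"
proof -
 interpret product_sigma_finite "%_::nat. lborel :: 'a measure" by (rule lborel_product_sigma_finite)
 let ?I = "{..<k}" and ?J = "{k..<k + l}"
 have un: "{..<k + l} = ?I Un ?J" by auto
 let ?M = "\<Pi>\<^sub>M j\<in>{..<k + l}. lborel :: 'a measure"
 have S: "PiE {..<k + l} A : sets ?M" using A by (intro PiE_sets) auto
 have E: "emeasure ?M (PiE {..<k + l} A) = ennreal (PROD j<k + l. vol (A j))" using A by (intro PiE_emeasure) auto
 let ?g = "%x. R k x*R l (%j. x (k + j))*ind (PiE {..<k + l} A) x"
 have r1: "(%x. R k x) : BM ?M"
 proof -
  have "(%x. R k (restrict x {..<k})) : BM ?M" by (rule measurable_compose[OF measurable_restrict_subset R_measurable]) auto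
  moreover have "R k (restrict x {..<k}) = R k x" for x by (rule R_cong) auto
  ultimately show ?thesis by simp
 qed
 have r2: "(%x. R l (%j. x (k + j))) : BM ?M"
 proof -
  have "(%x. \<lambda>j\<in>{..<l}. x (k + j)) : ?M \<rightarrow>\<^sub>M (\<Pi>\<^sub>M j\<in>{..<l}. lborel)"
   by (rule measurable_restrict) (auto intro!: measurable_component_singleton)
  from measurable_compose[OF this R_measurable]
  have "(%x. R l (\<lambda>j\<in>{..<l}. x (k + j))) : BM ?M" .
  moreover have "R l (\<lambda>j\<in>{..<l}. x (k + j)) = R l (%j. x (k + j))" for x by (rule R_cong) auto
  ultimately show ?thesis by simp
 qed
 show I: "integrable ?M ?g"
 proof (rule integrable_bound)
  show "integrable ?M (%x. fact k*fact l*ind (PiE {..<k + l} A) x :: real)" using S E by (intro integrable_mult_right integrable_real_indicator) auto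
  show "?g : BM ?M" using S r1 r2 by (intro borel_measurable_times borel_measurable_indicator)
  show "AE x in ?M. norm (?g x) <= norm (fact k*fact l*ind (PiE {..<k + l} A) x :: real)"
  proof (intro AE_I2)
   fix x
   have "\<bar>R k x\<bar>*\<bar>R l (%j. x (k + j))\<bar> <= fact k*fact l" by (intro mult_mono R_bound) simp_all
   then show "norm (?g x) <= norm (fact k*fact l*ind (PiE {..<k + l} A) x :: real)" by (simp add: indicator_def abs_mult)
  qed
 qed
 have I': "integrable (\<Pi>\<^sub>M j\<in>?I Un ?J. lborel) ?g" using I by (simp only: un[symmetric])
 have disj: "?I Int ?J = {}" by auto
 have "(LINT x|?M. ?g x) = (LINT x|(\<Pi>\<^sub>M j\<in>?I Un ?J. lborel). ?g x)" by (simp only: un[symmetric])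
 also have "... = (LINT x|(\<Pi>\<^sub>M j\<in>?I. lborel). (LINT y|(\<Pi>\<^sub>M j\<in>?J. lborel). ?g (merge ?I ?J (x, y))))"
  by (rule product_integral_fold[OF disj _ _ I']) simp_all
 also have "... = (LINT x|(\<Pi>\<^sub>M j\<in>?I. lborel). (LINT y|(\<Pi>\<^sub>M j\<in>?J. lborel). (R k x*ind (PiE ?I A) x)*(R l (%j. y (k + j))*ind (PiE ?J A) y)))"
 proof (intro integral_cong refl)
  fix x y :: "nat => 'a" assume x: "x : space (\<Pi>\<^sub>M j\<in>?I. lborel)" and y: "y : space (\<Pi>\<^sub>M j\<in>?J. lborel)"
  have "R k (merge ?I ?J (x, y)) = R k x" by (rule R_cong) (auto simp: merge_def)
  moreover have "R l (%j. merge ?I ?J (x, y) (k + j)) = R l (%j. y (k + j))" by (rule R_cong) (auto simp: merge_def)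
  moreover have "merge ?I ?J (x, y) : PiE {..<k + l} A \<longleftrightarrow> x : PiE ?I A & y : PiE ?J A"
  proof -
   have e: "x : extensional ?I" "y : extensional ?J" using x y by (auto simp: space_PiM PiE_iff)
   have "(ALL i:{..<k + l}. merge ?I ?J (x, y) i : A i) \<longleftrightarrow> (ALL i:?I. x i : A i) & (ALL i:?J. y i : A i)"
    unfolding un by (auto simp: merge_def)
   moreover have "merge ?I ?J (x, y) : extensional {..<k + l}" by (auto simp: merge_def extensional_def)
   ultimately show ?thesis using e by (auto simp: PiE_iff)
  qed
  ultimately show "?g (merge ?I ?J (x, y)) = (R k x*ind (PiE ?I A) x)*(R l (%j. y (k + j))*ind (PiE ?J A) y)" by (simp add: indicator_def)
 qed
 also have "... = m k A*(LINT y|(\<Pi>\<^sub>M j\<in>?J. lborel). R l (%j. y (k + j))*ind (PiE ?J A) y)" unfolding m_def by simp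
 also have "(LINT y|(\<Pi>\<^sub>M j\<in>?J. lborel). R l (%j. y (k + j))*ind (PiE ?J A) y) = m l (%j. A (k + j))"
 proof -
  let ?f = "%x::nat => 'a. \<lambda>j\<in>{..<l}. x (k + j)"
  have f: "?f : (\<Pi>\<^sub>M j\<in>?J. lborel) \<rightarrow>\<^sub>M (\<Pi>\<^sub>M j\<in>{..<l}. lborel)"
   by (rule measurable_restrict) (auto intro!: measurable_component_singleton)
  have S': "PiE {..<l} (%j. A (k + j)) : sets (\<Pi>\<^sub>M j\<in>{..<l}. lborel)" using A by (intro PiE_sets) auto
  have "m l (%j. A (k + j)) = (\<integral>x. R l x*ind (PiE {..<l} (%j. A (k + j))) x \<partial>distr (\<Pi>\<^sub>M j\<in>?J. lborel) (\<Pi>\<^sub>M j\<in>{..<l}. lborel) ?f)"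
   unfolding m_def PiM_lborel_reindex ..
  also have "... = (LINT x|(\<Pi>\<^sub>M j\<in>?J. lborel). R l (?f x)*ind (PiE {..<l} (%j. A (k + j))) (?f x))"
   using S' by (intro integral_distr f borel_measurable_times borel_measurable_indicator R_measurable)
  also have "... = (LINT y|(\<Pi>\<^sub>M j\<in>?J. lborel). R l (%j. y (k + j))*ind (PiE ?J A) y)"
  proof (intro integral_cong refl arg_cong2[of _ _ _ _ "(*)"])
   fix y :: "nat => 'a" assume y: "y : space (\<Pi>\<^sub>M j\<in>?J. lborel)"
   show "R l (?f y) = R l (%j. y (k + j))" by (rule R_cong) auto
   have "(ALL j<l. y (k + j) : A (k + j)) \<longleftrightarrow> (ALL i:?J. y i : A i)"
   proof
    assume a: "ALL j<l. y (k + j) : A (k + j)"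
    show "ALL i:?J. y i : A i"
    proof
     fix i assume "i : ?J" then show "y i : A i" using a[rule_format, of "i - k"] by auto
    qed
   qed auto
   then have "?f y : PiE {..<l} (%j. A (k + j)) \<longleftrightarrow> y : PiE ?J A" using y by (auto simp: space_PiM PiE_iff)
   then show "ind (PiE {..<l} (%j. A (k + j))) (?f y) = (ind (PiE ?J A) y :: real)" by (simp add: indicator_def)
  qed
  finally show ?thesis by simp
 qed
 finally show "(LINT x|?M. ?g x) = m k A*m l (%j. A (k + j))" .
qed

text \<open>Integrating coordinate \<open>i\<close> with coordinate \<open>j\<close> fixed costs
  \<open>ka\<close>; every remaining coordinate contributes at most \<open>L\<close>. Since
  \<open>L >= 1\<close>, the exponent \<open>n\<close> may stand for the number of remaining
  factors.\<close>

lemma nn_integral_pair_factor: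
 assumes A: "!!h. h < n ==> A h : bbs" and ij: "i < n" "j < n" "i ~= j"
  and L: "L >= 1" "!!h. h < n ==> vol (A h) <= L"
  and ka: "ka >= 0" "!!b. b : A j ==> (NN y. ennreal (k2 (y - b))*ind (A i) y) <= ennreal ka"
 shows "(NNI (\<Pi>\<^sub>M h\<in>{..<n}. lborel) (%x. ennreal (k2 (x i - x j))*ind (PiE {..<n} A) x)) <= ennreal (L^n*ka)"
proof -
 interpret product_sigma_finite "%_::nat. lborel :: 'a measure" by (rule lborel_product_sigma_finite)
 let ?I = "{..<n} - {i}"
 have un: "{..<n} = insert i ?I" using ij by auto
 let ?f = "%x. ennreal (k2 (x i - x j))*ind (PiE {..<n} A) x"
 have S: "PiE {..<n} A : sets (\<Pi>\<^sub>M h\<in>{..<n}. lborel)" using A by (intro PiE_sets) auto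
 have S': "PiE ?I A : sets (\<Pi>\<^sub>M h\<in>?I. lborel)" using A by (intro PiE_sets) auto
 have E': "emeasure (\<Pi>\<^sub>M h\<in>?I. lborel) (PiE ?I A) = ennreal (PROD h:?I. vol (A h))" using A by (intro PiE_emeasure) auto
 have c: "(%x. x i) : (\<Pi>\<^sub>M h\<in>{..<n}. lborel) \<rightarrow>\<^sub>M (borel :: 'a measure)" "(%x. x j) : (\<Pi>\<^sub>M h\<in>{..<n}. lborel) \<rightarrow>\<^sub>M (borel :: 'a measure)"
  using measurable_component_singleton[of _ "{..<n}" "%_. lborel :: 'a measure"] ij by auto
 have k2m: "(%z. ennreal (k2 z)) : BM borel" by measurable
 have [measurable]: "A i : sets borel" using A[OF ij(1)] by (rule bbs_borel)
 have fm: "?f : BM (\<Pi>\<^sub>M h\<in>{..<n}. lborel)"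
  using S measurable_compose[OF borel_measurable_diff[OF c] k2m] by (intro borel_measurable_times_ennreal borel_measurable_indicator)
 have "(NNI (\<Pi>\<^sub>M h\<in>{..<n}. lborel) (%x. ?f x)) = (NNI (\<Pi>\<^sub>M h\<in>?I. lborel) (%x. (NN y. ?f (x(i := y)))))"
 proof -
  have "(NNI (\<Pi>\<^sub>M h\<in>insert i ?I. lborel) (%x. ?f x)) = (NNI (\<Pi>\<^sub>M h\<in>?I. lborel) (%x. (NN y. ?f (x(i := y)))))"
   by (rule product_nn_integral_insert) (use fm in \<open>simp_all only: un[symmetric]\<close>, simp_all)
  then show ?thesis by (simp only: un[symmetric])
 qed
 also have "... <= (NNI (\<Pi>\<^sub>M h\<in>?I. lborel) (%x. ennreal ka*ind (PiE ?I A) x))"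
 proof (rule nn_integral_mono)
  fix x assume x: "x : space (\<Pi>\<^sub>M h\<in>?I. lborel :: 'a measure)"
  have iff: "x(i := y) : PiE {..<n} A \<longleftrightarrow> x : PiE ?I A & y : A i" for y
   using x ij unfolding space_PiM PiE_iff extensional_def by (auto split: if_splits)
  have "(NN y. ?f (x(i := y))) = (NN y. ind (PiE ?I A) x*(ennreal (k2 (y - x j))*ind (A i) y))"
   using ij by (intro nn_integral_cong) (simp add: iff indicator_def)
  also have "... = ind (PiE ?I A) x*(NN y. ennreal (k2 (y - x j))*ind (A i) y)" by (rule nn_integral_cmult) measurable
  also have "... <= ennreal ka*ind (PiE ?I A) x" using ka(2)[of "x j"] ij by (auto simp: indicator_def PiE_iff)
  finally show "(NN y. ?f (x(i := y))) <= ennreal ka*ind (PiE ?I A) x" .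
 qed
 also have "... = ennreal ka*ennreal (PROD h:?I. vol (A h))" using S' by (simp add: nn_integral_cmult_indicator E')
 also have "... = ennreal (ka*(PROD h:?I. vol (A h)))" using ka(1) by (simp add: ennreal_mult prod_nonneg)
 also have "... <= ennreal (L^n*ka)"
 proof (rule ennreal_leI)
  have "(PROD h:?I. vol (A h)) <= (PROD h:?I. L)" using L by (intro prod_mono) auto
  also have "... = L^card ?I" by simp
  also have "... <= L^n" using L(1) ij by (intro power_increasing) auto
  finally show "ka*(PROD h:?I. vol (A h)) <= L^n*ka" using ka(1) by (subst mult.commute) (rule mult_right_mono)
 qed
 finally show ?thesis .
qed

text \<open>\<open>R_block\<close> integrated over the product of the sets. Only \<open>ka\<close>
  becomes small when the blocks are moved apart; the other factors depend on the numbers of points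
  and on volumes.\<close>

theorem m_block:
 assumes A: "!!j. j < k + l ==> A j : bbs" and L: "L >= 1" "!!h. h < k + l ==> vol (A h) <= L"
  and ka: "ka >= 0" "!!i j b. i < k ==> j < l ==> b : A (k + j) ==> (NN y. ennreal (k2 (y - b))*ind (A i) y) <= ennreal ka"
 shows "\<bar>m (k + l) A - m k A*m l (%j. A (k + j))\<bar> <= fact (k + l)*real k*real l*L^(k + l)*ka"
proof -
 let ?M = "\<Pi>\<^sub>M j\<in>{..<k + l}. lborel :: 'a measure"
 let ?ind = "ind (PiE {..<k + l} A)"
 have S: "PiE {..<k + l} A : sets ?M" using A by (intro PiE_sets) auto
 let ?d = "%x. R (k + l) x*?ind x - R k x*R l (%j. x (k + j))*?ind x"
 have I: "integrable ?M ?d" using m_integrable[OF A] m_prod(1)[OF A] by (intro integrable_diff) auto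
 have "m (k + l) A - m k A*m l (%j. A (k + j)) = (LINT x|?M. ?d x)" using m_integrable[of "k + l" A] m_prod[of k l A] A unfolding m_def[of "k + l"]
  by (subst integral_diff) auto
 then have "ennreal \<bar>m (k + l) A - m k A*m l (%j. A (k + j))\<bar> = ennreal (norm (LINT x|?M. ?d x))" by simp
 also have "... <= (NNI ?M (%x. ennreal (norm (?d x))))" by (rule integral_norm_bound_ennreal[OF I])
 also have "... <= (NNI ?M (%x. (SUM i<k. SUM j<l. ennreal (fact (k + l))*(ennreal (k2 (x i - x (k + j)))*?ind x))))"
 proof (rule nn_integral_mono)
  fix x
  have "norm (?d x) <= fact (k + l)*(SUM i<k. SUM j<l. k2 (x i - x (k + j)))*?ind x" using R_block[of k l x] by (auto simp: indicator_def)
  then have "ennreal (norm (?d x)) <= ennreal (fact (k + l)*(SUM i<k. SUM j<l. k2 (x i - x (k + j)))*?ind x)" by (rule ennreal_leI)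
  also have "... = ennreal (SUM i<k. SUM j<l. fact (k + l)*(k2 (x i - x (k + j))*?ind x))" by (simp add: sum_distrib_left sum_distrib_right mult.assoc)
  also have "... = (SUM i<k. SUM j<l. ennreal (fact (k + l)*(k2 (x i - x (k + j))*?ind x)))" by (simp add: sum_nonneg)
  also have "... = (SUM i<k. SUM j<l. ennreal (fact (k + l))*(ennreal (k2 (x i - x (k + j)))*?ind x))"
   by (intro sum.cong refl) (simp add: ennreal_mult indicator_def)
  finally show "ennreal (norm (?d x)) <= (SUM i<k. SUM j<l. ennreal (fact (k + l))*(ennreal (k2 (x i - x (k + j)))*?ind x))" .
 qed
 also have "... = (SUM i<k. SUM j<l. ennreal (fact (k + l))*(NNI ?M (%x. ennreal (k2 (x i - x (k + j)))*?ind x)))"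
 proof -
  have k2m: "(%z. ennreal (k2 z)) : BM borel" by measurable
  have fm: "(%x. ennreal (k2 (x i - x (k + j)))*?ind x) : BM ?M" if "i < k" "j < l" for i j
  proof -
   have "(%x. x i) : ?M \<rightarrow>\<^sub>M (borel :: 'a measure)" "(%x. x (k + j)) : ?M \<rightarrow>\<^sub>M (borel :: 'a measure)"
    using measurable_component_singleton[of _ "{..<k + l}" "%_. lborel :: 'a measure"] that by auto
   from measurable_compose[OF borel_measurable_diff[OF this] k2m] show ?thesis using S by (intro borel_measurable_times_ennreal borel_measurable_indicator)
  qed
  have "(NNI ?M (%x. (SUM i<k. SUM j<l. ennreal (fact (k + l))*(ennreal (k2 (x i - x (k + j)))*?ind x))))
   = (SUM i<k. (NNI ?M (%x. (SUM j<l. ennreal (fact (k + l))*(ennreal (k2 (x i - x (k + j)))*?ind x)))))"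
   by (intro nn_integral_sum borel_measurable_sum borel_measurable_times_ennreal[OF borel_measurable_const] fm) auto
  also have "... = (SUM i<k. SUM j<l. ennreal (fact (k + l))*(NNI ?M (%x. ennreal (k2 (x i - x (k + j)))*?ind x)))"
  proof (rule sum.cong[OF refl])
   fix i assume i: "i : {..<k}"
   have "(NNI ?M (%x. (SUM j<l. ennreal (fact (k + l))*(ennreal (k2 (x i - x (k + j)))*?ind x))))
    = (SUM j<l. (NNI ?M (%x. ennreal (fact (k + l))*(ennreal (k2 (x i - x (k + j)))*?ind x))))"
    by (intro nn_integral_sum borel_measurable_times_ennreal[OF borel_measurable_const] fm) (use i in auto)
   also have "... = (SUM j<l. ennreal (fact (k + l))*(NNI ?M (%x. ennreal (k2 (x i - x (k + j)))*?ind x)))"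
    by (intro sum.cong refl nn_integral_cmult fm) (use i in auto)
   finally show "(NNI ?M (%x. (SUM j<l. ennreal (fact (k + l))*(ennreal (k2 (x i - x (k + j)))*?ind x))))
    = (SUM j<l. ennreal (fact (k + l))*(NNI ?M (%x. ennreal (k2 (x i - x (k + j)))*?ind x)))" .
  qed
  finally show ?thesis .
 qed
 also have "... <= (SUM i<k. SUM j<l. ennreal (fact (k + l))*ennreal (L^(k + l)*ka))"
  using A L ka by (intro sum_mono mult_left_mono nn_integral_pair_factor) auto
 also have "... = ennreal (fact (k + l)*real k*real l*L^(k + l)*ka)"
  using L(1) ka(1) by (simp add: ennreal_mult[symmetric] ennreal_of_nat_eq_real_of_nat mult_ac)
 finally show ?thesis using L(1) ka(1) by (subst (asm) ennreal_le_iff) auto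
qed

text \<open>The integral of \<open>k2\<close> over the ball of radius \<open>r\<close> around
  \<open>x\<close>. It controls all pairs of points taken from two bounded sets at displacement
  \<open>x\<close>, and inherits integrability from \<open>k2\<close>.\<close>

definition kb :: "real => 'a => real" where
 "kb r x = (LBINT y. k2 (x + y)*ind (ball 0 r) y)"

lemma kb_integrable: "integrable lborel (%y. k2 (x + y)*ind (ball 0 r) y)"
 by (rule integrable_bound[OF integrable_lborel_translate[of k2 x, THEN iffD2, OF k_integrable]]) (auto simp: indicator_def)

lemma kb_nonneg: "kb r x >= 0" unfolding kb_def by (intro integral_nonneg) auto

lemma kb_mono: "r <= s ==> kb r x <= kb s x" unfolding kb_def by (intro integral_mono kb_integrable) (auto simp: indicator_def)

text \<open>If y lies in the translated set, then x + y and b both lie in the ball of radius r, so y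
  - b differs from -x by less than 2 r; evenness of \<open>k2\<close> removes the sign.\<close>

lemma kb_bound:
 assumes A: "A : bbs" "A <= ball 0 r" and b: "b : ball 0 r"
 shows "(NN y. ennreal (k2 (y - b))*ind ((+) x -` A) y) <= ennreal (kb (2*r) x)"
proof -
 have [measurable]: "A : sets borel" "ball (0::'a) (2*r) : sets borel" using A by (simp_all add: bbs_borel)
 have "(NN y. ennreal (k2 (y - b))*ind ((+) x -` A) y)
   = (NN y. ennreal (k2 (y - b))*ind A (x + y))" by (intro nn_integral_cong) (simp add: indicator_def)
 also have "... = (NN y. ennreal (k2 ((b - x + y) - b))*ind A (x + (b - x + y)))" by (rule nn_integral_lborel_translate[symmetric]) measurable
 also have "... <= (NN y. ennreal (k2 (- (x + (- y))))*ind (ball 0 (2*r)) (- y))"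
 proof (intro nn_integral_mono mult_mono)
  fix y
  show "ind A (x + (b - x + y)) <= (ind (ball 0 (2*r)) (- y) :: ennreal)"
  proof (cases "b + y : A")
   case True
   then have "norm (b + y) < r" "norm b < r" using A b by auto
   then have "norm y < 2*r" using norm_triangle_ineq4[of "b + y" b] by simp
   then show ?thesis by (simp add: indicator_def)
  qed (simp add: indicator_def)
  show "ennreal (k2 ((b - x + y) - b)) <= ennreal (k2 (- (x + (- y))))" by (simp add: algebra_simps)
 qed auto
 also have "... = (NN y. ennreal (k2 (x + (- y)))*ind (ball 0 (2*r)) (- y))" by (simp only: k_even)
 also have "... = (NN y. ennreal (k2 (x + y))*ind (ball 0 (2*r)) y)" by (rule nn_integral_lborel_uminus) measurable
 also have "... = (NN y. ennreal (k2 (x + y)*ind (ball 0 (2*r)) y))" by (intro nn_integral_cong) (simp add: indicator_def)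
 also have "... = ennreal (kb (2*r) x)" unfolding kb_def by (rule nn_integral_eq_integral[OF kb_integrable]) auto
 finally show ?thesis .
qed

end

section \<open>Counts, translations and polynomials in counts\<close>

lemma measurable_emeasure_point_measures:
 assumes "A : sets borel"
 shows "(%W. emeasure W A) : BM (point_measures :: 'a::euclidean_space measure measure)" unfolding point_measures_def
 by (rule measurable_SUP1[OF assms]) (auto intro: measurable_vimage_algebra1)

lemma measurable_measure_point_measures:
 "A : sets borel ==> (%W. measure W A) : BM (point_measures :: 'a::euclidean_space measure measure)"
 unfolding measure_def by (intro borel_measurable_enn2real measurable_emeasure_point_measures)

lemma measurable_point_measuresI:
 fixes f :: "'b => 'a::euclidean_space measure"
 assumes "!!w. w : space N ==> f w : PM"
  and "!!A. A : sets borel ==> (%w. emeasure (f w) A) : BM N"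
 shows "f : N \<rightarrow>\<^sub>M point_measures" unfolding point_measures_def
proof (rule measurable_SUP2)
 show "f : N \<rightarrow>\<^sub>M vimage_algebra {W. locally_finite_borel W & (ALL B:sets borel. emeasure W B : \<nat> Un {\<infinity>})} (%W. emeasure W A) borel"
  if "A : sets borel" for A using assms(1) assms(2)[OF that] by (intro measurable_vimage_algebra2) (auto simp: space_point_measures)
qed auto

lemma emeasure_translate:
 assumes "W : PM" "A : sets borel"
 shows "emeasure (translate x W) A = emeasure W ((+) x -` A)" using assms point_measuresD(1,2)[OF assms(1)] unfolding translate_def
 by (subst emeasure_distr) (auto cong: measurable_cong_sets)

lemma measure_translate:
 "W : PM ==> A : sets borel ==> measure (translate x W) A = measure W ((+) x -` A)"
 by (simp add: measure_def emeasure_translate)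

lemma sets_translate [simp]: "sets (translate x W) = sets borel" by (simp add: translate_def)

lemma vimage_plus_borel: "A : sets borel ==> (+) (x::'a::euclidean_space) -` A : sets borel" using measurable_sets[of "(+) x" borel borel A] by simp

lemma translate_space:
 assumes "W : PM"
 shows "translate x W : PM"
proof -
 have "emeasure (translate x W) A < \<infinity>" if "A : sets borel" "bounded A" for A
  using that point_measuresD(3)[OF assms, of "(+) x -` A"] bbs_vimage_plus[of A x] by (simp add: emeasure_translate[OF assms] bbs_def)
 moreover have "emeasure (translate x W) A : \<nat> Un {\<infinity>}" if "A : sets borel" for A using that point_measuresD(4)[OF assms, of "(+) x -` A"]
  by (simp add: emeasure_translate[OF assms] vimage_plus_borel)
 ultimately show ?thesis by (simp add: space_point_measures locally_finite_borel_def)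
qed

lemma measurable_translate [measurable]: "translate x : point_measures \<rightarrow>\<^sub>M point_measures"
proof (rule measurable_point_measuresI)
 fix A :: "'a set" assume "A : sets borel"
 then show "(%W. emeasure (translate x W) A) : BM point_measures" using measurable_emeasure_point_measures[OF vimage_plus_borel[of A x]]
  by (simp add: emeasure_translate cong: measurable_cong)
qed (rule translate_space)

lemma point_measure_mono:
 assumes "W : PM" "A : sets borel" "B : bbs" "A <= B"
 shows "measure W A <= measure W B"
proof -
 note p = point_measuresD[OF assms(1)]
 have A: "bounded A" using assms(3,4) by (auto simp: bbs_def intro: bounded_subset)
 have "emeasure W A <= emeasure W B" using assms p(1) by (intro emeasure_mono) (auto simp: bbs_def)
 then show ?thesis using p(5)[OF assms(2) A] p(5)[of B] assms(3) by (simp add: bbs_def)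
qed

text \<open>Convexity is preserved by intersections and translations and makes the frontier a null
  set (\<open>frontier_RR\<close>), so the counts are almost surely continuous at each fixed
  translation. Balls and lattice cells belong to the class.\<close>

definition RR :: "'a::euclidean_space set set" where "RR = {A : bbs. convex A}"

lemma RR_bbs: "A : RR ==> A : bbs" by (simp add: RR_def)
lemma RR_borel: "A : RR ==> A : sets borel" by (simp add: RR_def bbs_def)
lemma RR_Int: "A : RR ==> B : RR ==> A Int B : RR" by (auto simp: RR_def bbs_Int convex_Int)
lemma RR_vimage_plus: assumes "A : RR" shows "(+) v -` A : RR"
proof -
 have "(+) v -` A = (+) (- v) ` A" by (auto simp: image_iff intro!: bexI[of _ "v + _"])
 moreover have "convex ((+) (- v) ` A)" using assms by (intro convex_translation) (auto simp: RR_def)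
 ultimately show ?thesis using assms bbs_vimage_plus[of A v] by (simp add: RR_def)
qed
lemma RR_ball [simp]: "ball x r : RR" by (simp add: RR_def)

inductive_set polys :: "('a::euclidean_space measure => real) set" where
 polys_const: "(%_. c) : polys"
| polys_count: "A : RR ==> (%W. measure W A) : polys"
| polys_add: "p : polys ==> q : polys ==> (%W. p W + q W) : polys"
| polys_mult: "p : polys ==> q : polys ==> (%W. p W*q W) : polys"

lemma polys_sum: "finite I ==> (!!i. i : I ==> p i : polys) ==> (%W. SUM i:I. p i W) : polys"
proof (induction I rule: finite_induct)
 case (insert i I)
 have "(%W. p i W + (SUM i:I. p i W)) : polys" by (rule polys_add) (use insert in auto)
 then show ?case using insert by simp
qed (simp add: polys_const)

lemma polys_power: "p : polys ==> (%W. p W^n) : polys"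
proof (induction n)
 case (Suc n)
 have "(%W. p W*p W^n) : polys" by (rule polys_mult) (use Suc in auto)
 then show ?case by simp
qed (simp add: polys_const)

lemma polys_measurable: "p : polys ==> p : BM point_measures"
 by (induction rule: polys.induct) (auto intro: measurable_measure_point_measures RR_borel)

lemma polys_translate:
 "p : polys ==> EX q:polys. ALL W:PM. p (translate x W) = q W"
proof (induction rule: polys.induct)
 case (polys_const c)
 show ?case by (rule bexI[OF _ polys.polys_const[of c]]) simp
next
 case (polys_count A)
 show ?case by (rule bexI[OF _ polys.polys_count[OF RR_vimage_plus[OF polys_count, of x]]]) (simp add: measure_translate RR_borel[OF polys_count])
next
 case (polys_add p q)
 then obtain p' q' where "p' : polys" "q' : polys" "ALL W:PM. p (translate x W) = p' W"
  "ALL W:PM. q (translate x W) = q' W" by auto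
 then show ?case by (intro bexI[OF _ polys.polys_add[of p' q']]) auto
next
 case (polys_mult p q)
 then obtain p' q' where "p' : polys" "q' : polys" "ALL W:PM. p (translate x W) = p' W"
  "ALL W:PM. q (translate x W) = q' W" by auto
 then show ?case by (intro bexI[OF _ polys.polys_mult[of p' q']]) auto
qed

lemma polys_bound:
 "p : polys ==> EX C r k. C >= 0 & r >= 0 & (ALL W:PM. \<bar>p W\<bar> <= C*(1 + measure W (ball 0 r))^k)"
proof (induction rule: polys.induct)
 case (polys_const c)
 show ?case by (rule exI[of _ "\<bar>c\<bar>"], rule exI[of _ 0], rule exI[of _ 0]) simp
next
 case (polys_count A)
 have "bounded A" using polys_count by (simp add: RR_def bbs_def)
 then obtain r where r: "r > 0" "A <= ball 0 r" using bounded_subset_ballD by blast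
 have "\<bar>measure W A\<bar> <= 1*(1 + measure W (ball 0 r))^1" if "W : PM" for W
  using point_measure_mono[OF that RR_borel[OF polys_count] bbs_ball r(2)] by simp
 then show ?case using r(1) by (intro exI[of _ 1] exI[of _ r]) auto
next
 case (polys_add p q)
 then obtain C r k D s l where C: "C >= 0" "r >= 0" "!!W. W : PM ==> \<bar>p W\<bar> <= C*(1 + measure W (ball 0 r))^k"
  and D: "D >= 0" "s >= 0" "!!W. W : PM ==> \<bar>q W\<bar> <= D*(1 + measure W (ball 0 s))^l" by blast
 have "\<bar>p W + q W\<bar> <= (C + D)*(1 + measure W (ball 0 (r + s)))^(k + l)" if w: "W : PM" for W
 proof -
  let ?N = "1 + measure W (ball 0 (r + s))"
  have "(1 + measure W (ball 0 r))^k <= ?N^(k + l)" using point_measure_mono[OF w _ bbs_ball, of "ball 0 r" 0 "r + s"] D(2)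
   by (intro order_trans[OF power_mono power_increasing]) (auto simp: subset_ball)
  moreover have "(1 + measure W (ball 0 s))^l <= ?N^(k + l)" using point_measure_mono[OF w _ bbs_ball, of "ball 0 s" 0 "r + s"] C(2)
   by (intro order_trans[OF power_mono power_increasing]) (auto simp: subset_ball)
  ultimately have "C*(1 + measure W (ball 0 r))^k + D*(1 + measure W (ball 0 s))^l <= C*?N^(k + l) + D*?N^(k + l)"
   using C(1) D(1) by (intro add_mono mult_left_mono)
  then show ?thesis using C(3)[OF w] D(3)[OF w] by (simp add: distrib_right)
 qed
 then show ?case using C(1,2) D(1,2) by (intro exI[of _ "C + D"] exI[of _ "r + s"] exI[of _ "k + l"]) auto
next
 case (polys_mult p q)
 then obtain C r k D s l where C: "C >= 0" "r >= 0" "!!W. W : PM ==> \<bar>p W\<bar> <= C*(1 + measure W (ball 0 r))^k"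
  and D: "D >= 0" "s >= 0" "!!W. W : PM ==> \<bar>q W\<bar> <= D*(1 + measure W (ball 0 s))^l" by blast
 have "\<bar>p W*q W\<bar> <= (C*D)*(1 + measure W (ball 0 (r + s)))^(k + l)" if w: "W : PM" for W
 proof -
  let ?N = "1 + measure W (ball 0 (r + s))"
  have "(1 + measure W (ball 0 r))^k <= ?N^k" using point_measure_mono[OF w _ bbs_ball, of "ball 0 r" 0 "r + s"] D(2)
   by (intro power_mono) (auto simp: subset_ball)
  then have 1: "\<bar>p W\<bar> <= C*?N^k" using C(1) C(3)[OF w] by (meson mult_left_mono order_trans)
  have "(1 + measure W (ball 0 s))^l <= ?N^l" using point_measure_mono[OF w _ bbs_ball, of "ball 0 s" 0 "r + s"] C(2)
   by (intro power_mono) (auto simp: subset_ball)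
  then have 2: "\<bar>q W\<bar> <= D*?N^l" using D(1) D(3)[OF w] by (meson mult_left_mono order_trans)
  have "\<bar>p W*q W\<bar> <= (C*?N^k)*(D*?N^l)" unfolding abs_mult using 1 2 C(1) by (intro mult_mono) auto
  then show ?thesis by (simp add: power_add mult_ac)
 qed
 then show ?case using C(1,2) D(1,2) by (intro exI[of _ "C*D"] exI[of _ "r + s"] exI[of _ "k + l"]) auto
qed

lemma power_le_exp:
 fixes c :: real assumes "c > 0" shows "EX C>=0. ALL N>=0. (1 + N)^k <= C*exp (c*N)"
proof (intro exI conjI allI impI)
 fix N :: real assume N: "N >= 0"
 have 1: "(c*(1 + N))^k /\<^sub>R fact k <= exp (c*(1 + N))"
  using sum_le_suminf[OF summable_exp_generic[of "c*(1 + N)"], of "{k}"] N assms by (simp add: exp_def)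
 have "c^k*(1 + N)^k = fact k*((c*(1 + N))^k /\<^sub>R fact k)" by (simp add: power_mult_distrib)
 also have "... <= fact k*exp (c*(1 + N))" by (intro mult_left_mono 1) simp
 also have "exp (c*(1 + N)) = exp c*exp (c*N)" by (simp add: exp_add[symmetric] algebra_simps)
 finally show "(1 + N)^k <= fact k*exp c/c^k*exp (c*N)" using assms by (simp add: field_simps)
qed (use assms in simp)

lemma measurable_transfer:
 "f : N \<rightarrow>\<^sub>M M ==> (!!w. w : space N ==> f w = g w) ==> g : N \<rightarrow>\<^sub>M M"
 by (subst measurable_cong[of N g f]) simp_all

section \<open>Density of polynomials in counts\<close>

text \<open>Formulated for finite measures rather than probabilities, because uniqueness of the
  process is proved in L^2 of the sum of two laws.\<close>

locale exp_moments = finite_measure Q for Q :: "'a::euclidean_space measure measure" +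
 assumes sets_Q [measurable_cong, simp]: "sets Q = sets point_measures"
  and exp_moment: "B : bbs ==> EX c>0. (NNI Q (%W. ennreal (exp (c*measure W B)))) < \<infinity>"
begin

lemma space_Q [simp]: "space Q = PM" by (rule sets_eq_imp_space_eq) simp

lemma measurable_Q: "BM Q = BM point_measures" by (rule measurable_cong_sets) simp_all

lemma count_measurable: "A : sets borel ==> (%W. measure W A) : BM Q"
 unfolding measurable_Q by (rule measurable_measure_point_measures)

lemma polys_measurable_Q: "p : polys ==> p : BM Q" unfolding measurable_Q by (rule polys_measurable)

lemma polys_moment:
 assumes p: "p : polys" shows "(NNI Q (%W. ennreal (\<bar>p W\<bar>^n))) < \<infinity>"
proof -
 obtain C r k where C: "C >= 0" "!!W. W : PM ==> \<bar>p W\<bar> <= C*(1 + measure W (ball 0 r))^k"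
  using polys_bound[OF p] by blast
 obtain c where c: "c > 0" "(NNI Q (%W. ennreal (exp (c*measure W (ball 0 r))))) < \<infinity>" using exp_moment[OF bbs_ball] by blast
 note [measurable] = count_measurable[OF borel_open[OF open_ball[of 0 r]]]
 obtain D where D: "D >= 0" "!!N. N >= 0 ==> (1 + N)^(k*n) <= D*exp (c*N)" using power_le_exp[OF c(1)] by blast
 have "(NNI Q (%W. ennreal (\<bar>p W\<bar>^n))) <= (NNI Q (%W. ennreal (C^n*D)*ennreal (exp (c*measure W (ball 0 r)))))"
 proof (rule nn_integral_mono)
  fix W assume "W : space Q"
  then have "\<bar>p W\<bar>^n <= (C*(1 + measure W (ball 0 r))^k)^n" using C(2) by (intro power_mono) auto
  also have "... = C^n*(1 + measure W (ball 0 r))^(k*n)" by (simp add: power_mult_distrib power_mult)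
  also have "... <= C^n*(D*exp (c*measure W (ball 0 r)))" using C(1) by (intro mult_left_mono D) auto
  finally show "ennreal (\<bar>p W\<bar>^n) <= ennreal (C^n*D)*ennreal (exp (c*measure W (ball 0 r)))"
   using C(1) D(1) by (simp add: ennreal_mult[symmetric] mult.assoc ennreal_leI)
 qed
 also have "... = ennreal (C^n*D)*(NNI Q (%W. ennreal (exp (c*measure W (ball 0 r)))))" by (rule nn_integral_cmult) measurable
 also have "... < \<infinity>" using c(2) by (simp add: ennreal_mult_less_top)
 finally show ?thesis .
qed

lemma polys_integrable: assumes p: "p : polys" shows "integrable Q p" using polys_moment[OF p, of 1] polys_measurable_Q[OF p] by (intro integrableI_bounded) auto

abbreviation "clp \<equiv> L2_closure Q polys"

lemma polys_clp: "p : polys ==> p : clp" by (rule L2_closure_base) (auto intro: polys_measurable_Q)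

text \<open>The factor 4 leaves room for squaring a majorant that contains exp(\<open>rate H\<close>
  N), N the count of \<open>H\<close>, and for then separating the exponential from a polynomial by
  ab <= a^2 + b^2.\<close>

definition rate :: "'a set => real" where
 "rate H = (SOME c. c > 0 & (NNI Q (%W. ennreal (exp (4*c*measure W H)))) < \<infinity>)"

lemma rate: assumes "H : bbs" shows "rate H > 0" "(NNI Q (%W. ennreal (exp (4*rate H*measure W H)))) < \<infinity>"
proof -
 obtain c where "c > 0" "(NNI Q (%W. ennreal (exp (c*measure W H)))) < \<infinity>" using exp_moment[OF assms] by blast
 then have "c/4 > 0 & (NNI Q (%W. ennreal (exp (4*(c/4)*measure W H)))) < \<infinity>" by simp
 then have "rate H > 0 & (NNI Q (%W. ennreal (exp (4*rate H*measure W H)))) < \<infinity>" unfolding rate_def by (rule someI)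
 then show "rate H > 0" "(NNI Q (%W. ennreal (exp (4*rate H*measure W H)))) < \<infinity>" by auto
qed

text \<open>The exponential series converges in \<open>L^2\<close> because of the exponential moments.\<close>

lemma poly_exp_clp:
 assumes p: "p : polys" and H: "H : RR"
 shows "(%W. p W*exp (- rate H*measure W H)) : clp"
proof (rule L2_closure_limit)
 let ?c = "rate H"
 note c = rate[OF RR_bbs[OF H]]
 note [measurable] = polys_measurable_Q[OF p] count_measurable[OF RR_borel[OF H]]
 let ?u = "%n W. p W*(SUM k<n. (- ?c*measure W H)^k /\<^sub>R fact k)"
 show "?u n : clp" for n
 proof -
  have "(%W. p W*(SUM k<n. ((- ?c)^k/fact k)*measure W H^k)) : polys"
   by (intro polys.polys_mult p polys_sum polys.polys_const polys_power polys.polys_count H) auto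
  moreover have "((- ?c)^k/fact k)*t^k = (- ?c*t)^k /\<^sub>R fact k" for k t by (simp only: power_mult_distrib real_scaleR_def divide_inverse mult_ac)
  then have "(%W. p W*(SUM k<n. ((- ?c)^k/fact k)*measure W H^k)) = ?u n" by (simp only:)
  ultimately show ?thesis by (simp add: polys_clp)
 qed
 show "(%W. p W*exp (- ?c*measure W H)) : BM Q" by measurable
 show "AE W in Q. (%n. ?u n W) ~~> p W*exp (- ?c*measure W H)"
 proof (intro AE_I2 tendsto_mult tendsto_const)
  fix W
  have "(%k. (- ?c*measure W H)^k /\<^sub>R fact k) sums exp (- ?c*measure W H)" by (rule exp_converges)
  then show "(%n. SUM k<n. (- ?c*measure W H)^k /\<^sub>R fact k) ~~> exp (- ?c*measure W H)" by (simp add: sums_def)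
 qed
 let ?w = "%W. 2*\<bar>p W\<bar>*exp (?c*measure W H)"
 show "?w : BM Q" by measurable
 show "AE W in Q. \<bar>?u n W - p W*exp (- ?c*measure W H)\<bar> <= ?w W" for n
 proof (intro AE_I2)
  fix W
  let ?N = "measure W H"
  have "\<bar>SUM k<n. (- ?c*?N)^k /\<^sub>R fact k\<bar> <= (SUM k<n. (?c*?N)^k /\<^sub>R fact k)"
   using c(1) by (intro order_trans[OF sum_abs] sum_mono) (simp add: abs_mult power_abs)
  also have "... <= exp (?c*?N)" unfolding exp_def using c(1) by (intro sum_le_suminf summable_exp_generic) auto
  finally have "\<bar>SUM k<n. (- ?c*?N)^k /\<^sub>R fact k\<bar> <= exp (?c*?N)" .
  moreover have "exp (- ?c*?N) <= exp (?c*?N)" using c(1) by simp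
  moreover have "exp (- ?c*?N) > 0" by simp
  ultimately have "\<bar>(SUM k<n. (- ?c*?N)^k /\<^sub>R fact k) - exp (- ?c*?N)\<bar> <= 2*exp (?c*?N)" by linarith
  then have "\<bar>p W\<bar>*\<bar>(SUM k<n. (- ?c*?N)^k /\<^sub>R fact k) - exp (- ?c*?N)\<bar> <= \<bar>p W\<bar>*(2*exp (?c*?N))"
   by (intro mult_left_mono) auto
  then show "\<bar>?u n W - p W*exp (- ?c*?N)\<bar> <= ?w W" by (simp only: abs_mult[symmetric] right_diff_distrib mult_ac)
 qed
 have "(NNI Q (%W. ennreal ((?w W)^2))) <= (NNI Q (%W. 4*(ennreal (\<bar>p W\<bar>^4) + ennreal (exp (4*?c*measure W H)))))"
 proof (intro nn_integral_mono)
  fix W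
  let ?a = "\<bar>p W\<bar>^2" and ?b = "(exp (?c*measure W H))^2"
  have "x*y <= x^2 + y^2" if "0 <= x" "0 <= y" for x y :: real using sum_squares_bound[of x y] mult_nonneg_nonneg[OF that] by linarith
  then have "?a*?b <= ?a^2 + ?b^2" by (meson zero_le_power2)
  moreover have "?a^2 = \<bar>p W\<bar>^4" by (simp only: power_mult[symmetric]) simp
  moreover have "?b^2 = exp (4*?c*measure W H)" by (simp add: exp_double[symmetric] power_mult[symmetric] exp_of_nat_mult[symmetric] mult_ac)
  moreover have "(?w W)^2 = 4*(?a*?b)" by (simp add: power_mult_distrib)
  ultimately have "(?w W)^2 <= 4*(\<bar>p W\<bar>^4 + exp (4*?c*measure W H))" by simp
  then have "ennreal ((?w W)^2) <= ennreal (4*(\<bar>p W\<bar>^4 + exp (4*?c*measure W H)))" by (rule ennreal_leI)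
  then show "ennreal ((?w W)^2) <= 4*(ennreal (\<bar>p W\<bar>^4) + ennreal (exp (4*?c*measure W H)))" by (simp add: ennreal_mult ennreal_plus)
 qed
 also have "... = 4*((NNI Q (%W. ennreal (\<bar>p W\<bar>^4))) + (NNI Q (%W. ennreal (exp (4*?c*measure W H)))))"
  by (subst nn_integral_cmult) (auto simp: nn_integral_add)
 also have "... < \<infinity>" using c(2) polys_moment[OF p, of 4] by (simp add: ennreal_mult_less_top)
 finally show "(NNI Q (%W. ennreal ((?w W)^2))) < \<infinity>" .
qed

text \<open>Exponentials of negative multiples of counts determine the counts but are bounded, so
  \<open>bounded_algebra\<close> applies to them; polynomials in counts are unbounded and cannot be
  used there directly.\<close>

inductive_set EA :: "('a measure => real) set" where
 EA_const: "(%_. c) : EA"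
| EA_exp: "H : RR ==> (%W. exp (- rate H*measure W H)) : EA"
| EA_add: "f : EA ==> g : EA ==> (%W. f W + g W) : EA"
| EA_mult: "f : EA ==> g : EA ==> (%W. f W*g W) : EA"

text \<open>The exponential factor lies between 0 and 1, so multiplication by it does not increase
  L^2 distances. With \<open>poly_exp_clp\<close> this approximates products of several exponentials
  one factor at a time.\<close>

lemma exp_mult_clp:
 assumes h: "h : clp" and H: "H : RR"
 shows "(%W. h W*exp (- rate H*measure W H)) : clp"
proof (rule L2_closure_idem)
 note [measurable] = L2_closure_measurable[OF h] count_measurable[OF RR_borel[OF H]]
 show "(%W. h W*exp (- rate H*measure W H)) : BM Q" by measurable
 fix ep :: real assume "ep > 0"
 with h obtain p where p: "p : polys" "p : BM Q" "(NNI Q (%W. ennreal ((h W - p W)^2))) <= ennreal ep" by (rule L2_closureE)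
 have "(NNI Q (%W. ennreal ((h W*exp (- rate H*measure W H) - p W*exp (- rate H*measure W H))^2))) <= (NNI Q (%W. ennreal ((h W - p W)^2)))"
 proof (intro nn_integral_mono ennreal_leI)
  fix W
  have "(h W*exp (- rate H*measure W H) - p W*exp (- rate H*measure W H))^2 = (h W - p W)^2*(exp (- rate H*measure W H))^2"
   by (simp only: left_diff_distrib[symmetric] power_mult_distrib)
  also have "... <= (h W - p W)^2*1" using rate(1)[OF RR_bbs[OF H]] by (intro mult_left_mono power_le_one) auto
  finally show "(h W*exp (- rate H*measure W H) - p W*exp (- rate H*measure W H))^2 <= (h W - p W)^2" by simp
 qed
 with p show "EX g:clp. (NNI Q (%W. ennreal ((h W*exp (- rate H*measure W H) - g W)^2))) <= ennreal ep"
  by (intro bexI[OF _ poly_exp_clp[OF p(1) H]]) (rule order_trans)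
qed

lemma EA_mult_clp: "f : EA ==> h : clp ==> (%W. h W*f W) : clp"
proof (induction arbitrary: h rule: EA.induct)
 case (EA_const c)
 have "(%W. c*h W) : clp" by (rule L2_closure_cmult[OF polys.polys_mult[OF polys.polys_const] EA_const])
 then show ?case by (simp add: mult.commute)
next
 case (EA_exp H)
 then show ?case by (intro exp_mult_clp)
next
 case (EA_add f g)
 have "(%W. h W*f W + h W*g W) : clp" by (rule L2_closure_add[OF polys.polys_add EA_add.IH(1)[OF EA_add.prems] EA_add.IH(2)[OF EA_add.prems]])
 then show ?case by (simp add: distrib_left)
next
 case (EA_mult f g)
 have "(%W. (h W*f W)*g W) : clp" by (rule EA_mult.IH(2)[OF EA_mult.IH(1)[OF EA_mult.prems]])
 then show ?case by (simp add: mult.assoc)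
qed

lemma EA_clp: "f : EA ==> f : clp" using EA_mult_clp[OF _ polys_clp[OF polys.polys_const[of 1]]] by simp

lemma EA_bounded: "f : EA ==> EX B. ALL W:space Q. \<bar>f W\<bar> <= B"
proof (induction rule: EA.induct)
 case (EA_const c)
 show ?case by (rule exI[of _ "\<bar>c\<bar>"]) simp
next
 case (EA_exp H)
 show ?case using rate(1)[OF RR_bbs[OF EA_exp]] by (intro exI[of _ 1]) simp
next
 case (EA_add f g)
 then obtain B C where "!!W. W : space Q ==> \<bar>f W\<bar> <= B" "!!W. W : space Q ==> \<bar>g W\<bar> <= C" by blast
 then show ?case by (intro exI[of _ "B + C"] ballI order_trans[OF abs_triangle_ineq] add_mono)
next
 case (EA_mult f g)
 then obtain B C where B: "!!W. W : space Q ==> \<bar>f W\<bar> <= B" and C: "!!W. W : space Q ==> \<bar>g W\<bar> <= C" by blast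
 show ?case
 proof (intro exI[of _ "B*C"] ballI)
  fix W assume w: "W : space Q"
  show "\<bar>f W*g W\<bar> <= B*C" unfolding abs_mult using order_trans[OF abs_ge_zero B[OF w]] by (intro mult_mono B C w) auto
 qed
qed

lemma EA_measurable: "f : EA ==> f : BM Q" by (drule EA_clp) (rule L2_closure_measurable)

interpretation EA: bounded_algebra Q EA by unfold_locales (fact EA_measurable EA_bounded EA_const EA_add EA_mult)+

text \<open>Logarithms recover the counts of convex sets. Boxes cut by a ball are convex, so a
  Dynkin argument starting from boxes reaches all Borel sets inside a ball, and balls growing to the
  whole space give the remaining counts.\<close>

lemma EA_generates: "sets Q <= sigma_sets (space Q) {{W : space Q. g W > 0} | g. g : EA}"
proof -
 let ?G = "{{W : space Q. g W > 0} | g. g : EA}"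
 define N where "N = sigma (space Q) ?G"
 have G: "?G <= Pow (space Q)" by auto
 have sN: "sets N = sigma_sets (space Q) ?G" "space N = space Q" unfolding N_def using G by (simp_all add: sets_measure_of space_measure_of)
 have EA_N: "g : BM N" if g: "g : EA" for g
 proof (rule borel_measurableI_greater)
  fix y
  have "(%W. g W + - y) : EA" by (intro EA.intros g)
  then have "{W : space Q. g W + - y > 0} : ?G" by (intro CollectI exI[of _ "%W. g W + - y"] conjI refl)
  then have "{W : space Q. g W + - y > 0} : sets N" unfolding sN by (rule sigma_sets.Basic)
  then show "{x : space N. y < g x} : sets N" by (simp add: sN(2))
 qed
 have RR_N: "(%W. emeasure W H) : BM N" if H: "H : RR" for H
 proof -
  have "(%W. exp (- rate H*measure W H)) : BM N" by (intro EA_N EA.intros H)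
  then have "(%W. ennreal (- ln (exp (- rate H*measure W H))/rate H)) : BM N" by measurable
  moreover have "- ln (exp (- rate H*t))/rate H = t" for t using rate(1)[OF RR_bbs[OF H]] by simp
  ultimately have m: "(%W. ennreal (measure W H)) : BM N" by (simp only:)
  have eq: "emeasure W H = ennreal (measure W H)" if "W : space N" for W using that point_measuresD(5)[of W H] RR_bbs[OF H] by (simp add: sN(2) bbs_def)
  show ?thesis by (rule measurable_cong[THEN iffD2, OF eq m])
 qed
 have ball_N: "(%W. emeasure W (A Int bl n)) : BM N" if A: "A : sets borel" for A n
 proof -
  have A': "A : sigma_sets UNIV (range (%(a, b). box a b :: 'a set))" using A by (simp add: borel_eq_box)
  have "Int_stable (range (%(a, b). box a b :: 'a set))" by (auto simp: Int_stable_def box_Int_box)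
  moreover have "range (%(a, b). box a b :: 'a set) <= Pow UNIV" by simp
  ultimately have "A : sets borel & (%W. emeasure W (A Int bl n)) : BM N" using A'
  proof (induction rule: sigma_sets_induct_disjoint)
   case (basic B)
   then obtain a b where B: "B = box a b" by auto
   have "B Int bl n : RR" by (auto simp: B RR_def bbs_def intro!: convex_Int convex_box bounded_Int)
   then show ?case using RR_N B by auto
  next
   case empty
   then show ?case by simp
  next
   case (compl B)
   have B: "B : sets borel" and IH: "(%W. emeasure W (B Int bl n)) : BM N" using compl by auto
   have "(%W. emeasure W (bl n) - emeasure W (B Int bl n)) : BM N" by (intro borel_measurable_minus_ennreal IH RR_N RR_ball)
   moreover have "emeasure W (bl n) - emeasure W (B Int bl n) = emeasure W ((UNIV - B) Int bl n)"
    if "W : space N" for W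
   proof -
    have w: "W : PM" using that by (simp add: sN(2))
    have "emeasure W (bl n - B Int bl n) = emeasure W (bl n) - emeasure W (B Int bl n)"
     using point_measuresD(1)[OF w] point_measuresD(3)[OF w, of "B Int bl n"] B by (intro emeasure_Diff) (auto simp: less_top bounded_Int)
    moreover have "bl n - B Int bl n = (UNIV - B) Int bl n" by auto
    ultimately show ?thesis by simp
   qed
   ultimately have "(%W. emeasure W ((UNIV - B) Int bl n)) : BM N" by (rule measurable_transfer)
   then show ?case using B by auto
  next
   case (union F)
   have F: "F i : sets borel" and IH: "(%W. emeasure W (F i Int bl n)) : BM N" for i using union by auto
   have "(%W. \<Sum>i. emeasure W (F i Int bl n)) : BM N" by (intro borel_measurable_suminf_order IH)
   moreover have "(\<Sum>i. emeasure W (F i Int bl n)) = emeasure W (\<Union> (range F) Int bl n)" if "W : space N" for W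
   proof -
    have w: "W : PM" using that by (simp add: sN(2))
    have "(\<Sum>i. emeasure W (F i Int bl n)) = emeasure W (UN i. F i Int bl n)"
     using F union(1) point_measuresD(1)[OF w] by (intro suminf_emeasure) (auto simp: disjoint_family_on_def)
    then show ?thesis by simp
   qed
   ultimately have "(%W. emeasure W (\<Union> (range F) Int bl n)) : BM N" by (rule measurable_transfer)
   then show ?case using F by auto
  qed
  then show ?thesis by simp
 qed
 have all_N: "(%W. emeasure W A) : BM N" if A: "A : sets borel" for A
 proof -
  have "(%W. SUP n. emeasure W (A Int bl n)) : BM N" using ball_N[OF A] by (intro borel_measurable_SUP) auto
  moreover have "(SUP n. emeasure W (A Int bl n)) = emeasure W A" if "W : space N" for W
  proof -
   have w: "W : PM" using that by (simp add: sN(2))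
   have "(SUP n. emeasure W (A Int bl n)) = emeasure W (UN n. A Int bl n)"
   proof (rule SUP_emeasure_incseq)
    show "range (%n. A Int bl n) <= sets W" using A by (intro image_subsetI) (simp add: point_measuresD(1)[OF w])
    show "incseq (%n. A Int bl n)" by (intro incseq_SucI Int_mono order_refl subset_ball) simp
   qed
   also have "(UN n. A Int bl n) = A" by (simp only: Int_UN_distrib[symmetric] ball_UN_UNIV Int_UNIV_right)
   finally show ?thesis .
  qed
  ultimately show ?thesis by (rule measurable_transfer)
 qed
 have "(%W. W) : N \<rightarrow>\<^sub>M point_measures" by (rule measurable_point_measuresI[OF _ all_N]) (simp_all add: sN(2))
 then have "E : sets N" if "E : sets Q" for E
  using measurable_sets[of "%W. W" N point_measures E] that sets.sets_into_space[OF that] by (simp add: sN(2) Int_absorb2)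
 then show ?thesis by (auto simp: sN(1))
qed

theorem polys_dense:
 assumes f: "f : BM Q" and fin: "(NNI Q (%W. ennreal ((f W)^2))) < \<infinity>"
 shows "f : clp"
proof (rule L2_closure_idem[OF f])
 fix ep :: real assume "ep > 0"
 have "f : L2_closure Q EA" by (rule EA.L2_dense[OF EA_generates f fin])
 from this \<open>ep > 0\<close> obtain g where "g : EA" "g : BM Q" "(NNI Q (%W. ennreal ((f W - g W)^2))) <= ennreal ep"
  by (rule L2_closureE)
 then show "EX h:clp. (NNI Q (%W. ennreal ((f W - h W)^2))) <= ennreal ep" by (intro bexI[OF _ EA_clp])
qed

end

lemma (in prob_space) integral_le_L2:
 fixes f :: "'a => real"
 assumes [measurable]: "f : BM M" and le: "(NNI M (%x. ennreal ((f x)^2))) <= ennreal ep" and ep: "ep >= 0"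
 shows "integrable M f" "\<bar>(LINT x|M. f x)\<bar> <= sqrt ep" "integrable M (%x. (f x)^2)" "(LINT x|M. (f x)^2) <= ep"
proof -
 have "(NNI M (%x. ennreal (norm ((f x)^2)))) <= ennreal ep" using le by simp
 then have "(NNI M (%x. ennreal (norm ((f x)^2)))) < \<infinity>" by (rule order.strict_trans1) simp
 then show f2: "integrable M (%x. (f x)^2)" by (intro integrableI_bounded) auto
 show f: "integrable M f" by (rule square_integrable_imp_integrable[OF _ f2]) simp
 have "ennreal (LINT x|M. (f x)^2) <= ennreal ep" using le nn_integral_eq_integral[OF f2] by simp
 then show i: "(LINT x|M. (f x)^2) <= ep" using ep by simp
 have "variance f = (LINT x|M. (f x)^2) - (LINT x|M. f x)^2" by (rule variance_eq[OF f f2])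
 then have "(LINT x|M. f x)^2 <= ep" using variance_positive[of f] i by linarith
 then have "sqrt ((LINT x|M. f x)^2) <= sqrt ep" by (rule real_sqrt_le_mono)
 then show "\<bar>(LINT x|M. f x)\<bar> <= sqrt ep" by simp
qed

section \<open>Polynomials as combinations of factorial powers; uniqueness of the law\<close>

lemma ffact_count_const: "ffact_count n k (%_. B) = (PROD i<k. n B - real i)"
proof (induction k)
 case (Suc k)
 have "(%_. B)(j := B Int B) = (%_::nat. B)" for j by auto
 then show ?case using Suc by (simp add: algebra_simps)
qed simp

lemma ffact_count_vimage: "ffact_count (%B. n (f -` B)) k A = ffact_count n k (%j. f -` A j)"
proof (induction k arbitrary: A)
 case (Suc k)
 have "(%i. f -` (A(j := A j Int A k)) i) = (%i. f -` A i)(j := f -` A j Int f -` A k)" for j by (rule ext) simp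
 then show ?case using Suc by simp
qed simp

lemma ffact_count_translate:
 assumes w: "W : PM" and A: "!!j. j < k ==> A j : sets borel"
 shows "ffact_count (measure (translate x W)) k A = ffact_count (measure W) k (%j. (+) x -` A j)"
proof -
 have "ffact_count (measure (translate x W)) k A = ffact_count (%B. measure W ((+) x -` B)) k A"
  by (rule ffact_count_cong[of "sets borel"]) (simp_all add: A measure_translate[OF w])
 then show ?thesis by (simp only: ffact_count_vimage)
qed

text \<open>The recursion of \<open>ffact_count\<close> read backwards: a further point in
  \<open>H\<close> is either distinct from the chosen ones or one of them. Products of counts
  thereby become linear combinations of factorial powers.\<close>

lemma ffact_count_mult:
 "ffact_count n k A*n H = ffact_count n (Suc k) (A(k := H)) + (SUM j<k. ffact_count n k (A(j := A j Int H)))"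
proof -
 have "ffact_count n k (A(k := H)) = ffact_count n k A" by (rule ffact_count_cong_sets) auto
 moreover have "ffact_count n k ((A(k := H))(j := (A(k := H)) j Int H)) = ffact_count n k (A(j := A j Int H))" if "j < k" for j
  by (rule ffact_count_cong_sets) (use that in auto)
 ultimately show ?thesis by simp
qed

lemma ffact_count_measurable:
 "(!!j. j < k ==> A j : sets borel) ==> (%W. ffact_count (measure W) k A) : BM point_measures"
proof (induction k arbitrary: A)
 case (Suc k)
 have "(%W. ffact_count (measure W) k (A(j := A j Int A k))) : BM point_measures" if "j < k" for j by (rule Suc.IH) (use Suc.prems that in auto)
 then show ?case unfolding ffact_count.simps by (intro borel_measurable_diff borel_measurable_times borel_measurable_sum Suc.IH measurable_measure_point_measures)
   (use Suc.prems in auto)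
qed simp

text \<open>The linear span of factorial powers on convex sets. Its expectations are prescribed by
  \<open>m\<close> on the generators and hence by linearity everywhere;
  \<open>polys_subset_ffspan\<close> brings all polynomials under this rule.\<close>

inductive_set ffspan :: "('a::euclidean_space measure => real) set" where
 ffspan_base: "(!!j. j < k ==> A j : RR) ==> (%W. ffact_count (measure W) k A) : ffspan"
| ffspan_add: "v : ffspan ==> w : ffspan ==> (%W. v W + w W) : ffspan"
| ffspan_cmult: "v : ffspan ==> (%W. c * v W) : ffspan"

lemma ffspan_const: "(%_. c) : ffspan"
proof -
 have "(%W. c*ffact_count (measure W) 0 (%_. {})) : ffspan" by (intro ffspan_cmult ffspan_base) simp
 then show ?thesis by simp
qed

lemma ffspan_sum: "finite I ==> (!!i. i : I ==> p i : ffspan) ==> (%W. SUM i:I. p i W) : ffspan"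
proof (induction I rule: finite_induct)
 case (insert i I)
 have "(%W. p i W + (SUM i:I. p i W)) : ffspan" by (rule ffspan_add) (use insert in auto)
 then show ?case using insert by simp
qed (simp add: ffspan_const)

lemma ffspan_count_mult:
 assumes H: "H : RR" and w: "w : ffspan" shows "(%W. measure W H*w W) : ffspan" using w
proof (induction rule: ffspan.induct)
 case (ffspan_base k A)
 have "(%W. ffact_count (measure W) (Suc k) (A(k := H)) + (SUM j<k. ffact_count (measure W) k (A(j := A j Int H)))) : ffspan"
 proof (intro ffspan.ffspan_add ffspan_sum)
  show "(%W. ffact_count (measure W) (Suc k) (A(k := H))) : ffspan" by (rule ffspan.ffspan_base) (use ffspan_base H in \<open>auto simp: less_Suc_eq\<close>)
  show "(%W. ffact_count (measure W) k (A(j := A j Int H))) : ffspan" if "j : {..<k}" for j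
   by (rule ffspan.ffspan_base) (use ffspan_base H in \<open>auto intro: RR_Int\<close>)
 qed simp
 then show ?case by (simp only: ffact_count_mult[symmetric] mult.commute)
next
 case (ffspan_add v w)
 have "(%W. measure W H * v W + measure W H*w W) : ffspan" by (rule ffspan.ffspan_add[OF ffspan_add.IH])
 then show ?case by (simp only: distrib_left)
next
 case (ffspan_cmult v c)
 have "(%W. c*(measure W H * v W)) : ffspan" by (rule ffspan.ffspan_cmult[OF ffspan_cmult.IH])
 then show ?case by (simp only: mult.left_commute)
qed

lemma polys_ffspan_mult: "p : polys ==> w : ffspan ==> (%W. p W*w W) : ffspan"
proof (induction arbitrary: w rule: polys.induct)
 case (polys_const c)
 then show ?case by (rule ffspan_cmult)
next
 case (polys_count A)
 then show ?case by (rule ffspan_count_mult)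
next
 case (polys_add p q)
 have "(%W. p W*w W + q W*w W) : ffspan" by (rule ffspan_add[OF polys_add.IH(1)[OF polys_add.prems] polys_add.IH(2)[OF polys_add.prems]])
 then show ?case by (simp only: distrib_right)
next
 case (polys_mult p q)
 have "(%W. p W*(q W*w W)) : ffspan" by (rule polys_mult.IH(1)[OF polys_mult.IH(2)[OF polys_mult.prems]])
 then show ?case by (simp only: mult.assoc)
qed

lemma polys_subset_ffspan: "p : polys ==> p : ffspan" using polys_ffspan_mult[OF _ ffspan_const[of 1]] by simp

text \<open>A law with the factorial moments \<open>m\<close>. The condition concerns only moments
  over products of bounded sets, which are translation invariant, so the translated law is again an
  instance.\<close>

locale det_process = det_kernel K + prob_space P
 for K :: "'a::euclidean_space => complex" and P :: "'a measure measure" +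
 assumes sets_P [measurable_cong, simp]: "sets P = sets point_measures"
  and ffact_integrable: "(!!j. j < k ==> A j : bbs) ==> integrable P (%W. ffact_count (measure W) k A)"
  and ffact_expect: "(!!j. j < k ==> A j : bbs) ==> (LINT W|P. ffact_count (measure W) k A) = m k A"
begin

lemma space_P [simp]: "space P = PM" by (rule sets_eq_imp_space_eq) simp

text \<open>The binomial theorem writes (1 + c)^N as the sum of c^k/k! times the k-th factorial
  power of the count N. Since the k-th factorial moment is at most k! vol(B)^k, the expectations are
  dominated by a geometric series.\<close>

lemma exp_moment_P:
 assumes B: "B : bbs"
 shows "EX c>0. (NNI P (%W. ennreal (exp (c*measure W B)))) < \<infinity>"
proof -
 let ?l = "vol B"
 \<comment> \<open>Chosen so that c vol(B) <= 1/2; adding 1 keeps the denominator positive for null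
   sets.\<close>
 define c where "c = 1/(2*(?l + 1))"
 have l: "?l >= 0" by simp
 have c: "c > 0" unfolding c_def using l by (intro divide_pos_pos mult_pos_pos) linarith+
 have c': "c*?l <= 1/2"
 proof -
  have "c*(?l + 1) = 1/2" unfolding c_def using l by (simp add: add_nonneg_eq_0_iff)
  then show ?thesis using c by (simp add: distrib_left)
 qed
 define F where "F k W = c^k/fact k*ffact_count (measure W) k (%_. B)" for k and W :: "'a measure"
 have F: "F k W = real (N choose k)*c^k" if "measure W B = real N" for k W N
  unfolding F_def ffact_count_const that binomial_gbinomial gbinomial_prod_rev by (simp add: lessThan_atLeast0)
 have exN: "EX N. measure W B = real N" if "W : space P" for W using point_measuresD(6)[of W B] that B by (simp add: bbs_def)
 have F0: "F k W >= 0" if w: "W : space P" for k W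
 proof -
  obtain N where "measure W B = real N" using exN[OF w] by auto
  then show ?thesis using c by (simp add: F)
 qed
 have Fm: "(%W. F k W) : BM P" for k
 proof -
  have "(%W. ffact_count (measure W) k (%_. B)) : BM P" by (rule borel_measurable_integrable[OF ffact_integrable]) (rule B)
  then show ?thesis unfolding F_def by (intro borel_measurable_times borel_measurable_const)
 qed
 have "(NNI P (%W. ennreal (exp (ln (1 + c)*measure W B)))) = (NNI P (%W. (\<Sum>k. ennreal (F k W))))"
 proof (rule nn_integral_cong)
  fix W assume w: "W : space P"
  obtain N where N: "measure W B = real N" using exN[OF w] by auto
  have "exp (ln (1 + c)*measure W B) = (1 + c)^N" using c by (simp add: N exp_of_nat2_mult)
  also have "... = (SUM k<=N. F k W)" by (simp add: binomial_ring[of c 1 N, simplified add.commute[of c]] F[OF N])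
  finally have "ennreal (exp (ln (1 + c)*measure W B)) = (SUM k<=N. ennreal (F k W))" using F0[OF w] by simp
  also have "... = (\<Sum>k. ennreal (F k W))" by (rule suminf_finite[symmetric]) (auto simp: F[OF N] binomial_eq_0)
  finally show "ennreal (exp (ln (1 + c)*measure W B)) = (\<Sum>k. ennreal (F k W))" .
 qed
 also have "... = (\<Sum>k. (NNI P (%W. ennreal (F k W))))" using Fm by (intro nn_integral_suminf measurable_compose[OF _ measurable_ennreal])
 also have "... <= (\<Sum>k. ennreal ((1/2)^k))"
 proof (intro suminf_le summableI)
  fix k
  have i: "integrable P (%W. F k W)" unfolding F_def by (intro integrable_mult_right ffact_integrable B)
  have "(NNI P (%W. ennreal (F k W))) = ennreal (LINT W|P. F k W)" by (rule nn_integral_eq_integral[OF i AE_I2[OF F0]])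
  also have "(LINT W|P. F k W) = c^k/fact k*m k (%_. B)" unfolding F_def by (simp add: ffact_expect[OF B])
  also have "... <= c^k/fact k*(fact k*?l^k)" using m_abs[of k "%_. B"] B c by (intro mult_left_mono) auto
  also have "... = (c*?l)^k" by (simp add: power_mult_distrib)
  also have "... <= (1/2)^k" using c c' l by (intro power_mono) auto
  finally show "(NNI P (%W. ennreal (F k W))) <= ennreal ((1/2)^k)" by (simp add: ennreal_leI)
 qed
 also have "... = ennreal (\<Sum>k. (1/2)^k)" by (rule suminf_ennreal2) (auto intro: summable_geometric)
 also have "... < \<infinity>" by simp
 finally show ?thesis using c by (intro exI[of _ "ln (1 + c)"]) simp
qed

sublocale exp_moments P by unfold_locales (fact sets_P exp_moment_P)+

lemma ffspan_integrable: "w : ffspan ==> integrable P w"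
proof (induction rule: ffspan.induct)
 case (ffspan_base k A)
 then show ?case by (intro ffact_integrable RR_bbs)
next
 case (ffspan_add v w)
 then show ?case by (intro integrable_add)
next
 case (ffspan_cmult v c)
 then show ?case by (intro integrable_mult_right)
qed

lemma det_process_translate: "det_process K (distr P point_measures (translate x))"
proof -
 let ?P = "distr P point_measures (translate x)"
 have T: "translate x : P \<rightarrow>\<^sub>M point_measures" by measurable
 interpret P': prob_space ?P by (rule prob_space_distr[OF T])
 show ?thesis
 proof unfold_locales
  show "sets ?P = sets point_measures" by simp
  fix k and A :: "nat => 'a set" assume A: "!!j. j < k ==> A j : bbs"
  have A': "(+) x -` A j : bbs" if "j < k" for j using A[OF that] by (rule bbs_vimage_plus)
  have fm: "(%W. ffact_count (measure W) k A) : BM point_measures" by (rule ffact_count_measurable) (use A in \<open>simp add: bbs_borel\<close>)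
  have eq: "ffact_count (measure (translate x W)) k A = ffact_count (measure W) k (%j. (+) x -` A j)" if "W : space P" for W
   by (rule ffact_count_translate) (use that A in \<open>simp_all add: bbs_borel\<close>)
  have "integrable P (%W. ffact_count (measure (translate x W)) k A) \<longleftrightarrow> integrable P (%W. ffact_count (measure W) k (%j. (+) x -` A j))"
   by (rule integrable_cong[OF refl eq])
  then show "integrable ?P (%W. ffact_count (measure W) k A)" using integrable_distr_eq[OF T fm] ffact_integrable[OF A'] by simp
  have "(LINT W|?P. ffact_count (measure W) k A) = (LINT W|P. ffact_count (measure (translate x W)) k A)" by (rule integral_distr[OF T fm])
  also have "... = (LINT W|P. ffact_count (measure W) k (%j. (+) x -` A j))" by (rule integral_cong[OF refl eq])
  also have "... = m k (%j. (+) x -` A j)" by (rule ffact_expect[OF A'])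
  also have "... = m k A" by (rule m_translate[OF A])
  finally show "(LINT W|?P. ffact_count (measure W) k A) = m k A" .
 qed
qed

text \<open>Density in L^2 of the sum \<open>Q\<close> of the laws yields one polynomial close to
  the indicator of an event under both laws at once. The laws agree on polynomials, hence give the
  event probabilities differing by at most \<open>2 * sqrt ep\<close>.\<close>

lemma det_process_unique:
 assumes "det_process K P'" shows "P' = P"
proof -
 interpret P': det_process K P' by fact
 have sp: "sets P' = sets P" by simp
 define Q where "Q = add_measure P P'"
 have nnQ: "(NNI Q (%W. f W)) = (NNI P (%W. f W)) + (NNI P' (%W. f W))" if "f : BM point_measures" for f
 proof -
  have "f : BM P" using that by (simp cong: measurable_cong_sets)
  then show ?thesis unfolding Q_def by (rule nn_integral_add_measure[OF sp])
 qed
 have sQ: "sets Q = sets point_measures" by (simp add: Q_def)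
 interpret Q: exp_moments Q
 proof
  have "emeasure Q (space Q) = emeasure P (space P) + emeasure P' (space P')" unfolding Q_def by (subst emeasure_add_measure) (auto simp: sp)
  also have "... = 2" using emeasure_space_1 P'.emeasure_space_1 by (simp add: one_add_one)
  finally have fin: "emeasure Q (space Q) < \<infinity>" by simp
  then show "emeasure Q (space Q) ~= \<top>" by simp
  show "EX A. countable A & A <= sets Q & \<Union> A = space Q & (ALL a:A. emeasure Q a ~= \<infinity>)"
   using fin by (intro exI[of _ "{space Q}"]) simp
  show "sets Q = sets point_measures" by (rule sQ)
  fix B :: "'a set" assume B: "B : bbs"
  obtain c where c: "c > 0" "(NNI P (%W. ennreal (exp (c*measure W B)))) < \<infinity>" using exp_moment_P[OF B] by auto
  obtain d where d: "d > 0" "(NNI P' (%W. ennreal (exp (d*measure W B)))) < \<infinity>" using P'.exp_moment_P[OF B] by auto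
  have mm: "(%W. ennreal (exp (min c d*measure W B))) : BM point_measures"
   by (rule measurable_compose[OF measurable_measure_point_measures[OF bbs_borel[OF B]], of "%t. ennreal (exp (min c d*t))"]) measurable
  have "(NNI P (%W. ennreal (exp (min c d*measure W B)))) <= (NNI P (%W. ennreal (exp (c*measure W B))))"
   by (intro nn_integral_mono ennreal_leI) (simp add: mult_right_mono)
  moreover have "(NNI P' (%W. ennreal (exp (min c d*measure W B)))) <= (NNI P' (%W. ennreal (exp (d*measure W B))))"
   by (intro nn_integral_mono ennreal_leI) (simp add: mult_right_mono)
  ultimately have "(NNI Q (%W. ennreal (exp (min c d*measure W B)))) < \<infinity>" unfolding nnQ[OF mm] using c(2) d(2) by (simp add: order.strict_trans1)
  then show "EX c>0. (NNI Q (%W. ennreal (exp (c*measure W B)))) < \<infinity>" using c(1) d(1) by (intro exI[of _ "min c d"]) simp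
 qed
 have ff: "(LINT W|P'. w W) = (LINT W|P. w W)" if "w : ffspan" for w using that
 proof (induction rule: ffspan.induct)
  case (ffspan_base k A)
  then show ?case by (simp add: ffact_expect P'.ffact_expect RR_bbs)
 next
  case (ffspan_add v w)
  then show ?case by (simp add: ffspan_integrable P'.ffspan_integrable)
 next
  case (ffspan_cmult v c)
  then show ?case by simp
 qed
 show ?thesis
 proof (rule measure_eqI)
  fix E assume E: "E : sets P'"
  then have [measurable]: "E : sets point_measures" by simp
  have iQ: "ind E : BM Q" unfolding Q.measurable_Q by measurable
  have "(NNI Q (%W. ennreal ((ind E W)^2))) <= (NNI Q (%W. 1))" by (intro nn_integral_mono) (simp add: indicator_def)
  also have "... < \<infinity>" using Q.emeasure_finite[of "space Q"] by (simp add: less_top del: Q.emeasure_finite)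
  finally have cl: "ind E : L2_closure Q polys" by (rule Q.polys_dense[OF iQ])
  have "\<bar>measure P' E - measure P E\<bar> <= 2 * sqrt ep" if e: "ep > 0" for ep
  proof -
   obtain p where p: "p : polys" "p : BM Q" "(NNI Q (%W. ennreal ((ind E W - p W)^2))) <= ennreal ep"
    using cl e by (rule L2_closureE)
   have pm: "p : BM point_measures" using p(2) by (simp add: Q.measurable_Q)
   have dm: "(%W. ind E W - p W) : BM point_measures" using pm by measurable
   have "(%W. ennreal ((ind E W - p W)^2)) : BM point_measures" using pm by measurable
   note s = nnQ[OF this]
   have 1: "(NNI P (%W. ennreal ((ind E W - p W)^2))) <= ennreal ep" by (rule order_trans[OF _ p(3)]) (simp add: s)
   have 2: "(NNI P' (%W. ennreal ((ind E W - p W)^2))) <= ennreal ep" by (rule order_trans[OF _ p(3)]) (simp add: s)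
   have dP: "(%W. ind E W - p W) : BM P" "(%W. ind E W - p W) : BM P'" using dm by (simp_all cong: measurable_cong_sets)
   have a: "\<bar>(LINT W|P. ind E W - p W)\<bar> <= sqrt ep" by (rule integral_le_L2(2)[OF dP(1) 1]) (use e in simp)
   have b: "\<bar>(LINT W|P'. ind E W - p W)\<bar> <= sqrt ep" by (rule P'.integral_le_L2(2)[OF dP(2) 2]) (use e in simp)
   have pw: "p : ffspan" by (rule polys_subset_ffspan[OF p(1)])
   have "(LINT W|P. ind E W - p W) = measure P E - (LINT W|P. p W)"
    using ffspan_integrable[OF pw] E by (subst integral_diff) (auto simp: integrable_real_indicator emeasure_finite less_top[symmetric])
   moreover have "(LINT W|P'. ind E W - p W) = measure P' E - (LINT W|P'. p W)"
    using P'.ffspan_integrable[OF pw] E by (subst integral_diff) (auto simp: integrable_real_indicator P'.emeasure_finite less_top[symmetric])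
   ultimately show ?thesis using a b ff[OF pw] by linarith
  qed
  note est = this
  have "\<bar>measure P' E - measure P E\<bar> <= de" if d: "de > 0" for de
  proof -
   have "\<bar>measure P' E - measure P E\<bar> <= 2 * sqrt ((de/2)^2)" by (rule est) (use d in simp)
   also have "sqrt ((de/2)^2) = de/2" using d by (intro real_sqrt_unique) auto
   finally show ?thesis by simp
  qed
  then have "\<bar>measure P' E - measure P E\<bar> <= 0" by (rule field_le_epsilon[of _ 0, simplified])
  then show "emeasure P' E = emeasure P E" by (simp add: emeasure_eq_measure P'.emeasure_eq_measure)
 qed simp
qed

theorem stationary_P: "stationary P" unfolding stationary_def by (intro allI det_process_unique det_process_translate)

end

section \<open>Decay of covariances\<close>

context det_process begin

lemma polys_integrable_P: "p : polys ==> integrable P p" by (rule polys_integrable)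

lemma integral_translate_P:
 fixes f :: "'a measure => real"
 assumes f: "f : BM point_measures"
 shows "(LINT W|P. f (translate x W)) = (LINT W|P. f W)"
proof -
 have T: "translate x : P \<rightarrow>\<^sub>M point_measures" by measurable
 have "(LINT W|P. f (translate x W)) = (\<integral>W. f W \<partial>distr P point_measures (translate x))" by (rule integral_distr[OF T f, symmetric])
 then show ?thesis using stationary_P by (simp add: stationary_def)
qed

lemma polys_translate_integrable:
 assumes "p : polys" "q : polys"
 shows "integrable P (%W. p (translate x W)*q W)"
proof -
 obtain p' where p': "p' : polys" "ALL W:PM. p (translate x W) = p' W" using polys_translate[OF assms(1)] by auto
 have "integrable P (%W. p' W*q W)" by (rule polys_integrable_P[OF polys.polys_mult[OF p'(1) assms(2)]])
 then show ?thesis by (rule integrable_cong[THEN iffD1, rotated 2]) (use p' in auto)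
qed

definition covP :: "('a measure => real) => ('a measure => real) => 'a => real" where
 "covP F G x = (LINT W|P. F (translate x W)*G W) - (LINT W|P. F W)*(LINT W|P. G W)"

text \<open>The bound concerns only large translations, where the sets behind \<open>F\<close> and
  \<open>G\<close> are separated. Integrability is included so that the property passes to linear
  combinations in each argument.\<close>

definition decor :: "('a measure => real) => ('a measure => real) => bool" where
 "decor F G \<longleftrightarrow> (EX r C. C >= 0 & (ALL x. norm x > r --> integrable P (%W. F (translate x W)*G W) \<and>
  \<bar>covP F G x\<bar> <= C*kb r x))"

text \<open>For |x| > 2 r the translated sets are disjoint from the others, so the product of the
  two factorial powers is a single factorial power of order k + l
  (\<open>ffact_count_append\<close>), whose moment is estimated by \<open>m_block\<close>.\<close>

lemma decor_base:
 assumes A: "!!j. j < k ==> A j : bbs" and B: "!!j. j < l ==> B j : bbs"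
 shows "decor (%W. ffact_count (measure W) k A) (%W. ffact_count (measure W) l B)"
proof -
 have "bounded ((UN j<k. A j) Un (UN j<l. B j))" using A B by (auto simp: bbs_def)
 then obtain r where r: "r > 0" "(UN j<k. A j) Un (UN j<l. B j) <= ball 0 r" using bounded_subset_ballD by blast
 define L where "L = 1 + vol (ball (0::'a) r)"
 define C where "C = fact (k + l)*real k*real l*L^(k + l)"
 have L: "L >= 1" by (simp add: L_def)
 have main: "integrable P (%W. ffact_count (measure (translate x W)) k A*ffact_count (measure W) l B) \<and>
  \<bar>covP (%W. ffact_count (measure W) k A) (%W. ffact_count (measure W) l B) x\<bar> <= C*kb (2*r) x"
  if x: "norm x > 2*r" for x
 proof -
  define H where "H j = (if j < k then (+) x -` A j else B (j - k))" for j
  have H: "H j : bbs" if "j < k + l" for j using that A B by (auto simp: H_def intro!: bbs_vimage_plus)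
  have Hk: "H (k + j) = B j" for j by (simp add: H_def)
  have disj: "H i Int H (k + j) = {}" if "i < k" "j < l" for i j
  proof (rule ccontr)
   assume "H i Int H (k + j) ~= {}"
   then obtain y where y: "y : H i" "y : H (k + j)" by blast
   then have "x + y : A i" "y : B j" using that by (simp_all add: H_def)
   then have "norm (x + y) < r" "norm y < r" using that r(2) by (auto simp: subset_eq)
   then show False using x norm_triangle_ineq4[of "x + y" y] by simp
  qed
  have prod: "ffact_count (measure W) (k + l) H = ffact_count (measure (translate x W)) k A*ffact_count (measure W) l B"
   if w: "W : space P" for W
  proof -
   have "ffact_count (measure W) k H = ffact_count (measure W) k (%j. (+) x -` A j)" by (rule ffact_count_cong_sets) (simp add: H_def)
   also have "... = ffact_count (measure (translate x W)) k A" by (rule ffact_count_translate[symmetric]) (use w A in \<open>simp_all add: bbs_borel\<close>)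
   finally show ?thesis using ffact_count_append[of "measure W" k l H] disj by (simp add: Hk)
  qed
  have i: "integrable P (%W. ffact_count (measure (translate x W)) k A*ffact_count (measure W) l B)"
  proof (rule integrable_cong[THEN iffD1, OF refl])
   show "integrable P (%W. ffact_count (measure W) (k + l) H)" by (rule ffact_integrable) (rule H)
  qed (rule prod)
  have "(LINT W|P. ffact_count (measure (translate x W)) k A*ffact_count (measure W) l B) = (LINT W|P. ffact_count (measure W) (k + l) H)"
   by (rule integral_cong[OF refl prod[symmetric]])
  also have "... = m (k + l) H" by (rule ffact_expect[OF H])
  finally have e: "(LINT W|P. ffact_count (measure (translate x W)) k A*ffact_count (measure W) l B) = m (k + l) H" .
  have mk: "m k H = m k A"
  proof -
   have "PiE {..<k} H = PiE {..<k} (%j. (+) x -` A j)" by (rule PiE_cong) (simp add: H_def)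
   then have "m k H = m k (%j. (+) x -` A j)" unfolding m_def by simp
   also have "... = m k A" by (rule m_translate[OF A])
   finally show ?thesis .
  qed
  have ml: "m l (%j. H (k + j)) = m l B" by (simp only: Hk)
  have "covP (%W. ffact_count (measure W) k A) (%W. ffact_count (measure W) l B) x = m (k + l) H - m k H*m l (%j. H (k + j))"
   unfolding covP_def mk ml by (simp only: e ffact_expect[OF A] ffact_expect[OF B])
  moreover have "\<bar>m (k + l) H - m k H*m l (%j. H (k + j))\<bar> <= fact (k + l)*real k*real l*L^(k + l)*kb (2*r) x"
  proof (rule m_block[OF H L _ kb_nonneg])
   fix h assume h: "h < k + l"
   have b: "vol D <= vol (ball (0::'a) r)" if "D : bbs" "D <= ball 0 r" for D :: "'a set"
    by (rule measure_mono_fmeasurable) (use that emeasure_bounded_finite[of "ball (0::'a) r"] in \<open>auto simp: bbs_def fmeasurable_def less_top\<close>)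
   show "vol (H h) <= L"
   proof (cases "h < k")
    case True
    have "A h <= ball 0 r" using r(2) True by auto
    then have "vol (A h) <= vol (ball (0::'a) r)" by (rule b[OF A[OF True]])
     then show ?thesis using True measure_lborel_vimage_plus[OF A[OF True], of x] by (simp add: H_def L_def)
   next
    case False
    then have h': "h - k < l" using h by simp
    then have "B (h - k) <= ball 0 r" using r(2) by auto
    then show ?thesis using b[OF B[OF h']] False by (simp add: H_def L_def)
   qed
  next
   fix i j b assume ij: "i < k" "j < l" "b : H (k + j)"
   have "b : ball 0 r" "A i <= ball 0 r" using ij r(2) by (auto simp: Hk)
   then show "(NN y. ennreal (k2 (y - b))*ind (H i) y) <= ennreal (kb (2*r) x)" using kb_bound[OF A[OF ij(1)], of r b x] ij(1) by (simp add: H_def)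
  qed
  ultimately show ?thesis using i by (simp add: C_def)
 qed
 show ?thesis unfolding decor_def by (rule exI[of _ "2*r"], rule exI[of _ C]) (use main L in \<open>simp add: C_def\<close>)
qed

lemma decorI:
 assumes "C >= 0" "!!x. norm x > r ==> integrable P (%W. F (translate x W)*G W)" "!!x. norm x > r ==> \<bar>covP F G x\<bar> <= C*kb r x"
 shows "decor F G" unfolding decor_def by (rule exI[of _ r], rule exI[of _ C]) (use assms in simp)

lemma decor_add:
 assumes 1: "decor F G" "decor F' G'" and i: "!!x W. F'' (translate x W)*G'' W = F (translate x W)*G W + F' (translate x W)*G' W"
  and e: "(LINT W|P. F'' W)*(LINT W|P. G'' W) = (LINT W|P. F W)*(LINT W|P. G W) + (LINT W|P. F' W)*(LINT W|P. G' W)"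
 shows "decor F'' G''"
proof -
 obtain r C where 1: "C >= 0" "ALL x. norm x > r --> integrable P (%W. F (translate x W)*G W) & \<bar>covP F G x\<bar> <= C*kb r x"
  using 1(1) unfolding decor_def by auto
 obtain r' C' where 2: "C' >= 0" "ALL x. norm x > r' --> integrable P (%W. F' (translate x W)*G' W) & \<bar>covP F' G' x\<bar> <= C'*kb r' x"
  using assms(2) unfolding decor_def by auto
 show ?thesis
 proof (rule decorI[of "C + C'" "max r r'"])
  fix x :: 'a assume x: "norm x > max r r'"
  have a: "integrable P (%W. F (translate x W)*G W)" "\<bar>covP F G x\<bar> <= C*kb r x" using 1(2) x by auto
  have b: "integrable P (%W. F' (translate x W)*G' W)" "\<bar>covP F' G' x\<bar> <= C'*kb r' x" using 2(2) x by auto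
  show "integrable P (%W. F'' (translate x W)*G'' W)" unfolding i by (rule integrable_add[OF a(1) b(1)])
  have "covP F'' G'' x = covP F G x + covP F' G' x" unfolding covP_def i e using integral_add[OF a(1) b(1)] by simp
  moreover have "C*kb r x <= C*kb (max r r') x" "C'*kb r' x <= C'*kb (max r r') x" using 1(1) 2(1) by (intro mult_left_mono kb_mono; simp)+
  ultimately show "\<bar>covP F'' G'' x\<bar> <= (C + C')*kb (max r r') x" using a(2) b(2) by (simp add: distrib_right)
 qed (use 1 2 in simp)
qed

lemma decor_cmult:
 assumes 1: "decor F G" and i: "!!x W. F'' (translate x W)*G'' W = c*(F (translate x W)*G W)"
  and e: "(LINT W|P. F'' W)*(LINT W|P. G'' W) = c*((LINT W|P. F W)*(LINT W|P. G W))"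
 shows "decor F'' G''"
proof -
 obtain r C where 1: "C >= 0" "ALL x. norm x > r --> integrable P (%W. F (translate x W)*G W) & \<bar>covP F G x\<bar> <= C*kb r x"
  using 1(1) unfolding decor_def by auto
 show ?thesis
 proof (rule decorI[of "\<bar>c\<bar>*C" r])
  fix x :: 'a assume x: "norm x > r"
  have a: "integrable P (%W. F (translate x W)*G W)" "\<bar>covP F G x\<bar> <= C*kb r x" using 1(2) x by auto
  show "integrable P (%W. F'' (translate x W)*G'' W)" unfolding i by (rule integrable_mult_right) (rule a)
  have "covP F'' G'' x = c*covP F G x" unfolding covP_def i e by (simp add: right_diff_distrib)
  then show "\<bar>covP F'' G'' x\<bar> <= \<bar>c\<bar>*C*kb r x" using mult_left_mono[OF a(2), of "\<bar>c\<bar>"] by (simp add: abs_mult mult.assoc)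
 qed (use 1 in simp)
qed

lemma decor_ffspan:
 assumes F: "F : ffspan" and G: "G : ffspan" shows "decor F G" using F
proof (induction rule: ffspan.induct)
 case (ffspan_base k A)
 note A = ffspan_base
 show ?case using G
 proof (induction rule: ffspan.induct)
  case (ffspan_base l B)
  then show ?case using A by (intro decor_base RR_bbs)
 next
  case (ffspan_add v w)
  show ?case by (rule decor_add[OF ffspan_add.IH])
   (simp_all add: distrib_left ffspan_integrable[OF ffspan_add.hyps(1)] ffspan_integrable[OF ffspan_add.hyps(2)])
 next
  case (ffspan_cmult v c)
  show ?case by (rule decor_cmult[OF ffspan_cmult.IH, of _ _ c]) (simp_all)
 qed
next
 case (ffspan_add v w)
 show ?case by (rule decor_add[OF ffspan_add.IH])
  (simp_all add: distrib_right ffspan_integrable[OF ffspan_add.hyps(1)] ffspan_integrable[OF ffspan_add.hyps(2)])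
next
 case (ffspan_cmult v c)
 show ?case by (rule decor_cmult[OF ffspan_cmult.IH, of _ _ c]) (simp_all)
qed

text \<open>\<open>kb\<close> enlarged by a bump near the origin, so that one integrable function
  bounds covariances at all distances.\<close>

definition kc :: "real => 'a => real" where "kc r x = kb r x + ind (ball 0 r) x"

lemma kc_nonneg: "kc r x >= 0" using kb_nonneg[of r x] by (simp add: kc_def)

lemma k2_measurable [measurable]: "k2 : BM borel" by (rule borel_measurable_continuous_onI) (rule k_cont)

lemma ball_ind_measurable [measurable]: "ind (ball 0 r) : BM (borel :: 'a measure)" by (rule borel_measurable_indicator) simp

lemma kb_ker_measurable:
 "(%(x, y). k2 (x + y)*ind (ball 0 r) y) : BM (borel \<Otimes>\<^sub>M borel)"
proof -
 have "(%z. k2 (fst z + snd z)) : BM (borel \<Otimes>\<^sub>M borel)" by measurable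
 moreover have "(%z. ind (ball 0 r) (snd z)) : BM ((borel :: 'a measure) \<Otimes>\<^sub>M (borel :: 'a measure))"
  by (rule measurable_compose[OF measurable_snd ball_ind_measurable])
 ultimately have "(%z. k2 (fst z + snd z)*ind (ball 0 r) (snd z)) : BM (borel \<Otimes>\<^sub>M borel)" by (rule borel_measurable_times)
 then show ?thesis by (simp only: split_def)
qed

lemma kb_measurable [measurable]: "kb r : BM borel"
proof -
 have "(%x. (LBINT y. k2 (x + y)*ind (ball 0 r) y)) : BM borel"
  by (rule lborel.borel_measurable_lebesgue_integral) (use kb_ker_measurable[of r] in \<open>simp cong: measurable_cong_sets\<close>)
 then show ?thesis unfolding kb_def[abs_def] .
qed

lemma kc_measurable [measurable]: "kc r : BM borel" unfolding kc_def[abs_def] by (intro borel_measurable_add kb_measurable ball_ind_measurable)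

lemma kb_alt: "kb r x = (LBINT y. k2 y*ind (ball x r) y)"
proof -
 have "kb r x = (LBINT y. k2 (x + (y - x))*ind (ball 0 r) (y - x))" unfolding kb_def
  using integral_lborel_translate[of "%y. k2 (x + y)*ind (ball 0 r) y" "- x"] borel_measurable_integrable[OF kb_integrable[of x r]] by simp
 then show ?thesis by (simp add: indicator_def dist_norm norm_minus_commute)
qed

lemma kc_integrable: "integrable lborel (kc r)"
proof -
 have em: "(%(x, y). ennreal (k2 (x + y)*ind (ball 0 r) y)) : BM (lborel \<Otimes>\<^sub>M lborel)"
  using measurable_compose[OF kb_ker_measurable[of r] measurable_ennreal] by (simp add: split_def cong: measurable_cong_sets)
 have i: "(NN x. ennreal (k2 (x + y)*ind (ball 0 r) y)) = ennreal (LBINT x. k2 x)*ind (ball 0 r) y" for y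
 proof -
  have "(NN x. ennreal (k2 (x + y))) = (NN x. ennreal (k2 x))" using nn_integral_lborel_translate[of "%x. ennreal (k2 x)" y] by (simp add: add.commute)
  also have "... = ennreal (LBINT x. k2 x)" by (rule nn_integral_eq_integral[OF k_integrable]) simp
  finally show ?thesis by (simp add: indicator_def)
 qed
 have "(NN x. ennreal (kb r x)) = (NN x. (NN y. ennreal (k2 (x + y)*ind (ball 0 r) y)))"
  unfolding kb_def by (intro nn_integral_cong nn_integral_eq_integral[OF kb_integrable, symmetric]) simp
 also have "... = (NN y. (NN x. ennreal (k2 (x + y)*ind (ball 0 r) y)))" by (rule lborel_pair.Fubini'[OF em, symmetric])
 also have "... = (NNI (lborel :: 'a measure) (%y. ennreal (LBINT x. k2 x)*ind (ball 0 r) y))" by (simp only: i)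
 also have "... = ennreal (LBINT x. k2 x)*emeasure lborel (ball (0::'a) r)" by (rule nn_integral_cmult_indicator) simp
 also have "... < \<infinity>" using emeasure_bounded_finite[of "ball (0::'a) r"] by (simp add: ennreal_mult_less_top)
 finally have "integrable lborel (kb r)" by (intro integrableI_bounded) (auto simp: kb_nonneg)
 moreover have "integrable lborel (ind (ball (0::'a) r) :: 'a => real)"
  using emeasure_bounded_finite[of "ball (0::'a) r"] by (intro integrable_real_indicator) auto
 ultimately show ?thesis unfolding kc_def[abs_def] by (rule integrable_add)
qed

text \<open>Moving the argument by \<open>d\<close> is absorbed by enlarging the radius by
  \<open>d\<close>. This lets values at lattice points be compared with integrals over
  cells.\<close>

lemma kc_shift: assumes "norm (x - z) <= d" shows "kc r z <= kc (r + d) x"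
proof -
 have s: "ball z r <= ball x (r + d)"
 proof
  fix y assume "y : ball z r"
  then show "y : ball x (r + d)" using assms dist_triangle[of x y z] by (simp add: dist_norm)
 qed
 have int: "integrable lborel (%y. k2 y*ind (ball v t) y)" for v :: 'a and t
  using integrable_mult_indicator[OF _ k_integrable, of "ball v t"] by (simp add: mult.commute)
 have "kb r z <= kb (r + d) x" unfolding kb_alt by (intro integral_mono int) (use s in \<open>auto simp: indicator_def\<close>)
 moreover have "ind (ball 0 r) z <= (ind (ball 0 (r + d)) x :: real)" using assms norm_triangle_ineq2[of x z] by (auto simp: indicator_def)
 ultimately show ?thesis by (simp add: kc_def)
qed

lemma kc_mono: "r <= s ==> kc r x <= kc s x" using kc_shift[of x x "s - r" r] by simp

text \<open>Far from the origin this is \<open>decor\<close>. Near it, stationarity and |ab| <= a^2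
  + b^2 give a bound by second moments, and there the indicator in \<open>kc\<close> equals
  1.\<close>

theorem cov_bound:
 assumes F: "F : polys" and G: "G : polys"
 shows "EX r C. r >= 0 & C >= 0 & (ALL x. \<bar>covP F G x\<bar> <= C*kc r x)"
proof -
 obtain r C where 1: "C >= 0" "ALL x. norm x > r --> integrable P (%W. F (translate x W)*G W) & \<bar>covP F G x\<bar> <= C*kb r x"
  using decor_ffspan[OF polys_subset_ffspan[OF F] polys_subset_ffspan[OF G]] unfolding decor_def by auto
 have FF: "(%W. F W*F W) : polys" and GG: "(%W. G W*G W) : polys" by (rule polys.polys_mult F G)+
 define D where "D = (LINT W|P. F W*F W) + (LINT W|P. G W*G W) + \<bar>(LINT W|P. F W)\<bar>*\<bar>(LINT W|P. G W)\<bar>"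
 have D: "D >= 0" unfolding D_def by (intro add_nonneg_nonneg integral_nonneg) auto
 have b: "\<bar>covP F G x\<bar> <= D" for x
 proof -
  obtain F' where F': "F' : polys" "ALL W:PM. F (translate x W) = F' W" using polys_translate[OF F] by auto
  have e: "(LINT W|P. F (translate x W)*G W) = (LINT W|P. F' W*G W)" by (rule integral_cong) (use F'(2) in auto)
  have f: "(LINT W|P. F' W*F' W) = (LINT W|P. F W*F W)"
  proof -
   have "(LINT W|P. F' W*F' W) = (LINT W|P. F (translate x W)*F (translate x W))" by (rule integral_cong) (use F'(2) in auto)
   then show ?thesis using integral_translate_P[OF polys_measurable[OF FF], of x] by simp
  qed
  have i: "integrable P (%W. F' W*F' W)" "integrable P (%W. G W*G W)" "integrable P (%W. F' W*G W)" by (rule polys_integrable_P polys.polys_mult F' G)+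
  have "\<bar>(LINT W|P. F' W*G W)\<bar> <= (LINT W|P. \<bar>F' W*G W\<bar>)" by (rule integral_abs_bound)
  also have "... <= (LINT W|P. F' W*F' W + G W*G W)"
  proof (rule integral_mono)
   show "\<bar>F' W*G W\<bar> <= F' W*F' W + G W*G W" for W
    using sum_squares_bound[of "F' W" "G W"] sum_squares_bound[of "F' W" "- G W"] zero_le_square[of "F' W"] zero_le_square[of "G W"]
    by (simp add: abs_le_iff power2_eq_square)
  qed (intro integrable_abs integrable_add i)+
  also have "... = (LINT W|P. F W*F W) + (LINT W|P. G W*G W)" using integral_add[OF i(1,2)] f by simp
  finally show ?thesis unfolding covP_def D_def e using abs_triangle_ineq4[of "(LINT W|P. F' W*G W)" "(LINT W|P. F W)*(LINT W|P. G W)"] by (simp add: abs_mult)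
 qed
 have "\<bar>covP F G x\<bar> <= (C + D)*kc (\<bar>r\<bar> + 1) x" for x
 proof (cases "norm x > r")
  case True
  have "\<bar>covP F G x\<bar> <= C*kb r x" using 1(2) True by simp
  also have "... <= C*kc r x" using 1(1) by (intro mult_left_mono) (auto simp: kc_def)
  also have "... <= (C + D)*kc (\<bar>r\<bar> + 1) x" using 1(1) D by (intro mult_mono kc_mono kc_nonneg) auto
  finally show ?thesis .
 next
  case False
  then have "kc (\<bar>r\<bar> + 1) x >= 1" using kb_nonneg[of "\<bar>r\<bar> + 1" x] by (simp add: kc_def)
  then have "(C + D)*1 <= (C + D)*kc (\<bar>r\<bar> + 1) x" using 1(1) D by (intro mult_left_mono) auto
  moreover have "\<bar>covP F G x\<bar> <= (C + D)*1" using b[of x] 1(1) by simp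
  ultimately show ?thesis by (rule order_trans[rotated])
 qed
 then show ?thesis using 1(1) D by (intro exI[of _ "\<bar>r\<bar> + 1"] exI[of _ "C + D"]) simp
qed

end

text \<open>Replacing the argument by a simple function turns the integral into a finite weighted
  sum; in this way positive definiteness, a statement on finite sums, reaches double
  integrals.\<close>

lemma simple_range_integral:
 fixes s :: "'a::euclidean_space => 'a" and g \<phi> :: "'a => real"
 assumes s: "simple_function lborel s" and g: "integrable lborel g"
 shows "(LBINT x. g x*\<phi> (s x)) = (SUM u:range s. (LBINT x. g x*ind (s -` {u}) x)*\<phi> u)"
proof -
 have fin: "finite (range s)" using simple_functionD(1)[OF s] by simp
 have S: "s -` {u} : sets borel" for u using simple_functionD(2)[OF s, of "{u}"] by simp
 have i: "integrable lborel (%x. g x*ind (s -` {u}) x*\<phi> u)" for u using integrable_mult_indicator[OF _ g, of "s -` {u}"] S by (simp add: mult.commute)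
 have "g x*\<phi> (s x) = (SUM u:range s. g x*ind (s -` {u}) x*\<phi> u)" for x
 proof -
  have "(SUM u:range s. g x*ind (s -` {u}) x*\<phi> u) = (SUM u:{s x}. g x*ind (s -` {u}) x*\<phi> u)"
   by (rule sum.mono_neutral_right[OF fin]) auto
  then show ?thesis by simp
 qed
 then have "(LBINT x. g x*\<phi> (s x)) = (LBINT x. (SUM u:range s. g x*ind (s -` {u}) x*\<phi> u))" by presburger
 also have "... = (SUM u:range s. (LBINT x. g x*ind (s -` {u}) x*\<phi> u))" by (rule integral_sum) (rule i)
 finally show ?thesis by simp
qed

section \<open>Spectral densities\<close>

text \<open>\<open>H_pd\<close> has real coefficients, matching covariance functions of real
  observables; evenness enters as a separate hypothesis of \<open>bochner_L1\<close>.\<close>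

locale pos_def_kernel =
 fixes H :: "'a::euclidean_space => real" and B :: real
 assumes H_cont: "continuous_on UNIV H" and H_bound: "!!x. \<bar>H x\<bar> <= B"
  and H_pd: "!!S (a :: 'a => real). finite S ==> 0 <= (SUM u:S. SUM v:S. a u*a v * H (u - v))"
  and H_int: "integrable lborel H"
begin

lemma H_measurable [measurable]: "H : BM borel" by (rule borel_measurable_continuous_onI[OF H_cont])

text \<open>Simple functions \<open>s i\<close> approximate the identity map. With the arguments
  replaced by their values, the double integral is a finite quadratic form and hence nonnegative;
  boundedness and continuity of \<open>H\<close> justify the limit.\<close>

lemma double_nonneg:
 assumes g: "integrable lborel g"
 shows "0 <= (LBINT x. g x*(LBINT y. g y*H (x - y)))"
proof -
 have "id : BM (lborel :: 'a measure)" by simp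
 then obtain s :: "nat => 'a => 'a" where s: "!!i. simple_function lborel (s i)" "!!x. (%i. s i x) ~~> x"
  using borel_measurable_implies_sequence_metric[of id lborel 0] by auto
 have [measurable]: "s i : BM borel" for i using borel_measurable_simple_function[OF s(1)[of i]] by simp
 have [measurable]: "g : BM borel" using borel_measurable_integrable[OF g] by simp
 have B: "B >= 0" using H_bound[of 0] by linarith
 define w where "w i u = (LBINT x. g x*ind (s i -` {u}) x)" for i u
 define J where "J i x = (LBINT y. g y*H (s i x - s i y))" for i x
 have Jsum: "J i x = (SUM v:range (s i). w i v * H (s i x - v))" for i x unfolding J_def w_def by (rule simple_range_integral[OF s(1) g])
 have [measurable]: "J i : BM borel" for i unfolding Jsum[abs_def] by measurable
 have dom: "integrable lborel (%y. B*\<bar>g y\<bar>)" using g by auto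
 have gB: "\<bar>g y*H z\<bar> <= B*\<bar>g y\<bar>" for y z using mult_left_mono[OF H_bound[of z], of "\<bar>g y\<bar>"] by (simp add: abs_mult mult.commute)
 have cH: "isCont H z" for z using H_cont by (simp add: continuous_on_eq_continuous_at)
 have Jlim: "(%i. J i x) ~~> (LBINT y. g y*H (x - y))" for x unfolding J_def
 proof (rule integral_dominated_convergence[OF _ _ dom])
  show "AE y in lborel. (%i. g y*H (s i x - s i y)) ~~> g y*H (x - y)"
   by (intro AE_I2 tendsto_mult tendsto_const isCont_tendsto_compose[OF cH] tendsto_diff s(2))
 qed (use gB in auto)
 define C where "C = B*(LBINT y. \<bar>g y\<bar>)"
 have Jb: "\<bar>J i x\<bar> <= C" for i x
 proof -
  have "\<bar>J i x\<bar> <= (LBINT y. \<bar>g y*H (s i x - s i y)\<bar>)" unfolding J_def by (rule integral_abs_bound)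
  also have "... <= (LBINT y. B*\<bar>g y\<bar>)" by (rule integral_mono[OF _ dom gB], rule integrable_bound[OF dom]) (use gB B in auto)
  finally show ?thesis by (simp add: C_def)
 qed
 have "(%i. (LBINT x. g x*J i x)) ~~> (LBINT x. g x*(LBINT y. g y*H (x - y)))"
 proof (rule integral_dominated_convergence[where w = "%x. C*\<bar>g x\<bar>"])
  show "AE x in lborel. (%i. g x*J i x) ~~> g x*(LBINT y. g y*H (x - y))" by (intro AE_I2 tendsto_mult tendsto_const Jlim)
  show "AE x in lborel. norm (g x*J i x) <= C*\<bar>g x\<bar>" for i
   using mult_left_mono[OF Jb, of "\<bar>g _\<bar>"] by (intro AE_I2) (simp add: abs_mult mult.commute)
  show "integrable lborel (%x. C*\<bar>g x\<bar>)" using g by auto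
 qed measurable
 moreover have "0 <= (LBINT x. g x*J i x)" for i
 proof -
  have "(LBINT x. g x*J i x) = (LBINT x. g x*(%u. SUM v:range (s i). w i v * H (u - v)) (s i x))" by (simp only: Jsum)
  also have "... = (SUM u:range (s i). w i u*(SUM v:range (s i). w i v * H (u - v)))" unfolding w_def by (rule simple_range_integral[OF s(1) g])
  also have "... = (SUM u:range (s i). SUM v:range (s i). w i u*w i v * H (u - v))" by (simp add: sum_distrib_left mult.assoc)
  also have "... >= 0" using simple_functionD(1)[OF s(1)[of i]] by (intro H_pd) simp
  finally show ?thesis .
 qed
 ultimately show ?thesis by (rule LIMSEQ_le_const[OF _ exI[of _ 0], rule_format])
qed

text \<open>The parallelogram identity centred at w/2 separates the product of two Gaussians into a
  factor in \<open>w\<close> and a shifted Gaussian in \<open>x\<close>.\<close>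

lemma gauss_product:
 "gauss e x*gauss e (x - w) = gauss (e/2) w*gauss (2*e) (- (w /\<^sub>R 2) + (x::'a))"
proof -
 have "(norm x)^2 + (norm (x - w))^2 = (norm w)^2/2 + 2*(norm (- (w /\<^sub>R 2) + x))^2"
  unfolding power2_norm_eq_inner by (simp add: inner_simps inner_commute)
 then have "pi*e*((norm x)^2 + (norm (x - w))^2) = pi*e*((norm w)^2/2 + 2*(norm (- (w /\<^sub>R 2) + x))^2)" by simp
 then show ?thesis unfolding gauss_def mult_exp_exp by (simp add: algebra_simps)
qed

text \<open>\<open>double_nonneg\<close> with a Gaussian weight. In difference coordinates the
  integral over x is explicit by \<open>gauss_product\<close> and leaves a positive constant times
  the damped integral of \<open>H\<close>.\<close>

lemma integral_gauss_nonneg: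
 assumes e: "e > 0" shows "0 <= (LBINT w. H w*gauss (e/2) w)"
proof -
 let ?g = "gauss e :: 'a => real"
 let ?h = "%x w. ?g x*?g (x - w)*H w"
 have g: "integrable lborel ?g" by (rule integrable_gauss[OF e])
 have "0 <= (LBINT x. ?g x*(LBINT y. ?g y*H (x - y)))" by (rule double_nonneg[OF g])
 also have "... = (LBINT x. (LBINT w. ?h x w))"
 proof (intro integral_cong refl)
  fix x :: 'a
  have "(LBINT w. ?g (x - w)*H w) = (LBINT w. ?g (x - - w)*H (- w))" by (rule integral_lborel_uminus[symmetric]) measurable
  also have "... = (LBINT w. (%y. ?g y*H (x - y)) (x + w))" by simp
  also have "... = (LBINT y. ?g y*H (x - y))" by (rule integral_lborel_translate) measurable
  finally show "?g x*(LBINT y. ?g y*H (x - y)) = (LBINT w. ?h x w)" by (simp add: mult.assoc)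
 qed
 also have "... = (LBINT w. (LBINT x. ?h x w))"
 proof (rule lborel_pair.Fubini_integral[symmetric])
  have "integrable (lborel \<Otimes>\<^sub>M lborel) (%(x, w). cr (?g x)*cr (H w))"
   by (intro integrable_pair_mult lborel.sigma_finite_measure_axioms integrable_of_real g H_int)
  then show "integrable (lborel \<Otimes>\<^sub>M lborel) (%(x, w). ?h x w)"
  proof (rule integrable_bound)
   show "AE z in lborel \<Otimes>\<^sub>M lborel. norm (case z of (x, w) => ?h x w) <= norm (case z of (x, w) => cr (?g x)*cr (H w))"
    using e gauss_le_1[of e] by (intro AE_I2) (auto simp: abs_mult norm_mult intro!: mult_left_mono mult_left_le_one_le)
  qed measurable
 qed
 also have "... = (LBINT w. (1 / sqrt (2*e))^DIM('a)*(H w*gauss (e/2) w))"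
 proof (intro integral_cong refl)
  fix w :: 'a
  have "(LBINT x. ?h x w) = (LBINT x. (H w*gauss (e/2) w)*gauss (2*e) (- (w /\<^sub>R 2) + x))" by (simp only: gauss_product mult_ac)
  also have "... = (H w*gauss (e/2) w)*(LBINT x. gauss (2*e) (- (w /\<^sub>R 2) + x))" by simp
  also have "(LBINT x. gauss (2*e) (- (w /\<^sub>R 2) + x)) = (1 / sqrt (2*e))^DIM('a)" using e by (subst integral_lborel_translate) (simp_all add: integral_gauss)
  finally show "(LBINT x. ?h x w) = (1 / sqrt (2*e))^DIM('a)*(H w*gauss (e/2) w)" by (simp only: mult_ac)
 qed
 also have "... = (1 / sqrt (2*e))^DIM('a)*(LBINT w. H w*gauss (e/2) w)" by simp
 finally have "0 <= (1 / sqrt (2*e))^DIM('a)*(LBINT w. H w*gauss (e/2) w)" .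
 moreover have "(1 / sqrt (2*e))^DIM('a) > 0" using e by simp
 ultimately show ?thesis by (simp only: zero_le_mult_iff)  linarith
qed

lemma integral_H_nonneg: "0 <= (LBINT w. H w)"
proof (rule LIMSEQ_le_const)
 let ?e = "%n. inverse (real (Suc n))/2"
 have e0: "?e ~~> 0" using tendsto_divide[OF inverse_Suc_tendsto tendsto_const[of 2]] by simp
 show "(%n. (LBINT w. H w*gauss (?e n) w)) ~~> (LBINT w. H w)"
 proof (rule integral_dominated_convergence[where w = "%x. \<bar>H x\<bar>"])
  have "(%n. H w*gauss (?e n) w) ~~> H w*1" for w by (intro tendsto_mult tendsto_const gauss_tendsto_1[OF e0])
  then show "AE w in lborel. (%n. H w*gauss (?e n) w) ~~> H w" by simp
  show "AE w in lborel. norm (H w*gauss (?e n) w) <= \<bar>H w\<bar>" for n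
   using gauss_le_1[of "?e n"] by (intro AE_I2) (auto simp: abs_mult intro!: mult_right_le_one_le)
 qed (use H_int in auto)
 show "EX N. ALL n>=N. 0 <= (LBINT w. H w*gauss (?e n) w)" by (intro exI[of _ 0] allI impI integral_gauss_nonneg) simp
qed

end

text \<open>The addition theorem splits the cosine of a difference into products of cosines and of
  sines, so the quadratic form is the sum of two forms for \<open>C\<close> with modified
  weights.\<close>

lemma pos_def_cos:
 fixes t :: "'a::euclidean_space"
 assumes "pos_def_kernel C B" shows "pos_def_kernel (%x. C x*cos (ph x t)) B"
proof -
 interpret pos_def_kernel C B by fact
 show ?thesis
 proof
  show "continuous_on UNIV (%x. C x*cos (ph x t))" by (intro continuous_intros H_cont)
  have b: "\<bar>C x*cos (ph x t)\<bar> <= \<bar>C x\<bar>" for x by (auto simp: abs_mult intro!: mult_right_le_one_le abs_cos_le_one)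
  then show "\<bar>C x*cos (ph x t)\<bar> <= B" for x using H_bound[of x] order_trans by blast
  show "integrable lborel (%x. C x*cos (ph x t))" by (rule integrable_bound[OF H_int]) (use b in auto)
  fix S :: "'a set" and a :: "'a => real" assume S: "finite S"
  let ?c = "%u. a u*cos (ph u t)" and ?s = "%u. a u * sin (ph u t)"
  have "a u*a v * (C (u - v)*cos (ph (u - v) t)) = ?c u*?c v * C (u - v) + ?s u*?s v * C (u - v)" for u v
   unfolding inner_diff_left right_diff_distrib cos_diff by (simp add: algebra_simps)
  then have "(SUM u:S. SUM v:S. a u*a v * (C (u - v)*cos (ph (u - v) t)))
   = (SUM u:S. SUM v:S. ?c u*?c v * C (u - v)) + (SUM u:S. SUM v:S. ?s u*?s v * C (u - v))" by (simp only: sum.distrib)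
  also have "... >= 0" by (intro add_nonneg_nonneg H_pd S)
  finally show "0 <= (SUM u:S. SUM v:S. a u*a v * (C (u - v)*cos (ph (u - v) t)))" .
 qed
qed

definition cos_transform :: "('a::euclidean_space => real) => 'a => real" where
 "cos_transform C t = (LBINT x. C x*cos (ph x t))"

lemma fourier_even:
 assumes C: "integrable lborel C" and even: "!!x. C (- x) = C x"
 shows "fourier (%x. cr (C x)) t = cr (cos_transform C t)"
proof -
 note [measurable] = borel_measurable_integrable[OF C, simplified]
 let ?s = "%x. C x * sin (ph x t)"
 have i: "integrable lborel (%x. C x*cos (ph x t))" "integrable lborel ?s"
  by (rule integrable_bound[OF C]; auto simp: abs_mult intro!: mult_right_le_one_le)+
 have "(LBINT x. ?s x) = (LBINT x. ?s (- x))" by (rule integral_lborel_uminus[symmetric]) measurable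
 also have "... = - (LBINT x. ?s x)" by (simp add: even)
 finally have s: "(LBINT x. ?s x) = 0" by simp
 have "fourier (%x. cr (C x)) t = (LBINT x. cr (C x*cos (ph x t)) - \<i>*cr (?s x))"
  unfolding fourier_cis by (intro integral_cong refl) (simp add: complex_eq_iff)
 also have "... = (LBINT x. cr (C x*cos (ph x t))) - (LBINT x. \<i>*cr (?s x))"
  by (intro integral_diff integrable_mult_right integrable_of_real i)
 also have "... = cr (cos_transform C t)" unfolding cos_transform_def integral_mult_right_zero integral_complex_of_real s by simp
 finally show ?thesis .
qed

text \<open>Bochner's theorem for integrable kernels with an explicit density: nonnegative by
  \<open>integral_H_nonneg\<close> after \<open>pos_def_cos\<close>, integrable by
  \<open>integrable_nonneg_fourier\<close>, and the representation is Fourier inversion.\<close>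

theorem bochner_L1:
 assumes "pos_def_kernel C B" and even: "!!x. C (- x) = C x"
 shows "!!t. cos_transform C t >= 0" and "integrable lborel (cos_transform C)"
  and "cr (C x) = (LBINT t. cr (cos_transform C t)*cis (ph x t))"
proof -
 interpret pos_def_kernel C B by fact
 show nn: "!!t. cos_transform C t >= 0" unfolding cos_transform_def by (rule pos_def_kernel.integral_H_nonneg[OF pos_def_cos[OF assms(1)]])
 let ?f = "%x. cr (C x)"
 have f: "integrable lborel ?f" using H_int by simp
 have c: "isCont ?f y" for y using H_cont by (simp add: continuous_on_eq_continuous_at continuous_intros)
 have b: "norm (?f x) <= B" for x using H_bound by simp
 have F: "fourier ?f t = cr (cos_transform C t)" for t by (rule fourier_even[OF H_int even])
 have fi: "integrable lborel (fourier ?f)" by (rule integrable_nonneg_fourier[OF f b c F nn])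
 then show "integrable lborel (cos_transform C)" by (simp add: F[abs_def] complex_of_real_integrable_eq)
 show "cr (C x) = (LBINT t. cr (cos_transform C t)*cis (ph x t))"
  using fourier_inversion[OF f b c fi, of x] by (simp add: F inner_commute)
qed

section \<open>Continuity of correlations and spectral measures of polynomials\<close>

lemma translate_translate:
 "W : PM ==> translate x (translate y W) = translate (x + y) W" by (rule measure_eqI)
  (simp_all add: emeasure_translate translate_space vimage_plus_borel vimage_def add.assoc add.left_commute[of y])

lemma translate_0: "W : PM ==> translate 0 W = W"
 by (rule measure_eqI) (simp_all add: point_measuresD(1) emeasure_translate vimage_def)

lemma frontier_RR:
 assumes "A : RR" shows "frontier A : bbs" "vol (frontier A) = 0"
proof -
 have c: "convex A" "bounded A" using assms by (auto simp: RR_def bbs_def)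
 then have "compact (frontier A)" by (simp add: compact_frontier_bounded)
 then show "frontier A : bbs" by (simp add: bbs_def compact_imp_bounded compact_imp_closed)
 have "negligible (frontier A)" by (rule negligible_convex_frontier[OF c(1)])
 then have "frontier A : null_sets lborel" by (auto simp: null_sets_completion_iff negligible_iff_null_sets)
 then show "vol (frontier A) = 0" by (simp add: null_setsD1 measure_def)
qed

text \<open>The indicator of \<open>A\<close> at a translated point can fail to converge only if the
  limit of that point lies on the frontier, which hypothesis \<open>n\<close> excludes; the
  translations are bounded, so the indicator of one ball dominates.\<close>

lemma count_continuous:
 assumes w: "W : PM" and A: "A : RR" and X: "X ~~> x"
  and n: "measure W ((+) x -` frontier A) = 0"
 shows "(%n. measure (translate (X n) W) A) ~~> measure (translate x W) A"
proof -
 note p = point_measuresD[OF w]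
 have Ab: "A : sets borel" "bounded A" using A by (auto simp: RR_def bbs_def)
 have N: "(+) x -` frontier A : bbs" by (rule bbs_vimage_plus[OF frontier_RR(1)[OF A]])
 then have "emeasure W ((+) x -` frontier A) = 0" using n p(5) by (simp add: bbs_def)
 then have ae: "AE p in W. x + p ~: frontier A" using N p(1) by (intro AE_I[of _ _ "(+) x -` frontier A"]) (auto simp: p(2) bbs_def)
 obtain M where M: "!!n. norm (X n) <= M" using convergent_imp_Bseq[OF convergentI[OF X]] by (auto elim!: BseqE)
 obtain r where r: "A <= ball 0 r" using Ab(2) bounded_subset_ballD by blast
 have m: "measure (translate y W) A = (LINT p|W. ind A (y + p))" for y
 proof -
  have "(%p. ind A (y + p) :: real) = ind ((+) y -` A)" by (auto simp: indicator_def)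
  then show ?thesis using measure_translate[OF w Ab(1), of y] by (simp add: p(2))
 qed
 have im: "(%p. ind A (y + p) :: real) : BM W" for y
 proof -
  have "(%p. ind A (y + p) :: real) : BM borel" by (rule measurable_compose[OF _ borel_measurable_indicator[OF Ab(1)]]) measurable
  then show ?thesis using p(1) by (simp cong: measurable_cong_sets)
 qed
 show ?thesis unfolding m
 proof (rule integral_dominated_convergence[OF im im])
  have "ball (0::'a) (r + M) : sets W" by (simp add: p(1))
  then show "integrable W (ind (ball 0 (r + M)) :: 'a => real)" using p(3)[of "ball 0 (r + M)"] by (intro integrable_real_indicator) auto
  have "\<bar>ind A (X n + p)\<bar> <= (ind (ball 0 (r + M)) p :: real)" for n p
  proof (cases "X n + p : A")
   case True
   then have "norm (X n + p) < r" using r by auto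
   then have "norm p < r + M" using M[of n] norm_triangle_ineq4[of "X n + p" "X n"] by simp
   then show ?thesis by simp
  qed simp
  then show "AE p in W. norm (ind A (X n + p) :: real) <= ind (ball 0 (r + M)) p" for n by (intro AE_I2) (simp only: real_norm_def)
  have lim: "(%n. ind A (X n + p) :: real) ~~> ind A (x + p)" if np: "x + p ~: frontier A" for p
  proof -
   have c: "(%n. X n + p) ~~> x + p" by (intro tendsto_intros X)
   consider "x + p : interior A" | "x + p : - closure A" using np by (auto simp: frontier_def)
   then have "eventually (%n. (ind A (X n + p) :: real) = ind A (x + p)) sequentially"
   proof cases
    case 1
    have "eventually (%n. X n + p : interior A) sequentially" by (rule topological_tendstoD[OF c open_interior 1])
    then show ?thesis by eventually_elim (use 1 interior_subset[of A] in \<open>auto simp: indicator_def\<close>)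
   next
    case 2
    have "eventually (%n. X n + p : - closure A) sequentially" by (rule topological_tendstoD[OF c _ 2]) (simp add: open_Compl)
    then show ?thesis by eventually_elim (use 2 closure_subset[of A] in \<open>auto simp: indicator_def\<close>)
   qed
   then show ?thesis by (rule tendsto_eventually)
  qed
  show "AE p in W. (%n. ind A (X n + p) :: real) ~~> ind A (x + p)" using ae by eventually_elim (rule lim)
 qed
qed

context det_process begin

lemma count_null:
 assumes N: "N : bbs" "vol N = 0" shows "AE W in P. measure W N = 0"
proof -
 have f: "(%W. ffact_count (measure W) 1 (%_. N)) = (%W. measure W N)" by (simp add: fun_eq_iff)
 have i: "integrable P (%W. measure W N)" using ffact_integrable[of 1 "%_. N"] N(1) unfolding f by simp
 have "(LINT W|P. measure W N) = m 1 (%_. N)" using ffact_expect[of 1 "%_. N"] N(1) unfolding f by simp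
 also have "... = 0" using m_abs[of 1 "%_. N"] N by simp
 finally show ?thesis using integral_nonneg_eq_0_iff_AE[OF i] by simp
qed

lemma polys_ae_continuous:
 assumes X: "X ~~> x"
 shows "F : polys ==> AE W in P. (%n. F (translate (X n) W)) ~~> F (translate x W)"
proof (induction rule: polys.induct)
 case (polys_count A)
 have "AE W in P. measure W ((+) x -` frontier A) = 0" using frontier_RR[OF polys_count] by (intro count_null bbs_vimage_plus) (simp_all add: measure_lborel_vimage_plus)
 moreover have "AE W in P. W : space P" by (rule AE_space)
 ultimately show ?case by eventually_elim (rule count_continuous[OF _ polys_count X], simp_all)
next
 case (polys_add p q)
 from polys_add.IH show ?case by eventually_elim (rule tendsto_add)
next
 case (polys_mult p q)
 from polys_mult.IH show ?case by eventually_elim (rule tendsto_mult)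
qed simp

lemma corr_continuous:
 assumes F: "F : polys" and G: "G : polys"
 shows "isCont (%x. (LINT W|P. F (translate x W)*G W)) x" unfolding continuous_at_sequentially
proof (intro allI impI)
 fix X assume X: "X ~~> x"
 obtain M where M: "!!n. norm (X n) <= M" using convergent_imp_Bseq[OF convergentI[OF X]] by (auto elim!: BseqE)
 obtain C r k where C: "C >= 0" "r >= 0" "!!W. W : PM ==> \<bar>F W\<bar> <= C*(1 + measure W (ball 0 r))^k"
  using polys_bound[OF F] by auto
 \<comment> \<open>A polynomial dominating every term: translations bounded by \<open>M\<close>
   enlarge the ball from radius r to r + M, and |G| <= 1 + G^2 keeps the factor for \<open>G\<close>
   polynomial.\<close>
 define Wd where "Wd W = C*(1 + measure W (ball 0 (r + M)))^k*(1 + G W*G W)" for W :: "'a measure"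
 have Wd: "Wd : polys" unfolding Wd_def[abs_def] by (intro polys.polys_mult polys.polys_add polys_power polys.polys_const polys.polys_count RR_ball G)
 have Wb: "\<bar>F (translate (X n) W)*G W\<bar> <= Wd W" if w: "W : PM" for n W
 proof -
  have "\<bar>F (translate (X n) W)\<bar> <= C*(1 + measure (translate (X n) W) (ball 0 r))^k" by (rule C(3)[OF translate_space[OF w]])
  also have "measure (translate (X n) W) (ball 0 r) = measure W ((+) (X n) -` ball 0 r)" by (rule measure_translate[OF w]) simp
  also have "C*(1 + ...)^k <= C*(1 + measure W (ball 0 (r + M)))^k"
  proof (intro mult_left_mono power_mono add_left_mono point_measure_mono[OF w] C)
   show "(+) (X n) -` ball 0 r : sets borel" using bbs_vimage_plus[OF bbs_ball] by (rule bbs_borel)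
   show "(+) (X n) -` ball 0 r <= ball 0 (r + M)"
   proof
    fix p assume "p : (+) (X n) -` ball 0 r"
    then have "norm (X n + p) < r" by simp
    then show "p : ball 0 (r + M)" using M[of n] norm_triangle_ineq4[of "X n + p" "X n"] by simp
   qed
  qed (simp_all)
  finally have a: "\<bar>F (translate (X n) W)\<bar> <= C*(1 + measure W (ball 0 (r + M)))^k" .
  have b: "\<bar>G W\<bar> <= 1 + G W*G W" using sum_squares_bound[of "\<bar>G W\<bar>" 1] by (simp add: power2_eq_square)
  show ?thesis unfolding abs_mult Wd_def by (intro mult_mono a b) (use C in auto)
 qed
 have "(%n. (LINT W|P. F (translate (X n) W)*G W)) ~~> (LINT W|P. F (translate x W)*G W)"
 proof (rule integral_dominated_convergence[where w = Wd])
  show "integrable P Wd" by (rule polys_integrable_P[OF Wd])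
  show "AE W in P. norm (F (translate (X n) W)*G W) <= Wd W" for n using AE_space by eventually_elim (simp only: real_norm_def space_P Wb)
  show "AE W in P. (%n. F (translate (X n) W)*G W) ~~> F (translate x W)*G W"
   using polys_ae_continuous[OF X F] by eventually_elim (intro tendsto_mult tendsto_const)
 qed (intro borel_measurable_integrable polys_translate_integrable F G)+
 then show "((%x. (LINT W|P. F (translate x W)*G W)) \<circ> X) ~~> (LINT W|P. F (translate x W)*G W)" by (simp only: comp_def)
qed

lemma integral_translate_P':
 fixes f :: "'a measure => 'c::{banach,second_countable_topology}"
 assumes f: "f : BM P"
 shows "(LINT W|P. f (translate x W)) = (LINT W|P. f W)"
  and "integrable P (%W. f (translate x W)) \<longleftrightarrow> integrable P f"
proof -
 have T: "translate x : P \<rightarrow>\<^sub>M point_measures" by measurable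
 have f': "f : BM point_measures" using f by (simp cong: measurable_cong_sets)
 have s: "distr P point_measures (translate x) = P" using stationary_P by (simp add: stationary_def)
 show "(LINT W|P. f (translate x W)) = (LINT W|P. f W)" using integral_distr[OF T f'] by (simp only: s)
 show "integrable P (%W. f (translate x W)) \<longleftrightarrow> integrable P f" using integrable_distr_eq[OF T f'] by (simp only: s)
qed

lemma corr_shift:
 assumes F: "F : polys" and G: "G : polys"
 shows "(LINT W|P. F (translate u W)*G (translate v W)) = (LINT W|P. F (translate (u - v) W)*G W)"
proof -
 have "(LINT W|P. F (translate u W)*G (translate v W)) = (LINT W|P. (%W. F (translate (u - v) W)*G W) (translate v W))"
  by (rule integral_cong) (simp_all add: translate_translate)
 also have "... = (LINT W|P. F (translate (u - v) W)*G W)"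
  by (rule integral_translate_P'(1)) (rule borel_measurable_integrable[OF polys_translate_integrable[OF F G]])
 finally show ?thesis .
qed

lemma covP_even:
 assumes F: "F : polys" shows "covP F F (- x) = covP F F x"
proof -
 have "(LINT W|P. F (translate (- x) W)*F W) = (LINT W|P. F (translate 0 W)*F (translate x W))" using corr_shift[OF F F, of 0 x] by simp
 also have "... = (LINT W|P. F (translate x W)*F W)" by (rule integral_cong) (simp_all add: translate_0)
 finally show ?thesis by (simp add: covP_def)
qed

lemma
 assumes F: "F : polys"
 defines "E \<equiv> (LINT W|P. F W)"
 shows cov_centered_integrable: "integrable P (%W. (F (translate u W) - E)*(F (translate v W) - E))"
  and cov_centered: "(LINT W|P. (F (translate u W) - E)*(F (translate v W) - E)) = covP F F (u - v)"
proof -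
 have i2: "integrable P (%W. F (translate u W)*F (translate v W))"
 proof -
  obtain F' where F': "F' : polys" "ALL W:PM. F (translate v W) = F' W" using polys_translate[OF F] by auto
  show ?thesis by (rule integrable_cong[THEN iffD1, OF refl _ polys_translate_integrable[OF F F'(1)]]) (use F'(2) in auto)
 qed
 have i1: "integrable P (%W. F (translate u W))" for u using polys_integrable_P[OF F] by (subst integral_translate_P'(2)) auto
 have e1: "(LINT W|P. F (translate u W)) = E" for u unfolding E_def by (rule integral_translate_P'(1)[OF borel_measurable_integrable[OF polys_integrable_P[OF F]]])
 have e: "(F (translate u W) - E)*(F (translate v W) - E) = F (translate u W)*F (translate v W) - E*F (translate u W) - (E*F (translate v W) - E*E)" for W
  by (simp add: algebra_simps)
 show "integrable P (%W. (F (translate u W) - E)*(F (translate v W) - E))" unfolding e using i1 i2 by simp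
 have "(LINT W|P. (F (translate u W) - E)*(F (translate v W) - E)) = (LINT W|P. F (translate u W)*F (translate v W)) - E*E - (E*E - E*E)"
  unfolding e using i1 i2 prob_space by (simp add: e1)
 then show "(LINT W|P. (F (translate u W) - E)*(F (translate v W) - E)) = covP F F (u - v)" unfolding covP_def using corr_shift[OF F F, of u v] by (simp add: E_def)
qed

text \<open>The quadratic form is the expectation of the square of a linear combination of centred
  translates of \<open>F\<close>. Integrability comes from \<open>cov_bound\<close>, continuity from
  \<open>corr_continuous\<close>.\<close>

lemma covP_pos_def:
 assumes F: "F : polys" shows "EX B. pos_def_kernel (covP F F) B"
proof -
 let ?E = "(LINT W|P. F W)"
 obtain r C where rC: "C >= 0" "!!x. \<bar>covP F F x\<bar> <= C*kc r x" using cov_bound[OF F F] by auto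
 have kcb: "kc r x <= 2" for x
 proof -
  have "kb r x <= (LBINT y. k2 (x + y))" unfolding kb_def
   by (intro integral_mono kb_integrable integrable_lborel_translate[THEN iffD2] k_integrable) (auto simp: indicator_def)
  also have "... <= 1" using k_mass by (subst integral_lborel_translate) auto
  finally show ?thesis by (simp add: kc_def indicator_def)
 qed
 have cont: "continuous_on UNIV (covP F F)" unfolding covP_def[abs_def] continuous_on_eq_continuous_at[OF open_UNIV]
  by (intro ballI continuous_diff continuous_const corr_continuous F)
 have "pos_def_kernel (covP F F) (C*2)"
 proof
  show "continuous_on UNIV (covP F F)" by (rule cont)
  have "C*kc r x <= C*2" for x using kcb rC(1) by (rule mult_left_mono)
  then show "\<bar>covP F F x\<bar> <= C*2" for x using rC(2) order_trans by blast
  show "integrable lborel (covP F F)"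
  proof (rule integrable_bound)
   show "integrable lborel (%x. C*kc r x)" by (intro integrable_mult_right kc_integrable)
   show "covP F F : BM lborel" using borel_measurable_continuous_onI[OF cont] by simp
   show "AE x in lborel. norm (covP F F x) <= norm (C*kc r x)" by (intro AE_I2) (simp add: rC kc_nonneg abs_mult)
  qed
  fix S :: "'a set" and a :: "'a => real" assume S: "finite S"
  have ic: "integrable P (%W. a u*a v * ((F (translate u W) - ?E)*(F (translate v W) - ?E)))" for u v
   by (rule integrable_mult_right) (rule cov_centered_integrable[OF F])
  have "(SUM u:S. SUM v:S. a u*a v * covP F F (u - v))
   = (LINT W|P. (SUM u:S. SUM v:S. a u*a v * ((F (translate u W) - ?E)*(F (translate v W) - ?E))))" using ic by (simp add: cov_centered[OF F])
  also have "... = (LINT W|P. (SUM u:S. a u*(F (translate u W) - ?E))^2)" by (rule integral_cong) (simp_all add: power2_eq_square sum_product mult_ac)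
  also have "... >= 0" by simp
  finally show "0 <= (SUM u:S. SUM v:S. a u*a v * covP F F (u - v))" .
 qed
 then show ?thesis ..
qed

definition spec_density :: "('a measure => real) => 'a => real" where
 "spec_density F = cos_transform (covP F F)"

text \<open>The correlation is the covariance plus the squared mean; the constant is the transform
  of an atom at 0, and the covariance is that of its density by \<open>bochner_L1\<close>.\<close>

theorem spectral_polys:
 assumes F: "F : polys"
 shows "!!t. spec_density F t >= 0" "integrable lborel (spec_density F)"
  and "cr (LINT W|P. F (translate x W)*F W)
   = (\<integral>t. cis (ph x t) \<partial>atom_density ((LINT W|P. F W)^2) (spec_density F))"
proof -
 obtain B where B: "pos_def_kernel (covP F F) B" using covP_pos_def[OF F] ..
 note b = bochner_L1[OF B covP_even[OF F]]
 show nn: "!!t. spec_density F t >= 0" and int: "integrable lborel (spec_density F)" unfolding spec_density_def by (rule b)+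
 have mD: "spec_density F : BM borel" using borel_measurable_integrable[OF int] by simp
 have i: "integrable lborel (%t. spec_density F t *\<^sub>R cis (ph x t))" by (rule integrable_bound[OF int]) (use mD in auto)
 have "(\<integral>t. cis (ph x t) \<partial>atom_density ((LINT W|P. F W)^2) (spec_density F))
   = cr ((LINT W|P. F W)^2) + (LBINT t. spec_density F t *\<^sub>R cis (ph x t))"
  by (subst integral_atom_density[OF _ nn mD _ i]) (auto simp: scaleR_conv_of_real)
 also have "(LBINT t. spec_density F t *\<^sub>R cis (ph x t)) = cr (covP F F x)" unfolding spec_density_def b(3) scaleR_conv_of_real ..
 finally show "cr (LINT W|P. F (translate x W)*F W)
   = (\<integral>t. cis (ph x t) \<partial>atom_density ((LINT W|P. F W)^2) (spec_density F))" by (simp add: covP_def power2_eq_square)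
qed

end

section \<open>Trigonometric polynomials as operators on L^2\<close>

lemma cnj_measurable [measurable]: "cnj : BM borel" by (intro borel_measurable_continuous_onI continuous_on_cnj continuous_on_id)

lemma mult_le_sum_squares: "(a::real)*b <= a^2 + b^2"
proof (cases "a*b >= 0")
 case False
 then show ?thesis using sum_power2_ge_zero[of a b] by linarith
qed (use sum_squares_bound[of a b] in simp)

lemma exp_2pi_cis: "exp (2*cr pi*\<i>*cr r) = cis (2*pi*r)" by (simp add: cis_conv_exp mult_ac)

text \<open>One encoding by lists of coefficients and indices serves both trigonometric polynomials
  (\<open>trig\<close>) and combinations of translates of an observable (\<open>opL\<close>), so
  that identities transfer between the two sides.\<close>

definition lincomb :: "(complex \<times> 'b) list => ('b => 'c => complex) => 'c => complex" where
 "lincomb L g W = (\<Sum>p\<leftarrow>L. fst p*g (snd p) W)"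

lemma lincomb_simps [simp]:
 "lincomb [] g W = 0" "lincomb (p # L) g W = fst p*g (snd p) W + lincomb L g W"
 "lincomb (L @ L') g W = lincomb L g W + lincomb L' g W" by (simp_all add: lincomb_def)

lemma lincomb_left:
 assumes "!!x. integrable mm (%W. g x W*h W)"
 shows "integrable mm (%W. lincomb L g W*h W)"
  and "(LINT W|mm. lincomb L g W*h W) = (\<Sum>p\<leftarrow>L. fst p*(LINT W|mm. g (snd p) W*h W))"
proof (induction L)
 case (Cons p L)
 { case 1
  show ?case unfolding lincomb_simps distrib_right mult.assoc by (intro integrable_add integrable_mult_right assms Cons.IH) }
 { case 2
  have i: "integrable mm (%W. fst p*(g (snd p) W*h W))" by (intro integrable_mult_right assms)
  show ?case unfolding lincomb_simps distrib_right mult.assoc by (subst integral_add[OF i Cons.IH(1)]) (simp add: Cons.IH(2)) }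
qed simp_all

text \<open>Families with equal Gram matrices have combinations of equal norm, even on different
  measure spaces; this is the isometry behind the spectral representation.\<close>

lemma lincomb_inner_cong:
 fixes g :: "'i => 'c => complex" and g' :: "'i => 'd => complex"
 assumes i: "!!x y. integrable mm (%W. g x W*cnj (g y W))" "!!x y. integrable mm' (%W. g' x W*cnj (g' y W))"
  and e: "!!x y. (LINT W|mm. g x W*cnj (g y W)) = (LINT W|mm'. g' x W*cnj (g' y W))"
 shows "(LINT W|mm. lincomb L g W*cnj (lincomb L g W)) = (LINT W|mm'. lincomb L g' W*cnj (lincomb L g' W))"
proof -
 have c: "integrable mm (%W. g x W*cnj (lincomb L g W)) \<and>
  (LINT W|mm. g x W*cnj (lincomb L g W)) = (\<Sum>p\<leftarrow>L. cnj (fst p)*(LINT W|mm. g x W*cnj (g (snd p) W)))"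
  if i: "!!x y. integrable mm (%W. g x W*cnj (g y W))" for x and mm :: "'e measure" and g :: "'i => 'e => complex"
 proof -
  note l = lincomb_left[of mm "%y W. cnj (g y W)" "g x" "map (map_prod cnj id) L"]
  have *: "lincomb (map (map_prod cnj id) L) (%y W. cnj (g y W)) W = cnj (lincomb L g W)" for W by (induction L) simp_all
  show ?thesis using l i[of x] by (simp add: * mult.commute[of _ "g x _"] comp_def)
 qed
 note c1 = c[of mm g, OF i(1), THEN conjunct2] and c2 = c[of mm' g', OF i(2), THEN conjunct2]
 have "(LINT W|mm. lincomb L g W*cnj (lincomb L g W)) = (\<Sum>p\<leftarrow>L. fst p*(LINT W|mm. g (snd p) W*cnj (lincomb L g W)))"
  by (rule lincomb_left(2)) (rule c[OF i(1), THEN conjunct1])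
 also have "... = (\<Sum>p\<leftarrow>L. fst p*(\<Sum>p'\<leftarrow>L. cnj (fst p')*(LINT W|mm'. g' (snd p) W*cnj (g' (snd p') W))))" unfolding c1 e ..
 also have "... = (\<Sum>p\<leftarrow>L. fst p*(LINT W|mm'. g' (snd p) W*cnj (lincomb L g' W)))" unfolding c2 ..
 also have "... = (LINT W|mm'. lincomb L g' W*cnj (lincomb L g' W))" by (rule lincomb_left(2)[symmetric]) (rule c[OF i(2), THEN conjunct1])
 finally show ?thesis .
qed

abbreviation trig :: "(complex \<times> 'a) list => 'a::euclidean_space => complex" where
 "trig L \<equiv> lincomb L (%x t. cis (ph x t))"

definition trig_conj :: "(complex \<times> 'a::euclidean_space) list => (complex \<times> 'a) list" where
 "trig_conj L = map (map_prod cnj uminus) L"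

lemma trig_conj: "trig (trig_conj L) t = cnj (trig L t)" by (induction L) (simp_all add: trig_conj_def cis_cnj)

lemma trig_mult: "EX L''. ALL t. trig L'' t = trig L t*trig L' t"
proof (induction L)
 case (Cons p L)
 then obtain L'' where L: "ALL t. trig L'' t = trig L t*trig L' t" ..
 have *: "trig (map (%p'. (fst p*fst p', snd p + snd p')) L') t = fst p*cis (ph (snd p) t)*trig L' t" for t
  by (induction L') (simp_all add: distrib_left cis_mult[symmetric] inner_add_left mult_ac)
 show ?case by (rule exI[of _ "map (%p'. (fst p*fst p', snd p + snd p')) L' @ L''"]) (simp only: lincomb_simps * L distrib_right, simp)
qed (auto intro: exI[of _ "[]"])

lemma trig_measurable [measurable]: "trig L : BM borel"
proof (induction L)
 case (Cons p L)
 then show ?case unfolding lincomb_simps(2)[abs_def] by measurable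
qed (simp add: lincomb_def)

lemma trig_bounded: "EX B. ALL t. cmod (trig L t) <= B"
proof (induction L)
 case (Cons p L)
 then obtain B where B: "ALL t. cmod (trig L t) <= B" ..
 have "cmod (trig (p # L) t) <= cmod (fst p) + B" for t using norm_triangle_ineq[of "fst p*cis (ph (snd p) t)" "trig L t"] B[rule_format, of t]
  by (simp add: norm_mult)
 then show ?case by blast
qed (auto intro: exI[of _ 0])

definition real_trig :: "('a::euclidean_space => real) set" where
 "real_trig = {q. EX L. ALL t. cr (q t) = trig L t}"

lemma real_trig_cos: "(%t. a * sin (ph x t)) : real_trig" unfolding real_trig_def
 by (intro CollectI exI[of _ "[(- \<i>*a/2, x), (\<i>*a/2, - x)]"]) (simp add: complex_eq_iff)

lemma bounded_algebra_real_trig: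
 fixes rh :: "'a::euclidean_space measure"
 assumes "finite_measure rh" and s: "sets rh = sets borel"
 shows "bounded_algebra rh real_trig"
proof -
 interpret finite_measure rh by fact
 show ?thesis
 proof
  fix g :: "'a => real" assume "g : real_trig"
  then obtain L where L: "ALL t. cr (g t) = trig L t" by (auto simp: real_trig_def)
  have g: "g = (%t. Re (trig L t))" using L by (metis Re_complex_of_real)
  have "g : BM borel" unfolding g by measurable
  then show "g : BM rh" using s by (simp cong: measurable_cong_sets)
  obtain B where B: "ALL t. cmod (trig L t) <= B" using trig_bounded by blast
  have "\<bar>g t\<bar> <= B" for t using B[rule_format, of t] L[rule_format, of t, symmetric] by simp
  then show "EX B. ALL x:space rh. \<bar>g x\<bar> <= B" by blast
  fix h :: "'a => real" assume "h : real_trig"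
  then obtain L' where L': "ALL t. cr (h t) = trig L' t" by (auto simp: real_trig_def)
  show "(%x. g x + h x) : real_trig" unfolding real_trig_def by (intro CollectI exI[of _ "L @ L'"]) (simp add: L L')
  obtain L'' where "ALL t. trig L'' t = trig L t*trig L' t" using trig_mult by blast
  then show "(%x. g x*h x) : real_trig" unfolding real_trig_def by (intro CollectI exI[of _ L'']) (simp add: L L')
 next
  show "(%_::'a. c) : real_trig" for c unfolding real_trig_def by (intro CollectI exI[of _ "[(cr c, 0)]"]) simp
 qed
qed

text \<open>Each coordinate is the pointwise limit of n/(2 pi) sin(2 pi t_b/n), hence measurable for
  the sigma-field generated by trigonometric polynomials.\<close>

lemma real_trig_generates:
 "sets borel <= sigma_sets UNIV {{x. g x > 0} | g. g : (real_trig :: ('a::euclidean_space => real) set)}"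
proof -
 define N where "N = sigma (UNIV :: 'a set) {{x. g x > 0} | g. g : real_trig}"
 have N: "space N = UNIV" "sets N = sigma_sets UNIV {{x. g x > 0} | g. g : (real_trig :: ('a => real) set)}"
  unfolding N_def by (auto intro!: space_measure_of sets_measure_of)
 have "(%t. inner t b) : BM N" for b :: 'a
 proof (rule borel_measurable_LIMSEQ_real)
  let ?f = "%n t. real (Suc n)/(2*pi) * sin (ph (b /\<^sub>R real (Suc n)) t)"
  show "?f n : BM N" for n unfolding borel_measurable_iff_greater
  proof
   fix a
   \<comment> \<open>The closure properties of \<open>real_trig\<close> do not refer to the measure;
     the null measure merely gives access to them.\<close>
   interpret b: bounded_algebra "null_measure (borel :: 'a measure)" real_trig by (rule bounded_algebra_real_trig) (auto intro!: finite_measureI)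
   have "(%t. ?f n t + - a) : real_trig" by (rule b.add[OF real_trig_cos b.const])
   then have "{x. ?f n x + - a > 0} : sets N" unfolding N(2) by (intro sigma_sets.Basic CollectI exI[of _ "%t. ?f n t + - a"] conjI refl)
   then show "{w : space N. a < ?f n w} : sets N" by (simp add: N(1))
  qed
  fix t
  let ?y = "ph b t"
  have "(%n. (sin (?y*(0 + inverse (real (Suc n)))) - sin (?y*0))/inverse (real (Suc n))) ~~> ?y"
  proof -
   have "((%h. sin (?y*h)) has_real_derivative ?y) (at 0)" by (auto intro!: derivative_eq_intros)
   then have d: "((%h. (sin (?y*(0 + h)) - sin (?y*0))/h) \<longlongrightarrow> ?y) (at 0)" unfolding DERIV_def .
   have "filterlim (%n. inverse (real (Suc n))) (at 0) sequentially" unfolding filterlim_at using inverse_Suc_tendsto by simp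
   from filterlim_compose[OF d this] show ?thesis .
  qed
  from tendsto_divide[OF this tendsto_const[of "2*pi"]] show "(%n. ?f n t) ~~> inner t b" by (simp add: inner_commute field_simps del: of_nat_Suc)
 qed
 then have id: "(%t. t) : N \<rightarrow>\<^sub>M (borel :: 'a measure)" by (subst borel_measurable_euclidean_space) auto
 show ?thesis
 proof
  fix A :: "'a set" assume "A : sets borel"
  from measurable_sets[OF id this] show "A : sigma_sets UNIV {{x. g x > 0} | g. g : real_trig}" by (simp add: N)
 qed
qed

context det_process begin

abbreviation "nrm F \<equiv> (LINT W|P. (cmod (F W))^2)"

lemma SI_translate:
 assumes "square_integrable P F" shows "square_integrable P (%W. F (translate x W))"
proof -
 have T: "translate x : P \<rightarrow>\<^sub>M P" by (simp cong: measurable_cong_sets)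
 have m: "F : BM P" using assms by (simp add: square_integrable_def)
 then have "(%W. (cmod (F W))^2) : BM P" by measurable
 then show ?thesis using assms measurable_compose[OF T m] unfolding square_integrable_def by (simp add: integral_translate_P'(2)[of "%W. (cmod (F W))^2"])
qed

lemma SI_inner_integrable:
 assumes F: "square_integrable P F" and G: "square_integrable P G"
 shows "integrable P (%W. F W*cnj (G W))"
proof (rule integrable_bound)
 show "integrable P (%W. (cmod (F W))^2 + (cmod (G W))^2)" using F G by (simp add: square_integrable_def)
 show "(%W. F W*cnj (G W)) : BM P"
  using F G unfolding square_integrable_def by (intro borel_measurable_times measurable_compose[OF _ cnj_measurable]) auto
 have "cmod (F W)*cmod (G W) <= (cmod (F W))^2 + (cmod (G W))^2" for W by (rule mult_le_sum_squares)
 then show "AE W in P. norm (F W*cnj (G W)) <= norm ((cmod (F W))^2 + (cmod (G W))^2)" by (intro AE_I2) (simp add: norm_mult)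
qed

lemma SI_add:
 assumes F: "square_integrable P F" and G: "square_integrable P G"
 shows "square_integrable P (%W. F W + c*G W)" "nrm (%W. F W + c*G W) <= 2*nrm F + 2*(cmod c)^2*nrm G"
proof -
 have b: "(cmod (F W + c*G W))^2 <= 2*(cmod (F W))^2 + 2*(cmod c)^2*(cmod (G W))^2" for W
 proof -
  have "(cmod (F W + c*G W))^2 <= (cmod (F W) + cmod c*cmod (G W))^2"
   using norm_triangle_ineq[of "F W" "c*G W"] by (intro power_mono) (auto simp: norm_mult)
  also have "... <= 2*(cmod (F W))^2 + 2*(cmod c*cmod (G W))^2"
   using sum_squares_bound[of "cmod (F W)" "cmod c*cmod (G W)"] unfolding power2_sum by linarith
  finally show ?thesis by (simp add: power_mult_distrib)
 qed
 have i: "integrable P (%W. 2*(cmod (F W))^2 + 2*(cmod c)^2*(cmod (G W))^2)" using F G by (simp add: square_integrable_def)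
 have m: "(%W. F W + c*G W) : BM P" using F G unfolding square_integrable_def by (intro borel_measurable_times borel_measurable_add) auto
 have j: "integrable P (%W. (cmod (F W + c*G W))^2)" by (rule integrable_bound[OF i]) (use m b in \<open>auto intro!: AE_I2 order_trans[OF b abs_ge_self]\<close>)
 show "square_integrable P (%W. F W + c*G W)" using m j by (simp add: square_integrable_def)
 have "nrm (%W. F W + c*G W) <= (LINT W|P. 2*(cmod (F W))^2 + 2*(cmod c)^2*(cmod (G W))^2)" by (rule integral_mono[OF j i b])
 also have "... = 2*nrm F + 2*(cmod c)^2*nrm G" using F G by (simp add: square_integrable_def)
 finally show "nrm (%W. F W + c*G W) <= 2*nrm F + 2*(cmod c)^2*nrm G" .
qed

text \<open>Cauchy-Schwarz in the form of a weighted inequality of arithmetic and geometric means;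
  the free weight \<open>s\<close> is matched later to the sizes of the two norms.\<close>

lemma inner_le:
 assumes F: "square_integrable P F" and G: "square_integrable P G" and s: "s > 0"
 shows "cmod (LINT W|P. F W*cnj (G W)) <= s*nrm F + nrm G / s"
proof -
 have b: "cmod (F W*cnj (G W)) <= s*(cmod (F W))^2 + (cmod (G W))^2 / s" for W
 proof -
  have "0 <= (s*cmod (F W) - cmod (G W))^2 / s" using s by simp
  also have "... = s*(cmod (F W))^2 + (cmod (G W))^2 / s - 2*(cmod (F W)*cmod (G W))" using s by (simp add: power2_eq_square field_simps)
  finally have "2*(cmod (F W)*cmod (G W)) <= s*(cmod (F W))^2 + (cmod (G W))^2 / s" by simp
  moreover have "cmod (F W)*cmod (G W) <= 2*(cmod (F W)*cmod (G W))" by simp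
  ultimately show ?thesis by (simp only: norm_mult complex_mod_cnj)
 qed
 have i: "integrable P (%W. s*(cmod (F W))^2 + (cmod (G W))^2 / s)" using F G by (simp add: square_integrable_def)
 have "cmod (LINT W|P. F W*cnj (G W)) <= (LINT W|P. cmod (F W*cnj (G W)))" by (rule integral_norm_bound)
 also have "... <= (LINT W|P. s*(cmod (F W))^2 + (cmod (G W))^2 / s)" by (rule integral_mono[OF integrable_norm[OF SI_inner_integrable[OF F G]] i b])
 also have "... = s*nrm F + nrm G / s" using F G by (simp add: square_integrable_def)
 finally show ?thesis .
qed

abbreviation "opL L G \<equiv> lincomb L (%x W. G (translate x W))"

lemma SI_opL: assumes "square_integrable P G" shows "square_integrable P (opL L G)"
proof (induction L)
 case (Cons p L)
 have "square_integrable P (%W. opL L G W + fst p*G (translate (snd p) W))" by (rule SI_add(1)[OF Cons.IH SI_translate[OF assms]])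
 then show ?case by (simp add: add.commute lincomb_def)
qed (simp add: square_integrable_def lincomb_def)

lemma spectral_inner:
 assumes G: "square_integrable P G" and ta: "spectral_measure P G ta"
 shows "(LINT W|P. G (translate x W)*cnj (G (translate y W))) = (LINT t|ta. cis (ph x t)*cnj (cis (ph y t)))"
proof -
 have "(LINT W|P. G (translate x W)*cnj (G (translate y W)))
   = (LINT W|P. (%W. G (translate (x - y) W)*cnj (G W)) (translate y W))" by (rule integral_cong) (simp_all add: translate_translate)
 also have "... = (LINT W|P. G (translate (x - y) W)*cnj (G W))"
  by (rule integral_translate_P'(1)) (rule borel_measurable_integrable[OF SI_inner_integrable[OF SI_translate[OF G] G]])
 also have "... = (LINT t|ta. exp (2 * of_real pi*\<i> * of_real (inner (x - y) t)))" using ta by (simp add: spectral_measure_def L2_inner_def comp_def)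
 also have "... = (LINT t|ta. cis (ph x t)*cnj (cis (ph y t)))"
 proof (intro integral_cong refl)
  fix t
  have "cis (ph x t)*cnj (cis (ph y t)) = cis (ph (x - y) t)" by (simp add: cis_cnj cis_mult inner_diff_left algebra_simps)
  then show "exp (2 * of_real pi*\<i> * of_real (inner (x - y) t)) = cis (ph x t)*cnj (cis (ph y t))" by (simp add: cis_conv_exp mult_ac)
 qed
 finally show ?thesis .
qed

lemma cis_integrable: "finite_measure ta ==> sets ta = sets borel ==> integrable ta (%t. cis (ph (x::'a) t)*cnj (cis (ph y t)))"
 by (rule finite_measure.integrable_const_bound[of _ _ 1]) (auto simp: norm_mult cong: measurable_cong_sets
   intro!: borel_measurable_times measurable_compose[OF _ cnj_measurable] measurable_compose[OF _ borel_measurable_cis])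

text \<open>Translations act as multiplication by characters in L^2 of the spectral measure, so a
  combination of translates has the norm of its trigonometric polynomial.\<close>

lemma nrm_opL:
 assumes G: "square_integrable P G" and ta: "spectral_measure P G ta"
 shows "nrm (opL L G) = (LINT t|ta. (cmod (trig L t))^2)"
proof -
 have f: "finite_measure ta" "sets ta = sets borel" using ta by (auto simp: spectral_measure_def)
 have "cr (nrm (opL L G)) = (LINT W|P. opL L G W*cnj (opL L G W))" by (simp add: complex_norm_square[symmetric] flip: integral_complex_of_real)
 also have "... = (LINT t|ta. trig L t*cnj (trig L t))"
  by (rule lincomb_inner_cong[OF SI_inner_integrable[OF SI_translate[OF G] SI_translate[OF G]] cis_integrable[OF f] spectral_inner[OF G ta]])
 also have "... = cr (LINT t|ta. (cmod (trig L t))^2)" by (simp add: complex_norm_square[symmetric] flip: integral_complex_of_real)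
 finally show ?thesis by (simp only: of_real_eq_iff)
qed

lemma inner_opL:
 assumes G: "square_integrable P G" and ta: "spectral_measure P G ta"
 shows "(LINT W|P. opL L G W*cnj (G W)) = (LINT t|ta. trig L t)"
proof -
 have f: "finite_measure ta" "sets ta = sets borel" using ta by (auto simp: spectral_measure_def)
 have e: "(LINT W|P. G (translate x W)*cnj (G W)) = (LINT t|ta. cis (ph x t)*1)" for x
  using ta by (simp add: spectral_measure_def L2_inner_def comp_def cis_conv_exp mult_ac)
 have "(LINT W|P. opL L G W*cnj (G W)) = (\<Sum>p\<leftarrow>L. fst p*(LINT W|P. G (translate (snd p) W)*cnj (G W)))"
  by (rule lincomb_left(2)) (rule SI_inner_integrable[OF SI_translate[OF G] G])
 also have "... = (LINT t|ta. trig L t*1)" unfolding e using cis_integrable[OF f, of _ 0] by (intro lincomb_left(2)[symmetric]) simp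
 finally show ?thesis by simp
qed

text \<open>By stationarity the adjoint of the translation by x is the translation by -x; on lists
  this is \<open>trig_conj\<close>.\<close>

lemma opL_adjoint:
 assumes G: "square_integrable P G" and F: "square_integrable P F"
 shows "(LINT W|P. opL L G W*cnj (F W)) = (LINT W|P. G W*cnj (opL (trig_conj L) F W))"
proof -
 have e: "(LINT W|P. G (translate x W)*cnj (F W)) = (LINT W|P. G W*cnj (F (translate (- x) W)))" for x
 proof -
  have "(LINT W|P. G (translate x W)*cnj (F W)) = (LINT W|P. (%W. G W*cnj (F (translate (- x) W))) (translate x W))"
   by (rule integral_cong) (simp_all add: translate_translate translate_0)
  also have "... = (LINT W|P. G W*cnj (F (translate (- x) W)))"
   by (rule integral_translate_P'(1)) (rule borel_measurable_integrable[OF SI_inner_integrable[OF G SI_translate[OF F]]])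
  finally show ?thesis .
 qed
 have *: "lincomb (map (map_prod id uminus) L) (%x W. cnj (F (translate x W))) W = cnj (opL (trig_conj L) F W)" for W by (induction L) (simp_all add: trig_conj_def)
 have "(LINT W|P. opL L G W*cnj (F W)) = (\<Sum>p\<leftarrow>L. fst p*(LINT W|P. G (translate (snd p) W)*cnj (F W)))"
  by (rule lincomb_left(2)) (rule SI_inner_integrable[OF SI_translate[OF G] F])
 also have "... = (\<Sum>p\<leftarrow>map (map_prod id uminus) L. fst p*(LINT W|P. cnj (F (translate (snd p) W))*G W))"
  unfolding e by (simp add: comp_def mult.commute)
 also have "... = (LINT W|P. lincomb (map (map_prod id uminus) L) (%x W. cnj (F (translate x W))) W*G W)"
  by (rule lincomb_left(2)[symmetric]) (use SI_inner_integrable[OF G SI_translate[OF F]] in \<open>simp add: mult.commute\<close>)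
 also have "... = (LINT W|P. cnj (opL (trig_conj L) F W)*G W)" unfolding * ..
 finally show ?thesis by (simp add: mult.commute)
qed

lemma finite_measure_spec:
 assumes F: "F : polys" shows "finite_measure (atom_density c (spec_density F))"
proof
 have i: "integrable lborel (spec_density F)" by (rule spectral_polys(2)[OF F])
 then have m: "spec_density F : BM borel" using borel_measurable_integrable by force
 have "(NN x. ennreal (spec_density F x)) < \<infinity>" using nn_integral_eq_integral[OF i] spectral_polys(1)[OF F] by simp
 then show "emeasure (atom_density c (spec_density F)) (space (atom_density c (spec_density F))) ~= \<infinity>"
  by (simp add: emeasure_atom_density[OF _ m] ennreal_add_eq_top)
qed

lemma spectral_measure_polys:
 assumes F: "F : polys"
 shows "spectral_measure P (%W. cr (F W)) (atom_density ((LINT W|P. F W)^2) (spec_density F))"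
  and "square_integrable P (%W. cr (F W))"
proof -
 have "integrable P (%W. F W*F W)" by (rule polys_integrable_P[OF polys.polys_mult[OF F F]])
 then show "square_integrable P (%W. cr (F W))"
  using borel_measurable_integrable[OF polys_integrable_P[OF F]] by (simp add: square_integrable_def power2_eq_square)
 have "L2_inner P ((%W. cr (F W)) \<circ> translate x) (%W. cr (F W))
  = cr (LINT W|P. F (translate x W)*F W)" for x by (simp add: L2_inner_def comp_def flip: integral_complex_of_real)
 then show "spectral_measure P (%W. cr (F W)) (atom_density ((LINT W|P. F W)^2) (spec_density F))" unfolding spectral_measure_def exp_2pi_cis
  by (intro conjI allI finite_measure_spec[OF F] sets_atom_density) (simp only: spectral_polys(3)[OF F])
qed

end

section \<open>Domination of all spectral measures; the maximal spectral type\<close>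

lemma integral_le_of_nn:
 fixes f :: "'c => real"
 assumes "integrable mm f" "!!x. f x >= 0" "(NNI mm (%x. ennreal (f x))) <= ennreal c" "c >= 0"
 shows "(LINT x|mm. f x) <= c" using assms nn_integral_eq_integral[OF assms(1)] by simp

lemma lincomb_fun_add: "lincomb L (%x W. g x W + c*h x W) W = lincomb L g W + c*lincomb L h W" by (induction L) (simp_all add: algebra_simps)

context det_process begin

text \<open>\<open>G\<close> is approximated by \<open>F\<close> with polynomial real and imaginary
  parts. A trigonometric polynomial \<open>q\<close> close to the indicator of \<open>E\<close> acts
  as an approximate spectral projection: it makes \<open>F\<close> small, since the spectral
  measures of \<open>F1\<close> and \<open>F2\<close> do not charge \<open>E\<close>, while its
  quadratic form at \<open>G\<close> is close to the mass of \<open>E\<close> under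
  \<open>ta\<close>. Moving the operator from \<open>G\<close> to \<open>F\<close> by the adjoint
  shows that this mass is small.\<close>

theorem spectral_dominated:
 assumes G: "square_integrable P G" and ta: "spectral_measure P G ta" and E: "E : null_sets (atom_density 1 (%_. 1))"
 shows "E : null_sets ta"
proof -
 have fta: "finite_measure ta" and sta: "sets ta = sets borel" using ta by (auto simp: spectral_measure_def)
 interpret ta: finite_measure ta by fact
 have E': "E : sets borel" using null_setsD2[OF E] by simp
 have Gm: "G : BM P" and Gi: "integrable P (%W. (cmod (G W))^2)" using G by (auto simp: square_integrable_def)
 define T where "T = measure ta UNIV"
 have spta: "space ta = UNIV" using sets_eq_imp_space_eq[OF sta] by simp
 have T: "T >= 0" "measure ta E <= T" using ta.bounded_measure[of E] by (simp_all add: T_def spta)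
 \<comment> \<open>The constant adds up the errors below: T + 1 from replacing the indicator by
   \<open>q\<close>, and 2 T + 7 + \<open>nrm G\<close> from the estimate of the integral of
   \<open>q\<close>.\<close>
 have main: "measure ta E <= et*(3*T + 8 + nrm G)" if et: "0 < et" "et <= 1" for et
 proof -
  have et2: "et^2 > 0" "et^2/2 > 0" using et by simp_all
  have Gfin: "(NNI P (%W. ennreal ((cmod (G W))^2))) < \<infinity>" using nn_integral_eq_integral[OF Gi] by simp
  have r: "(%W. Re (G W)) : L2_closure P polys" "(%W. Im (G W)) : L2_closure P polys"
  proof -
   have "(NNI P (%W. ennreal ((Re (G W))^2))) <= (NNI P (%W. ennreal ((cmod (G W))^2)))" by (intro nn_integral_mono ennreal_leI) (simp add: cmod_power2)
   from order.strict_trans1[OF this Gfin] show "(%W. Re (G W)) : L2_closure P polys" by (rule polys_dense[rotated]) (use Gm in measurable)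
   have "(NNI P (%W. ennreal ((Im (G W))^2))) <= (NNI P (%W. ennreal ((cmod (G W))^2)))" by (intro nn_integral_mono ennreal_leI) (simp add: cmod_power2)
   from order.strict_trans1[OF this Gfin] show "(%W. Im (G W)) : L2_closure P polys" by (rule polys_dense[rotated]) (use Gm in measurable)
  qed
  obtain F1 where F1: "F1 : polys" "F1 : BM P" "(NNI P (%W. ennreal ((Re (G W) - F1 W)^2))) <= ennreal (et^2/2)"
   using r(1) et2(2) by (rule L2_closureE)
  obtain F2 where F2: "F2 : polys" "F2 : BM P" "(NNI P (%W. ennreal ((Im (G W) - F2 W)^2))) <= ennreal (et^2/2)"
   using r(2) et2(2) by (rule L2_closureE)
  let ?C1 = "%W. cr (F1 W)" and ?C2 = "%W. cr (F2 W)"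
  define F where "F W = ?C1 W + \<i>*?C2 W" for W
  note s1 = spectral_measure_polys[OF F1(1)] and s2 = spectral_measure_polys[OF F2(1)]
  have F: "square_integrable P F" unfolding F_def[abs_def] by (rule SI_add(1)[OF s1(2) s2(2)])
  have GF: "square_integrable P (%W. G W - F W)" using SI_add(1)[OF G F, of "- 1"] by simp
  have nGF: "nrm (%W. G W - F W) <= et^2"
  proof (rule integral_le_of_nn)
   show "integrable P (%W. (cmod (G W - F W))^2)" using GF by (simp add: square_integrable_def)
   have "(NNI P (%W. ennreal ((cmod (G W - F W))^2)))
    = (NNI P (%W. ennreal ((Re (G W) - F1 W)^2) + ennreal ((Im (G W) - F2 W)^2)))" by (intro nn_integral_cong) (simp add: cmod_power2 F_def)
   also have "... = (NNI P (%W. ennreal ((Re (G W) - F1 W)^2))) + (NNI P (%W. ennreal ((Im (G W) - F2 W)^2)))"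
    by (rule nn_integral_add) (use Gm F1(2) F2(2) in measurable)
   also have "... <= ennreal (et^2/2) + ennreal (et^2/2)" by (intro add_mono F1(3) F2(3))
   also have "... = ennreal (et^2)" using et2 by (subst ennreal_plus[symmetric]) auto
   finally show "(NNI P (%W. ennreal ((cmod (G W - F W))^2))) <= ennreal (et^2)" .
  qed simp_all
  define si1 where "si1 = atom_density ((LINT W|P. F1 W)^2) (spec_density F1)"
  define si2 where "si2 = atom_density ((LINT W|P. F2 W)^2) (spec_density F2)"
  have fsi: "finite_measure si1" "finite_measure si2" unfolding si1_def si2_def by (intro finite_measure_spec F1(1) F2(1))+
  have ssi: "sets si1 = sets borel" "sets si2 = sets borel" by (simp_all add: si1_def si2_def)
  have nsi: "E : null_sets si1" "E : null_sets si2"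
  proof -
   have m: "spec_density F1 : BM borel" "spec_density F2 : BM borel"
    using borel_measurable_integrable[OF spectral_polys(2)[OF F1(1)]] borel_measurable_integrable[OF spectral_polys(2)[OF F2(1)]] by simp_all
   show "E : null_sets si1" unfolding si1_def by (rule null_sets_atom_density_mono[OF m(1) _ E]) simp
   show "E : null_sets si2" unfolding si2_def by (rule null_sets_atom_density_mono[OF m(2) _ E]) simp
  qed
  \<comment> \<open>One \<open>q\<close> must approximate the indicator for all three measures at
    once, so the approximation takes place in L^2 of their sum.\<close>
  define rh where "rh = add_measure (add_measure ta si1) si2"
  have srh: "sets rh = sets borel" by (simp add: rh_def sta)
  have nnrh: "(NNI rh (%t. f t)) = (NNI ta (%t. f t)) + (NNI si1 (%t. f t)) + (NNI si2 (%t. f t))" if "f : BM borel" for f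
  proof -
   have m: "f : BM ta" "f : BM (add_measure ta si1)" using that sta by (simp_all cong: measurable_cong_sets)
   show ?thesis unfolding rh_def
    by (subst nn_integral_add_measure[OF _ m(2)], simp add: sta ssi, subst nn_integral_add_measure[OF _ m(1)], simp_all add: sta ssi)
  qed
  have frh: "finite_measure rh"
  proof
   have "emeasure rh (space rh) = (NNI rh (%t. 1))" by simp
   also have "... < \<infinity>" using ta.emeasure_finite[of "space ta", unfolded less_top] finite_measure.emeasure_finite[OF fsi(1), of "space si1", unfolded less_top]
     finite_measure.emeasure_finite[OF fsi(2), of "space si2", unfolded less_top] by (subst nnrh) (simp_all only: nn_integral_const mult_1 ennreal_add_less_top infinity_ennreal_def, simp_all)
   finally show "emeasure rh (space rh) ~= \<infinity>" by simp
  qed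
  interpret A: bounded_algebra rh real_trig by (rule bounded_algebra_real_trig[OF frh srh])
  have sprh: "space rh = UNIV" using sets_eq_imp_space_eq[OF srh] by simp
  have iE: "ind E : BM rh" using E' srh by (simp cong: measurable_cong_sets)
  have "ind E : L2_closure rh real_trig"
  proof (rule A.L2_dense[OF _ iE])
   show "sets rh <= sigma_sets (space rh) {{x : space rh. 0 < g x} |g. g : real_trig}"
    using real_trig_generates by (simp add: sprh srh)
   have "(NNI rh (%x. ennreal ((ind E x)^2))) <= (NNI rh (%x. 1))" by (intro nn_integral_mono) (simp add: indicator_def)
   also have "... < \<infinity>" using A.emeasure_finite[of "space rh", unfolded less_top] by (simp only: nn_integral_const mult_1 infinity_ennreal_def)
   finally show "(NNI rh (%x. ennreal ((ind E x)^2))) < \<infinity>" .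
  qed
  then obtain q where q: "q : real_trig" "(NNI rh (%x. ennreal ((ind E x - q x)^2))) <= ennreal (et^2)"
   using et2(1) by (rule L2_closureE)
  obtain L where L: "!!t. cr (q t) = trig L t" using q(1) by (auto simp: real_trig_def)
  have qRe: "q = (%t. Re (trig L t))" using L by (metis Re_complex_of_real)
  have qm [measurable]: "q : BM borel" unfolding qRe by measurable
  have cq: "(cmod (trig L t))^2 = (q t)^2" "(cmod (trig (trig_conj L) t))^2 = (q t)^2" for t by (simp_all add: L[symmetric] trig_conj)
  obtain B where B: "!!t. \<bar>q t\<bar> <= B" using A.bounded[OF q(1)] by (auto simp: sprh)
  have B0: "B >= 0" using B[of 0] by linarith
  have bint: "integrable mm f" if "finite_measure mm" "sets mm = sets borel" "f : BM borel" "!!t. \<bar>f t\<bar> <= b"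
   for mm :: "'a measure" and f :: "'a => real" and b
   using that by (intro finite_measure.integrable_const_bound[of _ _ b]) (auto cong: measurable_cong_sets)
  have dq: "\<bar>(ind E t - q t)^2\<bar> <= (1 + B)^2" for t
  proof -
   have "\<bar>ind E t - q t\<bar> <= \<bar>ind E t\<bar> + \<bar>q t\<bar>" by (rule abs_triangle_ineq4)
   also have "... <= 1 + B" using B[of t] by (intro add_mono) (simp_all add: indicator_def)
   finally have "\<bar>ind E t - q t\<bar>^2 <= (1 + B)^2" by (rule power_mono) simp
   then show ?thesis by simp
  qed
  have em: "(%t. ennreal ((ind E t - q t)^2)) : BM borel" using E' by measurable
  note q3 = q(2)[unfolded nnrh[OF em]]
  have est: "(LINT t|mm. (ind E t - q t)^2) <= et^2"
   if "finite_measure mm" "sets mm = sets borel" "(NNI mm (%x. ennreal ((ind E x - q x)^2))) <= ennreal (et^2)" for mm :: "'a measure"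
  proof (rule integral_le_of_nn[OF bint[OF that(1,2) _ dq] _ that(3)])
   show "(%t. (ind E t - q t)^2) : BM borel" using E' by measurable
  qed simp_all
  have dta: "(LINT t|ta. (ind E t - q t)^2) <= et^2" by (rule est[OF fta sta order_trans[OF _ q3]]) (simp add: add.assoc)
  have null_est: "(LINT t|mm. (q t)^2) <= et^2"
   if "finite_measure mm" "sets mm = sets borel" "E : null_sets mm" "(NNI mm (%x. ennreal ((ind E x - q x)^2))) <= ennreal (et^2)" for mm :: "'a measure"
  proof -
   have m: "(%t. (ind E t - q t)^2) : BM mm" "(%t. (q t)^2) : BM mm"
    using E' that(2) by (simp_all cong: measurable_cong_sets)
   have "(LINT t|mm. (q t)^2) = (LINT t|mm. (ind E t - q t)^2)"
    by (rule integral_cong_AE[OF m(2,1)]) (use AE_not_in[OF that(3)] in \<open>auto simp: indicator_def\<close>)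
   then show ?thesis using est[OF that(1,2,4)] by simp
  qed
  have a1: "(LINT t|si1. (q t)^2) <= et^2" "(LINT t|si2. (q t)^2) <= et^2"
   by (rule null_est[OF fsi(1) ssi(1) nsi(1) order_trans[OF _ q3]], simp add: add_increasing add_increasing2)
    (rule null_est[OF fsi(2) ssi(2) nsi(2) order_trans[OF _ q3]], simp add: add_increasing add_increasing2)
  have iq: "integrable ta q" by (rule bint[OF fta sta qm B])
  have i1: "integrable ta (ind E :: 'a => real)" by (rule bint[OF fta sta _, of _ 1]) (use E' in \<open>auto simp: indicator_def\<close>)
  have id: "integrable ta (%t. (ind E t - q t)^2)" by (rule bint[OF fta sta _ dq]) (use E' in measurable)
  have iq2: "integrable ta (%t. (q t)^2)" by (rule bint[OF fta sta _, of _ "B^2"]) (use B B0 in \<open>auto simp: abs_le_square_iff[symmetric]\<close>)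
  have mE: "measure ta E = (LINT t|ta. ind E t)" by (simp add: spta)
  have T1: "(LINT t|ta. c) = c*T" for c :: real by (simp add: T_def spta)
  have b: "(LINT t|ta. (q t)^2) <= 2*T + 2"
  proof -
   have "(q t)^2 <= 2 + 2*(ind E t - q t)^2" for t
   proof -
    have "x^2 <= 2*y^2 + 2*(y - x)^2" for x y :: real using zero_le_power2[of "2*y - x"] by (simp add: power2_eq_square algebra_simps)
    from this[of "q t" "ind E t"] have "(q t)^2 <= 2*(ind E t)^2 + 2*(ind E t - q t)^2" .
    also have "(ind E t :: real)^2 <= 1" by (simp add: indicator_def)
    finally show ?thesis by simp
   qed
   then have "(LINT t|ta. (q t)^2) <= (LINT t|ta. 2 + 2*(ind E t - q t)^2)" by (intro integral_mono[OF iq2]) (use id in simp_all)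
   also have "... = 2*T + 2*(LINT t|ta. (ind E t - q t)^2)" using id by (simp add: T_def spta)
   also have "... <= 2*T + 2*1" using dta et power_le_one[of et 2] by (intro add_left_mono mult_left_mono) auto
   finally show ?thesis by simp
  qed
  have c: "\<bar>measure ta E - (LINT t|ta. q t)\<bar> <= et*T + et"
  proof -
   have p: "\<bar>ind E t - q t\<bar> <= et + (ind E t - q t)^2/et" for t
   proof -
    have "et*\<bar>ind E t - q t\<bar> <= et^2 + \<bar>ind E t - q t\<bar>^2" by (rule mult_le_sum_squares)
    then have "\<bar>ind E t - q t\<bar> <= (et^2 + \<bar>ind E t - q t\<bar>^2)/et" using et by (simp add: field_simps)
    also have "... = et + (ind E t - q t)^2/et" using et by (simp add: add_divide_distrib power2_eq_square)
    finally show ?thesis .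
   qed
   have ij: "integrable ta (%t. ind E t - q t)" by (rule integrable_diff[OF i1 iq])
   have "\<bar>measure ta E - (LINT t|ta. q t)\<bar> = \<bar>(LINT t|ta. ind E t - q t)\<bar>" unfolding mE by (simp only: integral_diff[OF i1 iq])
   also have "... <= (LINT t|ta. \<bar>ind E t - q t\<bar>)" by (rule integral_abs_bound)
   also have "... <= (LINT t|ta. et + (ind E t - q t)^2/et)" by (rule integral_mono[OF integrable_abs[OF ij] _ p]) (use id in simp)
   also have "... = et*T + (LINT t|ta. (ind E t - q t)^2)/et" using id by (simp add: T_def spta)
   also have "... <= et*T + et^2/et" using dta et by (intro add_left_mono divide_right_mono) auto
   finally show ?thesis using et by (simp add: power2_eq_square)
  qed
  have nL: "nrm (opL L G) <= 2*T + 2" using b by (simp add: nrm_opL[OF G ta] cq)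
  have nF: "nrm (opL (trig_conj L) F) <= 4*et^2"
  proof -
   have "opL (trig_conj L) F W = opL (trig_conj L) ?C1 W + \<i> * opL (trig_conj L) ?C2 W" for W unfolding F_def lincomb_fun_add ..
   then have "nrm (opL (trig_conj L) F) = nrm (%W. opL (trig_conj L) ?C1 W + \<i> * opL (trig_conj L) ?C2 W)" by presburger
   also have "... <= 2*nrm (opL (trig_conj L) ?C1) + 2*(cmod \<i>)^2*nrm (opL (trig_conj L) ?C2)"
    by (rule SI_add(2)[OF SI_opL[OF s1(2)] SI_opL[OF s2(2)]])
   also have "... = 2*(LINT t|si1. (q t)^2) + 2*(LINT t|si2. (q t)^2)"
    unfolding nrm_opL[OF s1(2) s1(1)] nrm_opL[OF s2(2) s2(1)] cq by (simp add: si1_def si2_def)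
   also have "... <= 2*et^2 + 2*et^2" using a1 by linarith
   finally show ?thesis by simp
  qed
  have "\<bar>(LINT t|ta. q t)\<bar> = cmod (LINT t|ta. trig L t)" by (simp add: L[symmetric])
  also have "... = cmod (LINT W|P. opL L G W*cnj (G W))" by (simp only: inner_opL[OF G ta])
  \<comment> \<open>The pairing with the difference is small because \<open>F\<close> is close to
    \<open>G\<close>; in the pairing with \<open>F\<close> the operator is moved by
    \<open>opL_adjoint\<close> onto \<open>F\<close>, where it is small.\<close>
  also have "(LINT W|P. opL L G W*cnj (G W)) = (LINT W|P. opL L G W*cnj (G W - F W) + opL L G W*cnj (F W))" by (simp add: algebra_simps)
  also have "... = (LINT W|P. opL L G W*cnj (G W - F W)) + (LINT W|P. opL L G W*cnj (F W))"
   by (rule integral_add[OF SI_inner_integrable[OF SI_opL[OF G] GF] SI_inner_integrable[OF SI_opL[OF G] F]])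
  also have "cmod ... <= cmod (LINT W|P. opL L G W*cnj (G W - F W)) + cmod (LINT W|P. opL L G W*cnj (F W))" by (rule norm_triangle_ineq)
  also have "... <= (et*nrm (opL L G) + nrm (%W. G W - F W)/et) + (et*nrm G + nrm (opL (trig_conj L) F)/et)" unfolding opL_adjoint[OF G F]
   by (intro add_mono inner_le[OF SI_opL[OF G] GF et(1)] inner_le[OF G SI_opL[OF F] et(1)])
  also have "... <= (et*(2*T + 2) + et^2/et) + (et*nrm G + 4*et^2/et)"
   using et by (intro add_mono mult_left_mono divide_right_mono nL nGF nF order_refl) auto
  also have "... = et*(2*T + 7 + nrm G)" using et by (simp add: power2_eq_square algebra_simps)
  finally have "\<bar>(LINT t|ta. q t)\<bar> <= et*(2*T + 7 + nrm G)" .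
  then show ?thesis using c by (simp add: algebra_simps)
 qed
 have "(%n. inverse (real (Suc n))*(3*T + 8 + nrm G)) ~~> 0*(3*T + 8 + nrm G)" by (intro tendsto_mult tendsto_const inverse_Suc_tendsto)
 then have "measure ta E <= 0*(3*T + 8 + nrm G)"
 proof (rule LIMSEQ_le_const)
  show "EX N. ALL n>=N. measure ta E <= inverse (real (Suc n))*(3*T + 8 + nrm G)"
   by (intro exI[of _ 0] allI impI main) (simp_all add: inverse_le_1_iff)
 qed
 then have "measure ta E = 0" by (simp add: measure_le_0_iff)
 then show ?thesis using E' by (intro null_setsI) (simp_all add: sta ta.emeasure_eq_measure)
qed

text \<open>The spectral measure \<open>si0\<close> of a single observable with nonzero mean and
  positive density already has the null sets of the reference measure. It dominates all others by
  \<open>spectral_dominated\<close>, and any other dominating spectral measure has the same null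
  sets.\<close>

theorem dynamical_spectrum_P:
 assumes F: "F : polys" "(LINT W|P. F W) ~= 0" "AE t in lborel. spec_density F t > 0"
 shows "dynamical_spectrum P = measure_class (atom_density 1 (%_. 1))"
proof -
 define si0 where "si0 = atom_density ((LINT W|P. F W)^2) (spec_density F)"
 note s = spectral_measure_polys[OF F(1), folded si0_def]
 have n: "null_sets si0 = null_sets (atom_density 1 (%_. 1))" unfolding si0_def
  by (rule null_sets_atom_density) (use F borel_measurable_integrable[OF spectral_polys(2)[OF F(1)]] in simp_all)
 have dom: "null_sets (atom_density 1 (%_. 1)) <= null_sets ta" if "square_integrable P G" "spectral_measure P G ta" for G ta
  using spectral_dominated[OF that] by blast
 have c: "measure_class si = measure_class (atom_density 1 (%_. 1))" if "sets si = sets borel" "null_sets si = null_sets (atom_density 1 (%_. 1))" for si :: "'a measure"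
  using that by (simp add: measure_class_def equivalent_measures_def)
 show ?thesis
 proof (intro subset_antisym subsetI)
  fix mm :: "'a measure" assume "mm : dynamical_spectrum P"
  then obtain si where si: "mm : measure_class si" "EX F. square_integrable P F & spectral_measure P F si"
   "ALL G ta. square_integrable P G & spectral_measure P G ta --> absolutely_continuous si ta"
   unfolding dynamical_spectrum_def by (elim UN_E CollectE conjE) (rule that)
  obtain G where G: "square_integrable P G" "spectral_measure P G si" using si(2) by (elim exE conjE) (rule that)
  have "null_sets si <= null_sets si0" using si(3)[rule_format, OF conjI[OF s(2,1)]] by (simp add: absolutely_continuous_def)
  then have "null_sets si = null_sets (atom_density 1 (%_. 1))" using dom[OF G] n by auto
  moreover have "sets si = sets borel" using G(2) by (simp add: spectral_measure_def)
  ultimately show "mm : measure_class (atom_density 1 (%_. 1))" using si(1) by (simp only: c)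
 next
  fix mm :: "'a measure" assume "mm : measure_class (atom_density 1 (%_. 1))"
  then have "mm : measure_class si0" using c[of si0] n by (simp add: si0_def)
  moreover have "ALL G ta. square_integrable P G & spectral_measure P G ta --> absolutely_continuous si0 ta"
   unfolding absolutely_continuous_def n by (intro allI impI, elim conjE) (rule dom)
  ultimately show "mm : dynamical_spectrum P" unfolding dynamical_spectrum_def by (intro UN_I CollectI conjI stationary_P) (rule exI, rule conjI[OF s(2,1)])
 qed
qed

end

section \<open>The spectral density of the count of a set\<close>

lemma
 fixes g h c :: "'a::euclidean_space => real"
 assumes g: "integrable lborel g" and h: "integrable lborel h" and c [measurable]: "c : BM borel" and c1: "!!x. \<bar>c x\<bar> <= 1"
 shows conv_swap: "(LBINT x. (LBINT w. g w*h (x + w)*c x)) = (LBINT w. g w*(LBINT x. h (x + w)*c x))"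
  and conv_integrable: "integrable lborel (%x. (LBINT w. g w*h (x + w)*c x))"
proof -
 note [measurable] = borel_measurable_integrable[OF g, simplified] borel_measurable_integrable[OF h, simplified]
 have I: "integrable (lborel \<Otimes>\<^sub>M lborel) (%(x, w). g w*h (x + w)*c x)"
 proof (rule integrableI_bounded)
  have hw: "(NN x. ennreal \<bar>h (x + w)\<bar>) = (NN x. ennreal \<bar>h x\<bar>)" for w
   using nn_integral_lborel_translate[of "%x. ennreal \<bar>h x\<bar>" w] by (simp add: add.commute)
  have "(NNI (lborel \<Otimes>\<^sub>M lborel) (%z. ennreal (norm (case z of (x, w) => g w*h (x + w)*c x))))
   <= (NNI (lborel \<Otimes>\<^sub>M lborel) (%z. (case z of (x, w) => ennreal \<bar>g w\<bar>*ennreal \<bar>h (x + w)\<bar>)))"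
   using c1 by (intro nn_integral_mono) (auto simp: abs_mult ennreal_mult[symmetric] intro!: ennreal_leI mult_right_le_one_le)
  also have "... = (NN w. (NN x. ennreal \<bar>g w\<bar>*ennreal \<bar>h (x + w)\<bar>))" by (subst lborel_pair.nn_integral_snd[symmetric]) (auto simp: split_def)
  also have "... = (NN w. ennreal \<bar>g w\<bar>*(NN x. ennreal \<bar>h x\<bar>))" by (subst nn_integral_cmult) (simp_all add: hw)
  also have "... = (NN w. ennreal \<bar>g w\<bar>)*(NN x. ennreal \<bar>h x\<bar>)" by (rule nn_integral_multc) simp
  also have "... < \<infinity>" using g h by (auto simp: integrable_iff_bounded ennreal_mult_less_top)
  finally show "(NNI (lborel \<Otimes>\<^sub>M lborel) (%z. ennreal (norm (case z of (x, w) => g w*h (x + w)*c x)))) < \<infinity>" .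
 qed measurable
 show "integrable lborel (%x. (LBINT w. g w*h (x + w)*c x))" using lborel_pair.integrable_fst'[OF I] by simp
 have "(LBINT x. (LBINT w. g w*h (x + w)*c x)) = (LBINT w. (LBINT x. g w*h (x + w)*c x))" by (rule lborel_pair.Fubini_integral[OF I, symmetric])
 then show "(LBINT x. (LBINT w. g w*h (x + w)*c x)) = (LBINT w. g w*(LBINT x. h (x + w)*c x))" by (simp add: mult.assoc)
qed

lemma integral_shift_cos:
 fixes h :: "'a::euclidean_space => real"
 assumes h: "integrable lborel h"
 shows "(LBINT x. h (x + w)*cos (ph x t))
  = cos (ph w t)*(LBINT x. h x*cos (ph x t)) + sin (ph w t)*(LBINT x. h x * sin (ph x t))"
proof -
 note [measurable] = borel_measurable_integrable[OF h, simplified]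
 have i: "integrable lborel (%x. h x*cos (ph x t))" "integrable lborel (%x. h x * sin (ph x t))"
  by (rule integrable_bound[OF h]; auto simp: abs_mult intro!: mult_right_le_one_le)+
 have "(LBINT x. h (x + w)*cos (ph x t)) = (LBINT x. (%y. h y*cos (ph (y - w) t)) (w + x))" by (simp add: add.commute)
 also have "... = (LBINT y. h y*cos (ph (y - w) t))" by (rule integral_lborel_translate) measurable
 also have "... = (LBINT y. cos (ph w t)*(h y*cos (ph y t)) + sin (ph w t)*(h y * sin (ph y t)))"
  by (intro integral_cong refl) (simp add: inner_diff_left right_diff_distrib cos_diff algebra_simps)
 also have "... = cos (ph w t)*(LBINT x. h x*cos (ph x t)) + sin (ph w t)*(LBINT x. h x * sin (ph x t))"
  using i by simp
 finally show ?thesis .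
qed

lemma integral_unit_interval_cis:
 assumes "!!n::int. c ~= of_int n"
 shows "(LBINT s. ind {0..1} s *\<^sub>R cis (2*pi*(s*c))) ~= 0"
proof -
 have c: "c ~= 0" using assms[of 0] by simp
 let ?F = "%s. cis (2*pi*(s*c))/(2*pi*c*\<i>)"
 have d: "(cis has_vector_derivative \<i>*cis x) (at x)" for x unfolding has_vector_derivative_complex_iff by (auto intro!: derivative_eq_intros)
 have "(LBINT s. ind {0..1} s *\<^sub>R cis (2*pi*(s*c))) = ?F 1 - ?F 0"
 proof (rule integral_FTC_Icc)
  fix s :: real
  have "((%s. cis (2*pi*(s*c))) has_vector_derivative (2*pi*c) *\<^sub>R (\<i>*cis (2*pi*(s*c)))) (at s within {0..1})"
   by (rule vector_diff_chain_within[of "%s. 2*pi*(s*c)" _ _ _ cis, unfolded comp_def])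
    (auto intro!: derivative_eq_intros has_vector_derivative_at_within[OF d] simp: has_real_derivative_iff_has_vector_derivative[symmetric])
  from has_vector_derivative_divide[OF this, of "2*pi*c*\<i>"]
  show "(?F has_vector_derivative cis (2*pi*(s*c))) (at s within {0..1})" using c by (simp add: scaleR_conv_of_real)
 qed (auto intro!: continuous_intros)
 also have "... = (cis (2*pi*c) - 1)/(2*pi*c*\<i>)" by (simp add: diff_divide_distrib)
 also have "... ~= 0"
 proof
  assume "(cis (2*pi*c) - 1)/(2*pi*c*\<i>) = 0"
  then have "cis (2*pi*c) = 1" using c by simp
  then have "cos (2*pi*c) = 1" by (metis cis.sel(1) one_complex.sel(1))
  then obtain n :: int where "2*pi*c = of_int n*2*pi" using cos_one_2pi_int by auto
  then show False using assms[of n] by simp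
 qed
 finally show ?thesis .
qed

definition ucube :: "'a::euclidean_space set" where "ucube = cbox 0 One"

lemma ucube_RR [simp]: "ucube : RR" by (simp add: ucube_def RR_def bbs_def)

lemma ucube_measure: "vol (ucube :: 'a::euclidean_space set) = 1" unfolding ucube_def by (simp add: content_cbox')

lemma ucube_indicator: "ind ucube x = (PROD b:Basis. ind {0..1} (inner x b) :: real)"
 unfolding ucube_def mem_box indicator_def by (auto simp: prod_zero_iff intro!: prod.neutral)

text \<open>The transform of the cube factors over coordinates, and a factor is nonzero unless the
  coordinate of t is an integer. The exceptional set thus lies in countably many
  hyperplanes.\<close>

lemma ucube_fourier_AE:
 "AE t in (lborel :: 'a::euclidean_space measure). (LBINT x. ind ucube x*cos (ph x t))^2
  + (LINT x|(lborel :: 'a measure). ind ucube x * sin (ph x t))^2 > 0"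
proof -
 have hyp: "AE t in (lborel :: 'a measure). inner t b ~= of_int n" if "b : Basis" for b and n :: int
 proof -
  have "negligible {x::'a. inner x b = of_int n}" by (rule negligible_standard_hyperplane[OF that])
  moreover have "{x::'a. inner x b = of_int n} : sets borel" by measurable
  ultimately have "{x::'a. inner x b = of_int n} : null_sets lborel" by (auto simp: null_sets_completion_iff negligible_iff_null_sets)
  from AE_not_in[OF this] show ?thesis by simp
 qed
 have "AE t in (lborel :: 'a measure). ALL b:Basis. ALL n::int. inner t b ~= of_int n"
  using hyp by (intro AE_finite_allI finite_Basis) (simp add: AE_all_countable)
 then show ?thesis
 proof eventually_elim
  fix t :: 'a assume t: "ALL b:Basis. ALL n::int. inner t b ~= of_int n"
  let ?g = "%b s. ind {0..1} s *\<^sub>R cis (2*pi*(s*inner t b))"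
  have cs: "cis (SUM i:A. f i) = (PROD i:A. cis (f i))" if "finite A" for A :: "'a set" and f using that by (induction A) (auto simp: cis_mult[symmetric])
  have gi: "integrable lborel (?g b)" for b using borel_integrable_compact[of "{0..1::real}" "%s. cis (2*pi*(s*inner t b))"] by (simp add: continuous_intros)
  have e: "(PROD b:Basis. ?g b (inner x b)) = cr (ind ucube x)*cis (ph x t)" for x :: 'a
  proof -
   have "(PROD b:Basis. ?g b (inner x b)) = cr (PROD b:Basis. ind {0..1} (inner x b))*(PROD b:Basis. cis (2*pi*(inner x b*inner t b)))"
    by (simp add: scaleR_conv_of_real prod.distrib)
   also have "(PROD b:Basis. cis (2*pi*(inner x b*inner t b))) = cis (ph x t)"
    unfolding euclidean_inner[of x t] by (simp add: cs[symmetric] sum_distrib_left)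
   finally show ?thesis by (simp add: ucube_indicator)
  qed
  have ii: "integrable lborel (%x::'a. cr (ind ucube x)*cis (ph x t))" using integrable_prod_Basis[of ?g, OF gi] by (simp only: e)
  have "(LINT x|(lborel :: 'a measure). cr (ind ucube x)*cis (ph x t)) = (PROD b:Basis. (LBINT s. ?g b s))"
   using integral_prod_Basis[of ?g, OF gi] by (simp only: e)
  also have "... ~= 0" using t by (simp add: integral_unit_interval_cis)
  finally have nz: "(LINT x|(lborel :: 'a measure). cr (ind ucube x)*cis (ph x t)) ~= 0" (is "?I ~= 0") .
  have "Re ?I = (LBINT x. ind ucube x*cos (ph x t))" "Im ?I = (LBINT x. ind ucube x * sin (ph x t))"
   using ii by (simp_all flip: integral_Re integral_Im)
  then show "(LBINT x. ind ucube x*cos (ph x t))^2 + (LINT x|(lborel :: 'a measure). ind ucube x * sin (ph x t))^2 > 0"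
   using nz by (simp add: complex_eq_iff sum_power2_gt_zero_iff)
 qed
qed

context det_kernel begin

lemma R_1: "R (Suc 0) x = 1" by (simp add: R_def dt_leibniz K_0)

lemma R_2: "R 2 x = 1 - k2 (x 0 - x 1)"
proof -
 have e: "{0..<2} = insert 0 {1::nat}" by auto
 have K10: "K (x (Suc 0) - x 0) = cnj (K (x 0 - x 1))" using K_cnj[of "x 0 - x 1"] by simp
 have "dt 2 x = (SUM p | p permutes insert 0 {1}. of_int (sign p)*(PROD i=0..<2. K (x i - x (p i))))" unfolding dt_leibniz e ..
 also have "... = 1 - K (x 0 - x 1)*cnj (K (x 0 - x 1))"
  by (subst sum_over_permutations_insert) (simp_all add: e K_0 sign_swap_id K10 sign_compose permutation_swap_id)
 finally show ?thesis by (simp add: R_def complex_norm_square[symmetric])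
qed

lemma m_1: assumes A: "A 0 : bbs" shows "m (Suc 0) A = vol (A 0)"
proof -
 have j: "A j : bbs" if "j : {..<Suc 0}" for j using A that by simp
 have "m (Suc 0) A = measure (\<Pi>\<^sub>M j\<in>{..<Suc 0}. lborel) (PiE {..<Suc 0} A)"
 proof -
  have "PiE {..<Suc 0} A Int space (\<Pi>\<^sub>M j\<in>{..<Suc 0}. lborel) = PiE {..<Suc 0} A" by (auto simp: space_PiM PiE_def)
  then show ?thesis unfolding m_def R_1 by simp
 qed
 also have "... = vol (A 0)" using PiE_emeasure[of "{..<Suc 0}" A, OF finite_lessThan j] by (simp add: measure_def[of "\<Pi>\<^sub>M j\<in>{..<Suc 0}. lborel"])
 finally show ?thesis .
qed

lemma m_2:
 assumes A: "A 0 : bbs" "A 1 : bbs"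
 shows "ennreal (m 2 A) = (\<integral>\<^sup>+u. \<integral>\<^sup>+v. ennreal (1 - k2 (u - v))*ind (A 0) u*ind (A 1) v \<partial>lborel \<partial>lborel)"
proof -
 interpret product_sigma_finite "%_::nat. lborel :: 'a measure" by (rule lborel_product_sigma_finite)
 have [measurable]: "A 0 : sets borel" "A (Suc 0) : sets borel" using A by (auto simp: bbs_borel)
 let ?f = "%u v. ennreal (1 - k2 (u - v))*ind (A 0) u*ind (A 1) v"
 have j: "A j : bbs" if "j < 2" for j using A that by (auto simp: less_2_cases_iff)
 have e: "{..<2} = {0, 1::nat}" by auto
 have "ennreal (m 2 A) = (NNI (\<Pi>\<^sub>M j\<in>{..<2}. lborel) (%x. ennreal (R 2 x*ind (PiE {..<2} A) x)))"
  unfolding m_def by (rule nn_integral_eq_integral[symmetric, OF m_integrable[OF j]]) (simp_all add: R_2 k_le_1)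
 also have "... = (NNI (\<Pi>\<^sub>M j\<in>{0, 1::nat}. lborel) (%x. ?f (x 0) (x 1)))" unfolding e[symmetric]
 proof (intro nn_integral_cong)
  fix x assume "x : space (\<Pi>\<^sub>M j\<in>{..<2::nat}. lborel :: 'a measure)"
  then have ex: "x : extensional {..<2}" by (auto simp: space_PiM PiE_def)
  then have "x : PiE {..<2} A \<longleftrightarrow> x 0 : A 0 & x 1 : A 1" by (simp only: PiE_def Int_iff) (auto simp: Pi_def less_2_cases_iff)
  then show "ennreal (R 2 x*ind (PiE {..<2} A) x) = ?f (x 0) (x 1)" by (auto simp: indicator_def R_2)
 qed
 also have "... = (NNI (lborel \<Otimes>\<^sub>M lborel) (%z. ?f (fst z) (snd z)))" by (rule product_nn_integral_pair) (auto simp: split_def)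
 also have "... = (\<integral>\<^sup>+u. \<integral>\<^sup>+v. ?f u v \<partial>lborel \<partial>lborel)"
  by (subst lborel.nn_integral_fst[symmetric]) (auto simp: split_def)
 finally show ?thesis .
qed

end

context det_process begin

lemma expect_count: assumes A: "A : bbs" shows "(LINT W|P. measure W A) = vol A" using ffact_expect[of "Suc 0" "%_. A"] m_1[of "%_. A"] A by simp

text \<open>An ordered pair of points from \<open>A\<close> and \<open>B\<close> is either a pair of
  distinct points or the repetition of a point of the intersection.\<close>

lemma expect_count_mult:
 assumes A: "A : bbs" and B: "B : bbs"
 shows "(LINT W|P. measure W A*measure W B) = m 2 (%j. if j = 0 then A else B) + vol (A Int B)"
proof -
 let ?C = "%j::nat. if j = 0 then A else B"
 have C: "?C j : bbs" for j using A B by simp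
 have e: "measure W A*measure W B = ffact_count (measure W) 2 ?C + ffact_count (measure W) (Suc 0) (%_. A Int B)" for W :: "'a measure"
  by (simp add: numeral_2_eq_2)
 have i: "integrable P (%W. ffact_count (measure W) 2 ?C)" "integrable P (%W. ffact_count (measure W) (Suc 0) (%_. A Int B))"
  by (rule ffact_integrable, rule C) (rule ffact_integrable, rule bbs_Int[OF A B])
 have "(LINT W|P. measure W A*measure W B) = (LINT W|P. ffact_count (measure W) 2 ?C) + (LINT W|P. ffact_count (measure W) (Suc 0) (%_. A Int B))"
  unfolding e by (rule integral_add[OF i])
 also have "(LINT W|P. ffact_count (measure W) 2 ?C) = m 2 ?C" by (rule ffact_expect[OF C])
 also have "(LINT W|P. ffact_count (measure W) (Suc 0) (%_. A Int B)) = vol (A Int B)" using expect_count[OF bbs_Int[OF A B]] by simp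
 finally show ?thesis .
qed

text \<open>\<open>T x\<close> is the volume of the overlap of \<open>A\<close> with its translate.
  Coinciding points contribute \<open>T\<close>; the pair correlation 1 - \<open>k2\<close> falls
  short of the product of intensities 1 by \<open>k2\<close>, which subtracts the average of
  \<open>T\<close> against \<open>k2\<close>.\<close>

lemma covP_count:
 assumes A: "A : bbs"
 defines "T \<equiv> %x. (LBINT v. ind A v * ind A (x + v)*(1::real))"
 shows "covP (%W. measure W A) (%W. measure W A) x = T x - (LBINT w. k2 w*T (x + w))"
proof -
 let ?B = "(+) x -` A"
 let ?C = "%j::nat. if j = 0 then ?B else A"
 have B: "?B : bbs" by (rule bbs_vimage_plus[OF A])
 have [measurable]: "A : sets borel" "?B : sets borel" using A B by (auto simp: bbs_borel)
 have iB: "ind ?B u = (ind A (x + u) :: ennreal)" for u by (simp add: indicator_def)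
 have T: "T y = vol ((+) y -` A Int A)" for y
 proof -
  have "(%v. ind A v * ind A (y + v)*(1::real)) = ind ((+) y -` A Int A)" by (auto simp: indicator_def)
  then show ?thesis unfolding T_def by simp
 qed
 have Tn: "ennreal (T y) = (NN v. ind A v * ind A (y + v))" for y
 proof -
  have b: "(+) y -` A Int A : bbs" by (intro bbs_Int bbs_vimage_plus A)
  have "(%v. ind A v * ind A (y + v)) = (ind ((+) y -` A Int A) :: 'a => ennreal)" by (auto simp: indicator_def)
  then show ?thesis unfolding T using bbs_emeasure_lborel[OF b] bbs_borel[OF b] by simp
 qed
 have T0: "T y >= 0" for y by (simp add: T)
 have TL: "T y <= vol A" for y unfolding T
  by (rule measure_mono_fmeasurable) (use A bbs_emeasure_lborel[OF A] in \<open>auto simp: fmeasurable_def bbs_borel\<close>)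
 have Tm [measurable]: "T : BM borel" unfolding T_def by measurable
 let ?N = "\<integral>\<^sup>+u. \<integral>\<^sup>+v. ennreal (k2 (u - v))*ind ?B u*ind A v \<partial>lborel \<partial>lborel"
 have N: "?N = ennreal (LBINT w. k2 w*T (x + w))"
 proof -
  have "?N = (\<integral>\<^sup>+v. \<integral>\<^sup>+u. ennreal (k2 (u - v))*ind A (x + u)*ind A v \<partial>lborel \<partial>lborel)"
   unfolding iB by (rule lborel_pair.Fubini') measurable
  also have "... = (\<integral>\<^sup>+v. \<integral>\<^sup>+w. ennreal (k2 w)*(ind A v * ind A (x + w + v)) \<partial>lborel \<partial>lborel)"
  proof (rule nn_integral_cong)
   fix v :: 'a
   have "(NN u. ennreal (k2 (u - v))*ind A (x + u)*ind A v)
    = (NN w. ennreal (k2 (v + w - v))*ind A (x + (v + w))*ind A v)" by (rule nn_integral_lborel_translate[symmetric]) measurable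
   then show "(NN u. ennreal (k2 (u - v))*ind A (x + u)*ind A v)
    = (NN w. ennreal (k2 w)*(ind A v * ind A (x + w + v)))" by (simp add: ac_simps)
  qed
  also have "... = (\<integral>\<^sup>+w. \<integral>\<^sup>+v. ennreal (k2 w)*(ind A v * ind A (x + w + v)) \<partial>lborel \<partial>lborel)"
   by (rule lborel_pair.Fubini') measurable
  also have "... = (NN w. ennreal (k2 w*T (x + w)))" by (intro nn_integral_cong) (simp add: nn_integral_cmult Tn[symmetric] ennreal_mult T0)
  also have "... = ennreal (LBINT w. k2 w*T (x + w))"
  proof (rule nn_integral_eq_integral)
   show "integrable lborel (%w. k2 w*T (x + w))" by (rule integrable_bound[of _ "%w. vol A*k2 w"])
     (use TL T0 k_integrable in \<open>auto simp: abs_mult mult.commute intro!: mult_right_mono\<close>)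
  qed (simp add: T0)
  finally show ?thesis .
 qed
 have m0: "m 2 ?C >= 0" unfolding m_def by (intro integral_nonneg) (simp add: R_2 k_le_1)
 \<comment> \<open>The term with \<open>k2\<close> is added to the moment instead of being
   subtracted from the product of volumes, which avoids subtraction in
   \<open>ennreal\<close>.\<close>
 have "ennreal (m 2 ?C) + ?N = (\<integral>\<^sup>+u. \<integral>\<^sup>+v. ind ?B u*ind A v \<partial>lborel \<partial>lborel)"
 proof -
  have "ennreal (m 2 ?C) = (\<integral>\<^sup>+u. \<integral>\<^sup>+v. ennreal (1 - k2 (u - v))*ind ?B u*ind A v \<partial>lborel \<partial>lborel)"
   using m_2[of ?C] A B by simp
  then have "ennreal (m 2 ?C) + ?N = (\<integral>\<^sup>+u. \<integral>\<^sup>+v. ennreal (1 - k2 (u - v))*ind ?B u*ind A v + ennreal (k2 (u - v))*ind ?B u*ind A v \<partial>lborel \<partial>lborel)"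
   by (simp add: nn_integral_add[symmetric])
  also have "... = (\<integral>\<^sup>+u. \<integral>\<^sup>+v. ind ?B u*ind A v \<partial>lborel \<partial>lborel)"
   by (intro nn_integral_cong) (simp add: distrib_right[symmetric] k_le_1 flip: ennreal_plus)
  finally show ?thesis .
 qed
 also have "... = ennreal (vol A * vol A)"
  by (simp add: nn_integral_cmult nn_integral_multc bbs_emeasure_lborel[OF A] bbs_emeasure_lborel[OF B] measure_lborel_vimage_plus[OF A] ennreal_mult)
 finally have "ennreal (m 2 ?C + (LBINT w. k2 w*T (x + w))) = ennreal (vol A * vol A)"
  unfolding N using m0 T0 by (subst ennreal_plus) (auto intro!: integral_nonneg)
 then have eq: "m 2 ?C + (LBINT w. k2 w*T (x + w)) = vol A * vol A"
  using m0 T0 by (subst (asm) ennreal_inj) (auto intro!: integral_nonneg add_nonneg_nonneg)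
 have "(LINT W|P. measure (translate x W) A*measure W A) = (LINT W|P. measure W ?B*measure W A)" by (rule integral_cong) (simp_all add: measure_translate)
 then show ?thesis unfolding covP_def expect_count_mult[OF B A] expect_count[OF A] using eq T[of x] by simp
qed

text \<open>The transform of the overlap function T is the squared modulus of the transform of the
  indicator of \<open>A\<close>, and averaging against the even function \<open>k2\<close> becomes
  multiplication by \<open>ps\<close>.\<close>

theorem spec_density_count:
 assumes A: "A : bbs"
 shows "spec_density (%W. measure W A) t
  = ((LBINT x. ind A x*cos (ph x t))^2 + (LBINT x. ind A x * sin (ph x t))^2)*(1 - ps t)"
proof -
 have [measurable]: "A : sets borel" using A by (simp add: bbs_borel)
 define T where "T x = (LBINT v. ind A v * ind A (x + v)*(1::real))" for x
 let ?c = "%x. cos (ph x t)" and ?s = "%x. sin (ph x t)"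
 have iA: "integrable lborel (ind A :: 'a => real)" using bbs_emeasure_lborel[OF A] by (intro integrable_real_indicator) auto
 have Ti: "integrable lborel T" unfolding T_def[abs_def] using conv_integrable[OF iA iA, of "%_. 1"] by (simp add: add.commute)
 note [measurable] = borel_measurable_integrable[OF Ti, simplified]
 have cm [measurable]: "?c : BM borel" "?s : BM borel" by measurable
 have Teven: "T (- x) = T x" for x
 proof -
  have "T x = (LBINT v. (%u. ind A (- x + u)*ind A u) (x + v))" unfolding T_def by simp
  also have "... = (LBINT u. ind A (- x + u)*ind A u)" by (rule integral_lborel_translate) measurable
  finally show ?thesis unfolding T_def by (simp add: mult.commute)
 qed
 have Ts: "(LBINT x. T x*?s x) = 0"
 proof -
  have "(LBINT x. T x*?s x) = (LBINT x. T (- x)*?s (- x))" by (rule integral_lborel_uminus[symmetric]) measurable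
  also have "... = - (LBINT x. T x*?s x)" by (simp add: Teven)
  finally show ?thesis by simp
 qed
 let ?a = "(LBINT x. ind A x*?c x)" and ?b = "(LBINT x. ind A x*?s x)"
 have Tc: "(LBINT x. T x*?c x) = ?a^2 + ?b^2"
 proof -
  have ia: "integrable lborel (%x. ind A x*?c x)" "integrable lborel (%x. ind A x*?s x)"
   by (rule integrable_bound[OF iA]; auto simp: abs_mult intro!: mult_right_le_one_le)+
  have "(LBINT x. T x*?c x) = (LBINT x. (LBINT w. ind A w*ind A (x + w)*?c x))" unfolding T_def by simp
  also have "... = (LBINT w. ind A w*(LBINT x. ind A (x + w)*?c x))" by (rule conv_swap[OF iA iA cm(1)]) simp
  also have "... = (LBINT w. ?a*(ind A w*?c w) + ?b*(ind A w*?s w))"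
   unfolding integral_shift_cos[OF iA] by (intro integral_cong refl) (simp add: algebra_simps)
  also have "... = ?a^2 + ?b^2" using ia by (simp add: power2_eq_square)
  finally show ?thesis .
 qed
 have i1: "integrable lborel (%x. T x*?c x)" by (rule integrable_bound[OF Ti]; auto simp: abs_mult intro!: mult_right_le_one_le)
 have "spec_density (%W. measure W A) t = (LBINT x. T x*?c x - (LBINT w. k2 w*T (x + w)*?c x))"
  unfolding spec_density_def cos_transform_def covP_count[OF A] T_def[symmetric] by (simp add: left_diff_distrib)
 also have "... = (LBINT x. T x*?c x) - (LBINT x. (LBINT w. k2 w*T (x + w)*?c x))" by (rule integral_diff[OF i1 conv_integrable[OF k_integrable Ti cm(1)]]) simp
 also have "(LBINT x. (LBINT w. k2 w*T (x + w)*?c x)) = (LBINT w. k2 w*(LBINT x. T (x + w)*?c x))" by (rule conv_swap[OF k_integrable Ti cm(1)]) simp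
 also have "... = (LBINT w. (?a^2 + ?b^2)*(k2 w*?c w))"
  unfolding integral_shift_cos[OF Ti] Ts Tc by (intro integral_cong refl) (simp add: algebra_simps)
 also have "... = (?a^2 + ?b^2)*ps t" unfolding ps_cos by simp
 finally show ?thesis unfolding Tc by (simp add: right_diff_distrib)
qed

theorem dynamical_spectrum_eq: "dynamical_spectrum P = measure_class (atom_density 1 (%_. 1))"
proof (rule dynamical_spectrum_P)
 show "(%W. measure W ucube) : polys" by (rule polys.polys_count) simp
 show "(LINT W|P. measure W ucube) ~= 0" using expect_count[of ucube] by (simp add: RR_bbs ucube_measure)
 show "AE t in lborel. spec_density (%W. measure W ucube) t > 0" using ucube_fourier_AE ps_less_1_AE
  by eventually_elim (simp add: spec_density_count[OF RR_bbs[OF ucube_RR]])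
qed

end

section \<open>Law of large numbers on lattice cells\<close>

definition latt :: "nat => 'a::euclidean_space set" where
 "latt m = {z. ALL b:Basis. real m*inner z b : \<int>}"

definition rnd :: "nat => 'a::euclidean_space => 'a" where
 "rnd m x = (SUM b:Basis. (of_int \<lfloor>real m*inner x b\<rfloor>/real m) *\<^sub>R b)"

text \<open>As fibres of the rounding map, cells are disjoint and cover the space by construction;
  for \<open>m > 0\<close> and lattice points \<open>z\<close> they are the half-open cubes of side
  1/m with corner \<open>z\<close>.\<close>

definition cell :: "nat => 'a::euclidean_space => 'a set" where
 "cell m z = {x. rnd m x = z}"

lemma rnd_inner: "b : Basis ==> inner (rnd m x) b = of_int \<lfloor>real m*inner x b\<rfloor>/real m"
 unfolding rnd_def by (rule inner_sum_left_Basis)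

lemma latt_add: "x : latt m ==> y : latt m ==> x + y : latt m" by (simp add: latt_def inner_add_left distrib_left)

lemma latt_diff: "x : latt m ==> y : latt m ==> x - y : latt m" by (simp add: latt_def inner_diff_left right_diff_distrib)

lemma latt_0 [simp]: "0 : latt m" by (simp add: latt_def)

lemma latt_uminus: "x : latt m ==> - x : latt m" using latt_diff[of 0 m x] by simp

context
 fixes m :: nat assumes m: "m > 0"
begin

lemma rnd_latt: "rnd m x : latt m" using m by (simp add: latt_def rnd_inner)

lemma rnd_add:
 assumes z: "z : latt m" shows "rnd m (x + z) = rnd m x + z"
proof (rule euclidean_eqI)
 fix b :: 'a assume b: "b : Basis"
 then obtain k :: int where k: "real m*inner z b = of_int k" using z by (auto simp: latt_def elim!: Ints_cases)
 have "inner (rnd m (x + z)) b = of_int \<lfloor>real m*inner x b + of_int k\<rfloor>/real m" using b by (simp add: rnd_inner inner_add_left distrib_left k)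
 also have "... = of_int \<lfloor>real m*inner x b\<rfloor>/real m + of_int k/real m" by (simp add: add_divide_distrib)
 also have "of_int k/real m = inner z b" using m k[symmetric] by simp
 finally show "inner (rnd m (x + z)) b = inner (rnd m x + z) b" using b by (simp add: rnd_inner inner_add_left)
qed

lemma rnd_0: "rnd m 0 = 0" by (simp add: rnd_def)

lemma rnd_fix: "z : latt m ==> rnd m z = z" using rnd_add[of z 0] by (simp add: rnd_0)

lemma norm_rnd: "norm (x - rnd m x) <= DIM('a)/real m" for x :: "'a::euclidean_space"
proof -
 have "norm (x - rnd m x) <= (SUM b:Basis. \<bar>inner (x - rnd m x) b\<bar>)" by (rule norm_le_l1)
 also have "... <= (SUM b:(Basis::'a set). 1/real m)"
 proof (rule sum_mono)
  fix b :: 'a assume b: "b : Basis"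
  have "\<bar>real m*inner x b - of_int \<lfloor>real m*inner x b\<rfloor>\<bar> <= 1" by linarith
  moreover have "inner (x - rnd m x) b = (real m*inner x b - of_int \<lfloor>real m*inner x b\<rfloor>)/real m"
   using m b by (simp add: inner_diff_left rnd_inner diff_divide_distrib)
  ultimately show "\<bar>inner (x - rnd m x) b\<bar> <= 1/real m" using m by (simp add: divide_right_mono)
 qed
 finally show ?thesis by simp
qed

lemma finite_latt: "finite (latt m Int ball (0::'a::euclidean_space) r)"
proof -
 obtain N :: nat where N: "real m*r <= real N" using real_arch_simple by blast
 let ?f = "%f. SUM b:(Basis::'a set). (of_int (f b)/real m) *\<^sub>R b"
 have "latt m Int ball 0 r <= ?f ` (Basis \<rightarrow>\<^sub>E {- int N..int N})"
 proof
  fix z :: 'a assume z: "z : latt m Int ball 0 r"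
  let ?g = "\<lambda>b\<in>Basis. \<lfloor>real m*inner z b\<rfloor>"
  have "z = rnd m z" using rnd_fix[of z] z by simp
  also have "... = ?f ?g" unfolding rnd_def by (intro sum.cong refl) simp
  finally have "z = ?f ?g" .
  moreover have "?g : Basis \<rightarrow>\<^sub>E {- int N..int N}"
  proof (intro restrict_PiE_iff[THEN iffD2] ballI)
   fix b :: 'a assume b: "b : Basis"
   have "\<bar>inner z b\<bar> <= norm z" by (rule Basis_le_norm[OF b])
   then have "\<bar>real m*inner z b\<bar> <= real m*r" using z m by (simp add: abs_mult)
   then show "\<lfloor>real m*inner z b\<rfloor> : {- int N..int N}" using N by (simp add: floor_le_iff le_floor_iff) linarith
  qed
  ultimately show "z : ?f ` (Basis \<rightarrow>\<^sub>E {- int N..int N})" by blast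
 qed
 then show ?thesis by (rule finite_subset) (intro finite_imageI finite_PiE; simp)
qed

lemma rnd_measurable [measurable]: "rnd m : BM borel" unfolding rnd_def[abs_def] by measurable

lemma cell_translate: "z : latt m ==> cell m z = (+) (- z) -` cell m 0"
proof -
 assume z: "z : latt m"
 have "rnd m (- z + x) = rnd m x - z" for x using rnd_add[OF latt_uminus[OF z], of x] by (simp add: add.commute)
 then show ?thesis by (auto simp: cell_def)
qed

lemma cell_0: "cell m (0::'a::euclidean_space) = {x. ALL b:Basis. 0 <= inner x b & inner x b < 1/real m}"
proof -
 have "rnd m x = 0 \<longleftrightarrow> (ALL b:Basis. 0 <= inner x b & inner x b < 1/real m)" for x :: 'a
 proof -
  have "rnd m x = 0 \<longleftrightarrow> (ALL b:Basis. \<lfloor>real m*inner x b\<rfloor> = 0)"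
   using m by (simp add: euclidean_eq_iff[of "rnd m x"] rnd_inner)
  also have "... \<longleftrightarrow> (ALL b:Basis. 0 <= inner x b & inner x b < 1/real m)"
   using m by (intro ball_cong refl) (simp add: floor_eq_iff zero_le_mult_iff pos_less_divide_eq mult.commute)
  finally show ?thesis .
 qed
 then show ?thesis by (simp add: cell_def)
qed

lemma cell_borel [measurable]: "cell m z : sets borel"
proof -
 have "cell m z = rnd m -` {z}" by (auto simp: cell_def)
 then show ?thesis using measurable_sets[OF rnd_measurable, of "{z}"] by simp
qed

lemma cell_0_RR: "cell m 0 : RR"
proof -
 have "convex (cell m (0::'a))" unfolding cell_0 by (rule convexI) (auto simp: inner_add_left intro!: add_nonneg_nonneg convex_bound_lt)
 moreover have "cell m (0::'a) <= cball 0 (DIM('a)/real m)"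
 proof
  fix x :: 'a assume "x : cell m 0"
  then show "x : cball 0 (DIM('a)/real m)" using norm_rnd[of x] by (simp add: cell_def)
 qed
 then have "bounded (cell m (0::'a))" using bounded_cball bounded_subset by blast
 ultimately show ?thesis by (simp add: RR_def bbs_def)
qed

lemma cell_RR: "z : latt m ==> cell m z : RR" by (subst cell_translate) (auto intro: RR_vimage_plus cell_0_RR)

lemma cell_measure: "(z::'a) : latt m ==> vol (cell m z) = vol (cell m (0::'a::euclidean_space))"
 using measure_lborel_vimage_plus[OF RR_bbs[OF cell_0_RR], of "- z"] by (subst cell_translate) auto

lemma measure_cells:
 assumes "finite S" "(S :: 'a set) <= latt m"
 shows "vol (UN z:S. cell m z) = real (card S) * vol (cell m (0::'a::euclidean_space))"
proof -
 have "vol (UN z:S. cell m z) = (SUM z:S. vol (cell m z))"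
 proof (rule measure_finite_Union[OF assms(1)])
  show "disjoint_family_on (cell m) S" by (auto simp: disjoint_family_on_def cell_def)
  show "emeasure lborel (cell m z) ~= \<infinity>" if "z : S" for z using that assms(2) bbs_emeasure_lborel[OF RR_bbs[OF cell_RR[of z]]] by auto
 qed auto
 also have "... = (SUM z:S. vol (cell m (0::'a)))" using assms(2) by (intro sum.cong refl cell_measure) auto
 finally show ?thesis by simp
qed

definition lball :: "nat => 'a::euclidean_space set" where "lball n = latt m Int bl n"

lemma lball_finite [simp]: "finite (lball n)" unfolding lball_def by (rule finite_latt)

lemma lball_mono: "n <= k ==> lball n <= lball k" by (auto simp: lball_def)

text \<open>Multiples of one basis vector suffice. The linear bound is crude, but along the radii
  k^2 it makes the variances of averages summable.\<close>

lemma card_lball_ge: "card (lball n :: 'a::euclidean_space set) >= n"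
proof -
 obtain b :: 'a where b: "b : Basis" using nonempty_Basis by blast
 have "inj_on (%j. real j *\<^sub>R b) {..<n}" using b by (auto simp: inj_on_def)
 moreover have "(%j. real j *\<^sub>R b) ` {..<n} <= lball n" using b by (auto simp: lball_def latt_def inner_Basis)
 ultimately have "card {..<n} <= card (lball n :: 'a set)" by (intro card_inj_on_le) auto
 then show ?thesis by simp
qed

text \<open>The cells of the lattice points in a ball are disjoint, and their union lies between the
  balls whose radius is changed by the rounding error \<open>de\<close>.\<close>

lemma card_lball_bounds:
 fixes n :: nat
 defines "de \<equiv> DIM('a)/real m"
 shows "real (card (lball n :: 'a::euclidean_space set)) * vol (cell m (0::'a)) <= unit_ball_vol DIM('a)*(real n + de)^DIM('a)"
  and "real n >= de ==> unit_ball_vol DIM('a)*(real n - de)^DIM('a) <= real (card (lball n :: 'a::euclidean_space set)) * vol (cell m (0::'a))"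
proof -
 let ?U = "UN z:lball n :: 'a set. cell m z"
 have de: "de > 0" using m by (simp add: de_def)
 have mu: "vol ?U = real (card (lball n :: 'a set)) * vol (cell m (0::'a))" by (rule measure_cells) (auto simp: lball_def finite_latt)
 have fin: "ball (0::'a) r : fmeasurable lborel" for r using emeasure_bounded_finite[of "ball (0::'a) r"] by (auto simp: fmeasurable_def less_top)
 have r1: "norm x <= norm (rnd m x) + de" "norm (rnd m x) <= norm x + de" for x :: 'a
  using norm_rnd[of x] norm_triangle_ineq2[of x "rnd m x"] norm_triangle_ineq2[of "rnd m x" x] by (auto simp: de_def norm_minus_commute)
 have U: "?U <= ball 0 (real n + de)"
 proof
  fix x assume "x : ?U"
  then have "norm (rnd m x) < real n" by (auto simp: lball_def cell_def)
  then show "x : ball 0 (real n + de)" using r1(1)[of x] by simp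
 qed
 have Us: "?U : sets borel" by (intro sets.finite_UN) auto
 have "vol ?U <= vol (ball (0::'a) (real n + de))" by (rule measure_mono_fmeasurable[OF U _ fin]) (use Us in simp)
 then show "real (card (lball n :: 'a set)) * vol (cell m (0::'a)) <= unit_ball_vol DIM('a)*(real n + de)^DIM('a)"
  using de by (simp add: mu content_ball)
 assume n: "real n >= de"
 have "ball 0 (real n - de) <= ?U"
 proof
  fix x :: 'a assume "x : ball 0 (real n - de)"
  then have "rnd m x : lball n" using r1(2)[of x] rnd_latt by (simp add: lball_def)
  then show "x : ?U" by (auto simp: cell_def)
 qed
 then have "vol (ball (0::'a) (real n - de)) <= vol ?U"
 proof (rule measure_mono_fmeasurable)
  show "?U : fmeasurable lborel" using fmeasurableI2[OF fin U] Us by simp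
 qed simp
 then show "unit_ball_vol DIM('a)*(real n - de)^DIM('a) <= real (card (lball n :: 'a set)) * vol (cell m (0::'a))"
  using n by (simp add: mu content_ball)
qed

text \<open>If cells were null sets, finitely many of them could not fill a ball of positive radius,
  contrary to the lower bound in \<open>card_lball_bounds\<close>.\<close>

lemma cell_measure_pos: "vol (cell m (0::'a::euclidean_space)) > 0"
proof (rule ccontr)
 assume "~ vol (cell m (0::'a)) > 0"
 then have 0: "vol (cell m (0::'a)) = 0" by (simp add: measure_le_0_iff zero_less_measure_iff)
 obtain n :: nat where n: "real n > DIM('a)/real m" using reals_Archimedean2 by blast
 then have "unit_ball_vol (real DIM('a))*(real n - DIM('a)/real m)^DIM('a) > 0" by (intro mult_pos_pos zero_less_power) simp_all
 also have "unit_ball_vol (real DIM('a))*(real n - DIM('a)/real m)^DIM('a) <= 0" using card_lball_bounds(2)[of n, where 'a = 'a] n unfolding 0 by simp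
 finally show False by simp
qed

lemma card_lball_lim:
 "(%n. real (card (lball n :: 'a::euclidean_space set))/real n^DIM('a)) ~~> unit_ball_vol DIM('a) / vol (cell m (0::'a))"
proof -
 let ?de = "DIM('a)/real m" and ?q = "vol (cell m (0::'a))" and ?U = "unit_ball_vol DIM('a)"
 have q: "?q > 0" by (rule cell_measure_pos)
 have l: "(%n. ?U/?q*(1 + c/real n)^DIM('a)) ~~> ?U/?q" for c :: real
 proof -
  have "(%n. c/real n) ~~> 0" using tendsto_divide_0[OF tendsto_const filterlim_at_top_imp_at_infinity[OF filterlim_real_sequentially]] .
  then have "(%n. ?U/?q*(1 + c/real n)^DIM('a)) ~~> ?U/?q*(1 + 0)^DIM('a)" by (intro tendsto_intros)
  then show ?thesis by simp
 qed
 have e: "?U/?q*(1 + c/real n)^DIM('a) = ?U*(real n + c)^DIM('a)/?q/real n^DIM('a)" if "n > 0" for n c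
 proof -
  have "1 + c/real n = (real n + c)/real n" using that by (simp add: field_simps)
  then show ?thesis by (simp add: power_divide)
 qed
 have ev: "eventually (%n. n > 0 & real n >= ?de) sequentially"
  using eventually_gt_at_top[of 0] eventually_ge_at_top[of "nat \<lceil>?de\<rceil>"] by eventually_elim linarith
 show ?thesis
 proof (rule tendsto_sandwich[OF _ _ l[of "- ?de"] l[of ?de]])
  show "eventually (%n. ?U/?q*(1 + - ?de/real n)^DIM('a) <= real (card (lball n :: 'a set))/real n^DIM('a)) sequentially" using ev
  proof eventually_elim
   fix n :: nat assume n: "n > 0 & real n >= ?de"
   then have "?U*(real n - ?de)^DIM('a)/?q <= real (card (lball n :: 'a set))"
    using card_lball_bounds(2)[of n, where 'a = 'a] q by (simp add: pos_divide_le_eq)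
   then show "?U/?q*(1 + - ?de/real n)^DIM('a) <= real (card (lball n :: 'a set))/real n^DIM('a)"
    unfolding e[OF conjunct1[OF n]] using n by (intro divide_right_mono) simp_all
  qed
  show "eventually (%n. real (card (lball n :: 'a set))/real n^DIM('a) <= ?U/?q*(1 + ?de/real n)^DIM('a)) sequentially" using ev
  proof eventually_elim
   fix n :: nat assume n: "n > 0 & real n >= ?de"
   then have "real (card (lball n :: 'a set)) <= ?U*(real n + ?de)^DIM('a)/?q"
    using card_lball_bounds(1)[of n, where 'a = 'a] q by (simp add: pos_le_divide_eq)
   then show "real (card (lball n :: 'a set))/real n^DIM('a) <= ?U/?q*(1 + ?de/real n)^DIM('a)"
    unfolding e[OF conjunct1[OF n]] using n by (intro divide_right_mono) simp_all
  qed
 qed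
qed

end

section \<open>Interpolation along squares and almost sure convergence\<close>

lemma floor_sqrt_ratio:
 "(%n. real ((floor_sqrt n)^2)/real n) ~~> 1" "(%n. real ((Suc (floor_sqrt n))^2)/real n) ~~> 1"
proof -
 have up: "(%n. (1 + 1 / sqrt (real n))^2) ~~> 1" by real_asymp
 have lo: "(%n. (1 - 1 / sqrt (real n))^2) ~~> 1" by real_asymp
 have b: "real (floor_sqrt n) <= sqrt (real n)" "sqrt (real n) <= real (Suc (floor_sqrt n))" for n
 proof -
  have "real ((floor_sqrt n)^2) <= real n" unfolding of_nat_le_iff by (rule floor_sqrt_power2_le)
  then show "real (floor_sqrt n) <= sqrt (real n)" by (intro real_le_rsqrt) simp
  have "real n <= real ((Suc (floor_sqrt n))^2)" unfolding of_nat_le_iff using Suc_floor_sqrt_power2_gt[of n] by simp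
  then show "sqrt (real n) <= real (Suc (floor_sqrt n))" by (intro real_le_lsqrt) (simp_all del: of_nat_Suc)
 qed
 have d: "real n = (sqrt (real n))^2" for n by simp
 have ev: "eventually (%n::nat. n >= 1) sequentially" by (rule eventually_ge_at_top)
 have 1: "(1 - 1 / sqrt (real n))^2 <= real ((floor_sqrt n)^2)/real n" if "n >= 1" for n
 proof -
  have s: "sqrt (real n) >= 1" using that by simp
  have "(1 - 1 / sqrt (real n))^2 = (sqrt (real n) - 1)^2/real n"
   using s by (subst (3) d) (simp add: power_divide[symmetric] diff_divide_distrib del: real_sqrt_pow2)
  also have "... <= (real (floor_sqrt n))^2/real n" using s b(2)[of n] by (intro divide_right_mono power_mono) auto
  finally show ?thesis by simp
 qed
 have 2: "real ((Suc (floor_sqrt n))^2)/real n <= (1 + 1 / sqrt (real n))^2" if "n >= 1" for n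
 proof -
  have s: "sqrt (real n) >= 1" using that by simp
  have "real ((Suc (floor_sqrt n))^2)/real n <= (sqrt (real n) + 1)^2/real n"
   unfolding of_nat_power using b(1)[of n] by (intro divide_right_mono power_mono) auto
  also have "... = (1 + 1 / sqrt (real n))^2" using s by (subst (2) d) (simp add: power_divide[symmetric] add_divide_distrib del: real_sqrt_pow2)
  finally show ?thesis .
 qed
 have 3: "real ((floor_sqrt n)^2)/real n <= 1" "1 <= real ((Suc (floor_sqrt n))^2)/real n" if "n >= 1" for n
 proof -
  have "real ((floor_sqrt n)^2) <= real n" unfolding of_nat_le_iff by (rule floor_sqrt_power2_le)
  then show "real ((floor_sqrt n)^2)/real n <= 1" using that by simp
  have "real n <= real ((Suc (floor_sqrt n))^2)" unfolding of_nat_le_iff using Suc_floor_sqrt_power2_gt[of n] by simp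
  then show "1 <= real ((Suc (floor_sqrt n))^2)/real n" using that by simp
 qed
 show "(%n. real ((floor_sqrt n)^2)/real n) ~~> 1"
  by (rule tendsto_sandwich[OF _ _ lo tendsto_const]; use ev in eventually_elim; use 1 3 in blast)
 show "(%n. real ((Suc (floor_sqrt n))^2)/real n) ~~> 1"
  by (rule tendsto_sandwich[OF _ _ tendsto_const up]; use ev in eventually_elim; use 2 3 in blast)
qed

lemma filterlim_floor_sqrt: "filterlim floor_sqrt at_top sequentially" unfolding filterlim_at_top
proof
 fix Z show "eventually (%n. Z <= floor_sqrt n) sequentially" using eventually_ge_at_top[of "Z^2"] by eventually_elim (simp add: le_floor_sqrt_iff)
qed

text \<open>Every n lies between consecutive squares whose ratios to n tend to 1. Polynomial growth
  of \<open>a\<close> makes the corresponding ratios of \<open>a\<close> tend to 1, and monotonicity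
  of \<open>y\<close> gives the sandwich.\<close>

lemma interpolate_squares:
 fixes y a :: "nat => real"
 assumes y: "mono y" "!!n. y n >= 0" and a: "!!n. n >= 1 ==> a n > 0"
  and L: "L > 0" "(%n. a n/real n^d) ~~> L" and e: "(%k. y (k^2)/a (k^2)) ~~> e"
 shows "(%n. y n/a n) ~~> e"
proof -
 have main: "(%n. y ((g n)^2)/a ((g n)^2)*(a ((g n)^2)/a n)) ~~> e"
  if g: "filterlim g at_top sequentially" "(%n. real ((g n)^2)/real n) ~~> 1" for g :: "nat => nat"
 proof -
  have g2: "filterlim (%n. (g n)^2) at_top sequentially" by (rule filterlim_at_top_mono[OF g(1)]) (simp add: power2_nat_le_imp_le self_le_power power2_eq_square)
  have "(%n. (a ((g n)^2)/real ((g n)^2)^d)/(a n/real n^d)*(real ((g n)^2)/real n)^d) ~~> L/L*1^d"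
   using L by (intro tendsto_intros filterlim_compose[OF L(2) g2] g(2)) auto
  then have r: "(%n. (a ((g n)^2)/real ((g n)^2)^d)/(a n/real n^d)*(real ((g n)^2)/real n)^d) ~~> 1" using L(1) by simp
  have "(%n. a ((g n)^2)/a n) ~~> 1"
  proof (rule Lim_transform_eventually[OF r])
   have "eventually (%n. g n >= 1) sequentially" using g(1) by (simp add: filterlim_at_top)
   then show "eventually (%n. (a ((g n)^2)/real ((g n)^2)^d)/(a n/real n^d)*(real ((g n)^2)/real n)^d = a ((g n)^2)/a n) sequentially"
    using eventually_ge_at_top[of 1] by eventually_elim (simp add: power_divide)
  qed
  from tendsto_mult[OF filterlim_compose[OF e g(1)] this] show ?thesis by simp
 qed
 show ?thesis
 proof (rule tendsto_sandwich[OF _ _ main[OF filterlim_floor_sqrt floor_sqrt_ratio(1)] main[of "%n. Suc (floor_sqrt n)"]])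
  have "eventually (%n. floor_sqrt n >= 1) sequentially" using filterlim_floor_sqrt by (simp add: filterlim_at_top)
  then show "eventually (%n. y ((floor_sqrt n)^2)/a ((floor_sqrt n)^2)*(a ((floor_sqrt n)^2)/a n) <= y n/a n) sequentially"
   using eventually_ge_at_top[of 1]
  proof eventually_elim
   fix n :: nat assume n: "floor_sqrt n >= 1" "1 <= n"
   have "a ((floor_sqrt n)^2) > 0" "a n > 0" using n by (intro a; simp)+
   moreover have "y ((floor_sqrt n)^2) <= y n" by (rule monoD[OF y(1)]) simp
   ultimately show "y ((floor_sqrt n)^2)/a ((floor_sqrt n)^2)*(a ((floor_sqrt n)^2)/a n) <= y n/a n" by (simp add: divide_right_mono)
  qed
  show "eventually (%n. y n/a n <= y ((Suc (floor_sqrt n))^2)/a ((Suc (floor_sqrt n))^2)*(a ((Suc (floor_sqrt n))^2)/a n)) sequentially"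
   using eventually_ge_at_top[of 1]
  proof eventually_elim
   fix n :: nat assume n: "1 <= n"
   have "a ((Suc (floor_sqrt n))^2) > 0" "a n > 0" using n by (intro a; simp)+
   moreover have "y n <= y ((Suc (floor_sqrt n))^2)" by (rule monoD[OF y(1)]) (use Suc_floor_sqrt_power2_gt[of n] in simp)
   ultimately show "y n/a n <= y ((Suc (floor_sqrt n))^2)/a ((Suc (floor_sqrt n))^2)*(a ((Suc (floor_sqrt n))^2)/a n)"
    by (simp add: divide_right_mono)
  qed
  show "filterlim (%n. Suc (floor_sqrt n)) at_top sequentially" by (rule filterlim_at_top_mono[OF filterlim_floor_sqrt]) simp
  show "(%n. real ((Suc (floor_sqrt n))^2)/real n) ~~> 1" by (rule floor_sqrt_ratio(2))
 qed
qed

text \<open>The sum of the squares has a finite integral, hence is finite almost everywhere, and the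
  terms of a convergent series tend to 0.\<close>

lemma AE_tendsto_0_summable:
 fixes Z :: "nat => 'b => real"
 assumes m: "!!k. Z k : BM M" and b: "!!k. (NNI M (%x. ennreal ((Z k x)^2))) <= ennreal (c k)" "!!k. c k >= 0" and c: "summable c"
 shows "AE x in M. (%k. Z k x) ~~> 0"
proof -
 have mm: "(%x. ennreal ((Z k x)^2)) : BM M" for k using m[of k] by measurable
 have "(NNI M (%x. (\<Sum>k. ennreal ((Z k x)^2)))) = (\<Sum>k. (NNI M (%x. ennreal ((Z k x)^2))))" by (rule nn_integral_suminf[OF mm])
 also have "... <= (\<Sum>k. ennreal (c k))" by (intro suminf_le b summableI)
 also have "... = ennreal (\<Sum>k. c k)" by (rule suminf_ennreal2[OF b(2) c])
 finally have "(NNI M (%x. (\<Sum>k. ennreal ((Z k x)^2)))) ~= \<infinity>" by (auto simp: top_unique)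
 then have "AE x in M. (\<Sum>k. ennreal ((Z k x)^2)) ~= \<infinity>" by (intro nn_integral_noteq_infinite borel_measurable_suminf_order mm)
 then show ?thesis
 proof eventually_elim
  fix x assume "(\<Sum>k. ennreal ((Z k x)^2)) ~= \<infinity>"
  then have "summable (%k. (Z k x)^2)" by (intro summable_suminf_not_top) auto
  then have "(%k. sqrt ((Z k x)^2)) ~~> sqrt 0" by (intro tendsto_real_sqrt summable_LIMSEQ_zero)
  then show "(%k. Z k x) ~~> 0" by (simp add: tendsto_rabs_zero_iff)
 qed
qed

context det_process begin

text \<open>The value at a lattice point is at most the enlarged \<open>kc\<close> throughout its
  cell; the cells are disjoint, so the sum is bounded by an integral divided by the cell
  volume.\<close>

lemma kc_lattice_sum:
 assumes N: "N > 0"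
 shows "EX B>=0. ALL S::'a set. finite S --> S <= latt N --> (SUM u:S. kc r u) <= B"
proof -
 let ?de = "DIM('a)/real N" and ?q = "vol (cell N (0::'a))"
 have q: "?q > 0" by (rule cell_measure_pos[OF N])
 define I where "I = (LBINT x. kc (r + ?de) x)"
 have I: "I >= 0" unfolding I_def by (intro integral_nonneg kc_nonneg)
 have "(SUM u:S. kc r u) <= I/?q" if S: "finite S" "S <= latt N" for S :: "'a set"
 proof -
  have ic: "integrable lborel (ind (cell N u) :: 'a => real)" if "u : S" for u
   using bbs_emeasure_lborel[OF RR_bbs[OF cell_RR[OF N, of u]]] cell_borel[OF N, of u] that S(2) by (intro integrable_real_indicator) auto
  have i1: "integrable lborel (%x. kc r u*ind (cell N u) x)" if "u : S" for u using ic[OF that] by simp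
  have "(SUM u:S. kc r u)*?q = (SUM u:S. (LBINT x. kc r u*ind (cell N u) x))"
  proof -
   have iu: "(LBINT x. kc r u*ind (cell N u) x) = kc r u*?q" if "u : S" for u using cell_measure[OF N, of u] that S(2) by auto
   then show ?thesis unfolding sum_distrib_right by (intro sum.cong refl) (rule iu[symmetric])
  qed
  also have "... = (LBINT x. (SUM u:S. kc r u*ind (cell N u) x))" by (rule integral_sum[symmetric]) (rule i1)
  also have "... <= I" unfolding I_def
  proof (rule integral_mono[OF _ kc_integrable])
   show "integrable lborel (%x. SUM u:S. kc r u*ind (cell N u) x)" by (intro integrable_sum i1)
   fix x :: 'a
   have "(SUM u:S. kc r u*ind (cell N u) x) = (SUM u:S. if u = rnd N x then kc r u else 0)"
    by (intro sum.cong refl) (auto simp: cell_def indicator_def)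
   also have "... = (if rnd N x : S then kc r (rnd N x) else 0)" using S(1) by (simp add: sum.delta)
   also have "... <= kc (r + ?de) x" using kc_shift[OF norm_rnd[OF N, of x], of r] kc_nonneg[of "r + ?de" x] by auto
   finally show "(SUM u:S. kc r u*ind (cell N u) x) <= kc (r + ?de) x" .
  qed
  finally show ?thesis using q by (simp add: pos_le_divide_eq)
 qed
 then show ?thesis using I q by (intro exI[of _ "I/?q"]) auto
qed

text \<open>The variance is a double sum of covariances at lattice differences. Each row is bounded
  by \<open>kc_lattice_sum\<close> uniformly in \<open>S\<close>, so the total grows only linearly
  in the number of points.\<close>

lemma lattice_variance:
 assumes N: "N > 0" and F: "F : polys"
 shows "EX B>=0. ALL S::'a set. finite S --> S <= latt N -->
  (NNI P (%W. ennreal (((SUM z:S. F (translate (- z) W)) - real (card S)*(LINT W|P. F W))^2))) <= ennreal (B*real (card S))"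
proof -
 let ?E = "(LINT W|P. F W)"
 obtain r C where C: "C >= 0" "!!x. \<bar>covP F F x\<bar> <= C*kc r x" using cov_bound[OF F F] by auto
 obtain B where B: "B >= 0" "!!S::'a set. finite S ==> S <= latt N ==> (SUM u:S. kc r u) <= B"
  using kc_lattice_sum[OF N, of r] by auto
 have "(NNI P (%W. ennreal (((SUM z:S. F (translate (- z) W)) - real (card S)*?E)^2))) <= ennreal (C*B*real (card S))"
  if S: "finite S" "S <= latt N" for S :: "'a set"
 proof -
  let ?h = "%W. (SUM z:S. SUM z':S. (F (translate (- z) W) - ?E)*(F (translate (- z') W) - ?E))"
  have sq: "((SUM z:S. F (translate (- z) W)) - real (card S)*?E)^2 = ?h W" for W
  proof -
   have "(SUM z:S. F (translate (- z) W)) - real (card S)*?E = (SUM z:S. F (translate (- z) W) - ?E)" by (simp add: sum_subtractf)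
   then show ?thesis by (simp only: power2_eq_square sum_product)
  qed
  have ih: "integrable P ?h" by (intro integrable_sum cov_centered_integrable F)
  have "(LINT W|P. ?h W) = (SUM z:S. SUM z':S. covP F F (z' - z))" using cov_centered[OF F] cov_centered_integrable[OF F] by simp
  also have "... <= (SUM z:S. C*B)"
  proof (rule sum_mono)
   fix z assume z: "z : S"
   have "(SUM z':S. covP F F (z' - z)) <= (SUM z':S. C*kc r (z' - z))" by (intro sum_mono order_trans[OF abs_ge_self C(2)])
   also have "... = C*(SUM u:(%z'. z' - z) ` S. kc r u)" by (subst sum.reindex) (auto simp: inj_on_def sum_distrib_left)
   also have "... <= C*B" using S z C(1) by (intro mult_left_mono B(2)) (auto intro!: latt_diff)
   finally show "(SUM z':S. covP F F (z' - z)) <= C*B" .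
  qed
  finally have le: "(LINT W|P. ?h W) <= C*B*real (card S)" by (simp add: mult.commute)
  have "(NNI P (%W. ennreal (?h W))) = ennreal (LINT W|P. ?h W)" by (rule nn_integral_eq_integral[OF ih]) (simp add: sq[symmetric])
  then show ?thesis unfolding sq using le by (simp add: ennreal_leI)
 qed
 then show ?thesis using C(1) B(1) by (intro exI[of _ "C*B"]) simp
qed

text \<open>Along the radii k^2 the mean square deviation of the averages is at most a constant over
  k^2, hence summable; nonnegativity of \<open>F\<close> makes the sums monotone in the radius, so
  the remaining radii follow by interpolation.\<close>

theorem lattice_lln:
 assumes N: "N > 0" and F: "F : polys" and F0: "!!W. W : PM ==> F W >= 0"
 shows "AE W in P. (%n. (SUM z:lball N n. F (translate (- z) W))/real (card (lball N n :: 'a set))) ~~> (LINT W|P. F W)"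
proof -
 let ?E = "(LINT W|P. F W)"
 define Y where "Y n W = (SUM z:lball N n. F (translate (- z) W))" for n and W :: "'a measure"
 define a where "a n = real (card (lball N n :: 'a set))" for n
 have a: "a n >= real n" for n unfolding a_def using card_lball_ge[OF N, of n] by simp
 obtain B where B: "B >= 0" "!!S::'a set. finite S ==> S <= latt N ==>
  (NNI P (%W. ennreal (((SUM z:S. F (translate (- z) W)) - real (card S)*?E)^2))) <= ennreal (B*real (card S))" using lattice_variance[OF N F] by auto
 have Fm: "(%W. F (translate z W)) : BM P" for z
  using measurable_compose[OF measurable_translate polys_measurable[OF F]] by (simp cong: measurable_cong_sets)
 have Ym: "Y n : BM P" for n unfolding Y_def[abs_def] by (intro borel_measurable_sum Fm)
 define Z where "Z k W = (Y (k^2) W - a (k^2)*?E)/a (k^2)" for k W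
 have Zm: "Z k : BM P" for k unfolding Z_def[abs_def] using Ym by measurable
 \<comment> \<open>The index is shifted because the open ball of radius 0 contains no lattice point,
   and the average would be a quotient by 0.\<close>
 have "AE W in P. (%k. Z (Suc k) W) ~~> 0"
 proof (rule AE_tendsto_0_summable[where c = "%k. B*(1/(real (Suc k))^2)"])
  show "Z (Suc k) : BM P" for k by (rule Zm)
  show "(NNI P (%W. ennreal ((Z (Suc k) W)^2))) <= ennreal (B*(1/(real (Suc k))^2))" for k
  proof -
   let ?a = "a ((Suc k)^2)"
   have ap: "?a >= (real (Suc k))^2" using a[of "(Suc k)^2"] by simp
   moreover have "(real (Suc k))^2 > 0" by simp
   ultimately have a0: "?a > 0" by linarith
   have "(NNI P (%W. ennreal ((Z (Suc k) W)^2))) = (NNI P (%W. ennreal (1/?a^2)*ennreal ((Y ((Suc k)^2) W - ?a*?E)^2)))"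
    unfolding Z_def by (intro nn_integral_cong) (simp add: power_divide ennreal_mult[symmetric])
   also have "... = ennreal (1/?a^2)*(NNI P (%W. ennreal ((Y ((Suc k)^2) W - ?a*?E)^2)))" by (rule nn_integral_cmult) (use Ym in measurable)
   also have "... <= ennreal (1/?a^2)*ennreal (B*?a)"
    unfolding Y_def a_def by (intro mult_left_mono B(2)) (auto simp: lball_def[OF N] finite_latt[OF N])
   also have "... = ennreal (B/?a)" using a0 B(1) by (simp add: ennreal_mult[symmetric] power2_eq_square)
   also have "... <= ennreal (B*(1/(real (Suc k))^2))" using divide_left_mono[OF ap B(1)] a0 by (intro ennreal_leI) simp
   finally show ?thesis .
  qed
  show "summable (%k. B*(1/(real (Suc k))^2))"
  proof (rule summable_mult)
   have "summable (%k. inverse ((real (Suc k))^2))" using inverse_power_summable[of 2, where 'a = real] by (subst summable_Suc_iff) simp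
   then show "summable (%k. 1/(real (Suc k))^2)" by (simp add: divide_inverse)
  qed
 qed (use B(1) in simp)
 moreover have "AE W in P. W : space P" by (rule AE_space)
 ultimately have "AE W in P. (%n. Y n W/a n) ~~> ?E"
 proof eventually_elim
  fix W assume Z: "(%k. Z (Suc k) W) ~~> 0" and w: "W : space P"
  have p: "F (translate z W) >= 0" for z using F0[OF translate_space[of W]] w by simp
  show "(%n. Y n W/a n) ~~> ?E"
  proof (rule interpolate_squares[where d = "DIM('a)"])
   show "mono (%n. Y n W)" unfolding Y_def by (intro monoI sum_mono2 lball_mono lball_finite N p)
   show "Y n W >= 0" for n unfolding Y_def by (intro sum_nonneg p)
   show "a n > 0" if "n >= 1" for n using a[of n] that by simp
   show "(%n. a n/real n^DIM('a)) ~~> unit_ball_vol DIM('a) / vol (cell N (0::'a))" unfolding a_def by (rule card_lball_lim[OF N])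
   show "unit_ball_vol (real DIM('a)) / vol (cell N (0::'a)) > 0" using cell_measure_pos[OF N, where 'a = 'a] by simp
   have "(%k. Z k W + ?E) ~~> 0 + ?E" using Z LIMSEQ_imp_Suc[of "%k. Z k W"] by (intro tendsto_intros) auto
   moreover have "eventually (%k. Z k W + ?E = Y (k^2) W/a (k^2)) sequentially" using eventually_ge_at_top[of 1]
   proof eventually_elim
    fix k :: nat assume "1 <= k"
    then have "real (k^2) > 0" by simp
    then have "a (k^2) > 0" using a[of "k^2"] by linarith
    then show "Z k W + ?E = Y (k^2) W/a (k^2)" by (simp add: Z_def diff_divide_distrib)
   qed
   ultimately show "(%k. Y (k^2) W/a (k^2)) ~~> ?E" using Lim_transform_eventually by force
  qed
 qed
 then show ?thesis unfolding Y_def a_def .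
qed

end

section \<open>Autocorrelation and diffraction\<close>

text \<open>Sums f(x - y) over all pairs of points in a ball, the diagonal included; up to
  normalisation this is the integral of \<open>f\<close> against the finite-volume autocorrelation
  (\<open>nn_integral_autocorrelation\<close>).\<close>

definition pair_integral :: "('a::euclidean_space => real) => nat => 'a measure => ennreal" where
 "pair_integral f n W = (\<integral>\<^sup>+x. \<integral>\<^sup>+y. ennreal (f (x - y))*ind (bl n) x*ind (bl n) y \<partial>W \<partial>W)"

definition cell_pairs :: "nat => 'a::euclidean_space => nat => 'a measure => real" where
 "cell_pairs N v n W = (SUM z:lball N n. measure W (cell N z)*measure W (cell N (z + v)))"

text \<open>A step function on pairs of cells whose value depends only on the displacement
  \<open>v\<close>, with the first cell restricted to corners in \<open>S\<close>. Its double
  integral is a finite combination of \<open>cell_pairs\<close> when \<open>S\<close> is a lattice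
  ball.\<close>

definition grid :: "nat => 'a set => 'a set => ('a::euclidean_space => real) => 'a => 'a => real" where
 "grid N S V be x y = (SUM v:V. SUM z:S. be v * ind (cell N z) x*ind (cell N (z + v)) y)"

lemma grid_eq:
 assumes "finite S" "finite V"
 shows "grid N S V be x y = (if rnd N x : S & rnd N y - rnd N x : V then be (rnd N y - rnd N x) else 0)"
proof -
 have "(SUM z:S. be v * ind (cell N z) x*ind (cell N (z + v)) y) =
  (if rnd N x : S & v = rnd N y - rnd N x then be v else 0)" for v
 proof -
  have "(SUM z:S. be v * ind (cell N z) x*ind (cell N (z + v)) y)
   = (SUM z:S. if z = rnd N x then be v * ind (cell N (rnd N x + v)) y else 0)" by (intro sum.cong refl) (auto simp: cell_def indicator_def)
  also have "... = (if rnd N x : S then be v * ind (cell N (rnd N x + v)) y else 0)" using assms(1) by (simp add: sum.delta)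
  also have "... = (if rnd N x : S & v = rnd N y - rnd N x then be v else 0)" by (auto simp: cell_def indicator_def algebra_simps)
  finally show ?thesis .
 qed
 then have "grid N S V be x y = (SUM v:V. if v = rnd N y - rnd N x then (if rnd N x : S then be v else 0) else 0)"
  unfolding grid_def by (intro sum.cong refl) auto
 also have "... = (if rnd N y - rnd N x : V then (if rnd N x : S then be (rnd N y - rnd N x) else 0) else 0)" using assms(2) by (simp add: sum.delta')
 finally show ?thesis by simp
qed

lemma lball_mem: "N > 0 ==> z : lball N n \<longleftrightarrow> z : latt N & norm z < real n" by (simp add: lball_def)

lemma nn_integral_grid:
 assumes w: "W : PM" and N: "N > 0" and V: "finite V" "V <= latt N" and be: "!!v. v : V ==> be v >= 0"
 shows "(\<integral>\<^sup>+x. \<integral>\<^sup>+y. ennreal (grid N (lball N n) V be x y) \<partial>W \<partial>W) = ennreal (SUM v:V. be v * cell_pairs N v n W)"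
proof -
 note p = point_measuresD[OF w]
 have cs: "cell N z : sets W" for z using cell_borel[OF N] p(1) by simp
 have ce: "emeasure W (cell N z) = ennreal (measure W (cell N z))" if "z : latt N" for z using RR_bbs[OF cell_RR[OF N that]] by (intro p(5)) (auto simp: bbs_def)
 have ind: "(%x. ind (cell N z) x :: ennreal) : BM W" for z using cs by simp
 have "(\<integral>\<^sup>+x. \<integral>\<^sup>+y. ennreal (grid N (lball N n) V be x y) \<partial>W \<partial>W)
  = (\<integral>\<^sup>+x. \<integral>\<^sup>+y. (SUM v:V. SUM z:lball N n. (ennreal (be v)*ind (cell N z) x)*ind (cell N (z + v)) y) \<partial>W \<partial>W)"
  unfolding grid_def
 proof (intro nn_integral_cong)
  fix x y
  have "ennreal (SUM v:V. SUM z:lball N n. be v * ind (cell N z) x*ind (cell N (z + v)) y)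
   = (SUM v:V. ennreal (SUM z:lball N n. be v * ind (cell N z) x*ind (cell N (z + v)) y))"
   using be by (intro sum_ennreal[symmetric] sum_nonneg) auto
  also have "... = (SUM v:V. SUM z:lball N n. ennreal (be v * ind (cell N z) x*ind (cell N (z + v)) y))"
   using be by (intro sum.cong refl sum_ennreal[symmetric]) auto
  also have "... = (SUM v:V. SUM z:lball N n. (ennreal (be v)*ind (cell N z) x)*ind (cell N (z + v)) y)"
   by (intro sum.cong refl) (auto simp: indicator_def)
  finally show "ennreal (SUM v:V. SUM z:lball N n. be v * ind (cell N z) x*ind (cell N (z + v)) y)
   = (SUM v:V. SUM z:lball N n. (ennreal (be v)*ind (cell N z) x)*ind (cell N (z + v)) y)" .
 qed
 also have "... = (NNI W (%x. (SUM v:V. SUM z:lball N n. (ennreal (be v)*emeasure W (cell N (z + v)))*ind (cell N z) x)))"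
 proof (rule nn_integral_cong)
  fix x
  have "(NNI W (%y. (SUM v:V. SUM z:lball N n. (ennreal (be v)*ind (cell N z) x)*ind (cell N (z + v)) y)))
   = (SUM v:V. SUM z:lball N n. (NNI W (%y. (ennreal (be v)*ind (cell N z) x)*ind (cell N (z + v)) y)))"
   using ind by (simp add: nn_integral_sum)
  also have "... = (SUM v:V. SUM z:lball N n. (ennreal (be v)*emeasure W (cell N (z + v)))*ind (cell N z) x)"
   unfolding nn_integral_cmult_indicator[OF cs] by (simp only: ac_simps)
  finally show "(NNI W (%y. (SUM v:V. SUM z:lball N n. (ennreal (be v)*ind (cell N z) x)*ind (cell N (z + v)) y)))
   = (SUM v:V. SUM z:lball N n. (ennreal (be v)*emeasure W (cell N (z + v)))*ind (cell N z) x)" .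
 qed
 also have "... = (SUM v:V. SUM z:lball N n. (NNI W (%x. (ennreal (be v)*emeasure W (cell N (z + v)))*ind (cell N z) x)))"
  using ind by (simp add: nn_integral_sum)
 also have "... = (SUM v:V. SUM z:lball N n. ennreal (be v * (measure W (cell N z)*measure W (cell N (z + v)))))"
 proof (intro sum.cong refl)
  fix v z :: 'a assume v: "v : V" and z: "z : lball N n"
  have l: "z : latt N" "z + v : latt N" using v z V(2) by (auto simp: lball_mem[OF N] intro: latt_add)
  show "(NNI W (%x. (ennreal (be v)*emeasure W (cell N (z + v)))*ind (cell N z) x))
   = ennreal (be v * (measure W (cell N z)*measure W (cell N (z + v))))"
   unfolding nn_integral_cmult_indicator[OF cs] ce[OF l(1)] ce[OF l(2)] using be[OF v] by (simp add: ennreal_mult ac_simps)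
 qed
 also have "... = (SUM v:V. ennreal (be v * cell_pairs N v n W))"
  unfolding cell_pairs_def sum_distrib_left using be by (intro sum.cong refl sum_ennreal) auto
 also have "... = ennreal (SUM v:V. be v * cell_pairs N v n W)"
  using be by (intro sum_ennreal) (auto simp: cell_pairs_def intro!: mult_nonneg_nonneg sum_nonneg)
 finally show ?thesis .
qed

locale test_function =
 fixes f :: "'a::euclidean_space => real" and R :: nat
 assumes f_cont: "continuous_on UNIV f" and f_nonneg: "!!x. f x >= 0" and f_supp: "!!x. f x ~= 0 ==> norm x <= real R"
begin

lemma f_measurable [measurable]: "f : BM borel" by (rule borel_measurable_continuous_onI[OF f_cont])

text \<open>Bounded support makes the modulus of continuity global: two points at distance at most
  1, one of them outside the enlarged ball, are both zeros of \<open>f\<close>.\<close>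

lemma f_modulus:
 assumes "ep > 0"
 obtains de where "de > 0" "!!x y. norm (x - y) <= de ==> \<bar>f x - f y\<bar> <= ep"
proof -
 have "uniformly_continuous_on (cball 0 (real R + 1)) f" by (rule compact_uniformly_continuous) (use f_cont in \<open>auto intro: continuous_on_subset\<close>)
 then obtain d where d: "d > 0" "!!x y. norm x <= real R + 1 ==> norm y <= real R + 1 ==> dist x y < d ==> dist (f x) (f y) < ep"
  using assms unfolding uniformly_continuous_on_def by (metis dist_0_norm mem_cball dist_commute)
 have "\<bar>f x - f y\<bar> <= ep" if xy: "norm (x - y) <= min 1 (d/2)" for x y
 proof (cases "norm x <= real R + 1 & norm y <= real R + 1")
  case True
  then show ?thesis using d(2)[of x y] xy d(1) by (simp add: dist_norm dist_real_def)
 next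
  case False
  have "norm x <= norm y + 1" "norm y <= norm x + 1" using xy norm_triangle_ineq2[of x y] norm_triangle_ineq2[of y x] by (auto simp: norm_minus_commute)
  then have "~ norm x <= real R" "~ norm y <= real R" using False by auto
  then have "f x = 0" "f y = 0" using f_supp by blast+
  then show ?thesis using assms by simp
 qed
 then show thesis using that[of "min 1 (d/2)"] d(1) by auto
qed

context
 fixes N :: nat and ep :: real
 assumes N: "N > 0" and de1: "DIM('a)/real N <= 1" and ep: "ep > 0"
  and mod: "ALL x y. norm (x - y) <= 2*(DIM('a)/real N) --> \<bar>f x - f y\<bar> <= ep"
begin

text \<open>Rounding both points changes their difference by at most 2, so cell displacements with
  f(x - y) nonzero have norm at most R + 2; the radius R + 3 makes the bound strict. The sign in
  \<open>up\<close> and \<open>lo\<close> arises because displacements point from x to y.\<close>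

abbreviation "VV \<equiv> (lball N (R + 3) :: 'a set)"
abbreviation "up \<equiv> (%v. f (- v) + ep)"
abbreviation "lo \<equiv> (%v. max 0 (f (- v) - ep))"

lemma rnd_diff:
 "\<bar>f (x - y) - f (- (rnd N y - rnd N x))\<bar> <= ep"
 "norm (rnd N y - rnd N x) <= norm (x - y) + 2" "norm (rnd N x) <= norm x + 1" "norm x <= norm (rnd N x) + 1"
proof -
 have r: "norm (z - rnd N z) <= DIM('a)/real N" for z :: 'a by (rule norm_rnd[OF N])
 have "(x - y) - (- (rnd N y - rnd N x)) = (x - rnd N x) - (y - rnd N y)" by simp
 then have d: "norm ((x - y) - (- (rnd N y - rnd N x))) <= 2*(DIM('a)/real N)"
  using norm_triangle_ineq4[of "x - rnd N x" "y - rnd N y"] r[of x] r[of y] by (simp only:)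
 then show "\<bar>f (x - y) - f (- (rnd N y - rnd N x))\<bar> <= ep" by (rule mod[rule_format])
 have "norm (- (rnd N y - rnd N x)) <= norm (x - y) + norm ((x - y) - (- (rnd N y - rnd N x)))"
  using norm_triangle_ineq4[of "x - y" "(x - y) - (- (rnd N y - rnd N x))"] by simp
 then show "norm (rnd N y - rnd N x) <= norm (x - y) + 2" using d de1 by (simp only: norm_minus_cancel)
 show "norm (rnd N x) <= norm x + 1" "norm x <= norm (rnd N x) + 1"
  using r[of x] de1 norm_triangle_ineq2[of x "rnd N x"] norm_triangle_ineq2[of "rnd N x" x] by (auto simp: norm_minus_commute)
qed

lemma f_le_up: "f (x - y) <= (if rnd N y - rnd N x : VV then up (rnd N y - rnd N x) else 0)"
proof (cases "f (x - y) = 0")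
 case True
 then show ?thesis using f_nonneg ep by (simp add: add_nonneg_nonneg less_imp_le)
next
 case False
 then have "norm (rnd N y - rnd N x) < real (R + 3)" using f_supp[of "x - y"] rnd_diff(2)[of y x] by auto
 then have "rnd N y - rnd N x : VV" by (simp add: lball_mem[OF N] latt_diff rnd_latt[OF N])
 then show ?thesis using rnd_diff(1)[of x y] by simp
qed

lemma lo_le_f: "(if rnd N y - rnd N x : VV then lo (rnd N y - rnd N x) else 0) <= f (x - y)" using rnd_diff(1)[of x y] f_nonneg[of "x - y"] by auto

text \<open>Rounding moves a point by at most 1, so points in the ball of radius n belong to cells
  with corners in the ball of radius n + 1.\<close>

lemma pair_integral_le:
 assumes w: "W : PM"
 shows "pair_integral f n W <= ennreal (SUM v:VV. up v * cell_pairs N v (n + 1) W)"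
proof -
 have "pair_integral f n W <= (\<integral>\<^sup>+x. \<integral>\<^sup>+y. ennreal (grid N (lball N (n + 1)) VV up x y) \<partial>W \<partial>W)"
  unfolding pair_integral_def
 proof (intro nn_integral_mono)
  fix x y
  show "ennreal (f (x - y))*ind (bl n) x*ind (bl n) y <= ennreal (grid N (lball N (n + 1)) VV up x y)"
  proof (cases "norm x < real n")
   case True
   then have "rnd N x : lball N (n + 1)" using rnd_diff(3)[of x] by (simp add: lball_mem[OF N] rnd_latt[OF N])
   then have "f (x - y) <= grid N (lball N (n + 1)) VV up x y" unfolding grid_eq[OF lball_finite[OF N] lball_finite[OF N]] using f_le_up[of x y] by simp
   then show ?thesis by (auto simp: indicator_def intro: ennreal_leI)
  qed simp
 qed
 also have "... = ennreal (SUM v:VV. up v * cell_pairs N v (n + 1) W)"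
  by (rule nn_integral_grid[OF w N]) (auto simp: lball_mem[OF N] lball_finite[OF N] intro!: add_nonneg_nonneg f_nonneg less_imp_le[OF ep])
 finally show ?thesis .
qed

text \<open>The margin R + 5 accommodates the displacement, which is below R + 3, and the rounding
  of both points. For n <= R + 5 truncated subtraction gives radius 0 and an empty sum.\<close>

lemma pair_integral_ge:
 assumes w: "W : PM"
 shows "ennreal (SUM v:VV. lo v * cell_pairs N v (n - (R + 5)) W) <= pair_integral f n W"
proof -
 have "ennreal (SUM v:VV. lo v * cell_pairs N v (n - (R + 5)) W)
  = (\<integral>\<^sup>+x. \<integral>\<^sup>+y. ennreal (grid N (lball N (n - (R + 5))) VV lo x y) \<partial>W \<partial>W)"
  by (rule nn_integral_grid[OF w N, symmetric]) (auto simp: lball_mem[OF N] lball_finite[OF N])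
 also have "... <= pair_integral f n W" unfolding pair_integral_def
 proof (intro nn_integral_mono)
  fix x y
  show "ennreal (grid N (lball N (n - (R + 5))) VV lo x y) <= ennreal (f (x - y))*ind (bl n) x*ind (bl n) y"
  proof (cases "rnd N x : lball N (n - (R + 5)) & rnd N y - rnd N x : VV")
   case True
   then have 1: "norm (rnd N x) < real (n - (R + 5))" "norm (rnd N y - rnd N x) < real (R + 3)" by (auto simp: lball_mem[OF N])
   then have n: "n > R + 5" using norm_ge_zero[of "rnd N x"] by linarith
   then have 2: "norm (rnd N x) < real n - real R - 5" using 1(1) by (simp add: of_nat_diff)
   have "norm (rnd N y) <= norm (rnd N y - rnd N x) + norm (rnd N x)" using norm_triangle_ineq[of "rnd N y - rnd N x" "rnd N x"] by simp
   then have "norm x < real n" "norm y < real n" using 1(2) 2 rnd_diff(4)[of x] rnd_diff(4)[of y] by auto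
   then show ?thesis unfolding grid_eq[OF lball_finite[OF N] lball_finite[OF N]] using True lo_le_f[of y x] by (simp add: ennreal_leI)
  next
   case False
   then have "grid N (lball N (n - (R + 5))) VV lo x y = 0" unfolding grid_eq[OF lball_finite[OF N] lball_finite[OF N]] by auto
   then show ?thesis by simp
  qed
 qed
 finally show ?thesis .
qed

end

end

lemma tendsto_power_shift:
 fixes y :: "nat => real"
 assumes y: "(%n. y n/real n^d) ~~> L" and g: "filterlim g at_top sequentially" "(%n. real (g n)/real n) ~~> 1"
 shows "(%n. y (g n)/real n^d) ~~> L"
proof -
 have "(%n. y (g n)/real (g n)^d*(real (g n)/real n)^d) ~~> L*1^d" by (intro tendsto_intros filterlim_compose[OF y g(1)] g(2))
 moreover have "eventually (%n. y (g n)/real (g n)^d*(real (g n)/real n)^d = y (g n)/real n^d) sequentially"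
 proof -
  have "eventually (%n. g n >= 1) sequentially" using g(1) by (simp add: filterlim_at_top)
  then show ?thesis by eventually_elim (simp add: power_divide)
 qed
 ultimately show ?thesis using Lim_transform_eventually by force
qed

lemma shift_ratios:
 "filterlim (%n. n + 1) at_top (sequentially :: nat filter)" "(%n. real (n + 1)/real n) ~~> 1"
 "filterlim (%n. n - k) at_top (sequentially :: nat filter)" "(%n. real (n - k)/real n) ~~> 1"
proof -
 show "filterlim (%n. n + 1) at_top (sequentially :: nat filter)" by (rule filterlim_at_top_mono[OF filterlim_ident]) simp
 show "(%n. real (n + 1)/real n) ~~> 1" by real_asymp
 show "filterlim (%n. n - k) at_top (sequentially :: nat filter)" by (rule filterlim_minus_const_nat_at_top)
 have "(%n. (real n - real k)/real n) ~~> 1" by real_asymp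
 moreover have "eventually (%n. (real n - real k)/real n = real (n - k)/real n) sequentially"
  using eventually_ge_at_top[of k] by eventually_elim (simp add: of_nat_diff)
 ultimately show "(%n. real (n - k)/real n) ~~> 1" using Lim_transform_eventually by force
qed

lemma nn_integral_reflect:
 fixes g :: "'a::euclidean_space => ennreal"
 assumes [measurable]: "g : BM borel"
 shows "(NN y. g (x - y)) = (NN y. g y)"
proof -
 have "(NN y. g (x - y)) = (NN y. g (x - - y))" by (rule nn_integral_lborel_uminus[symmetric]) measurable
 also have "... = (NN y. g (x + y))" by simp
 also have "... = (NN y. g y)" by (rule nn_integral_lborel_translate) measurable
 finally show ?thesis .
qed

section \<open>Limits of pair sums for almost every realisation\<close>

context det_process begin

definition cexp :: "nat => 'a => real" where
 "cexp N v = (LINT W|P. measure W (cell N 0)*measure W (cell N v))"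

text \<open>The product of the counts of two cells, summed over lattice translates, is exactly
  \<open>cell_pairs\<close>, so \<open>lattice_lln\<close> applies to one polynomial per
  displacement \<open>v\<close>.\<close>

lemma cell_pairs_lln:
 assumes N: "N > 0" and v: "v : latt N"
 shows "AE W in P. (%n. cell_pairs N v n W/real n^DIM('a)) ~~> unit_ball_vol DIM('a) / vol (cell N (0::'a))*cexp N v"
proof -
 let ?F = "%W. measure W (cell N 0)*measure W (cell N v)"
 have F: "?F : polys" by (intro polys.polys_mult polys.polys_count cell_RR[OF N] v latt_0)
 have c: "(+) (- z) -` cell N u = cell N (z + u)" if "z : latt N" for z u :: 'a
 proof -
  have "rnd N (- z + x) = rnd N x - z" for x using rnd_add[OF N latt_uminus[OF that], of x] by (simp add: add.commute)
  then have "rnd N (- z + x) = u \<longleftrightarrow> rnd N x = z + u" for x by (simp add: diff_eq_eq add.commute)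
  then show ?thesis by (auto simp: cell_def)
 qed
 have "AE W in P. (%n. (SUM z:lball N n. ?F (translate (- z) W))/real (card (lball N n :: 'a set))) ~~> (LINT W|P. ?F W)"
  by (rule lattice_lln[OF N F]) simp
 moreover have "AE W in P. W : space P" by (rule AE_space)
 ultimately show ?thesis
 proof eventually_elim
  fix W assume lim: "(%n. (SUM z:lball N n. ?F (translate (- z) W))/real (card (lball N n :: 'a set))) ~~> (LINT W|P. ?F W)"
   and w: "W : space P"
  have e: "(SUM z:lball N n. ?F (translate (- z) W)) = cell_pairs N v n W" for n unfolding cell_pairs_def using w
   by (intro sum.cong refl) (simp add: measure_translate cell_borel[OF N] c lball_mem[OF N])
  have "(%n. cell_pairs N v n W/real (card (lball N n :: 'a set))*(real (card (lball N n :: 'a set))/real n^DIM('a)))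
   ~~> cexp N v * (unit_ball_vol DIM('a) / vol (cell N (0::'a)))"
   using lim unfolding e cexp_def by (intro tendsto_mult card_lball_lim[OF N])
  moreover have "eventually (%n. cell_pairs N v n W/real (card (lball N n :: 'a set))*(real (card (lball N n :: 'a set))/real n^DIM('a))
   = cell_pairs N v n W/real n^DIM('a)) sequentially" using eventually_ge_at_top[of 1]
  proof eventually_elim
   fix n :: nat assume "1 <= n"
   then have "real (card (lball N n :: 'a set)) > 0" using card_lball_ge[OF N, of n, where 'a = 'a] by simp
   then show "cell_pairs N v n W/real (card (lball N n :: 'a set))*(real (card (lball N n :: 'a set))/real n^DIM('a))
    = cell_pairs N v n W/real n^DIM('a)" by simp
  qed
  ultimately show "(%n. cell_pairs N v n W/real n^DIM('a)) ~~> unit_ball_vol DIM('a) / vol (cell N (0::'a))*cexp N v"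
   using Lim_transform_eventually by (simp add: mult.commute) force
 qed
qed

text \<open>All meshes and displacements at once: there are countably many, so the property holds
  almost surely, and every test function can then be treated for a fixed realisation.\<close>

definition typical :: "'a measure => bool" where
 "typical W \<longleftrightarrow> W : PM & (ALL N>0. ALL v:latt N.
  (%n. cell_pairs N v n W/real n^DIM('a)) ~~> unit_ball_vol DIM('a) / vol (cell N (0::'a))*cexp N v)"

lemma typical_AE: "AE W in P. typical W"
proof -
 have c: "countable (latt N :: 'a set)" if N: "N > 0" for N
 proof -
  have "latt N = (UN n. lball N n :: 'a set)" using reals_Archimedean2 by (auto simp: lball_mem[OF N])
  moreover have "countable (UN n. lball N n :: 'a set)" using lball_finite[OF N] by (intro countable_UN countableI_type countable_finite)
  ultimately show ?thesis by simp
 qed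
 have "AE W in P. ALL v:latt N. (%n. cell_pairs N v n W/real n^DIM('a)) ~~> unit_ball_vol DIM('a) / vol (cell N (0::'a))*cexp N v"
  if N: "N > 0" for N by (subst AE_ball_countable[OF c[OF N]]) (intro ballI cell_pairs_lln[OF N])
 then have "AE W in P. N > 0 --> (ALL v:latt N. (%n. cell_pairs N v n W/real n^DIM('a)) ~~> unit_ball_vol DIM('a) / vol (cell N (0::'a))*cexp N v)"
  for N by (cases "N > 0") simp_all
 then have "AE W in P. ALL N. N > 0 --> (ALL v:latt N. (%n. cell_pairs N v n W/real n^DIM('a)) ~~> unit_ball_vol DIM('a) / vol (cell N (0::'a))*cexp N v)"
  by (simp add: AE_all_countable)
 moreover have "AE W in P. W : space P" by (rule AE_space)
 ultimately show ?thesis by eventually_elim (simp add: typical_def)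
qed

text \<open>The integral of \<open>b\<close> against the mean distribution of points seen from a
  point at \<open>x\<close>: an atom at \<open>x\<close> for that point itself plus the density 1 -
  \<open>k2\<close>.\<close>

definition pairing :: "('a => ennreal) => 'a => ennreal" where
 "pairing b x = b x + (NN y. b y*ennreal (1 - k2 (x - y)))"

text \<open>Second moments of cell counts, rewritten as one integral of a step function; the
  comparison with a test function then takes place pointwise through
  \<open>pairing_mono\<close>.\<close>

lemma cexp_nn:
 assumes N: "N > 0" and V: "finite V" "V <= latt N" and be: "!!v. v : V ==> be v >= 0"
 shows "ennreal (SUM v:V. be v * cexp N v) = (NN x. pairing (%y. if rnd N y : V then ennreal (be (rnd N y)) else 0) x*ind (cell N 0) x)"
proof -
 note [measurable] = cell_borel[OF N]
 let ?i = "%v x. ind (cell N v) x :: ennreal"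
 have cx: "cexp N v >= 0" for v unfolding cexp_def by (intro integral_nonneg) simp
 have one: "ennreal (cexp N v) = (NN x. pairing (?i v) x*?i 0 x)" if v: "v : V" for v
 proof -
  have b: "cell N v : bbs" "cell N (0::'a) : bbs" using RR_bbs[OF cell_RR[OF N]] RR_bbs[OF cell_0_RR[OF N]] v V(2) by auto
  let ?C = "%j::nat. if j = 0 then cell N 0 else cell N v"
  have m0: "m 2 ?C >= 0" unfolding m_def by (intro integral_nonneg) (simp add: R_2 k_le_1)
  have i: "cell N 0 Int cell N v : bbs" by (rule bbs_Int[OF b(2,1)])
  have "ennreal (cexp N v) = ennreal (m 2 ?C) + emeasure lborel (cell N 0 Int cell N v)"
   unfolding cexp_def expect_count_mult[OF b(2,1)] bbs_emeasure_lborel[OF i] using m0 by (intro ennreal_plus) simp_all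
  also have "emeasure lborel (cell N 0 Int cell N v) = (NN x. ?i 0 x*?i v x)"
  proof -
   have "(%x. ?i 0 x*?i v x) = ind (cell N 0 Int cell N v)" by (auto simp: indicator_def)
   then show ?thesis by simp
  qed
  also have "ennreal (m 2 ?C) = (NN x. (NN y. ?i v y*ennreal (1 - k2 (x - y)))*?i 0 x)"
  proof -
   have "ennreal (m 2 ?C) = (\<integral>\<^sup>+x. \<integral>\<^sup>+y. (?i v y*ennreal (1 - k2 (x - y)))*?i 0 x \<partial>lborel \<partial>lborel)"
    using m_2[of ?C] b by (simp add: ac_simps)
   also have "... = (NN x. (NN y. ?i v y*ennreal (1 - k2 (x - y)))*?i 0 x)" by (intro nn_integral_cong nn_integral_multc) measurable
   finally show ?thesis .
  qed
  also have "... + (NN x. ?i 0 x*?i v x) = (NN x. pairing (?i v) x*?i 0 x)"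
   unfolding pairing_def by (subst nn_integral_add[symmetric]) (simp_all add: algebra_simps)
  finally show ?thesis .
 qed
 have pm: "pairing (?i v) : BM borel" for v unfolding pairing_def[abs_def] by measurable
 have "ennreal (SUM v:V. be v * cexp N v) = (SUM v:V. ennreal (be v)*ennreal (cexp N v))"
  using be cx by (subst sum_ennreal[symmetric]) (auto simp: ennreal_mult intro!: sum.cong)
 also have "... = (SUM v:V. (NN x. ennreal (be v)*(pairing (?i v) x*?i 0 x)))"
 proof (intro sum.cong refl)
  fix v assume v: "v : V"
  show "ennreal (be v)*ennreal (cexp N v) = (NN x. ennreal (be v)*(pairing (?i v) x*?i 0 x))"
   unfolding one[OF v] by (rule nn_integral_cmult[symmetric]) (use pm in measurable)
 qed
 also have "... = (NN x. (SUM v:V. ennreal (be v)*(pairing (?i v) x*?i 0 x)))" by (rule nn_integral_sum[symmetric]) (use pm in measurable)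
 also have "... = (NN x. pairing (%y. if rnd N y : V then ennreal (be (rnd N y)) else 0) x*ind (cell N 0) x)"
 proof (rule nn_integral_cong)
  fix x :: 'a
  have b: "(SUM v:V. ennreal (be v)*?i v y) = (if rnd N y : V then ennreal (be (rnd N y)) else 0)" for y
  proof -
   have "(SUM v:V. ennreal (be v)*?i v y) = (SUM v:V. if v = rnd N y then ennreal (be v) else 0)"
    by (intro sum.cong refl) (auto simp: cell_def indicator_def)
   then show ?thesis using V(1) by (simp add: sum.delta)
  qed
  have "(SUM v:V. ennreal (be v)*pairing (?i v) x) = (SUM v:V. ennreal (be v)*?i v x) + (SUM v:V. (NN y. ennreal (be v)*?i v y*ennreal (1 - k2 (x - y))))"
   unfolding pairing_def by (simp add: distrib_left sum.distrib nn_integral_cmult[symmetric] mult.assoc)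
  also have "(SUM v:V. (NN y. ennreal (be v)*?i v y*ennreal (1 - k2 (x - y)))) = (NN y. (SUM v:V. ennreal (be v)*?i v y*ennreal (1 - k2 (x - y))))"
   by (rule nn_integral_sum[symmetric]) measurable
  finally have "(SUM v:V. ennreal (be v)*pairing (?i v) x) = pairing (%y. if rnd N y : V then ennreal (be (rnd N y)) else 0) x"
   unfolding sum_distrib_right[symmetric] b pairing_def .
  then show "(SUM v:V. ennreal (be v)*(pairing (?i v) x*?i 0 x)) = pairing (%y. if rnd N y : V then ennreal (be (rnd N y)) else 0) x*ind (cell N 0) x"
   by (simp add: sum_distrib_right[symmetric] mult.assoc[symmetric])
 qed
 finally show ?thesis .
qed

lemma pairing_mono: "(!!y. b y <= b' y) ==> pairing b x <= pairing b' x"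
 unfolding pairing_def by (intro add_mono nn_integral_mono mult_right_mono) auto

definition auto_integral :: "('a => real) => real" where
 "auto_integral f = f 0 + (LBINT y. f y*(1 - k2 y))"

lemma test_integrable: assumes "test_function f rad" shows "integrable lborel f" "integrable lborel (%y. f y*(1 - k2 y))"
proof -
 interpret test_function f rad by fact
 have "integrable lborel (%x. ind (cball 0 (real rad)) x *\<^sub>R f x)"
  by (rule borel_integrable_compact) (use f_cont in \<open>auto intro: continuous_on_subset\<close>)
 moreover have "(%x. ind (cball 0 (real rad)) x *\<^sub>R f x) = f" using f_supp by (auto simp: indicator_def fun_eq_iff)
 ultimately show i: "integrable lborel f" by (simp only:)
 show "integrable lborel (%y. f y*(1 - k2 y))" by (rule integrable_bound[OF i]) (auto simp: abs_mult f_nonneg k_le_1 intro!: mult_right_le_one_le AE_I2)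
qed

lemma auto_integral_nn:
 assumes "test_function f rad" and N: "N > 0"
 shows "ennreal (vol (cell N (0::'a))*auto_integral f) = (NN x. pairing (%y. ennreal (f (x - y))) x*ind (cell N 0) x)"
proof -
 interpret test_function f rad by fact
 have nn: "(LBINT y. f y*(1 - k2 y)) >= 0" by (intro integral_nonneg) (simp add: f_nonneg k_le_1)
 have "pairing (%y. ennreal (f (x - y))) x = ennreal (auto_integral f)" for x
 proof -
  have "(NN y. ennreal (f (x - y))*ennreal (1 - k2 (x - y))) = (NN y. ennreal (f y)*ennreal (1 - k2 y))" by (rule nn_integral_reflect) measurable
  also have "... = (NN y. ennreal (f y*(1 - k2 y)))" by (intro nn_integral_cong) (simp add: ennreal_mult f_nonneg k_le_1)
  also have "... = ennreal (LBINT y. f y*(1 - k2 y))" by (rule nn_integral_eq_integral[OF test_integrable(2)[OF assms(1)]]) (simp add: f_nonneg k_le_1)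
  finally show ?thesis using nn by (simp add: pairing_def auto_integral_def f_nonneg)
 qed
 moreover have "auto_integral f >= 0" using nn f_nonneg[of 0] by (simp add: auto_integral_def)
 moreover have "(NN x. ennreal (auto_integral f)*ind (cell N (0::'a)) x) = ennreal (auto_integral f)*emeasure lborel (cell N (0::'a))"
  by (rule nn_integral_cmult_indicator) (simp add: cell_borel[OF N])
 ultimately show ?thesis unfolding bbs_emeasure_lborel[OF RR_bbs[OF cell_0_RR[OF N]]] by (simp only: ennreal_mult measure_nonneg mult.commute)
qed

text \<open>Upper and lower step functions enclose both the pair sum and the limit. For a typical
  realisation the enclosing sums converge, and their limits \<open>Up\<close> and \<open>Lo\<close>
  differ by at most \<open>2*ep*D\<close>, where \<open>D\<close> does not depend on the
  mesh.\<close>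

theorem pair_integral_limit:
 assumes w: "typical W" and f: "test_function f rad"
 shows "(%n. enn2real (pair_integral f n W) / vol (ball (0::'a) (real n))) ~~> auto_integral f"
  and "pair_integral f n W < \<infinity>"
proof -
 interpret test_function f rad by fact
 have ws: "W : PM" using w by (simp add: typical_def)
 let ?U = "unit_ball_vol (real DIM('a))"
 have U: "?U ~= 0" using unit_ball_vol_pos[of "real DIM('a)"] by linarith
 \<comment> \<open>Bounds the sum of \<open>cexp\<close> over all displacements in use, divided by
   the cell volume, independently of the mesh: an atom of mass 1 plus the volume of a ball
   containing every point whose cell corner has norm below rad + 3.\<close>
 define D where "D = 1 + vol (ball (0::'a) (real rad + 4))"
 have D: "D >= 1" by (simp add: D_def)
 have ex: "EX N. N > 0 & DIM('a)/real N <= 1 & (ALL x y. norm (x - y) <= 2*(DIM('a)/real N) --> \<bar>f x - f y\<bar> <= ep)" if e: "ep > 0" for ep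
 proof -
  obtain de where de: "de > 0" "!!x y. norm (x - y) <= de ==> \<bar>f x - f y\<bar> <= ep" using f_modulus[OF e] by blast
  obtain N :: nat where N: "real N > max (DIM('a)) (2*DIM('a)/de)" using reals_Archimedean2 by blast
  then have N0: "real N > 0" using DIM_positive[where 'a = 'a] by (simp add: less_le_trans)
  have "DIM('a)/real N <= 1" using N N0 by (simp add: divide_le_eq_1)
  moreover have "2*(DIM('a)/real N) <= de" using N N0 de(1) by (simp add: field_simps)
  ultimately show ?thesis using N0 de(2) by (intro exI[of _ N]) (simp add: order_trans)
 qed
 obtain N0 where N0: "N0 > 0" "DIM('a)/real N0 <= 1" "ALL x y. norm (x - y) <= 2*(DIM('a)/real N0) --> \<bar>f x - f y\<bar> <= 1"
  using ex[of 1] by auto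
 have e1: "(1::real) > 0" by simp
 have fin: "pair_integral f n W < \<infinity>" for n using order.strict_trans1[OF pair_integral_le[OF N0(1,2) e1 N0(3) ws, of n] ennreal_less_top] by simp
 then show "pair_integral f n W < \<infinity>" .
 show "(%n. enn2real (pair_integral f n W) / vol (ball (0::'a) (real n))) ~~> auto_integral f"
 proof (rule LIMSEQ_I)
  fix et :: real assume et: "et > 0"
  \<comment> \<open>Makes the gap \<open>2*ep*D\<close> one third of \<open>et\<close>; another
    third is allowed for the convergence of the enclosing sums.\<close>
  define ep where "ep = et/(6*D)"
  have ep: "ep > 0" and epD: "2*ep*D <= et/3" using et D by (simp_all add: ep_def)
  obtain N where N: "N > 0" "DIM('a)/real N <= 1" and mod: "ALL x y. norm (x - y) <= 2*(DIM('a)/real N) --> \<bar>f x - f y\<bar> <= ep"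
   using ex[OF ep] by auto
  note ctx = N ep mod
  let ?V = "lball N (rad + 3) :: 'a set" and ?q = "vol (cell N (0::'a))"
  let ?up = "%v. f (- v) + ep" and ?lo = "%v. max 0 (f (- v) - ep)"
  have q: "?q > 0" by (rule cell_measure_pos[OF N(1)])
  have V: "finite ?V" "?V <= latt N" using lball_finite[OF N(1)] by (auto simp: lball_mem[OF N(1)])
  have I0: "auto_integral f >= 0" unfolding auto_integral_def by (intro add_nonneg_nonneg integral_nonneg) (simp_all add: f_nonneg k_le_1)
  have cx: "cexp N v >= 0" for v unfolding cexp_def by (intro integral_nonneg) simp
  have upper: "?q*auto_integral f <= (SUM v:?V. ?up v * cexp N v)"
  proof -
   have "ennreal (?q*auto_integral f) <= ennreal (SUM v:?V. ?up v * cexp N v)" unfolding auto_integral_nn[OF f N(1)]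
   proof (subst cexp_nn[OF N(1) V])
    show "?up v >= 0" for v using f_nonneg[of "- v"] ep by simp
    show "(NN x. pairing (%y. ennreal (f (x - y))) x*ind (cell N 0) x)
     <= (NN x. pairing (%y. if rnd N y : ?V then ennreal (?up (rnd N y)) else 0) x*ind (cell N 0) x)"
    proof (rule nn_integral_mono)
     fix x :: 'a
     have "pairing (%y. ennreal (f (x - y))) x <= pairing (%y. if rnd N y : ?V then ennreal (?up (rnd N y)) else 0) x" if "rnd N x = 0"
     proof (rule pairing_mono)
      fix y
      have "f (x - y) <= (if rnd N y : ?V then ?up (rnd N y) else 0)" using f_le_up[OF ctx, of x y] that by (simp only: diff_0_right)
      then show "ennreal (f (x - y)) <= (if rnd N y : ?V then ennreal (?up (rnd N y)) else 0)"
       by (cases "rnd N y : ?V") (simp_all only: if_True if_False ennreal_leI ennreal_neg le_zero_eq)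
     qed
     then show "pairing (%y. ennreal (f (x - y))) x*ind (cell N 0) x <= pairing (%y. if rnd N y : ?V then ennreal (?up (rnd N y)) else 0) x*ind (cell N 0) x"
      by (auto simp: indicator_def cell_def)
    qed
   qed
   then show ?thesis using ep f_nonneg cx by (subst (asm) ennreal_le_iff) (auto intro!: sum_nonneg mult_nonneg_nonneg add_nonneg_nonneg)
  qed
  have lower: "(SUM v:?V. ?lo v * cexp N v) <= ?q*auto_integral f"
  proof -
   have "ennreal (SUM v:?V. ?lo v * cexp N v) <= ennreal (?q*auto_integral f)" unfolding auto_integral_nn[OF f N(1)]
   proof (subst cexp_nn[OF N(1) V])
    show "(NN x. pairing (%y. if rnd N y : ?V then ennreal (?lo (rnd N y)) else 0) x*ind (cell N 0) x)
     <= (NN x. pairing (%y. ennreal (f (x - y))) x*ind (cell N 0) x)"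
    proof (rule nn_integral_mono)
     fix x :: 'a
     have "pairing (%y. if rnd N y : ?V then ennreal (?lo (rnd N y)) else 0) x <= pairing (%y. ennreal (f (x - y))) x" if x: "rnd N x = 0"
     proof (rule pairing_mono)
      fix y
      have "(if rnd N y : ?V then ?lo (rnd N y) else 0) <= f (x - y)" using lo_le_f[OF ctx, of y x] x by (simp only: diff_0_right)
      then show "(if rnd N y : ?V then ennreal (?lo (rnd N y)) else 0) <= ennreal (f (x - y))"
       by (cases "rnd N y : ?V") (simp_all only: if_True if_False ennreal_leI zero_le)
     qed
     then show "pairing (%y. if rnd N y : ?V then ennreal (?lo (rnd N y)) else 0) x*ind (cell N 0) x <= pairing (%y. ennreal (f (x - y))) x*ind (cell N 0) x"
      by (auto simp: indicator_def cell_def)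
    qed
   qed simp
   then show ?thesis using I0 q by (subst (asm) ennreal_le_iff) simp_all
  qed
  have total: "(SUM v:?V. cexp N v) <= ?q*D"
  proof -
   have "ennreal (SUM v:?V. 1*cexp N v) <= ennreal (?q*D)"
   proof (subst cexp_nn[OF N(1) V])
    have "pairing (%y. if rnd N y : ?V then ennreal 1 else 0) x <= ennreal D" for x
    proof -
     have "(NN y. (if rnd N y : ?V then ennreal 1 else 0)*ennreal (1 - k2 (x - y))) <= (NN y. ind (ball (0::'a) (real rad + 4)) y)"
     proof (rule nn_integral_mono)
      fix y :: 'a
      have "norm y < real rad + 4" if "rnd N y : ?V" using that rnd_diff(4)[OF ctx, of y] by (simp add: lball_mem[OF N(1)])
      moreover have "ennreal (1 - k2 (x - y)) <= 1" by simp
      ultimately show "(if rnd N y : ?V then ennreal 1 else 0)*ennreal (1 - k2 (x - y)) <= ind (ball 0 (real rad + 4)) y"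
       by (cases "rnd N y : ?V") simp_all
     qed
     also have "... = ennreal (vol (ball (0::'a) (real rad + 4)))" by (simp add: bbs_emeasure_lborel)
     finally show ?thesis unfolding pairing_def D_def by (subst ennreal_plus) (auto intro: add_mono add_increasing)
    qed
    then have "(NN x. pairing (%y. if rnd N y : ?V then ennreal 1 else 0) x*ind (cell N 0) x) <= (NN x. ennreal D*ind (cell N (0::'a)) x)"
     by (intro nn_integral_mono mult_right_mono) auto
    also have "... = ennreal (?q*D)" using D cell_borel[OF N(1)]
     by (subst nn_integral_cmult_indicator) (simp_all add: bbs_emeasure_lborel[OF RR_bbs[OF cell_0_RR[OF N(1)]]] ennreal_mult mult.commute)
    finally show "(NN x. pairing (%y. if rnd N y : ?V then ennreal 1 else 0) x*ind (cell N 0) x) <= ennreal (?q*D)" .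
   qed simp
   then show ?thesis using D q by (subst (asm) ennreal_le_iff) simp_all
  qed
  define Up where "Up = (SUM v:?V. ?up v * cexp N v)/?q"
  define Lo where "Lo = (SUM v:?V. ?lo v * cexp N v)/?q"
  have UL: "auto_integral f <= Up" "Lo <= auto_integral f" using upper lower q by (simp_all add: Up_def Lo_def pos_le_divide_eq pos_divide_le_eq mult.commute)
  have "Up - Lo <= et/3"
  proof -
   have "(SUM v:?V. ?up v * cexp N v) <= (SUM v:?V. (?lo v + 2*ep)*cexp N v)" using cx by (intro sum_mono mult_right_mono) auto
   also have "... = (SUM v:?V. ?lo v * cexp N v) + 2*ep*(SUM v:?V. cexp N v)" by (simp add: distrib_right sum.distrib sum_distrib_left)
   also have "... <= (SUM v:?V. ?lo v * cexp N v) + 2*ep*(?q*D)" using total ep by (intro add_left_mono mult_left_mono) auto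
   finally have "Up <= ((SUM v:?V. ?lo v * cexp N v) + 2*ep*(?q*D))/?q" unfolding Up_def using q by (intro divide_right_mono) auto
   also have "... = Lo + 2*ep*D" using q by (simp add: Lo_def add_divide_distrib)
   finally show ?thesis using epD by linarith
  qed
  have lims: "(%n. (SUM v:?V. c v * cell_pairs N v (g n) W)/(?U*real n^DIM('a))) ~~> (SUM v:?V. c v * cexp N v)/?q"
   if g: "filterlim g at_top sequentially" "(%n. real (g n)/real n) ~~> 1" for c :: "'a => real" and g :: "nat => nat"
  proof -
   have "(%n. cell_pairs N v (g n) W/real n^DIM('a)) ~~> ?U/?q*cexp N v" if "v : ?V" for v
   proof (rule tendsto_power_shift[OF _ g])
    have "v : latt N" using that V(2) by blast
    then show "(%n. cell_pairs N v n W/real n^DIM('a)) ~~> ?U/?q*cexp N v" using w N(1) unfolding typical_def by blast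
   qed
   then have "(%n. (SUM v:?V. c v * (cell_pairs N v (g n) W/real n^DIM('a)))/?U) ~~> (SUM v:?V. c v * (?U/?q*cexp N v))/?U"
    using U by (intro tendsto_intros) auto
   moreover have "(SUM v:?V. c v * (cell_pairs N v (g n) W/real n^DIM('a)))/?U = (SUM v:?V. c v * cell_pairs N v (g n) W)/(?U*real n^DIM('a))" for n
    by (simp add: sum_divide_distrib mult.commute)
   moreover have "(SUM v:?V. c v * (?U/?q*cexp N v))/?U = (SUM v:?V. c v * cexp N v)/?q" using U by (simp add: sum_divide_distrib mult.commute)
   ultimately show ?thesis by simp
  qed
  have eu: "eventually (%n. (SUM v:?V. ?up v * cell_pairs N v (n + 1) W)/(?U*real n^DIM('a)) < Up + et/3) sequentially"
   by (rule order_tendstoD(2)[OF lims[OF shift_ratios(1,2), of ?up]]) (use et in \<open>simp add: Up_def\<close>)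
  have el: "eventually (%n. (SUM v:?V. ?lo v * cell_pairs N v (n - (rad + 5)) W)/(?U*real n^DIM('a)) > Lo - et/3) sequentially"
   by (rule order_tendstoD(1)[OF lims[OF shift_ratios(3,4), of ?lo]]) (use et in \<open>simp add: Lo_def\<close>)
  have cp: "cell_pairs N v n W >= 0" for v n unfolding cell_pairs_def by (intro sum_nonneg) simp
  have "eventually (%n. norm (enn2real (pair_integral f n W) / vol (ball (0::'a) (real n)) - auto_integral f) < et) sequentially" using eu el
  proof eventually_elim
   fix n assume n: "(SUM v:?V. ?up v * cell_pairs N v (n + 1) W)/(?U*real n^DIM('a)) < Up + et/3"
    "(SUM v:?V. ?lo v * cell_pairs N v (n - (rad + 5)) W)/(?U*real n^DIM('a)) > Lo - et/3"
   have b: "vol (ball (0::'a) (real n)) = ?U*real n^DIM('a)" by (simp add: content_ball)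
   have "enn2real (pair_integral f n W) <= (SUM v:?V. ?up v * cell_pairs N v (n + 1) W)"
    using enn2real_mono[OF pair_integral_le[OF ctx ws, of n] ennreal_less_top] cp f_nonneg ep
    by (subst (asm) enn2real_ennreal) (auto intro!: sum_nonneg mult_nonneg_nonneg add_nonneg_nonneg)
   then have 1: "enn2real (pair_integral f n W)/(?U*real n^DIM('a)) <= (SUM v:?V. ?up v * cell_pairs N v (n + 1) W)/(?U*real n^DIM('a))"
    by (intro divide_right_mono) simp_all
   have "(SUM v:?V. ?lo v * cell_pairs N v (n - (rad + 5)) W) <= enn2real (pair_integral f n W)"
    using enn2real_mono[OF pair_integral_ge[OF ctx ws, of n] fin[of n, unfolded infinity_ennreal_def]] cp
    by (subst (asm) enn2real_ennreal) (auto intro!: sum_nonneg mult_nonneg_nonneg)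
   then have 2: "(SUM v:?V. ?lo v * cell_pairs N v (n - (rad + 5)) W)/(?U*real n^DIM('a)) <= enn2real (pair_integral f n W)/(?U*real n^DIM('a))"
    by (intro divide_right_mono) simp_all
   show "norm (enn2real (pair_integral f n W) / vol (ball (0::'a) (real n)) - auto_integral f) < et"
    unfolding b real_norm_def using 1 2 n UL \<open>Up - Lo <= et / 3\<close> et by linarith
  qed
  then show "EX no. ALL n>=no. norm (enn2real (pair_integral f n W) / vol (ball (0::'a) (real n)) - auto_integral f) < et"
   by (simp add: eventually_sequentially)
 qed
qed

end

section \<open>Autocorrelation, diffraction and the passage to the given process\<close>

lemma finite_patch_facts:
 fixes W :: "'a::euclidean_space measure"
 assumes w: "W : PM"
 shows "sets (finite_patch W n) = sets borel" "finite_measure (finite_patch W n)"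
  and "g : BM borel ==> (\<integral>\<^sup>+x. g x \<partial>finite_patch W n) = (NNI W (%x. ind (bl n) x*g x))"
proof -
 note p = point_measuresD[OF w]
 have b: "(ind (bl n) :: 'a => ennreal) : BM W" by (rule borel_measurable_indicator) (simp add: p(1))
 show "sets (finite_patch W n) = sets borel" by (simp add: finite_patch_def p(1))
 show "(\<integral>\<^sup>+x. g x \<partial>finite_patch W n) = (NNI W (%x. ind (bl n) x*g x))" if "g : BM borel"
 proof -
  have "g : BM W" using that p(1) by (simp cong: measurable_cong_sets)
  then show ?thesis unfolding finite_patch_def by (rule nn_integral_density[OF b])
 qed
 show "finite_measure (finite_patch W n)"
 proof
  have "emeasure (finite_patch W n) (space (finite_patch W n)) = emeasure W (bl n)"
   unfolding finite_patch_def using b p(1) by (simp add: emeasure_density p(2) nn_integral_indicator)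
  then show "emeasure (finite_patch W n) (space (finite_patch W n)) ~= \<infinity>" using p(3)[of "bl n"] by simp
 qed
qed

lemma nn_integral_autocorrelation:
 fixes W :: "'a::ordered_euclidean_space measure"
 assumes w: "W : PM" and [measurable]: "f : BM borel" and f: "!!x. f x >= (0::real)"
 shows "(NNI (finite_patch W n \<star> reflected (finite_patch W n)) (%x. ennreal (f x))) = pair_integral f n W"
proof -
 note p = point_measuresD[OF w] and fp = finite_patch_facts[OF w]
 let ?mm = "finite_patch W n"
 have um: "uminus : ?mm \<rightarrow>\<^sub>M borel" using fp(1) by (simp cong: measurable_cong_sets)
 interpret finite_measure ?mm by (rule fp(2))
 have fr: "finite_measure (reflected ?mm)" unfolding reflected_def by (rule finite_measure_distr[OF um])
 have "(NNI (?mm \<star> reflected ?mm) (%x. ennreal (f x))) = (\<integral>\<^sup>+x. \<integral>\<^sup>+y. ennreal (f (x + y)) \<partial>reflected ?mm \<partial>?mm)"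
  by (rule nn_integral_convolution[OF fp(2) fr]) (simp_all add: reflected_def fp(1))
 also have "... = (\<integral>\<^sup>+x. \<integral>\<^sup>+y. ennreal (f (x - y)) \<partial>?mm \<partial>?mm)"
  unfolding reflected_def by (intro nn_integral_cong) (subst nn_integral_distr[OF um]; simp)
 also have "... = (NNI ?mm (%x. (NNI W (%y. ind (bl n) y*ennreal (f (x - y))))))" by (intro nn_integral_cong fp(3)) measurable
 also have "... = (NNI W (%x. ind (bl n) x*(NNI W (%y. ind (bl n) y*ennreal (f (x - y))))))"
 proof (rule fp(3))
  have "(%x. (NNI ?mm (%y. ennreal (f (x - y))))) : BM borel"
  proof (rule borel_measurable_nn_integral)
   have "(%z. ennreal (f (fst z - snd z))) : BM (borel \<Otimes>\<^sub>M borel)" by measurable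
   then show "(%(x, y). ennreal (f (x - y))) : BM (borel \<Otimes>\<^sub>M ?mm)"
    by (simp add: split_def fp(1) cong: measurable_cong_sets sets_pair_measure_cong)
  qed
  moreover have "(NNI ?mm (%y. ennreal (f (x - y)))) = (NNI W (%y. ind (bl n) y*ennreal (f (x - y))))" for x by (rule fp(3)) measurable
  ultimately show "(%x. (NNI W (%y. ind (bl n) y*ennreal (f (x - y))))) : BM borel" by simp
 qed
 also have "... = pair_integral f n W" unfolding pair_integral_def
 proof (intro nn_integral_cong)
  fix x
  have m: "(%y. ind (bl n) y*ennreal (f (x - y))) : BM W"
  proof -
   have "(%y. ennreal (f (x - y))) : BM borel" by measurable
   then have "(%y. ennreal (f (x - y))) : BM W" by (simp add: p(1) cong: measurable_cong_sets)
   moreover have "(ind (bl n) :: 'a => ennreal) : BM W" by (rule borel_measurable_indicator) (simp add: p(1))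
   ultimately show ?thesis by (intro borel_measurable_times_ennreal)
  qed
  show "ind (bl n) x*(NNI W (%y. ind (bl n) y*ennreal (f (x - y))))
   = (NNI W (%y. ennreal (f (x - y))*ind (bl n) x*ind (bl n) y))"
   unfolding nn_integral_cmult[OF m, symmetric] by (simp only: ac_simps)
 qed
 finally show ?thesis .
qed

text \<open>\<open>pair_integral_limit\<close> covers nonnegative test functions; a general one is
  split into positive and negative part, whose integrability permits subtracting the limits.\<close>

theorem autocorrelation_typical:
 fixes K :: "'a::ordered_euclidean_space => complex"
 assumes "det_process K P" and w: "det_process.typical P W"
 shows "autocorrelation W (atom_density 1 (%x. 1 - (cmod (K x))^2))"
proof -
 interpret det_process K P by fact
 let ?ga = "atom_density 1 (%x. 1 - k2 x) :: 'a measure"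
 let ?mm = "%n. scale_measure (1/emeasure lborel (ball (0::'a) (real n))) (finite_patch W n \<star> reflected (finite_patch W n))"
 have ws: "W : PM" using w by (simp add: typical_def)
 have test: "(%n. \<integral>x. f x \<partial>?mm n) ~~> (LINT x|?ga. f x) & (ALL n>=1. integrable (?mm n) f) & integrable ?ga f"
  if f: "test_function f r" for f :: "'a => real" and r
 proof -
  interpret test_function f r by fact
  \<comment> \<open>The restriction to n >= 1 excludes the empty ball, whose volume cannot serve as
    a normalisation.\<close>
  have nn: "(\<integral>\<^sup>+x. ennreal (f x) \<partial>?mm n) = ennreal (1 / vol (ball (0::'a) (real n)))*pair_integral f n W" if "n >= 1" for n
  proof -
   have b: "vol (ball (0::'a) (real n)) > 0" using that by (simp add: content_ball_pos)
   have "1/emeasure lborel (ball (0::'a) (real n)) = ennreal (1 / vol (ball (0::'a) (real n)))"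
    using b by (simp add: bbs_emeasure_lborel divide_ennreal flip: ennreal_1)
   then show ?thesis by (simp add: nn_integral_scale_measure nn_integral_autocorrelation[OF ws f_measurable f_nonneg])
  qed
  have fm: "f : BM (?mm n)" for n by (simp cong: measurable_cong_sets)
  have im: "(\<integral>x. f x \<partial>?mm n) = enn2real (pair_integral f n W) / vol (ball (0::'a) (real n))" if "n >= 1" for n
   by (subst integral_eq_nn_integral) (simp_all add: fm f_nonneg nn[OF that] enn2real_mult)
  have ii: "integrable (?mm n) f" if "n >= 1" for n
   by (rule integrableI_nonneg) (simp_all add: fm f_nonneg nn[OF that] ennreal_mult_less_top pair_integral_limit(2)[OF w f, unfolded infinity_ennreal_def])
  have D: "integrable lborel (%x. (1 - k2 x) *\<^sub>R f x)" using test_integrable(2)[OF f] by (simp add: mult.commute)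
  have g: "(LINT x|?ga. f x) = auto_integral f" by (subst integral_atom_density[OF _ _ _ _ D]) (simp_all add: auto_integral_def k_le_1 mult.commute)
  have gi: "integrable ?ga f" by (rule integrable_atom_density[OF _ _ _ _ D]) (simp_all add: k_le_1)
  have "(%n. \<integral>x. f x \<partial>?mm n) ~~> auto_integral f"
  proof (rule Lim_transform_eventually[OF pair_integral_limit(1)[OF w f]])
   show "eventually (%n. enn2real (pair_integral f n W) / vol (ball (0::'a) (real n)) = (\<integral>x. f x \<partial>?mm n)) sequentially"
    using eventually_ge_at_top[of 1] by eventually_elim (rule im[symmetric])
  qed
  then show ?thesis using g gi ii by simp
 qed
 show ?thesis unfolding autocorrelation_def vague_limit_def
 proof (intro conjI allI impI)
  show "locally_finite_borel ?ga" unfolding locally_finite_borel_def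
  proof (intro conjI ballI impI)
   fix A :: "'a set" assume A: "A : sets borel" "bounded A"
   have "(NN x. ennreal (1 - k2 x)*ind A x) <= (NN x. ind A x)" by (intro nn_integral_mono) (simp add: indicator_def)
   also have "... < \<infinity>" using A emeasure_bounded_finite[of A] by simp
   finally show "emeasure ?ga A < \<infinity>" using A by (subst emeasure_atom_density) (simp_all add: indicator_def)
  qed simp
  fix f :: "'a => real" assume f: "continuous_on UNIV f & compact (closure {x. f x ~= 0})"
  have "bounded (closure {x. f x ~= 0})" by (rule compact_imp_bounded[OF conjunct2[OF f]])
  then obtain B where B: "!!x. x : closure {x. f x ~= 0} ==> norm x <= B" unfolding bounded_iff by (elim exE) (rule that, rule bspec)
  obtain r :: nat where r: "B <= real r" using real_arch_simple by blast
  have s: "norm x <= real r" if "f x ~= 0" for x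
  proof -
   have "x : closure {x. f x ~= 0}" using subsetD[OF closure_subset, of x "{x. f x ~= 0}"] that by simp
   then show ?thesis using B[of x] r by linarith
  qed
  have t: "test_function (%x. max 0 (f x)) r" "test_function (%x. max 0 (- f x)) r"
  proof -
   have s': "norm x <= real r" if "max 0 (f x) ~= 0 \<or> max 0 (- f x) ~= 0" for x by (rule s) (use that in \<open>auto simp: max_def\<close>)
   show "test_function (%x. max 0 (f x)) r" by (intro test_function.intro continuous_on_max continuous_on_const conjunct1[OF f] s') simp_all
   show "test_function (%x. max 0 (- f x)) r" by (intro test_function.intro continuous_on_max continuous_on_const continuous_on_minus conjunct1[OF f] s') simp_all
  qed
  note t1 = test[OF t(1)] and t2 = test[OF t(2)]
  have e: "f x = max 0 (f x) - max 0 (- f x)" for x by (simp add: max_def)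
  have eqn: "(LINT x|M. f x) = (LINT x|M. max 0 (f x)) - (LINT x|M. max 0 (- f x))"
   if "integrable M (%x. max 0 (f x))" "integrable M (%x. max 0 (- f x))" for M :: "'a measure" using integral_diff[OF that] by (simp only: e[symmetric])
  have "(%n. (\<integral>x. max 0 (f x) \<partial>?mm n) - (\<integral>x. max 0 (- f x) \<partial>?mm n)) ~~> (LINT x|?ga. max 0 (f x)) - (LINT x|?ga. max 0 (- f x))"
   using t1 t2 by (intro tendsto_diff) simp_all
  then have "(%n. (\<integral>x. max 0 (f x) \<partial>?mm n) - (\<integral>x. max 0 (- f x) \<partial>?mm n)) ~~> (LINT x|?ga. f x)"
   using t1 t2 by (subst eqn) simp_all
  then show "(%n. \<integral>x. f x \<partial>?mm n) ~~> (LINT x|?ga. f x)"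
  proof (rule Lim_transform_eventually)
   show "eventually (%n. (\<integral>x. max 0 (f x) \<partial>?mm n) - (\<integral>x. max 0 (- f x) \<partial>?mm n) = (\<integral>x. f x \<partial>?mm n)) sequentially"
    using eventually_ge_at_top[of 1] by eventually_elim (rule eqn[symmetric], use t1 t2 in simp_all)
  qed
 qed
qed

lemma vague_limit_unique: "vague_limit mm ga ==> vague_limit mm ga' ==> ga = ga'"
 unfolding vague_limit_def by (elim conjE, rule borel_measure_eqI_continuous) (auto intro: LIMSEQ_unique)

text \<open>\<open>diffraction_spectrum\<close> is a union over all almost sure diffraction
  measures. For a competitor \<open>nu\<close> there is a realisation at which \<open>nu\<close> is
  a diffraction measure and \<open>?ga\<close> the autocorrelation; uniqueness of the transform of
  \<open>?ga\<close> leaves one term in the union.\<close>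

theorem diffraction_spectrum_eq:
 fixes K :: "'a::ordered_euclidean_space => complex"
 assumes D: "det_process K (distr M point_measures X)" and M: "prob_space M" and X: "X : M \<rightarrow>\<^sub>M point_measures"
 shows "diffraction_spectrum M X = measure_class (atom_density 1 (%_. 1))"
proof -
 let ?P = "distr M point_measures X"
 interpret det_process K ?P by fact
 interpret M: prob_space M by fact
 let ?ga = "atom_density 1 (%x. 1 - k2 x) :: 'a measure" and ?mm = "atom_density 1 (%t. 1 - ps t) :: 'a measure"
 have ac: "AE w in M. autocorrelation (X w) ?ga" using AE_distrD[OF X typical_AE] by eventually_elim (rule autocorrelation_typical[OF D])
 have mm: "AE w in M. diffraction_measure (X w) ?mm" using ac by eventually_elim (use fourier_diffraction in \<open>auto simp: diffraction_measure_def\<close>)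
 have uniq: "nu = ?mm" if "AE w in M. diffraction_measure (X w) nu" for nu
 proof -
  have "AE w in M. diffraction_measure (X w) nu & autocorrelation (X w) ?ga" using that ac by eventually_elim simp
  then obtain w where w: "diffraction_measure (X w) nu" "autocorrelation (X w) ?ga" using eventually_happens[of _ "ae_filter M"] M.ae_filter_bot by blast
  then obtain ga where ga: "autocorrelation (X w) ga" "measure_fourier_transform ga nu" by (auto simp: diffraction_measure_def)
  have "ga = ?ga" using ga(1) w(2) unfolding autocorrelation_def by (rule vague_limit_unique)
  then have "measure_fourier_transform ?ga nu" using ga(2) by simp
  then show ?thesis
  proof (rule measure_fourier_transform_unique[OF _ fourier_diffraction])
   have "emeasure ?ga UNIV >= 1" by (subst emeasure_atom_density) simp_all
   then show "emeasure ?ga UNIV ~= 0" by auto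
  qed simp
 qed
 have "{nu. AE w in M. diffraction_measure (X w) nu} = {?mm}" using mm uniq by blast
 then have "diffraction_spectrum M X = measure_class ?mm" by (simp add: diffraction_spectrum_def)
 also have "... = measure_class (atom_density 1 (%_. 1))"
 proof -
  have "null_sets ?mm = null_sets (atom_density 1 (%_. 1))" by (rule null_sets_atom_density[OF _ _ ps_less_1_AE]) simp_all
  then show ?thesis by (simp add: measure_class_def equivalent_measures_def)
 qed
 finally show ?thesis .
qed

lemma det_kernel_fourier:
 fixes \<phi> :: "'a::euclidean_space => real"
 assumes [measurable]: "\<phi> : BM borel" and \<phi>: "!!x. 0 <= \<phi> x & \<phi> x <= 1" and 1: "(NN x. ennreal (\<phi> x)) = 1"
 shows "det_kernel (fourier (%t. cr (\<phi> t)))"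
proof -
 have i: "integrable lborel \<phi>" by (rule integrableI_nonneg) (use \<phi> 1 in simp_all)
 have i1: "(LBINT x. \<phi> x) = 1" by (subst integral_eq_nn_integral) (use \<phi> 1 in simp_all)
 have ci: "integrable lborel (%t. cr (\<phi> t))" using i by simp
 show ?thesis
 proof
  show "continuous_on UNIV (fourier (%t. cr (\<phi> t)))" using isCont_fourier[OF ci] by (simp add: continuous_on_eq_continuous_at)
  show "fourier (%t. cr (\<phi> t)) 0 = 1" by (simp add: fourier_cis i1)
  show "cmod (fourier (%t. cr (\<phi> t)) x) <= 1" for x using norm_fourier_le[of "%t. cr (\<phi> t)" x] \<phi> i1 by simp
  show "fourier (%t. cr (\<phi> t)) (- x) = cnj (fourier (%t. cr (\<phi> t)) x)" for x
   unfolding fourier_cis integral_cnj[symmetric] by (simp add: cis_cnj)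
  show "integrable lborel (%x. (cmod (fourier (%t. cr (\<phi> t)) x))^2)" "(LBINT x. (cmod (fourier (%t. cr (\<phi> t)) x))^2) <= 1"
   by (rule fourier_L2_le_1[OF i]; use \<phi> i1 in simp)+
 qed
qed

text \<open>Transfers the correlation functions, given through \<open>factorial_power\<close> and
  identified only almost everywhere, to moments of \<open>ffact_count\<close> under the law of
  \<open>X\<close>.\<close>

lemma det_process_determinantal:
 fixes K :: "'a::euclidean_space => complex"
 assumes "det_kernel K" and det: "determinantal_process M X (%x y. K (x - y))"
 shows "det_process K (distr M point_measures X)"
proof -
 interpret det_kernel K by fact
 have M: "prob_space M" and X: "X : M \<rightarrow>\<^sub>M point_measures" using det by (auto simp: determinantal_process_def point_process_def)
 interpret M: prob_space M by fact
 have Xs: "X w : PM" if "w : space M" for w using measurable_space[OF X that] .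
 have main: "integrable M (%w. ffact_count (measure (X w)) k A) & (LINT w|M. ffact_count (measure (X w)) k A) = m k A"
  if A: "!!j. j < k ==> A j : bbs" for k and A :: "nat => 'a set"
 proof (cases "k = 0")
  case True
  \<comment> \<open>The determinantal property speaks of k >= 1. For k = 0 both sides are 1, the
    determinant of the empty matrix integrated over a one-point space.\<close>
  have "m 0 A = 1" by (simp add: m_def R_def dt_def kmat_def PiM_empty lebesgue_integral_count_space_finite)
  then show ?thesis using True M.prob_space by simp
 next
  case False
  then have k: "k >= 1" by simp
  obtain rh where rh: "correlation_function M X k rh"
   "AE x in (LL k). cr (rh x) = Determinant.det (Matrix.mat k k (%(i, j). K (x i - x j)))"
   using conjunct2[OF det[unfolded determinantal_process_def], rule_format, OF k] by (elim exE conjE) (rule that)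
  have B: "PiE {..<k} A : sets (\<Pi>\<^sub>M j\<in>{..<k}. borel)" using A by (intro sets_PiM_I_finite) (auto simp: bbs_borel)
  have rhR: "AE x in (LL k). rh x = R k x"
   using rh(2) unfolding R_def dt_def kmat_def by eventually_elim (metis Re_complex_of_real)
  have "(NNI M (%w. emeasure (factorial_power k (X w)) (PiE {..<k} A))) = (\<integral>\<^sup>+ x\<in>Pi\<^sub>E {..<k} A. ennreal (rh x) \<partial>(LL k))"
   using rh(1) B by (simp add: correlation_function_def factorial_moment_def)
  also have "... = (NNI (LL k) (%x. ennreal (R k x*ind (PiE {..<k} A) x)))"
   using rhR by (intro nn_integral_cong_AE) (auto simp: indicator_def)
  also have "... = ennreal (m k A)" unfolding m_def
  proof (rule nn_integral_eq_integral[OF m_integrable[OF A]])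
   show "AE x in (LL k). 0 <= R k x*ind (PiE {..<k} A) x" using rhR
   proof eventually_elim
    fix x assume "rh x = R k x"
    moreover have "rh x >= 0" using rh(1) by (simp add: correlation_function_def)
    ultimately show "0 <= R k x*ind (PiE {..<k} A) x" by simp
   qed
  qed
  finally have "(NNI M (%w. emeasure (factorial_power k (X w)) (PiE {..<k} A))) = ennreal (m k A)" .
  then have e: "(NNI M (%w. ennreal (ffact_count (measure (X w)) k A))) = ennreal (m k A)"
   using A Xs by (simp add: emeasure_factorial_power bbs_def cong: nn_integral_cong)
  have fm: "(%w. ffact_count (measure (X w)) k A) : BM M"
   by (rule measurable_compose[OF X ffact_count_measurable]) (use A in \<open>simp add: bbs_borel\<close>)
  have nn: "AE w in M. 0 <= ffact_count (measure (X w)) k A" by (rule AE_I2, rule ffact_count_nonneg[OF Xs]) (use A in \<open>simp_all add: bbs_def\<close>)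
  \<comment> \<open>The integrals agree so far only as \<open>ennreal\<close> values; nonnegativity
    of \<open>m k A\<close>, inherited from the density, turns this into an equation of real
    numbers.\<close>
  have m0: "m k A >= 0"
  proof -
   have "AE x in (LL k). 0 <= R k x*ind (PiE {..<k} A) x" using rhR
   proof eventually_elim
    fix x assume "rh x = R k x"
    moreover have "rh x >= 0" using rh(1) by (simp add: correlation_function_def)
    ultimately show "0 <= R k x*ind (PiE {..<k} A) x" by simp
   qed
   then show ?thesis unfolding m_def by (rule integral_nonneg_AE)
  qed
  have "integrable M (%w. ffact_count (measure (X w)) k A)" by (rule integrableI_nonneg[OF fm nn]) (simp add: e)
  moreover have "(LINT w|M. ffact_count (measure (X w)) k A) = m k A" using integral_eq_nn_integral[OF fm nn] m0 by (simp add: e)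
  ultimately show ?thesis ..
 qed
 interpret P: prob_space "distr M point_measures X" by (rule M.prob_space_distr[OF X])
 show ?thesis
 proof unfold_locales
  show "sets (distr M point_measures X) = sets point_measures" by simp
  fix k and A :: "nat => 'a set" assume A: "!!j. j < k ==> A j : bbs"
  have fm: "(%W. ffact_count (measure W) k A) : BM point_measures" by (rule ffact_count_measurable) (use A in \<open>simp add: bbs_borel\<close>)
  show "integrable (distr M point_measures X) (%W. ffact_count (measure W) k A)" using main[OF A] by (subst integrable_distr_eq[OF X fm]) simp
  show "(\<integral>W. ffact_count (measure W) k A \<partial>distr M point_measures X) = m k A" using main[OF A] by (subst integral_distr[OF X fm]) simp
 qed
qed

theorem mainTheorem5:
  fixes \<phi> :: "real ^ 'n \<Rightarrow> real"
    and M :: "'b measure"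
    and X :: "'b \<Rightarrow> (real ^ 'n) measure"
  assumes "\<phi> \<in> borel_measurable borel"
    and "\<And>x. 0 \<le> \<phi> x \<and> \<phi> x \<le> 1"
    and "(\<integral>\<^sup>+ x. ennreal (\<phi> x) \<partial>lborel) = 1"
    and "determinantal_process M X (\<lambda>x y. fourier (\<lambda>t. complex_of_real (\<phi> t)) (x - y))"
  shows "diffraction_spectrum M X = measure_class (add_measure (return borel 0) lborel) \<and>
    dynamical_spectrum (distr M point_measures X) =
      measure_class (add_measure (return borel 0) lborel) \<and>
    diffraction_spectrum M X = dynamical_spectrum (distr M point_measures X)"
proof -
 have K: "det_process (fourier (%t. cr (\<phi> t))) (distr M point_measures X)"
  by (rule det_process_determinantal[OF det_kernel_fourier[OF assms(1-3)] assms(4)])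
 have MX: "prob_space M" "X : M \<rightarrow>\<^sub>M point_measures" using assms(4) by (auto simp: determinantal_process_def point_process_def)
 show ?thesis unfolding diffraction_spectrum_eq[OF K MX] det_process.dynamical_spectrum_eq[OF K] add_measure_return_lborel by simp
qed

end
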